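(* Let $c\in\mathbb{F}$. For every $n\in\mathbb{F}_p=\{0,1,\dots,p-1\}\subset\mathbb{F}$, $L_{\mathcal{V}ir}(c,n)$ is an irreducible $\mathbb{N}$-graded $V^0_{\mathcal{V}ir}(c,0)$-module. Furthermore, the modules $L_{\mathcal{V}ir}(c,n)$ for $n\in\mathbb{F}_p$ form a complete set of equivalence class representatives of irreducible $\mathbb{N}$-graded $V^0_{\mathcal{V}ir}(c,0)$-modules.
   Context: $\mathbb{F}$ is an algebraically closed field of prime characteristic $p\ge 3$; all vector spaces are over $\mathbb{F}$. $\mathbb{N}$ denotes the nonnegative integers. Vertex algebras: a vertex algebra is a vector space $V$ with a linear map $Y(\cdot,x):V\to(\mathrm{End}\,V)[[x,x^{-1}]]$, $v\mapsto Y(v,x)=\sum_{n\in\mathbb{Z}}v_nx^{-n-1}$, and a vector $\mathbf 1\in V$ such that $Y(u,x)v\in V((x))$; $Y(\mathbf 1,x)=\mathrm{id}$; $Y(v,x)\mathbf 1\in V[[x]]$ with constant term $v$; and for $u,v,w\in V$ the Jacobi identity $x_0^{-1}\delta\left(\frac{x_1-x_2}{x_0}\right)Y(u,x_1)Y(v,x_2)w-x_0^{-1}\delta\left(\frac{x_2-x_1}{-x_0}\right)Y(v,x_2)Y(u,x_1)w=x_2^{-1}\delta\left(\frac{x_1-x_0}{x_2}\right)Y(Y(u,x_0)v,x_2)w$ holds, where $\delta(x)=\sum_{n\in\mathbb{Z}}x^n$ and $(x_1\pm x_2)^n$ is expanded in nonnegative powers of the second variable. A $V$-module is a vector space $W$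 with a linear map $Y_W(\cdot,x):V\to(\mathrm{End}\,W)[[x,x^{-1}]]$ with $Y_W(\mathbf 1,x)=1_W$, $Y_W(u,x)w\in W((x))$, and satisfying the analogous Jacobi identity on $W$. An ideal is a subspace $I$ with $v_nw,\,w_nv\in I$ for all $v\in V$, $w\in I$, $n\in\mathbb{Z}$. A $\mathbb{Z}$-graded vertex algebra is a vertex algebra with a grading $V=\bigoplus_{n\in\mathbb{Z}}V_{(n)}$ such that $\mathbf 1\in V_{(0)}$ and $u_kV_{(n)}\subset V_{(m+n-k-1)}$ for $u\in V_{(m)}$. Graded modules: an $\mathbb{N}$-graded $V$-module is a $V$-module $W=\bigoplus_{n\in\mathbb{Z}}W(n)$ with $W(n)=0$ for $n<0$ and $u_mW(n)\subset W(k+n-m-1)$ for $u\in V_{(k)}$. It is irreducible if it is nonzero and has no graded submodules other than $0$ and itself. Two graded modules $W_1,W_2$ are equivalent if there are a $V$-module isomorphism $\psi:W_1\to W_2$ and an integer $k$ with $\psi(W_1(n))=W_2(n+k)$ for all $n$. Virasoro: $\mathcal{V}ir$ is the Lie algebra with basis $\{L_n\mid n\in\mathbb{Z}\}\cup\{\mathbf c\}$, $\mathbf c$ central, $[L_m,L_n]=(m-n)L_{m+n}+\frac12\binom{m+1}{3}\delta_{m+n,0}\mathbf c$. $V_{\mathcal{V}ir}(c,0)$ is the $\mathcal{V}ir$-module induced from the one-dimensional module of the subalgebra spanned by $\mathbf c$ and $L_n$ ($n\ge-1$), where $\mathbf c$ acts as $c$ and each $L_n$ ($n\ge -1$) acts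 as $0$; $\mathbf 1=1\otimes1$. It has a unique vertex algebra structure with vacuum $\mathbf 1$ and $Y(\omega,x)=\sum_{n\in\mathbb{Z}}L_nx^{-n-2}$, where $\omega=L_{-2}\mathbf 1$; it is $\mathbb{Z}$-graded by $\deg\mathbf 1=0$, $\deg L_n=-n$. Its modules are the same as $\mathcal{V}ir$-modules $W$ of central charge $c$ (i.e. $\mathbf c$ acts as $c$) that are locally truncated (for each $w\in W$, $L_nw=0$ for $n$ sufficiently large), via $Y_W(\omega,x)=\sum_nL_nx^{-n-2}$. Let $\delta_{p\mid n}=1$ if $p\mid n$ and $0$ otherwise. $I_0$ is the $\mathcal{V}ir$-submodule generated by $(L_{-n}^p-\delta_{p\mid n}L_{-np})\mathbf 1$ for $n\ge2$; it is a graded ideal, and $V^0_{\mathcal{V}ir}(c,0)=V_{\mathcal{V}ir}(c,0)/I_0$. For $\lambda\in\mathbb{F}$, the Verma module is $M_{\mathcal{V}ir}(c,\lambda)=U(\mathcal{V}ir)/J(c,\lambda)$ with $J(c,\lambda)=U(\mathcal{V}ir)(\mathbf c-c)+U(\mathcal{V}ir)(L_0-\lambda)+\sum_{m\ge1}U(\mathcal{V}ir)L_m$, which is $\mathbb{N}$-graded (with $\deg L_n=-n$ and the image of $1$ in degree $0$). $L_{\mathcal{V}ir}(c,\lambda)$ is its quotient by the unique maximal (proper) graded submodule. *)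

theory Defs
  imports
    "HOL-Algebra.Module"
    "HOL-Algebra.AbelCoset"
    "HOL-Algebra.Algebraic_Closure_Type"
    "HOL-Library.Poly_Mapping"
begin

text \<open>
  Binomial coefficients are computed in the integers and then mapped to the field, since there
  division by factorials is impossible. (The type constraint on \<open>gbinomial\<close> excludes integers.)
\<close>

definition int_binomial :: "int \<Rightarrow> nat \<Rightarrow> int" where
  "int_binomial m k = (\<Prod>i=0..<k. m - int i) div fact k"


definition prime_subfield :: "'a::field set" where
  "prime_subfield = of_nat ` {0..<CHAR('a)}"


section \<open>Graded vector spaces\<close>

text \<open>
  A vector space over the field given by the type \<open>'a\<close> is a \<open>module\<close> (in the sense of HOL-Algebra)
  over \<open>ring_of_type_algebra :: 'a ring\<close>. The fields \<open>mult\<close> and \<open>one\<close>, which the record of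
  modules inherits from the record of rings, are never used for the spaces below.
\<close>

abbreviation scalars :: "'a::field ring" where
  "scalars \<equiv> ring_of_type_algebra"

abbreviation vector_space :: "('a::field, 'w, 'm) module_scheme \<Rightarrow> bool" where
  "vector_space M \<equiv> Module.module (scalars :: 'a ring) M"

abbreviation vector_subspace :: "'w set \<Rightarrow> ('a::field, 'w, 'm) module_scheme \<Rightarrow> bool" where
  "vector_subspace N M \<equiv> submodule N (scalars :: 'a ring) M"

text \<open>The sum of a finitely supported family; this is how the infinite sums in the coefficients
  of the Jacobi identity are read, where truncation makes all but finitely many terms vanish.\<close>

definition fsum :: "('a, 'w, 'm) module_scheme \<Rightarrow> ('i \<Rightarrow> 'w) \<Rightarrow> 'w" where
  "fsum M f = finsum M f {i. f i \<noteq> \<zero>\<^bsub>M\<^esub>}"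

definition direct_sum :: "('a::field, 'w, 'm) module_scheme \<Rightarrow> 'w set \<Rightarrow> (int \<Rightarrow> 'w set) \<Rightarrow> bool" where
  "direct_sum M N H \<longleftrightarrow>
     vector_subspace N M \<and>
     (\<forall>n. vector_subspace (H n) M \<and> H n \<subseteq> N) \<and>
     (\<forall>w\<in>N. \<exists>!f. (\<forall>n. f n \<in> H n) \<and> finite {n. f n \<noteq> \<zero>\<^bsub>M\<^esub>} \<and> w = fsum M f)"

record ('a, 'w) graded_space = "('a, 'w) module" +
  gr :: "int \<Rightarrow> 'w set"

definition is_graded :: "('a::field, 'w, 'm) graded_space_scheme \<Rightarrow> bool" where
  "is_graded M \<longleftrightarrow> direct_sum M (carrier M) (gr M)"

definition graded_subspace :: "'w set \<Rightarrow> ('a::field, 'w, 'm) graded_space_scheme \<Rightarrow> bool" where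
  "graded_subspace N M \<longleftrightarrow> direct_sum M N (\<lambda>n. N \<inter> gr M n)"

definition quot_map :: "('a, 'w, 'm) module_scheme \<Rightarrow> 'w set \<Rightarrow> ('w \<Rightarrow> 'w) \<Rightarrow> 'w set \<Rightarrow> 'w set" where
  "quot_map M I f A = (\<Union>x\<in>A. I +>\<^bsub>M\<^esub> f x)"

definition quot_space :: "('a, 'w, 'm) graded_space_scheme \<Rightarrow> 'w set \<Rightarrow> ('a, 'w set) graded_space" where
  "quot_space M I =
     \<lparr>carrier = a_rcosets\<^bsub>M\<^esub> I, monoid.mult = undefined, one = undefined,
      zero = I, add = set_add M,
      module.smult = (\<lambda>a. quot_map M I (\<lambda>x. a \<odot>\<^bsub>M\<^esub> x)),
      gr = (\<lambda>n. (\<lambda>x. I +>\<^bsub>M\<^esub> x) ` gr M n)\<rparr>"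


section \<open>Vertex algebras and their modules\<close>

text \<open>The fields \<open>vprod\<close> and \<open>vact\<close> send \<open>v\<close>, \<open>n\<close>, \<open>w\<close> to \<open>v\<^sub>n w\<close>, the coefficient of
  \<open>x\<^bsup>-n-1\<^esup>\<close> in \<open>Y(v,x)w\<close>.\<close>

record ('a, 'v) vertex_alg = "('a, 'v) graded_space" +
  vacuum :: 'v
  vprod :: "'v \<Rightarrow> int \<Rightarrow> 'v \<Rightarrow> 'v"

record ('a, 'v, 'w) vertex_mod = "('a, 'w) graded_space" +
  vact :: "'v \<Rightarrow> int \<Rightarrow> 'w \<Rightarrow> 'w"

definition vertex_operators ::
  "('a::field, 'v, 'm) module_scheme \<Rightarrow> ('a, 'w, 'k) module_scheme \<Rightarrow> ('v \<Rightarrow> int \<Rightarrow> 'w \<Rightarrow> 'w) \<Rightarrow> bool"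
  where
  "vertex_operators V W Y \<longleftrightarrow>
     (\<forall>v\<in>carrier V. \<forall>n. \<forall>w\<in>carrier W. Y v n w \<in> carrier W) \<and>
     (\<forall>u\<in>carrier V. \<forall>v\<in>carrier V. \<forall>n. \<forall>w\<in>carrier W.
        Y (u \<oplus>\<^bsub>V\<^esub> v) n w = Y u n w \<oplus>\<^bsub>W\<^esub> Y v n w) \<and>
     (\<forall>a. \<forall>v\<in>carrier V. \<forall>n. \<forall>w\<in>carrier W. Y (a \<odot>\<^bsub>V\<^esub> v) n w = a \<odot>\<^bsub>W\<^esub> Y v n w) \<and>
     (\<forall>v\<in>carrier V. \<forall>n. \<forall>w\<in>carrier W. \<forall>w'\<in>carrier W.
        Y v n (w \<oplus>\<^bsub>W\<^esub> w') = Y v n w \<oplus>\<^bsub>W\<^esub> Y v n w') \<and>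
     (\<forall>a. \<forall>v\<in>carrier V. \<forall>n. \<forall>w\<in>carrier W. Y v n (a \<odot>\<^bsub>W\<^esub> w) = a \<odot>\<^bsub>W\<^esub> Y v n w) \<and>
     (\<forall>v\<in>carrier V. \<forall>w\<in>carrier W. \<exists>N. \<forall>n\<ge>N. Y v n w = \<zero>\<^bsub>W\<^esub>)"

text \<open>
  The Jacobi identity for \<open>u\<close>, \<open>v\<close> and \<open>w\<close>, coefficient by coefficient: the equation is the
  one for \<open>x\<^sub>0\<^bsup>-l-1\<^esup> x\<^sub>1\<^bsup>-m-1\<^esup> x\<^sub>2\<^bsup>-n-1\<^esup>\<close>. On the right-hand side, the expansion of the delta
  function contributes \<open>(-1)\<^sup>i\<close> times the binomial coefficient of \<open>-m-1+i\<close> over \<open>i\<close>, which is the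
  one of \<open>m\<close> over \<open>i\<close>.
\<close>

definition jacobi_identity ::
  "('a::field, 'w, 'k) module_scheme \<Rightarrow> ('v \<Rightarrow> int \<Rightarrow> 'v \<Rightarrow> 'v) \<Rightarrow> ('v \<Rightarrow> int \<Rightarrow> 'w \<Rightarrow> 'w) \<Rightarrow>
   'v \<Rightarrow> 'v \<Rightarrow> 'w \<Rightarrow> bool" where
  "jacobi_identity W P Y u v w \<longleftrightarrow> (\<forall>(l::int) (m::int) (n::int).
     fsum W (\<lambda>i::nat. ((-1) ^ i * of_int (int_binomial l i)) \<odot>\<^bsub>W\<^esub> Y u (m + l - int i) (Y v (n + int i) w))
     \<ominus>\<^bsub>W\<^esub>
     fsum W (\<lambda>i::nat. ((-1) powi l * (-1) ^ i * of_int (int_binomial l i)) \<odot>\<^bsub>W\<^esub>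
                       Y v (n + l - int i) (Y u (m + int i) w))
     = fsum W (\<lambda>i::nat. of_int (int_binomial m i) \<odot>\<^bsub>W\<^esub> Y (P u (l + int i) v) (m + n - int i) w))"

definition vertex_algebra :: "('a::field, 'v, 'm) vertex_alg_scheme \<Rightarrow> bool" where
  "vertex_algebra V \<longleftrightarrow>
     vector_space V \<and> vacuum V \<in> carrier V \<and>
     vertex_operators V V (vprod V) \<and>
     (\<forall>n. \<forall>v\<in>carrier V. vprod V (vacuum V) n v = (if n = -1 then v else \<zero>\<^bsub>V\<^esub>)) \<and>
     (\<forall>v\<in>carrier V. vprod V v (-1) (vacuum V) = v \<and> (\<forall>n\<ge>0. vprod V v n (vacuum V) = \<zero>\<^bsub>V\<^esub>)) \<and>
     (\<forall>u\<in>carrier V. \<forall>v\<in>carrier V. \<forall>w\<in>carrier V. jacobi_identity V (vprod V) (vprod V) u v w)"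

definition graded_vertex_algebra :: "('a::field, 'v, 'm) vertex_alg_scheme \<Rightarrow> bool" where
  "graded_vertex_algebra V \<longleftrightarrow>
     vertex_algebra V \<and> is_graded V \<and> vacuum V \<in> gr V 0 \<and>
     (\<forall>m n k. \<forall>u\<in>gr V m. \<forall>v\<in>gr V n. vprod V u k v \<in> gr V (m + n - k - 1))"

definition vertex_module ::
  "('a::field, 'v, 'm) vertex_alg_scheme \<Rightarrow> ('a, 'v, 'w, 'k) vertex_mod_scheme \<Rightarrow> bool" where
  "vertex_module V W \<longleftrightarrow>
     vertex_algebra V \<and> vector_space W \<and>
     vertex_operators V W (vact W) \<and>
     (\<forall>n. \<forall>w\<in>carrier W. vact W (vacuum V) n w = (if n = -1 then w else \<zero>\<^bsub>W\<^esub>)) \<and>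
     (\<forall>u\<in>carrier V. \<forall>v\<in>carrier V. \<forall>w\<in>carrier W. jacobi_identity W (vprod V) (vact W) u v w)"

definition N_graded_vertex_module ::
  "('a::field, 'v, 'm) vertex_alg_scheme \<Rightarrow> ('a, 'v, 'w, 'k) vertex_mod_scheme \<Rightarrow> bool" where
  "N_graded_vertex_module V W \<longleftrightarrow>
     graded_vertex_algebra V \<and> vertex_module V W \<and> is_graded W \<and>
     (\<forall>n<0. gr W n = {\<zero>\<^bsub>W\<^esub>}) \<and>
     (\<forall>k m n. \<forall>u\<in>gr V k. \<forall>w\<in>gr W n. vact W u m w \<in> gr W (k + n - m - 1))"

definition vertex_graded_submodule ::
  "('a::field, 'v, 'm) vertex_alg_scheme \<Rightarrow> 'w set \<Rightarrow> ('a, 'v, 'w, 'k) vertex_mod_scheme \<Rightarrow> bool" where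
  "vertex_graded_submodule V N W \<longleftrightarrow>
     graded_subspace N W \<and> (\<forall>v\<in>carrier V. \<forall>n. \<forall>w\<in>N. vact W v n w \<in> N)"

definition irreducible_N_graded_module ::
  "('a::field, 'v, 'm) vertex_alg_scheme \<Rightarrow> ('a, 'v, 'w, 'k) vertex_mod_scheme \<Rightarrow> bool" where
  "irreducible_N_graded_module V W \<longleftrightarrow>
     N_graded_vertex_module V W \<and> carrier W \<noteq> {\<zero>\<^bsub>W\<^esub>} \<and>
     (\<forall>N. vertex_graded_submodule V N W \<longrightarrow> N = {\<zero>\<^bsub>W\<^esub>} \<or> N = carrier W)"

definition vertex_module_iso ::
  "('a::field, 'v, 'm) vertex_alg_scheme \<Rightarrow> ('a, 'v, 'w1, 'k1) vertex_mod_scheme \<Rightarrow>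
   ('a, 'v, 'w2, 'k2) vertex_mod_scheme \<Rightarrow> ('w1 \<Rightarrow> 'w2) \<Rightarrow> bool" where
  "vertex_module_iso V W1 W2 \<psi> \<longleftrightarrow>
     bij_betw \<psi> (carrier W1) (carrier W2) \<and>
     (\<forall>w\<in>carrier W1. \<forall>w'\<in>carrier W1. \<psi> (w \<oplus>\<^bsub>W1\<^esub> w') = \<psi> w \<oplus>\<^bsub>W2\<^esub> \<psi> w') \<and>
     (\<forall>a. \<forall>w\<in>carrier W1. \<psi> (a \<odot>\<^bsub>W1\<^esub> w) = a \<odot>\<^bsub>W2\<^esub> \<psi> w) \<and>
     (\<forall>v\<in>carrier V. \<forall>n. \<forall>w\<in>carrier W1. \<psi> (vact W1 v n w) = vact W2 v n (\<psi> w))"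

definition graded_equivalent ::
  "('a::field, 'v, 'm) vertex_alg_scheme \<Rightarrow> ('a, 'v, 'w1, 'k1) vertex_mod_scheme \<Rightarrow>
   ('a, 'v, 'w2, 'k2) vertex_mod_scheme \<Rightarrow> bool" where
  "graded_equivalent V W1 W2 \<longleftrightarrow>
     (\<exists>\<psi>. \<exists>k::int. vertex_module_iso V W1 W2 \<psi> \<and> (\<forall>n. \<psi> ` gr W1 n = gr W2 (n + k)))"

definition quot_vertex_algebra ::
  "('a, 'v, 'm) vertex_alg_scheme \<Rightarrow> 'v set \<Rightarrow> ('a, 'v set) vertex_alg" where
  "quot_vertex_algebra V I =
     graded_space.extend (quot_space V I)
       (vertex_alg.fields (I +>\<^bsub>V\<^esub> vacuum V)
          (\<lambda>A n B. \<Union>a\<in>A. quot_map V I (vprod V a n) B))"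


section \<open>The universal enveloping algebra of the Virasoro algebra\<close>

datatype vir_gen = L int | C

datatype vir_word = Word "vir_gen list"

instantiation vir_word :: monoid_add
begin

definition zero_vir_word :: vir_word where
  "0 = Word []"

fun plus_vir_word :: "vir_word \<Rightarrow> vir_word \<Rightarrow> vir_word" where
  "Word xs + Word ys = Word (xs @ ys)"

instance
proof
  fix a b c :: vir_word
  show "a + b + c = a + (b + c)" by (cases a; cases b; cases c) simp
  show "0 + a = a" "a + 0 = a" by (cases a; simp add: zero_vir_word_def)+
qed

end

text \<open>
  Words form the free monoid on the basis of the Virasoro algebra, so that
  \<open>vir_word \<Rightarrow>\<^sub>0 'a\<close>, with the convolution product, is the tensor algebra of the Virasoro algebra.
\<close>

type_synonym 'a vir_tensor = "vir_word \<Rightarrow>\<^sub>0 'a"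

abbreviation tensor_gen :: "vir_gen \<Rightarrow> 'a::field vir_tensor" where
  "tensor_gen g \<equiv> Poly_Mapping.single (Word [g]) 1"

fun vir_bracket :: "vir_gen \<Rightarrow> vir_gen \<Rightarrow> 'a::field vir_tensor" where
  "vir_bracket (L m) (L n) =
     Poly_Mapping.single (Word [L (m + n)]) (of_int (m - n)) +
     Poly_Mapping.single (Word [C]) (if m + n = 0 then of_int (int_binomial (m + 1) 3) / 2 else 0)"
| "vir_bracket C h = 0"
| "vir_bracket g C = 0"

inductive_set env_ideal :: "'a::field vir_tensor set" where
  zero: "0 \<in> env_ideal"
| step: "x \<in> env_ideal \<Longrightarrow>
     x + a * (tensor_gen g * tensor_gen h - tensor_gen h * tensor_gen g - vir_bracket g h) * b
       \<in> env_ideal"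

lemma env_ideal_add:
  assumes "x \<in> env_ideal" "y \<in> env_ideal"
  shows "x + y \<in> env_ideal"
  using assms(2,1)
proof (induction y rule: env_ideal.induct)
  case zero
  then show ?case by simp
next
  case (step y a g h b)
  then show ?case
    using env_ideal.step[of "x + y" a g h b] by (simp only: add.assoc)
qed

lemma env_ideal_mult: "x \<in> env_ideal \<Longrightarrow> a * x * b \<in> env_ideal"
proof (induction x rule: env_ideal.induct)
  case zero
  show ?case by (simp add: env_ideal.zero)
next
  case (step x a' g h b')
  then show ?case
    using env_ideal.step[of "a * x * b" "a * a'" g h "b' * b"]
    by (simp only: distrib_left distrib_right mult.assoc)
qed

lemma env_ideal_mult_left: "x \<in> env_ideal \<Longrightarrow> a * x \<in> env_ideal"
  using env_ideal_mult[of x a 1] by simp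

lemma env_ideal_mult_right: "x \<in> env_ideal \<Longrightarrow> x * b \<in> env_ideal"
  using env_ideal_mult[of x 1 b] by simp

lemma env_ideal_uminus: "x \<in> env_ideal \<Longrightarrow> - x \<in> env_ideal"
  using env_ideal_mult_left[of x "- 1"] by simp

text \<open>
  The enveloping algebra is nonzero because the relations have no constant term.
\<close>

lemma vir_word_add_eq_0: "u + v = 0 \<longleftrightarrow> u = 0 \<and> v = (0::vir_word)"
  by (cases u; cases v) (simp add: zero_vir_word_def)

lemma lookup_times_0:
  fixes x y :: "'a::field vir_tensor"
  shows "Poly_Mapping.lookup (x * y) 0 = Poly_Mapping.lookup x 0 * Poly_Mapping.lookup y 0"
proof -
  have *: "(Poly_Mapping.lookup y q when 0 = l + q) =
           ((Poly_Mapping.lookup y q when l = 0) when q = 0)" for l q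
    using vir_word_add_eq_0[of l q] by (auto simp: when_def)
  have "(\<Sum>q. Poly_Mapping.lookup y q when 0 = l + q) = (Poly_Mapping.lookup y 0 when l = 0)" for l
    unfolding * by simp
  then show ?thesis
    by (simp add: lookup_mult mult_when del: eq_commute)
qed

lemma env_ideal_augmentation: "x \<in> env_ideal \<Longrightarrow> Poly_Mapping.lookup x 0 = 0"
proof (induction x rule: env_ideal.induct)
  case (step x a g h b)
  have "Poly_Mapping.lookup (vir_bracket g h :: 'a vir_tensor) 0 = 0"
    by (cases g; cases h) (simp_all add: lookup_add lookup_single zero_vir_word_def)
  with step show ?case
    by (simp add: lookup_add lookup_minus lookup_times_0 algebra_simps)
qed simp

definition env_rel :: "'a::field vir_tensor \<Rightarrow> 'a vir_tensor \<Rightarrow> bool" where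
  "env_rel x y \<longleftrightarrow> x - y \<in> env_ideal"

lemma equivp_env_rel: "equivp env_rel"
proof (rule equivpI)
  show "reflp env_rel"
    by (simp add: reflp_def env_rel_def env_ideal.zero)
  show "symp env_rel"
    unfolding symp_def env_rel_def using env_ideal_uminus by fastforce
  show "transp env_rel"
    unfolding transp_def env_rel_def using env_ideal_add by fastforce
qed

quotient_type (overloaded) 'a vir_env = "'a::field vir_tensor" / env_rel
  by (rule equivp_env_rel)

instantiation vir_env :: (field) ring_1
begin

lift_definition zero_vir_env :: "'a vir_env" is "0" .

lift_definition one_vir_env :: "'a vir_env" is "1" .

lift_definition plus_vir_env :: "'a vir_env \<Rightarrow> 'a vir_env \<Rightarrow> 'a vir_env" is "(+)"
  unfolding env_rel_def using env_ideal_add by (fastforce simp: algebra_simps)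

lift_definition uminus_vir_env :: "'a vir_env \<Rightarrow> 'a vir_env" is "uminus"
  unfolding env_rel_def using env_ideal_uminus by fastforce

lift_definition minus_vir_env :: "'a vir_env \<Rightarrow> 'a vir_env \<Rightarrow> 'a vir_env" is "(-)"
proof -
  fix x x' y y' :: "'a vir_tensor"
  assume "env_rel x x'" "env_rel y y'"
  then have "(x - x') + - (y - y') \<in> env_ideal"
    unfolding env_rel_def using env_ideal_add env_ideal_uminus by blast
  then show "env_rel (x - y) (x' - y')"
    unfolding env_rel_def by (simp add: algebra_simps)
qed

lift_definition times_vir_env :: "'a vir_env \<Rightarrow> 'a vir_env \<Rightarrow> 'a vir_env" is "(*)"
proof -
  fix x x' y y' :: "'a vir_tensor"
  assume "env_rel x x'" "env_rel y y'"
  then have "(x - x') * y + x' * (y - y') \<in> env_ideal"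
    unfolding env_rel_def
    using env_ideal_add env_ideal_mult_left env_ideal_mult_right by blast
  then show "env_rel (x * y) (x' * y')"
    unfolding env_rel_def by (simp add: algebra_simps)
qed

instance
proof
  fix a b c :: "'a vir_env"
  show "a * b * c = a * (b * c)"
    by transfer (simp add: mult.assoc env_rel_def env_ideal.zero)
  show "1 * a = a" "a * 1 = a"
    by (transfer; simp add: env_rel_def env_ideal.zero)+
  show "(a + b) * c = a * c + b * c" "a * (b + c) = a * b + a * c"
    by (transfer; simp add: env_rel_def env_ideal.zero algebra_simps)+
  show "a + b + c = a + (b + c)" "a + b = b + a" "0 + a = a" "- a + a = 0" "a - b = a + - b"
    by (transfer; simp add: env_rel_def env_ideal.zero algebra_simps)+
  show "(0::'a vir_env) \<noteq> 1"
    by transfer (use env_ideal_augmentation in \<open>fastforce simp: env_rel_def\<close>)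
qed

end

lift_definition env_gen :: "vir_gen \<Rightarrow> 'a::field vir_env" is tensor_gen .

lift_definition env_scalar :: "'a::field \<Rightarrow> 'a vir_env" is "Poly_Mapping.single 0" .

fun vir_gen_deg :: "vir_gen \<Rightarrow> int" where
  "vir_gen_deg (L n) = - n"
| "vir_gen_deg C = 0"

fun vir_word_deg :: "vir_word \<Rightarrow> int" where
  "vir_word_deg (Word gs) = sum_list (map vir_gen_deg gs)"

inductive_set left_ideal :: "'u::ring_1 set \<Rightarrow> 'u set" for S where
  zero: "0 \<in> left_ideal S"
| step: "x \<in> left_ideal S \<Longrightarrow> s \<in> S \<Longrightarrow> x + u * s \<in> left_ideal S"


section \<open>Virasoro modules\<close>

text \<open>The field \<open>vir\<close> is the action of the basis elements of the Virasoro algebra.\<close>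

record ('a, 'w) vir_mod = "('a, 'w) graded_space" +
  vir :: "vir_gen \<Rightarrow> 'w \<Rightarrow> 'w"

definition env_module :: "('a::field, 'a vir_env) vir_mod" where
  "env_module =
     \<lparr>carrier = UNIV, monoid.mult = (*), one = 1, zero = 0, add = (+),
      module.smult = (\<lambda>a u. env_scalar a * u),
      gr = (\<lambda>n. abs_vir_env ` {x. \<forall>w\<in>Poly_Mapping.keys x. vir_word_deg w = n}),
      vir = (\<lambda>g u. env_gen g * u)\<rparr>"

definition vir_submodule :: "'w set \<Rightarrow> ('a::field, 'w, 'm) vir_mod_scheme \<Rightarrow> bool" where
  "vir_submodule N M \<longleftrightarrow> vector_subspace N M \<and> (\<forall>g. \<forall>w\<in>N. vir M g w \<in> N)"

definition vir_graded_submodule :: "'w set \<Rightarrow> ('a::field, 'w, 'm) vir_mod_scheme \<Rightarrow> bool" where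
  "vir_graded_submodule N M \<longleftrightarrow> vir_submodule N M \<and> graded_subspace N M"

definition vir_generated :: "('a::field, 'w, 'm) vir_mod_scheme \<Rightarrow> 'w set \<Rightarrow> 'w set" where
  "vir_generated M S = \<Inter>{N. vir_submodule N M \<and> S \<subseteq> N}"

definition quot_vir_mod :: "('a, 'w, 'm) vir_mod_scheme \<Rightarrow> 'w set \<Rightarrow> ('a, 'w set) vir_mod" where
  "quot_vir_mod M I =
     graded_space.extend (quot_space M I) (vir_mod.fields (\<lambda>g. quot_map M I (vir M g)))"

definition verma :: "'a::field \<Rightarrow> 'a \<Rightarrow> ('a, 'a vir_env set) vir_mod" where
  "verma c h = quot_vir_mod env_module
     (left_ideal ({env_gen C - env_scalar c, env_gen (L 0) - env_scalar h} \<union>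
                  {env_gen (L m) | m. m \<ge> 1}))"

definition maximal_graded_submodule :: "'w set \<Rightarrow> ('a::field, 'w, 'm) vir_mod_scheme \<Rightarrow> bool" where
  "maximal_graded_submodule N M \<longleftrightarrow>
     vir_graded_submodule N M \<and> N \<noteq> carrier M \<and>
     (\<forall>N'. vir_graded_submodule N' M \<and> N \<subseteq> N' \<longrightarrow> N' = N \<or> N' = carrier M)"

definition vir_simple :: "'a::field \<Rightarrow> 'a \<Rightarrow> ('a, 'a vir_env set set) vir_mod" where
  "vir_simple c h =
     quot_vir_mod (verma c h) (THE N. maximal_graded_submodule N (verma c h))"


section \<open>The vertex algebras of the Virasoro algebra\<close>

text \<open>
  Inducing a one-dimensional module given by a character \<open>\<chi>\<close> of a subalgebra \<open>\<bb>\<close> yields the quotient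
  of the enveloping algebra by the left ideal generated by all \<open>x - \<chi>(x)\<close> for \<open>x \<in> \<bb>\<close>;
  the vector \<open>1 \<otimes> 1\<close> becomes the coset of \<open>1\<close>.
\<close>

definition vacuum_ideal :: "'a::field \<Rightarrow> 'a vir_env set" where
  "vacuum_ideal c = left_ideal ({env_gen C - env_scalar c} \<union> {env_gen (L n) | n. n \<ge> -1})"

definition vacuum_module :: "'a::field \<Rightarrow> ('a, 'a vir_env set) vir_mod" where
  "vacuum_module c = quot_vir_mod env_module (vacuum_ideal c)"

definition vacuum_vector :: "'a::field \<Rightarrow> 'a vir_env set" where
  "vacuum_vector c = vacuum_ideal c +>\<^bsub>env_module\<^esub> 1"

definition conformal_vector :: "'a::field \<Rightarrow> 'a vir_env set" where
  "conformal_vector c = vir (vacuum_module c) (L (-2)) (vacuum_vector c)"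

definition vir_vertex_structure ::
  "'a::field \<Rightarrow> ('a vir_env set \<Rightarrow> int \<Rightarrow> 'a vir_env set \<Rightarrow> 'a vir_env set) \<Rightarrow>
   ('a, 'a vir_env set) vertex_alg" where
  "vir_vertex_structure c Y =
     graded_space.extend (graded_space.truncate (vacuum_module c))
       (vertex_alg.fields (vacuum_vector c) Y)"

text \<open>
  Both structures chosen by \<open>SOME\<close> below are unique on the carriers, but as functions
  on a whole type they are not, which rules out \<open>THE\<close>. The condition on the conformal vector
  \<open>\<omega>\<close> reads \<open>Y(\<omega>,x) = \<Sum>\<^sub>n L\<^sub>n x\<^bsup>-n-2\<^esup>\<close>.
\<close>

definition V_Vir :: "'a::field \<Rightarrow> ('a, 'a vir_env set) vertex_alg" where
  "V_Vir c = vir_vertex_structure c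
     (SOME Y. vertex_algebra (vir_vertex_structure c Y) \<and>
        (\<forall>n. \<forall>w\<in>carrier (vacuum_module c).
           Y (conformal_vector c) (n + 1) w = vir (vacuum_module c) (L n) w))"

definition I0 :: "'a::field \<Rightarrow> 'a vir_env set set" where
  "I0 c = vir_generated (vacuum_module c)
     {(vir (vacuum_module c) (L (- int n)) ^^ p) (vacuum_vector c)
        \<ominus>\<^bsub>vacuum_module c\<^esub>
      (if p dvd n then vir (vacuum_module c) (L (- int (n * p))) (vacuum_vector c)
       else \<zero>\<^bsub>vacuum_module c\<^esub>) | n p. n \<ge> 2 \<and> p = CHAR('a)}"

definition V0_Vir :: "'a::field \<Rightarrow> ('a, 'a vir_env set set) vertex_alg" where
  "V0_Vir c = quot_vertex_algebra (V_Vir c) (I0 c)"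

definition vir_simple_structure ::
  "'a::field \<Rightarrow> 'a \<Rightarrow> ('v \<Rightarrow> int \<Rightarrow> 'a vir_env set set \<Rightarrow> 'a vir_env set set) \<Rightarrow>
   ('a, 'v, 'a vir_env set set) vertex_mod" where
  "vir_simple_structure c h Y =
     graded_space.extend (graded_space.truncate (vir_simple c h)) (vertex_mod.fields Y)"

definition L_Vir ::
  "'a::field \<Rightarrow> 'a \<Rightarrow> ('a, 'a vir_env set set, 'a vir_env set set) vertex_mod" where
  "L_Vir c h = vir_simple_structure c h
     (SOME Y. vertex_module (V0_Vir c) (vir_simple_structure c h Y) \<and>
        (\<forall>n. \<forall>w\<in>carrier (vir_simple c h).
           Y (I0 c +>\<^bsub>V_Vir c\<^esub> conformal_vector c) (n + 1) w = vir (vir_simple c h) (L n) w))"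

end

theory Submission
  imports Defs "HOL-Computational_Algebra.Formal_Power_Series" "HOL-Library.Groups_Big_Fun"
begin

text \<open>
  All modules are quotients of the enveloping algebra by left ideals. On a locally truncated
  quotient, the Jacobi identity for \<open>\<omega>\<close> and \<open>v\<close> with \<open>m = 0\<close> expresses \<open>Y(L\<^sub>kv, x)\<close> by \<open>Y(v, x)\<close> and
  the \<open>L\<^sub>j\<close>; read as a recursion, it defines the fields, and the three terms of the Jacobi identity
  for \<open>u\<close> and \<open>v\<close> obey one and the same recursion in \<open>u\<close>, so that only \<open>u = \<one>\<close> is left.

  The elements \<open>z\<^sub>n = L\<^sub>-\<^sub>n\<^sup>p - \<delta>\<^bsub>p|n\<^esub>L\<^sub>-\<^sub>n\<^sub>p\<close> are central, hence their modes commute with the Virasoro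
  algebra. Jacobson's formula, applied to power series, computes \<open>Y(z\<^sub>n, x)\<one>\<close> up to elements of the
  Virasoro algebra, and the latter are singular vectors, thus zero; so the \<open>z\<^sub>n\<close> generate an ideal.
  On \<open>L(c, h)\<close> a mode of \<open>z\<^sub>n\<close> can be nonzero only in degree \<open>0\<close>, where it acts as
  \<open>\<plusminus>\<Prod>\<^bsub>j<p\<^esub> ((n - 1)h + jn)\<close>, corrected by \<open>\<plusminus>h\<close> if \<open>p\<close> divides \<open>n\<close>; this is zero for \<open>h\<close> in the prime
  field. Conversely, \<open>L\<^sub>-\<^sub>2\<^sup>p\<one> = 0\<close> forces \<open>\<Prod>\<^bsub>j<p\<^esub> (L\<^sub>0 + 2j)\<close> to vanish on the lowest degree of an
  irreducible module, which therefore contains an eigenvector of \<open>L\<^sub>0\<close> for an \<open>h\<close> in the prime field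
  and is isomorphic to \<open>L(c, h)\<close>.
\<close>

text \<open>No basis theorem for the enveloping algebra U enters. Whatever has to be nonzero is
  detected by one linear functional \<open>chi\<close>, the coefficient of the lowest weight vector,
  which is built on words and then shown to respect the relations of U. Its radical
  \<open>simple_ideal\<close> is the left ideal presenting L(c, h), and through it even L_-2 1 is
  seen to be nonzero in the vacuum module.

  Characteristic p rules out Taylor expansions with factorials in the denominators. All identities
  of formal series are therefore treated coefficient by coefficient, with integer binomials mapped
  to the field; what remains of the analysis are Vandermonde convolutions along the antidiagonals of
  double sums.

  Oddness of p is felt in two places: the factor 4 that excludes singular combinations of the L_-n
  is invertible, and z_2 = L_-2^p carries no correction term, so its zero mode on the lowest degree
  is a product of linear factors in L_0.\<close>

abbreviation EL :: "int \<Rightarrow> 'a::field vir_env" where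
  "EL n \<equiv> env_gen (L n)"

abbreviation tmon :: "vir_word \<Rightarrow> 'a::field \<Rightarrow> 'a vir_tensor" where
  "tmon \<equiv> Poly_Mapping.single"

abbreviation coef :: "'a::field vir_tensor \<Rightarrow> vir_word \<Rightarrow> 'a" where
  "coef \<equiv> Poly_Mapping.lookup"

abbreviation supp :: "'a::field vir_tensor \<Rightarrow> vir_word set" where
  "supp \<equiv> Poly_Mapping.keys"

section \<open>Binomial coefficients and finitely supported sums\<close>

text \<open>The division by \<open>fact k\<close> is exact; for a negative upper entry, upper
  negation leads back to natural numbers. Over this bridge the binomial identities below are
  imported from \<open>gchoose\<close> over \<open>rat\<close> and then hold in every field.\<close>

lemma of_int_int_binomial: "(of_int (int_binomial m k) :: rat) = of_int m gchoose k"
proof -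
  have "\<exists>z::int. (of_int m gchoose k :: rat) = of_int z"
  proof (cases "m \<ge> 0")
    case True
    then obtain n where "m = int n" by (metis nonneg_int_cases)
    then have "(of_int m gchoose k :: rat) = of_int (int (n choose k))"
      by (simp add: binomial_gbinomial)
    then show ?thesis by blast
  next
    case False
    then obtain n where n: "int k - m - 1 = int n" by (metis add_diff_eq diff_ge_0_iff_ge linorder_not_le nonneg_int_cases of_nat_0_le_iff zle_diff1_eq order_trans uminus_add_conv_diff)
    have "(of_int m gchoose k :: rat) = (-1) ^ k * ((of_int (int k - m - 1)) gchoose k)"
      using gbinomial_negated_upper[of "of_int m :: rat" k] by simp
    also have "\<dots> = of_int ((-1) ^ k * int (n choose k))"
      unfolding n by (simp add: binomial_gbinomial)
    finally show ?thesis by blast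
  qed
  then obtain z :: int where z: "(of_int m gchoose k :: rat) = of_int z" by blast
  have "(of_int (fact k * z) :: rat) = of_int (\<Prod>i=0..<k. m - int i)"
    using gbinomial_mult_fact[of k "of_int m :: rat"] by (simp add: z)
  then have "(\<Prod>i=0..<k. m - int i) = fact k * z" by (simp only: of_int_eq_iff)
  then show ?thesis by (simp add: int_binomial_def z)
qed

lemma int_binomial_eqI:
  assumes "(of_int a :: rat) = of_int b" shows "a = (b::int)"
  using assms by (simp only: of_int_eq_iff)

lemma int_binomial_0 [simp]: "int_binomial m 0 = 1"
  by (simp add: int_binomial_def)

lemma int_binomial_Suc_Suc:
  "int_binomial (m + 1) (Suc k) = int_binomial m k + int_binomial m (Suc k)"
  by (rule int_binomial_eqI) (simp add: of_int_int_binomial gbinomial_Suc_Suc)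

lemma int_binomial_of_nat: "int_binomial (int n) k = int (n choose k)"
  by (rule int_binomial_eqI) (simp add: of_int_int_binomial binomial_gbinomial)

lemma int_binomial_Vandermonde:
  "(\<Sum>i\<le>t. int_binomial a (t - i) * int_binomial b i) = int_binomial (a + b) t"
  by (rule int_binomial_eqI)
    (simp add: of_int_int_binomial gbinomial_Vandermonde[symmetric] add.commute[of "of_int a"]
      mult.commute atMost_atLeast0)

lemma int_binomial_trinomial:
  "int_binomial a (r + j) * int_binomial (int (r + j)) r = int_binomial a r * int_binomial (a - int r) j"
  by (rule int_binomial_eqI)
    (use gbinomial_trinomial_revision[of r "r + j" "of_int a :: rat"] in \<open>simp add: of_int_int_binomial\<close>)

lemma int_binomial_trinomial':
  "int_binomial a i * int_binomial (a - int i) r = int_binomial a r * int_binomial (a - int r) i"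
proof -
  have "int_binomial (int (i + r)) i = int_binomial (int (r + i)) r"
    unfolding int_binomial_of_nat using binomial_symmetric[of i "i + r"] by (simp add: add.commute)
  then show ?thesis
    using int_binomial_trinomial[of a i r] int_binomial_trinomial[of a r i] by (simp add: add.commute)
qed

lemma int_binomial_negated_upper:
  "int_binomial a k = (-1) ^ k * int_binomial (int k - a - 1) k"
  by (rule int_binomial_eqI)
    (use gbinomial_negated_upper[of "of_int a :: rat" k] in \<open>simp add: of_int_int_binomial\<close>)

lemma int_binomial_absorption:
  "int (Suc k) * int_binomial a (Suc k) = a * int_binomial (a - 1) k"
  by (rule int_binomial_eqI)
    (use gbinomial_absorption[of k "of_int a :: rat"] in \<open>simp add: of_int_int_binomial\<close>)

lemma int_binomial_absorb_comp:
  "(a - int k) * int_binomial a k = a * int_binomial (a - 1) k"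
  by (rule int_binomial_eqI)
    (use gbinomial_absorb_comp[of "of_int a :: rat" k] in \<open>simp add: of_int_int_binomial\<close>)

section \<open>Binomial coefficients in the field\<close>

definition bin :: "int \<Rightarrow> nat \<Rightarrow> 'a::field" where
  "bin m k = of_int (int_binomial m k)"

text \<open>The coefficient of x^k in (1 - x)^m for an arbitrary integer m, that is, of x_1^(m-k)
  x_2^k in (x_1 - x_2)^m.\<close>

definition sbin :: "int \<Rightarrow> nat \<Rightarrow> 'a::field" where
  "sbin m k = (-1) ^ k * bin m k"

text \<open>The sign of the second term of the Jacobi identity, with exponents that may be
  negative.\<close>

definition eps :: "int \<Rightarrow> 'a::field" where
  "eps m = (-1) powi m"

text \<open>The value at (m, -m) of the 2-cocycle defining the central extension.\<close>

definition vir_cocycle :: "int \<Rightarrow> 'a::field" where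
  "vir_cocycle m = of_int (int_binomial (m + 1) 3) / 2"

lemma eps_add: "eps (a + b) = eps a * eps b"
  by (simp add: eps_def power_int_add)

lemma eps_nat: "eps (int n) = (-1) ^ n"
  by (simp add: eps_def)

lemma eps_1 [simp]: "eps 1 = -1" and eps_0 [simp]: "eps 0 = 1"
  by (simp_all add: eps_def)

lemma eps_minus: "eps (- a) = eps a"
  by (simp add: eps_def power_int_minus power_int_minus_left)

lemma eps_diff: "eps (a - b) = eps a * eps b"
  using eps_add[of a "- b"] by (simp add: eps_minus)

lemma eps_mult_self [simp]: "eps a * eps a = 1"
  using eps_add[of a "- a"] by (simp add: eps_minus)

lemma eps_mult_self_left [simp]: "eps a * (eps a * x) = x"
  by (simp add: mult.assoc[symmetric])

lemma eps_numeral_simps [simp]: "eps 2 = 1" "eps (-1) = -1" "eps (-2) = 1"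
  by (simp_all add: eps_def power_int_def)

lemma eps_add_1: "eps (a + 1) = - eps a"
  by (simp add: eps_add)

lemma minus_one_power_eq_eps: "(-1) ^ n = eps (int n)"
  by (simp add: eps_nat)

lemma bin_0 [simp]: "bin m 0 = 1" and sbin_0 [simp]: "sbin m 0 = 1"
  by (simp_all add: bin_def sbin_def)

lemma bin_Suc_Suc: "bin (m + 1) (Suc k) = bin m k + bin m (Suc k)"
  by (simp add: bin_def int_binomial_Suc_Suc)

lemma sbin_Suc_Suc: "sbin (m + 1) (Suc k) = sbin m (Suc k) - (sbin m k :: 'a::field)"
  using bin_Suc_Suc[of m k, where ?'a = 'a] by (simp add: sbin_def algebra_simps)

lemma bin_Vandermonde: "(\<Sum>i\<le>t. bin a (t - i) * bin b i) = bin (a + b) t"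
  unfolding bin_def int_binomial_Vandermonde[symmetric] by simp

lemma sbin_Vandermonde: "(\<Sum>i\<le>t. sbin a (t - i) * sbin b i) = (sbin (a + b) t :: 'a::field)"
proof -
  have "(\<Sum>i\<le>t. sbin a (t - i) * sbin b i :: 'a) = (\<Sum>i\<le>t. (-1) ^ t * (bin a (t - i) * bin b i))"
    by (rule sum.cong[OF refl])
      (auto simp: sbin_def algebra_simps power_add[symmetric])
  then show ?thesis by (simp add: sum_distrib_left[symmetric] bin_Vandermonde sbin_def)
qed

lemma bin_trinomial: "bin a (r + j) * bin (int (r + j)) r = bin a r * bin (a - int r) j"
  unfolding bin_def of_int_mult[symmetric] by (simp only: int_binomial_trinomial)

lemma bin_trinomial': "bin a i * bin (a - int i) r = bin a r * bin (a - int r) i"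
  unfolding bin_def of_int_mult[symmetric] using int_binomial_trinomial'[of a i r] by simp

lemma bin_of_nat: "bin (int n) k = of_nat (n choose k)"
  by (simp add: bin_def int_binomial_of_nat)

lemma bin_of_nat_0: "n < k \<Longrightarrow> bin (int n) k = 0"
  by (simp add: bin_of_nat binomial_eq_0)

lemma bin_0_left: "bin 0 k = (if k = 0 then 1 else 0 :: 'a::field)"
  using bin_of_nat_0[of 0 k, where ?'a = 'a] by auto

lemma bin_1_left: "bin 1 k = (if k \<le> 1 then 1 else 0 :: 'a::field)"
proof -
  have "bin 1 k = (of_nat (1 choose k) :: 'a)" using bin_of_nat[of 1 k] by simp
  then show ?thesis by (cases k) (auto simp: binomial_eq_0)
qed

lemma bin_absorption: "of_nat (Suc k) * bin a (Suc k) = of_int a * bin (a - 1) k"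
proof -
  have "(of_int (int (Suc k) * int_binomial a (Suc k)) :: 'a) = of_int (a * int_binomial (a - 1) k)"
    by (simp only: int_binomial_absorption)
  then show ?thesis by (simp add: bin_def)
qed

lemma bin_absorb_comp: "(of_int a - of_nat k) * bin a k = of_int a * bin (a - 1) k"
proof -
  have "(of_int ((a - int k) * int_binomial a k) :: 'a) = of_int (a * int_binomial (a - 1) k)"
    by (simp only: int_binomial_absorb_comp)
  then show ?thesis by (simp add: bin_def)
qed

lemma bin_negated_upper: "bin a k = (-1) ^ k * bin (int k - a - 1) k"
  unfolding bin_def by (subst int_binomial_negated_upper) simp

lemma sbin_0_left: "sbin 0 k = (if k = 0 then 1 else 0)"
  by (simp add: sbin_def bin_0_left)

text \<open>Weighting by \<open>bin (int i) r\<close> replaces (1 - x)^b by x^r times its r-th Hasse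
  derivative, which is (-1)^r binom(b, r) x^r (1 - x)^(b-r). The claim compares coefficients of x^t
  after multiplication by (1 - x)^a.\<close>

lemma sbin_bin_sum:
  "(\<Sum>i\<le>t. sbin a (t - i) * sbin b i * bin (int i) r) =
   (if r \<le> t then (-1) ^ r * bin b r * sbin (a + b - int r) (t - r) else 0 :: 'a::field)"
proof (cases "r \<le> t")
  case False
  then have "bin (int i) r = (0::'a)" if "i \<le> t" for i using that by (intro bin_of_nat_0) simp
  with False show ?thesis by simp
next
  case True
  have "(\<Sum>i\<le>t. sbin a (t - i) * sbin b i * bin (int i) r) =
    (\<Sum>i\<in>{r..t}. sbin a (t - i) * sbin b i * (bin (int i) r :: 'a))"
    by (rule sum.mono_neutral_right) (auto simp: bin_of_nat_0 not_le)
  also have "\<dots> = (\<Sum>j\<le>t - r. sbin a (t - (r + j)) * sbin b (r + j) * bin (int (r + j)) r)"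
    by (rule sum.reindex_bij_witness[of _ "\<lambda>j. r + j" "\<lambda>i. i - r"]) (use True in auto)
  also have "\<dots> = (\<Sum>j\<le>t - r. (-1) ^ r * bin b r * (sbin a (t - r - j) * sbin (b - int r) j))"
  proof (rule sum.cong[OF refl])
    fix j
    have "sbin a (t - (r + j)) * sbin b (r + j) * bin (int (r + j)) r =
      (sbin a (t - r - j) * ((-1) ^ r * (-1) ^ j) * (bin b (r + j) * bin (int (r + j)) r) :: 'a)"
      by (simp add: sbin_def power_add algebra_simps)
    also have "\<dots> = (-1) ^ r * bin b r * (sbin a (t - r - j) * sbin (b - int r) j)"
      unfolding bin_trinomial by (simp add: sbin_def algebra_simps)
    finally show "sbin a (t - (r + j)) * sbin b (r + j) * bin (int (r + j)) r =
       (-1) ^ r * bin b r * (sbin a (t - r - j) * sbin (b - int r) j :: 'a)" .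
  qed
  also have "\<dots> = (-1) ^ r * bin b r * sbin (a + b - int r) (t - r)"
    by (simp only: sum_distrib_left[symmetric] sbin_Vandermonde) (simp add: algebra_simps)
  finally show ?thesis using True by simp
qed

text \<open>Trinomial revision, binom(b, i) binom(b-i, r) = binom(b, r) binom(b-r, i), pulls the
  weight out of the convolution.\<close>

lemma sbin_bin_sum':
  "(\<Sum>i\<le>t. sbin a (t - i) * sbin b i * bin (b - int i) r) = bin b r * (sbin (a + b - int r) t :: 'a::field)"
proof -
  have "sbin a (t - i) * sbin b i * bin (b - int i) r =
    (bin b r * (sbin a (t - i) * sbin (b - int r) i) :: 'a)" for i
  proof -
    have "sbin a (t - i) * sbin b i * bin (b - int i) r =
        (sbin a (t - i) * (-1) ^ i * (bin b i * bin (b - int i) r) :: 'a)"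
      by (simp add: sbin_def algebra_simps)
    also have "\<dots> = sbin a (t - i) * (-1) ^ i * (bin b r * bin (b - int r) i)"
      by (simp only: bin_trinomial'[of b i r])
    finally show ?thesis by (simp add: sbin_def algebra_simps)
  qed
  then have "(\<Sum>i\<le>t. sbin a (t - i) * sbin b i * bin (b - int i) r) =
      (\<Sum>i\<le>t. bin b r * (sbin a (t - i) * sbin (b - int r) i) :: 'a)" by (rule sum.cong[OF refl])
  also have "\<dots> = bin b r * sbin (a + b - int r) t"
    by (simp only: sum_distrib_left[symmetric] sbin_Vandermonde) (simp add: algebra_simps)
  finally show ?thesis .
qed

lemma bin_bin_sum':
  "(\<Sum>i\<le>t. bin a (t - i) * bin b i * bin (b - int i) r) = bin b r * (bin (a + b - int r) t :: 'a::field)"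
proof -
  have "bin a (t - i) * bin b i * bin (b - int i) r =
    (bin b r * (bin a (t - i) * bin (b - int r) i) :: 'a)" for i
    using bin_trinomial'[of b i r, where ?'a = 'a] by (simp add: mult.assoc mult.left_commute)
  then have "(\<Sum>i\<le>t. bin a (t - i) * bin b i * bin (b - int i) r) =
      (\<Sum>i\<le>t. bin b r * (bin a (t - i) * bin (b - int r) i) :: 'a)" by (rule sum.cong[OF refl])
  also have "\<dots> = bin b r * bin (a + b - int r) t"
    by (simp only: sum_distrib_left[symmetric] bin_Vandermonde) (simp add: algebra_simps)
  finally show ?thesis .
qed

text \<open>The weights are the structure constants of [L_(j-a), L_(k-b)] with a + b = t. With f =
  (1 - x)^(j+1) and g = (1 - x)^(k+1) the sum is the coefficient of x^t in (j - k) f g - x f' g + x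
  f g'. The derivative terms amount to (j - k) x (1 - x)^(j+k+1), which lowers the exponent of f g
  by one.\<close>

lemma sbin_weighted_Vandermonde:
  "(\<Sum>i\<le>t. sbin (j + 1) (t - i) * sbin (k + 1) i * of_int (j - int (t - i) - (k - int i))) =
   of_int (j - k) * (sbin (j + k + 1) t :: 'a::field)"
proof -
  have abs: "of_nat i * sbin (b + 1) i = (if i = 0 then 0 else - of_int (b + 1) * sbin b (i - 1) :: 'a)" for i b
  proof (cases i)
    case (Suc i')
    have "of_nat i * sbin (b + 1) i = (-1) ^ i * (of_nat (Suc i') * bin (b + 1) (Suc i') :: 'a)"
      by (simp add: Suc sbin_def)
    also have "\<dots> = (-1) ^ i * (of_int (b + 1) * bin b i')"
      unfolding bin_absorption by simp
    also have "\<dots> = - of_int (b + 1) * sbin b i'"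
      by (simp add: Suc sbin_def algebra_simps)
    finally show ?thesis by (simp add: Suc)
  qed simp
  have "(\<Sum>i\<le>t. sbin (j + 1) (t - i) * sbin (k + 1) i * of_int (j - int (t - i) - (k - int i))) =
    (\<Sum>i\<le>t. of_int (j - k) * (sbin (j + 1) (t - i) * sbin (k + 1) i)
      - (of_nat (t - i) * sbin (j + 1) (t - i)) * sbin (k + 1) i
      + sbin (j + 1) (t - i) * (of_nat i * sbin (k + 1) i) :: 'a)"
    by (rule sum.cong[OF refl]) (simp add: algebra_simps)
  also have "\<dots> = of_int (j - k) * sbin (j + k + 2) t
      - (\<Sum>i\<le>t. (of_nat (t - i) * sbin (j + 1) (t - i)) * sbin (k + 1) i)
      + (\<Sum>i\<le>t. sbin (j + 1) (t - i) * (of_nat i * sbin (k + 1) i))"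
    unfolding sum.distrib sum_subtractf sum_distrib_left[symmetric] sbin_Vandermonde
    by (simp add: algebra_simps)
  also have "(\<Sum>i\<le>t. sbin (j + 1) (t - i) * (of_nat i * sbin (k + 1) i)) =
      (if t = 0 then 0 else - of_int (k + 1) * sbin (j + k + 1) (t - 1) :: 'a)"
  proof (cases t)
    case (Suc t')
    have "(\<Sum>i\<le>Suc t'. sbin (j + 1) (Suc t' - i) * (of_nat i * sbin (k + 1) i)) =
       (\<Sum>i\<le>t'. - of_int (k + 1) * (sbin (j + 1) (t' - i) * sbin k i) :: 'a)"
      unfolding sum.atMost_Suc_shift abs by (simp add: algebra_simps)
    also have "\<dots> = - of_int (k + 1) * sbin (j + k + 1) t'"
      unfolding sum_distrib_left[symmetric] sbin_Vandermonde by (simp add: algebra_simps)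
    finally show ?thesis by (simp add: Suc)
  qed simp
  also have "(\<Sum>i\<le>t. (of_nat (t - i) * sbin (j + 1) (t - i)) * sbin (k + 1) i) =
      (if t = 0 then 0 else - of_int (j + 1) * sbin (j + k + 1) (t - 1) :: 'a)"
  proof (cases t)
    case (Suc t')
    have "(\<Sum>i\<le>Suc t'. (of_nat (Suc t' - i) * sbin (j + 1) (Suc t' - i)) * sbin (k + 1) i) =
       (\<Sum>i\<le>t'. - of_int (j + 1) * (sbin j (t' - i) * sbin (k + 1) i) :: 'a)"
      unfolding sum.atMost_Suc abs by (simp add: Suc_diff_le algebra_simps)
    also have "\<dots> = - of_int (j + 1) * sbin (j + k + 1) t'"
      unfolding sum_distrib_left[symmetric] sbin_Vandermonde by (simp add: algebra_simps)
    finally show ?thesis by (simp add: Suc)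
  qed simp
  also have "of_int (j - k) * sbin (j + k + 2) t
      - (if t = 0 then 0 else - of_int (j + 1) * sbin (j + k + 1) (t - 1))
      + (if t = 0 then 0 else - of_int (k + 1) * sbin (j + k + 1) (t - 1)) =
      of_int (j - k) * (sbin (j + k + 1) t :: 'a)"
  proof (cases t)
    case (Suc t')
    have e: "sbin (j + k + 2) (Suc t') = sbin (j + k + 1) (Suc t') - (sbin (j + k + 1) t' :: 'a)"
      using sbin_Suc_Suc[of "j + k + 1" t', where ?'a = 'a] by (simp add: add.assoc)
    show ?thesis unfolding Suc e by (simp add: algebra_simps)
  qed simp
  finally show ?thesis .
qed

text \<open>The same computation with the derivative terms alone; these weights are the structure
  constants of [L_(i-1), L_(t-i-1)].\<close>

lemma sbin_weighted_Vandermonde_right: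
  "(\<Sum>i\<le>t. sbin (j + 1) (t - i) * sbin (k + 1) i * of_int (int i - int (t - i))) =
   (if t = 0 then 0 else of_int (j - k) * (sbin (j + k + 1) (t - 1) :: 'a::field))"
proof -
  have "(\<Sum>i\<le>t. sbin (j + 1) (t - i) * sbin (k + 1) i * of_int (int i - int (t - i))) =
    (\<Sum>i\<le>t. sbin (j + 1) (t - i) * sbin (k + 1) i * of_int (j - int (t - i) - (k - int i))
       - of_int (j - k) * (sbin (j + 1) (t - i) * sbin (k + 1) i) :: 'a)"
    by (rule sum.cong[OF refl]) (simp add: algebra_simps)
  also have "\<dots> = of_int (j - k) * sbin (j + k + 1) t - of_int (j - k) * sbin (j + k + 2) t"
    unfolding sum_subtractf sbin_weighted_Vandermonde
    by (simp only: sum_distrib_left[symmetric] sbin_Vandermonde) (simp add: algebra_simps)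
  also have "\<dots> = (if t = 0 then 0 else of_int (j - k) * sbin (j + k + 1) (t - 1))"
  proof (cases t)
    case (Suc t')
    have e: "sbin (j + k + 2) (Suc t') = sbin (j + k + 1) (Suc t') - (sbin (j + k + 1) t' :: 'a)"
      using sbin_Suc_Suc[of "j + k + 1" t', where ?'a = 'a] by (simp add: add.assoc)
    show ?thesis unfolding Suc e by (simp add: algebra_simps)
  qed simp
  finally show ?thesis .
qed

lemma vir_cocycle_eq: "vir_cocycle m = bin (m + 1) 3 / 2"
  by (simp add: vir_cocycle_def bin_def)

lemma vir_cocycle_small [simp]:
  "vir_cocycle (-1) = (0::'a::field)" "vir_cocycle 0 = (0::'a)" "vir_cocycle 1 = (0::'a)"
proof -
  have "bin 2 3 = (of_nat (2 choose 3) :: 'a)" using bin_of_nat[of 2 3] by simp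
  also have "\<dots> = 0" by (simp add: binomial_eq_0)
  finally have "bin 2 3 = (0 :: 'a)" by simp
  then show "vir_cocycle (-1) = (0::'a)" "vir_cocycle 0 = (0::'a)" "vir_cocycle 1 = (0::'a)"
    by (simp_all add: vir_cocycle_eq bin_0_left bin_1_left)
qed

text \<open>The cocycle is a multiple of binom(j+1-a, 3), so trinomial revision extracts
  \<open>vir_cocycle j\<close> and leaves the coefficient of x^t in (1 - x)^(j+k-1). For j + k = t
  this is (1 - x)^(t-1), whose coefficient at x^t vanishes unless t = 0.\<close>

lemma sbin_cocycle_sum:
  assumes "int t = j + k"
  shows "(\<Sum>i\<le>t. sbin (j + 1) (t - i) * sbin (k + 1) i * vir_cocycle (j - int (t - i))) =
    (if t = 0 then vir_cocycle j else 0 :: 'a::field)"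
proof -
  have "sbin (j + 1) (t - i) * sbin (k + 1) i * vir_cocycle (j - int (t - i)) =
    (vir_cocycle j * (sbin (j - 2) (t - i) * sbin (k + 1) i) :: 'a)" if "i \<le> t" for i
  proof -
    have "sbin (j + 1) (t - i) * sbin (k + 1) i * vir_cocycle (j - int (t - i)) =
      ((-1) ^ (t - i) * sbin (k + 1) i * (bin (j + 1) (t - i) * bin (j + 1 - int (t - i)) 3) / 2 :: 'a)"
      by (simp add: vir_cocycle_eq sbin_def algebra_simps)
    also have "\<dots> = (-1) ^ (t - i) * sbin (k + 1) i * (bin (j + 1) 3 * bin (j - 2) (t - i)) / 2"
      using bin_trinomial'[of "j + 1" "t - i" 3, where ?'a = 'a] by simp
    finally show ?thesis by (simp add: vir_cocycle_eq sbin_def algebra_simps)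
  qed
  then have "(\<Sum>i\<le>t. sbin (j + 1) (t - i) * sbin (k + 1) i * vir_cocycle (j - int (t - i))) =
     (\<Sum>i\<le>t. vir_cocycle j * (sbin (j - 2) (t - i) * sbin (k + 1) i) :: 'a)"
    by (intro sum.cong) auto
  also have "\<dots> = vir_cocycle j * sbin (int t - 1) t"
    unfolding sum_distrib_left[symmetric] sbin_Vandermonde by (simp add: assms algebra_simps)
  also have "\<dots> = (if t = 0 then vir_cocycle j else 0)"
  proof (cases t)
    case (Suc t')
    then show ?thesis using bin_of_nat_0[of t' t, where ?'a = 'a] by (simp add: sbin_def)
  qed simp
  finally show ?thesis .
qed

section \<open>Finitely supported families and their sums\<close>

definition fs :: "(nat \<Rightarrow> 'w::zero) \<Rightarrow> bool" where
  "fs f \<longleftrightarrow> (\<exists>N. \<forall>i\<ge>N. f i = 0)"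

text \<open>Joint finite support is what licenses exchanging the two summations and regrouping along
  antidiagonals; finite support of each row alone would not.\<close>

definition fs2 :: "(nat \<Rightarrow> nat \<Rightarrow> 'w::zero) \<Rightarrow> bool" where
  "fs2 f \<longleftrightarrow> (\<exists>N. \<forall>s i. N \<le> s + i \<longrightarrow> f s i = 0)"

lemma fs_iff: "fs f \<longleftrightarrow> finite {i. f i \<noteq> 0}"
proof
  assume "fs f"
  then obtain N where "\<forall>i\<ge>N. f i = 0" by (auto simp: fs_def)
  then have "{i. f i \<noteq> 0} \<subseteq> {..<N}" by (auto simp: not_le)
  then show "finite {i. f i \<noteq> 0}" using finite_subset by blast
next
  assume "finite {i. f i \<noteq> 0}"
  then obtain N where "\<forall>i\<in>{i. f i \<noteq> 0}. i < N" by (meson finite_nat_set_iff_bounded)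
  then show "fs f" unfolding fs_def by (auto intro!: exI[of _ N] simp: not_less[symmetric])
qed

lemma fsI: "(\<And>i. N \<le> i \<Longrightarrow> f i = 0) \<Longrightarrow> fs f"
  by (auto simp: fs_def)

lemma fs_mono: "fs f \<Longrightarrow> (\<And>i. f i = 0 \<Longrightarrow> g i = 0) \<Longrightarrow> fs g"
  by (auto simp: fs_def)

lemma fs_add: "fs f \<Longrightarrow> fs g \<Longrightarrow> fs (\<lambda>i. f i + g i :: 'w::monoid_add)"
proof -
  assume "fs f" "fs g"
  then obtain M N where "\<forall>i\<ge>M. f i = 0" "\<forall>i\<ge>N. g i = 0" by (auto simp: fs_def)
  then show ?thesis by (intro fsI[of "max M N"]) simp
qed

lemma fs_diff: "fs f \<Longrightarrow> fs g \<Longrightarrow> fs (\<lambda>i. f i - g i :: 'w::group_add)"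
proof -
  assume "fs f" "fs g"
  then obtain M N where "\<forall>i\<ge>M. f i = 0" "\<forall>i\<ge>N. g i = 0" by (auto simp: fs_def)
  then show ?thesis by (intro fsI[of "max M N"]) simp
qed

lemma fs2I: "(\<And>s i. S \<le> s \<Longrightarrow> f s i = 0) \<Longrightarrow> (\<And>s. fs (f s)) \<Longrightarrow> fs2 f"
proof -
  assume a: "\<And>s i. S \<le> s \<Longrightarrow> f s i = 0" and b: "\<And>s. fs (f s)"
  from b obtain M where M: "\<And>s i. M s \<le> i \<Longrightarrow> f s i = 0" unfolding fs_def by metis
  \<comment> \<open>At most S rows are nonzero, and the sum of their bounds serves all of
    them.\<close>
  define N where "N = S + (\<Sum>s<S. M s)"
  have "f s i = 0" if "N \<le> s + i" for s i
  proof (cases "S \<le> s")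
    case False
    then have "M s \<le> (\<Sum>s<S. M s)" by (intro member_le_sum) auto
    with that False show ?thesis by (intro M) (simp add: N_def)
  qed (rule a)
  then show ?thesis by (auto simp: fs2_def)
qed

lemma fs2I': "(\<And>s i. I \<le> i \<Longrightarrow> f s i = 0) \<Longrightarrow> (\<And>i. fs (\<lambda>s. f s i)) \<Longrightarrow> fs2 f"
  using fs2I[of I "\<lambda>i s. f s i"] unfolding fs2_def by (metis add.commute)

lemma fs2_diag: "(\<And>s i. N \<le> s + i \<Longrightarrow> f s i = 0) \<Longrightarrow> fs2 f"
  by (auto simp: fs2_def)

lemma fs2_row: "fs2 f \<Longrightarrow> fs (f s)"
  unfolding fs_def fs2_def by (meson trans_le_add2)

lemma fs2_SA:
  fixes g :: "nat \<Rightarrow> nat \<Rightarrow> 'a::ab_group_add"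
  assumes "fs2 g" shows "fs (\<lambda>s. Sum_any (g s))"
proof -
  from assms obtain N where "\<And>s i. N \<le> s + i \<Longrightarrow> g s i = 0" by (auto simp: fs2_def)
  then show ?thesis unfolding fs_def by (intro exI[of _ N]) simp
qed

lemma SA_bound: "(\<And>i::nat. N \<le> i \<Longrightarrow> f i = 0) \<Longrightarrow> Sum_any f = (\<Sum>i<N. f i)"
  by (rule Sum_any.expand_superset) (use not_le in auto)

lemma SA_add: "fs f \<Longrightarrow> fs g \<Longrightarrow> (\<Sum>i. f i + g i) = Sum_any f + (Sum_any g :: 'w::ab_group_add)"
  by (rule Sum_any.distrib) (simp_all add: fs_iff)

lemma SA_hom:
  fixes h :: "'w::ab_group_add \<Rightarrow> 'v::ab_group_add"
  assumes "\<And>x y. h (x + y) = h x + h y" "fs f"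
  shows "h (Sum_any f) = (\<Sum>i. h (f i))"
proof -
  have h0: "h 0 = 0" using assms(1)[of 0 0] by simp
  from assms(2) obtain N where N: "\<And>i. N \<le> i \<Longrightarrow> f i = 0" by (auto simp: fs_def)
  have "h (\<Sum>i<n. f i) = (\<Sum>i<n. h (f i))" for n :: nat
    by (induction n) (simp_all add: assms(1) h0)
  moreover have "Sum_any f = (\<Sum>i<N. f i)" by (rule SA_bound) (rule N)
  moreover have "(\<Sum>i. h (f i)) = (\<Sum>i<N. h (f i))" by (rule SA_bound) (simp add: N h0)
  ultimately show ?thesis by simp
qed

lemma SA_minus: "fs f \<Longrightarrow> (\<Sum>i. - f i) = - (Sum_any f :: 'w::ab_group_add)"
  by (rule SA_hom[symmetric]) simp

lemma SA_diff: "fs f \<Longrightarrow> fs g \<Longrightarrow> (\<Sum>i. f i - g i) = Sum_any f - (Sum_any g :: 'w::ab_group_add)"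
  using SA_add[of f "\<lambda>i. - g i"] SA_minus[of g] fs_mono[of g "\<lambda>i. - g i"] by simp

lemma SA_diag:
  fixes f :: "nat \<Rightarrow> nat \<Rightarrow> 'w::ab_group_add"
  assumes "fs2 f"
  shows "(\<Sum>s. Sum_any (f s)) = (\<Sum>t. \<Sum>i\<le>t. f (t - i) i)"
proof -
  from assms obtain N where N: "\<And>s i. N \<le> s + i \<Longrightarrow> f s i = 0" by (auto simp: fs2_def)
  have in1: "Sum_any (f s) = (\<Sum>i<N. f s i)" for s by (rule SA_bound) (simp add: N)
  have "(\<Sum>s. Sum_any (f s)) = (\<Sum>s<N. \<Sum>i<N. f s i)"
    unfolding in1 by (rule SA_bound) (simp add: N)
  also have "\<dots> = (\<Sum>(s, i)\<in>{..<N} \<times> {..<N}. f s i)" by (simp add: sum.cartesian_product)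
  also have "\<dots> = (\<Sum>(s, i)\<in>{(s, i). s + i < N}. f s i)"
    by (rule sum.mono_neutral_right) (use N not_less in auto)
  also have "\<dots> = (\<Sum>(t, i)\<in>(SIGMA t:{..<N}. {..t}). f (t - i) i)"
    by (rule sum.reindex_bij_witness[of _ "\<lambda>(t, i). (t - i, i)" "\<lambda>(s, i). (s + i, i)"]) auto
  also have "\<dots> = (\<Sum>t<N. \<Sum>i\<le>t. f (t - i) i)" by (simp add: sum.Sigma)
  also have "\<dots> = (\<Sum>t. \<Sum>i\<le>t. f (t - i) i)"
    by (rule SA_bound[symmetric]) (simp add: N)
  finally show ?thesis .
qed

lemma SA_swap:
  fixes f :: "nat \<Rightarrow> nat \<Rightarrow> 'w::ab_group_add"
  assumes "fs2 f"
  shows "(\<Sum>s. Sum_any (f s)) = (\<Sum>i. (\<Sum>s. f s i))"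
proof -
  from assms obtain N where N: "\<And>s i. N \<le> s + i \<Longrightarrow> f s i = 0" by (auto simp: fs2_def)
  have "Sum_any (f s) = (\<Sum>i<N. f s i)" "(\<Sum>s. f s i) = (\<Sum>s<N. f s i)" for s i
    by (rule SA_bound; simp add: N)+
  then have "(\<Sum>s. Sum_any (f s)) = (\<Sum>s<N. \<Sum>i<N. f s i)"
    "(\<Sum>i. (\<Sum>s. f s i)) = (\<Sum>i<N. \<Sum>s<N. f s i)"
    by (simp only:; intro SA_bound; simp add: N)+
  then show ?thesis using sum.swap[of f "{..<N}" "{..<N}"] by simp
qed

lemma SA_shift:
  fixes f :: "nat \<Rightarrow> 'w::ab_group_add"
  assumes "\<And>t. t < r \<Longrightarrow> f t = 0"
  shows "Sum_any f = (\<Sum>j. f (j + r))"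
proof -
  have "{t. f t \<noteq> 0} = (\<lambda>j. j + r) ` {j. f (j + r) \<noteq> 0}"
  proof
    show "{t. f t \<noteq> 0} \<subseteq> (\<lambda>j. j + r) ` {j. f (j + r) \<noteq> 0}"
    proof
      fix t assume "t \<in> {t. f t \<noteq> 0}"
      then have "r \<le> t" "f t \<noteq> 0" using assms not_le by auto
      then show "t \<in> (\<lambda>j. j + r) ` {j. f (j + r) \<noteq> 0}"
        by (intro image_eqI[of _ _ "t - r"]) auto
    qed
  qed auto
  then have "Sum_any f = (\<Sum>t\<in>(\<lambda>j. j + r) ` {j. f (j + r) \<noteq> 0}. f t)"
    by (simp add: Sum_any.expand_set)
  also have "\<dots> = (\<Sum>j. f (j + r))"
    unfolding Sum_any.expand_set by (subst sum.reindex) (auto simp: inj_on_def)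
  finally show ?thesis .
qed

lemma SA_single: "(\<And>i. i \<noteq> a \<Longrightarrow> f i = 0) \<Longrightarrow> Sum_any f = f a"
  using Sum_any.expand_superset[of "{a}" f] by auto

lemma SA_cong: "(\<And>i. f i = g i) \<Longrightarrow> Sum_any f = Sum_any g"
  by simp

abbreviation sb1 :: "int \<Rightarrow> nat \<Rightarrow> 'a::field" where
  "sb1 k \<equiv> sbin (k + 1)"

section \<open>Fields on truncated Virasoro modules\<close>

text \<open>
  A module of central charge \<open>c\<close> is realised inside an ambient vector space as the range of an
  idempotent \<open>P\<close>, with the operators \<open>L n\<close> extended by zero to the kernel of \<open>P\<close>. All
  identities then hold without membership conditions.
\<close>

locale vir_rep = vector_space scale
  for scale :: "'a::field \<Rightarrow> 'w::ab_group_add \<Rightarrow> 'w" (infixr \<open>*s\<close> 75) +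
  fixes Lop :: "int \<Rightarrow> 'w \<Rightarrow> 'w" and P :: "'w \<Rightarrow> 'w" and c :: 'a
  assumes L_add [simp]: "Lop n (x + y) = Lop n x + Lop n y"
    and L_scale [simp]: "Lop n (a *s x) = a *s Lop n x"
    and P_add [simp]: "P (x + y) = P x + P y"
    and P_scale [simp]: "P (a *s x) = a *s P x"
    and P_P [simp]: "P (P x) = P x"
    and P_L [simp]: "P (Lop n x) = Lop n x"
    and L_P [simp]: "Lop n (P x) = Lop n x"
    and trunc: "\<exists>N. \<forall>n\<ge>N. Lop n x = 0"
    and vir_rel: "Lop m (Lop n x) - Lop n (Lop m x) =
      of_int (m - n) *s Lop (m + n) x + (if m + n = 0 then (vir_cocycle m * c) *s P x else 0)"
begin

lemma L_zero [simp]: "Lop n 0 = 0"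
  using L_add[of n 0 0] by simp

lemma L_neg [simp]: "Lop n (- x) = - Lop n x"
  using L_add[of n x "- x"] by (simp add: eq_neg_iff_add_eq_0 add.commute)

lemma L_diff [simp]: "Lop n (x - y) = Lop n x - Lop n y"
  using L_add[of n x "- y"] by simp

lemma P_zero [simp]: "P 0 = 0"
  using P_add[of 0 0] by simp

lemma P_neg [simp]: "P (- x) = - P x"
  using P_add[of x "- x"] by (simp add: eq_neg_iff_add_eq_0 add.commute)

lemma P_diff [simp]: "P (x - y) = P x - P y"
  using P_add[of x "- y"] by simp

text \<open>The coefficients of a series f(x) = sum of f_q x^(-q-1) with f(x)w in W((x)) for every
  w, where W is the range of \<open>P\<close>.\<close>

definition fld :: "(int \<Rightarrow> 'w \<Rightarrow> 'w) \<Rightarrow> bool" where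
  "fld f \<longleftrightarrow> (\<forall>q x y. f q (x + y) = f q x + f q y) \<and> (\<forall>q a x. f q (a *s x) = a *s f q x) \<and>
     (\<forall>q x. P (f q x) = f q x) \<and> (\<forall>q x. f q (P x) = f q x) \<and> (\<forall>x. \<exists>N. \<forall>q\<ge>N. f q x = 0)"

lemma fldD:
  assumes "fld f"
  shows "f q (x + y) = f q x + f q y" "f q (a *s x) = a *s f q x" "P (f q x) = f q x"
    "f q (P x) = f q x" "f q 0 = 0" "f q (- x) = - f q x" "f q (x - y) = f q x - f q y"
proof -
  have add: "f q (x + y) = f q x + f q y" for x y using assms by (simp add: fld_def)
  then show "f q (x + y) = f q x + f q y" .
  show z: "f q 0 = 0" using add[of 0 0] by simp
  have n: "f q (- x) = - f q x" for x
    using add[of x "- x"] z by (simp add: eq_neg_iff_add_eq_0 add.commute)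
  then show "f q (- x) = - f q x" .
  show "f q (x - y) = f q x - f q y" using add[of x "- y"] n by simp
qed (use assms in \<open>simp_all add: fld_def\<close>)

lemma fld_trunc: "fld f \<Longrightarrow> \<exists>N. \<forall>q\<ge>N. f q x = 0"
  by (simp add: fld_def)

lemma fs_L: "fs (\<lambda>i. Lop (int i + r) x)"
proof -
  obtain N where N: "\<And>n. N \<le> n \<Longrightarrow> Lop n x = 0" using trunc by blast
  show ?thesis by (rule fsI[of "nat (N - r)"]) (auto intro!: N)
qed

lemma fs_L': "fs (\<lambda>i. Lop (int i - 1) x)"
  using fs_L[of "-1"] by simp

lemma fs_fld: "fld f \<Longrightarrow> fs (\<lambda>i. f (r + int i) x)"
proof -
  assume "fld f"
  then obtain N where N: "\<And>n. N \<le> n \<Longrightarrow> f n x = 0" using fld_trunc by blast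
  show ?thesis by (rule fsI[of "nat (N - r)"]) (auto intro!: N)
qed

lemma SA_scale: "fs f \<Longrightarrow> a *s Sum_any f = (\<Sum>i. a *s f i)"
  by (rule SA_hom) (simp_all add: scale_right_distrib)

lemma SA_L: "fs f \<Longrightarrow> Lop n (Sum_any f) = (\<Sum>i. Lop n (f i))"
  by (rule SA_hom) simp_all

lemma SA_fld: "fld g \<Longrightarrow> fs f \<Longrightarrow> g q (Sum_any f) = (\<Sum>i. g q (f i))"
  by (rule SA_hom) (simp_all add: fldD)

lemma fs_scale: "fs f \<Longrightarrow> fs (\<lambda>i. a i *s f i)"
  by (erule fs_mono) simp

text \<open>If f is the field of v, this is the iterate formula for the mode q of L_k v =
  omega_(k+1) v. The index shifts come from omega_n = L_(n-1): the outer operators are L_(k-i), the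
  inner ones L_(i-1).\<close>

definition modeA :: "int \<Rightarrow> (int \<Rightarrow> 'w \<Rightarrow> 'w) \<Rightarrow> int \<Rightarrow> 'w \<Rightarrow> 'w" where
  "modeA k f q x =
     (\<Sum>i. sb1 k i *s Lop (k - int i) (f (q + int i) x)) -
     eps (k + 1) *s (\<Sum>i. sb1 k i *s f (q + k + 1 - int i) (Lop (int i - 1) x))"

lemma fs_A1: "fld f \<Longrightarrow> fs (\<lambda>i. a i *s Lop (r i) (f (q + int i) x))"
  by (rule fs_mono[OF fs_fld[of f q x]]) simp_all

lemma fs_A2: "fld f \<Longrightarrow> fs (\<lambda>i. a i *s f (r i) (Lop (int i - 1) x))"
  by (rule fs_mono[OF fs_L'[of x]]) (simp_all add: fldD)

lemma modeA_add:
  assumes f: "fld f" shows "modeA k f q (x + y) = modeA k f q x + modeA k f q y"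
  unfolding modeA_def
  by (simp add: fldD[OF f] scale_right_distrib SA_add fs_A1[OF f] fs_A2[OF f])

lemma modeA_scale:
  assumes f: "fld f" shows "modeA k f q (a *s x) = a *s modeA k f q x"
  unfolding modeA_def
  by (simp add: fldD[OF f] scale_right_diff_distrib SA_scale fs_A1[OF f] fs_A2[OF f] mult_ac)

lemma fld_modeA:
  assumes f: "fld f" shows "fld (modeA k f)"
  unfolding fld_def
proof (intro conjI allI)
  fix q x y a
  show "modeA k f q (x + y) = modeA k f q x + modeA k f q y" by (rule modeA_add[OF f])
  show "modeA k f q (a *s x) = a *s modeA k f q x" by (rule modeA_scale[OF f])
  show "modeA k f q (P x) = modeA k f q x" by (simp add: modeA_def fldD[OF f])
  have P_SA: "P (Sum_any g) = (\<Sum>i. P (g i))" if "fs g" for g :: "nat \<Rightarrow> 'w"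
    by (rule SA_hom) (simp_all add: that)
  show "P (modeA k f q x) = modeA k f q x"
    by (simp add: modeA_def P_SA fs_A1[OF f] fs_A2[OF f] fldD[OF f])
  obtain N where N: "\<And>q. N \<le> q \<Longrightarrow> f q x = 0" using fld_trunc[OF f] by blast
  obtain I where I: "\<And>i. I \<le> i \<Longrightarrow> Lop (int i - 1) x = 0" using fs_L'[of x] by (auto simp: fs_def)
  have "\<forall>i. \<exists>M. \<forall>q\<ge>M. f q (Lop (int i - 1) x) = 0" using fld_trunc[OF f] by blast
  then obtain M where M: "\<And>i q. M i \<le> q \<Longrightarrow> f q (Lop (int i - 1) x) = 0" by metis
  \<comment> \<open>Only the finitely many i < I contribute to the second sum, so their truncation
    bounds for f have a common majorant.\<close>
  define B where "B = (\<Sum>i<I. \<bar>M i\<bar>) + int I - k"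
  have "modeA k f q x = 0" if q: "max B N \<le> q" for q
  proof -
    have "f (q + int i) x = 0" for i using q by (intro N) simp
    moreover have "f (q + k + 1 - int i) (Lop (int i - 1) x) = 0" for i
    proof (cases "I \<le> i")
      case False
      then have "\<bar>M i\<bar> \<le> (\<Sum>i<I. \<bar>M i\<bar>)" by (intro member_le_sum) auto
      with q False have "M i \<le> q + k + 1 - int i" unfolding B_def by linarith
      then show ?thesis by (rule M)
    qed (simp add: I fldD[OF f])
    ultimately show ?thesis by (simp add: modeA_def)
  qed
  then show "\<exists>N. \<forall>q\<ge>N. modeA k f q x = 0" by blast
qed

text \<open>Four double sums arise according to whether each operator ends up left or right of f.
  The two mixed ones change places under exchange of j and k and hence cancel in the
  commutator.\<close>

lemma modeA_modeA:
  assumes f: "fld f"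
  shows "modeA j (modeA k f) q x =
    (\<Sum>a. (\<Sum>b. (sb1 j a * sb1 k b) *s
      Lop (j - int a) (Lop (k - int b) (f (q + int a + int b) x))))
    - eps (k + 1) *s (\<Sum>a. (\<Sum>b. (sb1 j a * sb1 k b) *s
      Lop (j - int a) (f (q + int a + k + 1 - int b) (Lop (int b - 1) x))))
    - eps (j + 1) *s (\<Sum>a. (\<Sum>b. (sb1 j a * sb1 k b) *s
      Lop (k - int b) (f (q + int b + j + 1 - int a) (Lop (int a - 1) x))))
    + (eps (j + 1) * eps (k + 1)) *s (\<Sum>a. (\<Sum>b. (sb1 j a * sb1 k b) *s
      f (q + j + k + 2 - int a - int b) (Lop (int b - 1) (Lop (int a - 1) x))))"
    (is "_ = ?S1 - _ *s ?S2 - _ *s ?S3 + _ *s ?S4")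
proof -
  note fd = fldD[OF f]
  have A: "modeA k f (q + int a) x = (\<Sum>b. sb1 k b *s Lop (k - int b) (f (q + int a + int b) x))
      - eps (k + 1) *s (\<Sum>b. sb1 k b *s f (q + int a + k + 1 - int b) (Lop (int b - 1) x))" for a
    by (simp add: modeA_def)
  have 1: "sb1 j a *s Lop (j - int a) (modeA k f (q + int a) x) =
      (\<Sum>b. (sb1 j a * sb1 k b) *s Lop (j - int a) (Lop (k - int b) (f (q + int a + int b) x)))
      - eps (k + 1) *s (\<Sum>b. (sb1 j a * sb1 k b) *s
          Lop (j - int a) (f (q + int a + k + 1 - int b) (Lop (int b - 1) x)))" for a
  proof -
    have e1: "sb1 j a *s Lop (j - int a) (Sum_any g) =
       (\<Sum>b. sb1 j a *s Lop (j - int a) (g b))" if "fs g" for g :: "nat \<Rightarrow> 'w"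
      using that by (intro SA_hom) (simp_all add: scale_right_distrib)
    have e2: "(sb1 j a * eps (k + 1)) *s Lop (j - int a) (Sum_any g) =
       eps (k + 1) *s (\<Sum>b. sb1 j a *s Lop (j - int a) (g b))" if "fs g" for g :: "nat \<Rightarrow> 'w"
      unfolding e1[OF that, symmetric] by (simp add: mult.commute)
    show ?thesis
      unfolding A L_diff L_scale scale_right_diff_distrib scale_scale
      by (simp only: e1[OF fs_A1[OF f]] e2[OF fs_A2[OF f]] L_scale scale_scale)
  qed
  have 2: "sb1 j a *s modeA k f (q + j + 1 - int a) (Lop (int a - 1) x) =
      (\<Sum>b. (sb1 j a * sb1 k b) *s Lop (k - int b) (f (q + int b + j + 1 - int a) (Lop (int a - 1) x)))
      - eps (k + 1) *s (\<Sum>b. (sb1 j a * sb1 k b) *s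
          f (q + j + k + 2 - int a - int b) (Lop (int b - 1) (Lop (int a - 1) x)))" for a
  proof -
    have e: "q + j + 1 - int a + int b = q + int b + j + 1 - int a"
      "q + j + 1 - int a + k + 1 - int b = q + j + k + 2 - int a - int b" for b by simp_all
    have "fs (\<lambda>b. sb1 k b *s Lop (k - int b) (f (q + int b + j + 1 - int a) (Lop (int a - 1) x)))"
      using fs_A1[OF f, of "sb1 k" _ "q + j + 1 - int a"] by (simp add: e)
    then show ?thesis
      unfolding modeA_def e
      by (simp add: SA_scale fs_A2[OF f] scale_right_diff_distrib fs_scale mult_ac)
  qed
  have s1: "fs2 (\<lambda>a b. (sb1 j a * sb1 k b) *s
      Lop (j - int a) (Lop (k - int b) (f (q + int a + int b) x)))"
  proof -
    obtain N where N: "\<And>i. N \<le> i \<Longrightarrow> f (q + int i) x = 0" using fs_fld[OF f, of q x] by (auto simp: fs_def)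
    show ?thesis by (rule fs2_diag[of N]) (use N in \<open>simp add: add.assoc flip: of_nat_add\<close>)
  qed
  obtain I where I: "\<And>i. I \<le> i \<Longrightarrow> Lop (int i - 1) x = 0" using fs_L'[of x] by (auto simp: fs_def)
  have s2: "fs2 (\<lambda>a b. (sb1 j a * sb1 k b) *s
      Lop (j - int a) (f (q + int a + k + 1 - int b) (Lop (int b - 1) x)))"
  proof (rule fs2I'[of I])
    fix b
    show "fs (\<lambda>a. (sb1 j a * sb1 k b) *s
      Lop (j - int a) (f (q + int a + k + 1 - int b) (Lop (int b - 1) x)))"
      by (rule fs_mono[OF fs_fld[OF f, of "q + k + 1 - int b" "Lop (int b - 1) x"]]) (simp add: algebra_simps)
  qed (simp add: I fd)
  have s3: "fs2 (\<lambda>a b. (sb1 j a * sb1 k b) *s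
      Lop (k - int b) (f (q + int b + j + 1 - int a) (Lop (int a - 1) x)))"
  proof (rule fs2I[of I])
    fix a
    show "fs (\<lambda>b. (sb1 j a * sb1 k b) *s
      Lop (k - int b) (f (q + int b + j + 1 - int a) (Lop (int a - 1) x)))"
      by (rule fs_mono[OF fs_fld[OF f, of "q + j + 1 - int a" "Lop (int a - 1) x"]]) (simp add: algebra_simps)
  qed (simp add: I fd)
  have s4: "fs2 (\<lambda>a b. (sb1 j a * sb1 k b) *s
      f (q + j + k + 2 - int a - int b) (Lop (int b - 1) (Lop (int a - 1) x)))"
  proof (rule fs2I[of I])
    fix a
    show "fs (\<lambda>b. (sb1 j a * sb1 k b) *s
      f (q + j + k + 2 - int a - int b) (Lop (int b - 1) (Lop (int a - 1) x)))"
      by (rule fs_mono[OF fs_L'[of "Lop (int a - 1) x"]]) (simp add: fd)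
  qed (simp add: I fd)
  note r = fs2_SA[where ?'a = 'w]
  have "modeA j (modeA k f) q x = ?S1 - eps (k + 1) *s ?S2 - eps (j + 1) *s (?S3 - eps (k + 1) *s ?S4)"
    unfolding modeA_def[of j "modeA k f"] 1 2
    by (simp add: SA_diff r s1 s2 s3 s4 fs_scale SA_scale[symmetric])
  then show ?thesis by (simp add: scale_right_diff_distrib)
qed

text \<open>The operations \<open>modeA k\<close> make the fields a representation of the Virasoro
  algebra of central charge c. This is exactly what allows Y to be defined on all of U by recursion
  over words.\<close>

lemma modeA_commutator:
  assumes f: "fld f"
  shows "modeA j (modeA k f) q x - modeA k (modeA j f) q x =
    of_int (j - k) *s modeA (j + k) f q x + (if j + k = 0 then (vir_cocycle j * c) *s f q x else 0)"
proof -
  note fd = fldD[OF f]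
  define LL where "LL j k a b = (sb1 j a * sb1 k b) *s
      Lop (j - int a) (Lop (k - int b) (f (q + int a + int b) x))" for j k a b
  define MM where "MM j k a b = (sb1 j a * sb1 k b) *s
      Lop (j - int a) (f (q + int a + k + 1 - int b) (Lop (int b - 1) x))" for j k a b
  define RR where "RR j k a b = (sb1 j a * sb1 k b) *s
      f (q + j + k + 2 - int a - int b) (Lop (int b - 1) (Lop (int a - 1) x))" for j k a b
  obtain N where N: "\<And>i. N \<le> i \<Longrightarrow> f (q + int i) x = 0" using fs_fld[OF f, of q x] by (auto simp: fs_def)
  obtain I where I: "\<And>i. I \<le> i \<Longrightarrow> Lop (int i - 1) x = 0" using fs_L'[of x] by (auto simp: fs_def)
  have sL: "fs2 (LL j k)" for j k
    by (rule fs2_diag[of N]) (use N in \<open>simp add: LL_def add.assoc flip: of_nat_add\<close>)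
  have sM: "fs2 (MM j k)" for j k
  proof (rule fs2I'[of I])
    fix b
    show "fs (\<lambda>a. MM j k a b)" unfolding MM_def
      by (rule fs_mono[OF fs_fld[OF f, of "q + k + 1 - int b" "Lop (int b - 1) x"]]) (simp add: algebra_simps)
  qed (simp add: I fd MM_def)
  have sR: "fs2 (RR j k)" for j k
  proof (rule fs2I[of I])
    fix a
    show "fs (RR j k a)" unfolding RR_def
      by (rule fs_mono[OF fs_L'[of "Lop (int a - 1) x"]]) (simp add: fd)
  qed (simp add: I fd RR_def)
  have sw: "fs2 (\<lambda>a b. g b a)" if "fs2 g" for g :: "nat \<Rightarrow> nat \<Rightarrow> 'w"
    using that unfolding fs2_def by (metis add.commute)
  have exp: "modeA j (modeA k f) q x = (\<Sum>a. Sum_any (LL j k a)) - eps (k + 1) *s (\<Sum>a. Sum_any (MM j k a))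
    - eps (j + 1) *s (\<Sum>a. Sum_any (MM k j a)) + (eps (j + 1) * eps (k + 1)) *s (\<Sum>a. Sum_any (RR j k a))" for j k
  proof -
    have "(\<Sum>a. (\<Sum>b. (sb1 j a * sb1 k b) *s
      Lop (k - int b) (f (q + int b + j + 1 - int a) (Lop (int a - 1) x)))) =
      (\<Sum>a. (\<Sum>b. MM k j b a))"
      unfolding MM_def by (simp add: mult.commute)
    also have "\<dots> = (\<Sum>a. Sum_any (MM k j a))" by (rule SA_swap[OF sM, symmetric])
    finally show ?thesis unfolding modeA_modeA[OF f] LL_def RR_def MM_def[of j k] by simp
  qed
  have dif: "(\<Sum>a. Sum_any (g a)) - (\<Sum>a. Sum_any (h a)) =
      (\<Sum>t. \<Sum>i\<le>t. g (t - i) i - h i (t - i))" if g: "fs2 g" and h: "fs2 h" for g h :: "nat \<Rightarrow> nat \<Rightarrow> 'w"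
  proof -
    have r: "fs (\<lambda>t. \<Sum>i\<le>t. g (t - i) i)" if g: "fs2 g" for g :: "nat \<Rightarrow> nat \<Rightarrow> 'w"
    proof -
      from g obtain N where N: "\<And>s i. N \<le> s + i \<Longrightarrow> g s i = 0" by (auto simp: fs2_def)
      show ?thesis by (rule fsI[of N]) (simp add: N)
    qed
    show ?thesis
      unfolding SA_swap[OF h] SA_diag[OF g] SA_diag[OF sw[OF h]]
      by (subst SA_diff[symmetric]) (simp_all add: r[OF g] r[OF sw[OF h]] sum_subtractf)
  qed
  \<comment> \<open>On the antidiagonal t every bracket is a multiple of L_(j+k-t), so the
    coefficients can be summed first. The central terms live only at t = j + k and cancel there
    unless t = 0.\<close>
  have LLc: "(\<Sum>i\<le>t. LL j k (t - i) i - LL k j i (t - i)) =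
      of_int (j - k) *s (sbin (j + k + 1) t *s Lop (j + k - int t) (f (q + int t) x))
      + (if int t = j + k \<and> t = 0 then (vir_cocycle j * c) *s f q x else 0)" for t
  proof -
    have "LL j k (t - i) i - LL k j i (t - i) =
        (sb1 j (t - i) * sb1 k i * of_int (j - int (t - i) - (k - int i))) *s Lop (j + k - int t) (f (q + int t) x)
        + (if int t = j + k then (sb1 j (t - i) * sb1 k i * vir_cocycle (j - int (t - i)) * c) *s f (q + int t) x else 0)"
      if i: "i \<le> t" for i
    proof -
      have "LL j k (t - i) i - LL k j i (t - i) = (sb1 j (t - i) * sb1 k i) *s
          (Lop (j - int (t - i)) (Lop (k - int i) (f (q + int t) x)) - Lop (k - int i) (Lop (j - int (t - i)) (f (q + int t) x)))"
        using i by (simp add: LL_def scale_right_diff_distrib of_nat_diff algebra_simps)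
      also have "\<dots> = (sb1 j (t - i) * sb1 k i) *s
          (of_int (j - int (t - i) - (k - int i)) *s Lop (j + k - int t) (f (q + int t) x)
          + (if int t = j + k then (vir_cocycle (j - int (t - i)) * c) *s f (q + int t) x else 0))"
      proof -
        have "j - int (t - i) + (k - int i) = j + k - int t" using i by (simp add: of_nat_diff)
        moreover have "(j + k - int t = 0) = (int t = j + k)" by auto
        ultimately show ?thesis unfolding vir_rel by (simp only: fd)
      qed
      finally show ?thesis by (simp add: scale_right_distrib mult_ac)
    qed
    then have "(\<Sum>i\<le>t. LL j k (t - i) i - LL k j i (t - i)) =
      (\<Sum>i\<le>t. (sb1 j (t - i) * sb1 k i * of_int (j - int (t - i) - (k - int i))) *s Lop (j + k - int t) (f (q + int t) x))
        + (\<Sum>i\<le>t. (if int t = j + k then (sb1 j (t - i) * sb1 k i * vir_cocycle (j - int (t - i)) * c) *s f (q + int t) x else 0))"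
      by (simp add: sum.distrib)
    also have "\<dots> = (of_int (j - k) * sbin (j + k + 1) t) *s Lop (j + k - int t) (f (q + int t) x)
        + (if int t = j + k \<and> t = 0 then (vir_cocycle j * c) *s f q x else 0)"
    proof -
      have "(\<Sum>i\<le>t. (if int t = j + k then (sb1 j (t - i) * sb1 k i * vir_cocycle (j - int (t - i)) * c) *s f (q + int t) x else 0))
        = (if int t = j + k \<and> t = 0 then (vir_cocycle j * c) *s f q x else 0)"
      proof (cases "int t = j + k")
        case True
        have "(\<Sum>i\<le>t. (if int t = j + k then (sb1 j (t - i) * sb1 k i * vir_cocycle (j - int (t - i)) * c) *s f (q + int t) x else 0))
          = ((\<Sum>i\<le>t. sb1 j (t - i) * sb1 k i * vir_cocycle (j - int (t - i))) * c) *s f (q + int t) x"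
          by (simp only: True refl if_True scale_sum_left sum_distrib_right)
        then show ?thesis using True unfolding sbin_cocycle_sum[OF True] by auto
      qed simp
      then show ?thesis
        unfolding scale_sum_left[symmetric] sbin_weighted_Vandermonde by simp
    qed
    finally show ?thesis by simp
  qed
  have RRc: "(\<Sum>i\<le>t. RR j k (t - i) i - RR k j i (t - i)) =
      (if t = 0 then 0 else of_int (j - k) *s (sbin (j + k + 1) (t - 1) *s f (q + j + k + 2 - int t) (Lop (int t - 2) x)))" for t
  proof -
    have "RR j k (t - i) i - RR k j i (t - i) =
        (sb1 j (t - i) * sb1 k i * of_int (int i - int (t - i))) *s f (q + j + k + 2 - int t) (Lop (int t - 2) x)"
      if i: "i \<le> t" for i
    proof -
      have e: "int i - 1 + (int (t - i) - 1) = int t - 2" using i by (simp add: of_nat_diff)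
      have "RR j k (t - i) i - RR k j i (t - i) = (sb1 j (t - i) * sb1 k i) *s
          f (q + j + k + 2 - int t) (Lop (int i - 1) (Lop (int (t - i) - 1) x) - Lop (int (t - i) - 1) (Lop (int i - 1) x))"
        using i by (simp add: RR_def fd scale_right_diff_distrib of_nat_diff algebra_simps)
      \<comment> \<open>A central term would need t = 2, where i - 1 lies in {-1, 0, 1} and the
        cocycle is zero.\<close>
      moreover have "vir_cocycle (int i - 1) = (0::'a)" if "int t = 2"
      proof -
        from i that have "i = 0 \<or> i = 1 \<or> i = 2" by auto
        then show ?thesis by auto
      qed
      ultimately show ?thesis
        unfolding vir_rel e by (auto simp: fd mult_ac)
    qed
    then have "(\<Sum>i\<le>t. RR j k (t - i) i - RR k j i (t - i)) =
      (\<Sum>i\<le>t. sb1 j (t - i) * sb1 k i * of_int (int i - int (t - i))) *s f (q + j + k + 2 - int t) (Lop (int t - 2) x)"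
      by (simp add: scale_sum_left)
    then show ?thesis unfolding sbin_weighted_Vandermonde_right by simp
  qed
  have "modeA j (modeA k f) q x - modeA k (modeA j f) q x =
      ((\<Sum>a. Sum_any (LL j k a)) - (\<Sum>a. Sum_any (LL k j a)))
      + (eps (j + 1) * eps (k + 1)) *s ((\<Sum>a. Sum_any (RR j k a)) - (\<Sum>a. Sum_any (RR k j a)))"
    unfolding exp by (simp add: scale_right_diff_distrib mult.commute)
  also have "(\<Sum>a. Sum_any (LL j k a)) - (\<Sum>a. Sum_any (LL k j a)) =
      of_int (j - k) *s (\<Sum>t. sbin (j + k + 1) t *s Lop (j + k - int t) (f (q + int t) x))
      + (if j + k = 0 then (vir_cocycle j * c) *s f q x else 0)"
  proof -
    have "fs (\<lambda>t. if int t = j + k \<and> t = 0 then (vir_cocycle j * c) *s f q x else 0)"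
      by (rule fsI[of 1]) simp
    moreover have "(\<Sum>t. if int t = j + k \<and> t = 0 then (vir_cocycle j * c) *s f q x else 0)
        = (if j + k = 0 then (vir_cocycle j * c) *s f q x else 0)"
      by (subst SA_single[of 0]) auto
    ultimately show ?thesis
      unfolding dif[OF sL sL] LLc
      by (simp add: SA_add fs_A1[OF f] fs_scale SA_scale)
  qed
  also have "(\<Sum>a. Sum_any (RR j k a)) - (\<Sum>a. Sum_any (RR k j a)) =
      of_int (j - k) *s (\<Sum>i. sbin (j + k + 1) i *s f (q + (j + k) + 1 - int i) (Lop (int i - 1) x))"
  proof -
    \<comment> \<open>With t = i + 1 the sum takes the shape of the second half of
      \<open>modeA (j + k)\<close>; the term t = 0 is absent.\<close>
    have e: "q + j + k + 2 - int (Suc i) = q + (j + k) + 1 - int i" "int (Suc i) - 2 = int i - 1" for i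
      by simp_all
    have "(\<Sum>a. Sum_any (RR j k a)) - (\<Sum>a. Sum_any (RR k j a)) =
      (\<Sum>i. if i + 1 = 0 then 0 else of_int (j - k) *s (sbin (j + k + 1) (i + 1 - 1) *s f (q + j + k + 2 - int (i + 1)) (Lop (int (i + 1) - 2) x)))"
      unfolding dif[OF sR sR] RRc by (rule SA_shift) simp
    also have "\<dots> = of_int (j - k) *s (\<Sum>i. sbin (j + k + 1) i *s f (q + (j + k) + 1 - int i) (Lop (int i - 1) x))"
      unfolding SA_scale[OF fs_A2[OF f]] by (simp add: e del: of_nat_Suc)
    finally show ?thesis .
  qed
  also have "eps (j + 1) * eps (k + 1) = (- eps (j + k + 1) :: 'a)"
    by (simp add: eps_add)
  finally show ?thesis
    unfolding modeA_def by (simp add: scale_right_diff_distrib mult.commute add.assoc[symmetric])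
qed

end

section \<open>The enveloping algebra\<close>

lemma vir_tensor_induct [case_names zero add single]:
  assumes "P 0" "\<And>x y. P x \<Longrightarrow> P y \<Longrightarrow> P (x + y)" "\<And>gs a. P (tmon (Word gs) a)"
  shows "P (t :: 'a::field vir_tensor)"
proof (induction t rule: update_induct)
  case (update f w b)
  obtain gs where w: "w = Word gs" by (cases w)
  have "Poly_Mapping.update w b f = f + tmon w b"
    using update(1) by (intro poly_mapping_eqI)
      (auto simp: lookup_add lookup_single lookup_update when_def in_keys_iff)
  with update assms w show ?case by simp
qed (rule assms)

lemma abs_vir_env_add: "abs_vir_env (x + y) = abs_vir_env x + abs_vir_env y"
  by (simp add: plus_vir_env.abs_eq)

lemma abs_vir_env_mult: "abs_vir_env (x * y) = abs_vir_env x * abs_vir_env y"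
  by (simp add: times_vir_env.abs_eq)

lemma abs_vir_env_0: "abs_vir_env 0 = 0"
  by (simp add: zero_vir_env.abs_eq)

lemma abs_vir_env_1: "abs_vir_env 1 = 1"
  by (simp add: one_vir_env.abs_eq)

lemma env_gen_abs: "env_gen g = abs_vir_env (tensor_gen g)"
  by (simp add: env_gen.abs_eq)

lemma env_scalar_abs: "env_scalar a = abs_vir_env (tmon 0 a)"
  by (simp add: env_scalar.abs_eq)

lemma abs_vir_env_eq_iff: "abs_vir_env x = abs_vir_env y \<longleftrightarrow> env_rel x y"
  using Quotient3_rel[OF Quotient3_vir_env] equivp_reflp[OF equivp_env_rel] by auto

lemma env_rel_rep_abs: "env_rel (rep_vir_env (abs_vir_env x)) x"
  using Quotient3_abs_rep[OF Quotient3_vir_env, of "abs_vir_env x"] abs_vir_env_eq_iff by metis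

lemma abs_rep_vir_env [simp]: "abs_vir_env (rep_vir_env u) = u"
  by (rule Quotient3_abs_rep[OF Quotient3_vir_env])

lemma env_scalar_add: "env_scalar (a + b) = env_scalar a + env_scalar b"
  by (simp add: env_scalar_abs single_add abs_vir_env_add)

lemma env_scalar_mult: "env_scalar (a * b) = env_scalar a * env_scalar b"
  by (simp add: env_scalar_abs mult_single abs_vir_env_mult[symmetric])

lemma env_scalar_0 [simp]: "env_scalar 0 = 0"
  by (simp add: env_scalar_abs abs_vir_env_0)

lemma env_scalar_1 [simp]: "env_scalar 1 = 1"
  by (simp add: env_scalar_abs abs_vir_env_1)

lemma env_scalar_minus: "env_scalar (- a) = - env_scalar a"
  using env_scalar_add[of a "- a"] by (simp add: eq_neg_iff_add_eq_0 add.commute)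

lemma env_scalar_diff: "env_scalar (a - b) = env_scalar a - env_scalar b"
  using env_scalar_add[of a "- b"] by (simp add: env_scalar_minus)

lemma env_scalar_of_nat: "env_scalar (of_nat n) = of_nat n"
  by (induction n) (simp_all add: env_scalar_add)

lemma env_scalar_of_int: "env_scalar (of_int n) = of_int n"
  by (cases n rule: int_cases2) (simp_all add: env_scalar_of_nat env_scalar_minus)

lemma env_scalar_commute: "env_scalar a * u = u * env_scalar a"
proof -
  have "tmon 0 a * t = t * tmon 0 a" for t :: "'a vir_tensor"
    by (induction t rule: vir_tensor_induct)
      (simp_all add: distrib_left distrib_right mult_single mult.commute)
  then have "abs_vir_env (tmon 0 a * rep_vir_env u) =
      abs_vir_env (rep_vir_env u * tmon 0 a)" by simp
  then show ?thesis by (simp add: abs_vir_env_mult env_scalar_abs)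
qed

lemma mult_env_scalar: "u * (env_scalar a * v) = env_scalar a * (u * v)"
  by (metis mult.assoc env_scalar_commute)

text \<open>Generators are multiplied on the left only, the direction in which the fields are
  defined recursively.\<close>

lemma vir_env_induct [case_names one add scale gen, induct type: vir_env]:
  assumes "P 1" "\<And>u v. P u \<Longrightarrow> P v \<Longrightarrow> P (u + v)" "\<And>a u. P u \<Longrightarrow> P (env_scalar a * u)"
    "\<And>g u. P u \<Longrightarrow> P (env_gen g * u)"
  shows "P (u :: 'a::field vir_env)"
proof -
  have "P (abs_vir_env t)" for t :: "'a vir_tensor"
  proof (induction t rule: vir_tensor_induct)
    case zero
    then show ?case using assms(3)[OF assms(1), of 0] by (simp add: abs_vir_env_0)
  next
    case (single gs a)
    have "P (abs_vir_env (tmon (Word gs) 1))"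
    proof (induction gs)
      case Nil
      then show ?case using assms(1) by (simp add: zero_vir_word_def[symmetric] abs_vir_env_1)
    next
      case (Cons g gs)
      have "tmon (Word (g # gs)) 1 =
          tensor_gen g * (tmon (Word gs) 1 :: 'a vir_tensor)"
        by (simp add: mult_single)
      with Cons assms(4) show ?case by (simp add: abs_vir_env_mult env_gen_abs)
    qed
    moreover have "tmon (Word gs) a =
        tmon 0 a * (tmon (Word gs) 1 :: 'a vir_tensor)"
      by (simp add: mult_single)
    ultimately show ?case using assms(3) by (simp add: abs_vir_env_mult env_scalar_abs)
  qed (simp add: abs_vir_env_add assms(2))
  then show ?thesis using abs_rep_vir_env by metis
qed

lemma env_gen_bracket:
  "env_gen g * env_gen h - env_gen h * env_gen g = abs_vir_env (vir_bracket g h)"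
proof -
  have "tensor_gen g * tensor_gen h - tensor_gen h * tensor_gen g - vir_bracket g h \<in> env_ideal"
    using env_ideal.step[OF env_ideal.zero, of 1 g h 1] by simp
  then have "abs_vir_env (tensor_gen g * tensor_gen h - tensor_gen h * tensor_gen g) =
      abs_vir_env (vir_bracket g h)"
    unfolding abs_vir_env_eq_iff env_rel_def .
  then show ?thesis
    by (simp add: env_gen_abs minus_vir_env.abs_eq[symmetric] abs_vir_env_mult[symmetric])
qed

lemma env_gen_L_L:
  "EL m * EL n = EL n * EL m + (of_int (m - n) * EL (m + n) +
    (if m + n = 0 then env_scalar (vir_cocycle m) * env_gen C else 0))"
proof -
  have s: "tmon (Word [g]) a = tmon 0 a * tensor_gen g" for g and a :: 'a
    by (simp add: mult_single)
  have "abs_vir_env (vir_bracket (L m) (L n)) = of_int (m - n) * EL (m + n) +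
     (if m + n = 0 then env_scalar (vir_cocycle m) * env_gen C else (0 :: 'a vir_env))"
    by (auto simp: abs_vir_env_add s[of _ "of_int (m - n)"] s[of C "of_int (int_binomial (m + 1) 3) / 2"]
        abs_vir_env_mult env_scalar_abs[symmetric] env_gen_abs[symmetric] env_scalar_of_int vir_cocycle_def abs_vir_env_0
        simp del: of_int_diff single_of_int)
  then show ?thesis using env_gen_bracket[of "L m" "L n", where ?'a = 'a]
    by (metis add.commute diff_eq_eq)
qed

lemma env_gen_L_L_mult:
  "EL m * (EL n * u) = EL n * (EL m * u) +
    (of_int (m - n) * (EL (m + n) * u) +
    (if m + n = 0 then env_scalar (vir_cocycle m) * (env_gen C * u) else 0))"
  unfolding mult.assoc[symmetric] env_gen_L_L[of m n] by (simp add: algebra_simps)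

lemma env_gen_C_commute: "env_gen C * u = u * env_gen C"
proof (induction u)
  case (add u v)
  then show ?case by (simp add: distrib_left distrib_right)
next
  case (scale a u)
  then show ?case by (simp add: mult_env_scalar mult.assoc)
next
  case (gen g u)
  have "env_gen C * env_gen g = env_gen g * env_gen C"
    using env_gen_bracket[of C g] by (simp add: abs_vir_env_0)
  with gen show ?case by (metis mult.assoc)
qed simp

lemma env_gen_C_mult: "u * (env_gen C * v) = env_gen C * (u * v)"
  by (metis mult.assoc env_gen_C_commute)

lemma left_ideal_add: "y \<in> left_ideal S \<Longrightarrow> x \<in> left_ideal S \<Longrightarrow> x + y \<in> left_ideal S"
proof (induction y rule: left_ideal.induct)
  case (step y s u)
  then show ?case using left_ideal.step[of "x + y" S s u] by (simp add: add.assoc)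
qed simp

lemma left_ideal_mult: "x \<in> left_ideal S \<Longrightarrow> u * x \<in> left_ideal S"
proof (induction x rule: left_ideal.induct)
  case (step x s v)
  then show ?case using left_ideal.step[of "u * x" S s "u * v"]
    by (simp add: distrib_left mult.assoc)
qed (simp add: left_ideal.zero)

lemma left_ideal_minus: "x \<in> left_ideal S \<Longrightarrow> - x \<in> left_ideal S"
  using left_ideal_mult[of x S "- 1"] by simp

lemma left_ideal_diff: "x \<in> left_ideal S \<Longrightarrow> y \<in> left_ideal S \<Longrightarrow> x - y \<in> left_ideal S"
  using left_ideal_add[of "- y" S x] left_ideal_minus[of y S] by simp

lemma left_ideal_gen: "s \<in> S \<Longrightarrow> s \<in> left_ideal S"
  using left_ideal.step[OF left_ideal.zero, of s S 1] by simp

lemma left_ideal_mono: "S \<subseteq> T \<Longrightarrow> left_ideal S \<subseteq> left_ideal T"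
proof
  fix x assume "S \<subseteq> T" "x \<in> left_ideal S"
  from this(2,1) show "x \<in> left_ideal T"
    by (induction rule: left_ideal.induct) (auto intro: left_ideal.intros)
qed

lemma vacuum_ideal_L: "n \<ge> -1 \<Longrightarrow> u * EL n \<in> vacuum_ideal c"
  unfolding vacuum_ideal_def by (intro left_ideal_mult left_ideal_gen) auto

lemma vacuum_ideal_C: "env_gen C * u - env_scalar c * u \<in> vacuum_ideal c"
proof -
  have "u * (env_gen C - env_scalar c) \<in> vacuum_ideal c"
    unfolding vacuum_ideal_def by (intro left_ideal_mult left_ideal_gen) auto
  then show ?thesis by (simp add: right_diff_distrib env_gen_C_commute env_scalar_commute)
qed

lemmas vacuum_ideal_add = left_ideal_add[of _ "{env_gen C - env_scalar c} \<union> {EL n | n. n \<ge> -1}" for c, folded vacuum_ideal_def]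
  and vacuum_ideal_mult = left_ideal_mult[of _ "{env_gen C - env_scalar c} \<union> {EL n | n. n \<ge> -1}" for c, folded vacuum_ideal_def]

text \<open>Moving L_n past a letter L_k costs a multiple of L_(n+k), which is again of large index
  when n is large.\<close>

lemma left_ideal_truncated:
  assumes "\<And>n. n \<ge> N0 \<Longrightarrow> EL n \<in> left_ideal S"
  shows "\<exists>N. \<forall>n\<ge>N. EL n * u \<in> left_ideal S"
proof (induction u)
  case one
  then show ?case using assms by auto
next
  case (add u v)
  then obtain M N where "\<forall>n\<ge>M. EL n * u \<in> left_ideal S" "\<forall>n\<ge>N. EL n * v \<in> left_ideal S"
    by blast
  then show ?case by (intro exI[of _ "max M N"]) (simp add: distrib_left left_ideal_add)
next
  case (scale a u)
  then show ?case unfolding mult_env_scalar using left_ideal_mult by blast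
next
  case (gen g u)
  then obtain N where N: "\<And>n. n \<ge> N \<Longrightarrow> EL n * u \<in> left_ideal S" by blast
  show ?case
  proof (cases g)
    case (L k)
    show ?thesis unfolding L
    \<comment> \<open>The three bounds give n >= N, n + k >= N, and n + k > 0, the last one
      excluding the central term.\<close>
    proof (intro exI[of _ "max N (max (N - k) (1 - k))"] allI impI)
      fix n assume "n \<ge> max N (max (N - k) (1 - k))"
      then have "n \<ge> N" "n + k \<ge> N" "n + k \<noteq> 0" by auto
      then show "EL n * (EL k * u) \<in> left_ideal S"
        unfolding env_gen_L_L_mult[of n k] using N left_ideal_mult by (auto intro!: left_ideal_add)
    qed
  next
    case C
    show ?thesis unfolding C env_gen_C_mult using N left_ideal_mult by blast
  qed
qed

lemma vacuum_ideal_truncated: "\<exists>N. \<forall>n\<ge>N. EL n * u \<in> vacuum_ideal c"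
  unfolding vacuum_ideal_def by (rule left_ideal_truncated[of "-1"], rule left_ideal_gen) auto

text \<open>The balance of central terms in \<open>Jom_L\<close>: on the left those from moving L_j
  past the operators left and right of the field, on the right the one from [L_(r-1), L_k] with r =
  1 - k. Once the cocycle of j is factored out, symmetry and upper negation of binomials settle each
  range of j and k.\<close>

lemma cocycle_identity:
  "(if j + k \<ge> 0 then sb1 k (nat (j + k)) * vir_cocycle j else 0)
   - eps (k + 1) * (if j \<le> 1 then sb1 k (nat (1 - j)) * vir_cocycle j else 0)
   = (if k \<le> 1 then bin (j + 1) (nat (1 - k)) * (vir_cocycle (- k) :: 'a::field) else 0)"
  (is "?A - ?B = ?D")
proof -
  have triv: "vir_cocycle k = (0::'a)" if "k \<in> {-1,0,1}" for k using that by auto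
  \<comment> \<open>Trinomial revision with inner index 3, the 3 coming from the cubic binomial in
    the cocycle.\<close>
  have trin: "bin (j + 1) (nat (1 - k)) * vir_cocycle (- k) = (vir_cocycle j * bin (j - 2) (nat (- 2 - k)) :: 'a)"
    if k: "k \<le> -2"
  proof -
    have "bin (j + 1) (3 + nat (-2 - k)) * bin (int (3 + nat (-2 - k))) 3 =
        (bin (j + 1) 3 * bin (j + 1 - int 3) (nat (-2 - k)) :: 'a)" by (rule bin_trinomial)
    moreover have "3 + nat (-2 - k) = nat (1 - k)" "int (nat (1 - k)) = - k + 1" using k by auto
    ultimately show ?thesis by (simp add: vir_cocycle_eq)
  qed
  have pos0: "bin a (nat b) = (0::'a)" if "0 \<le> a" "a < b" for a b
  proof -
    have "bin a (nat b) = (bin (int (nat a)) (nat b) :: 'a)" using that by simp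
    also have "\<dots> = 0" by (rule bin_of_nat_0) (use that in auto)
    finally show ?thesis .
  qed
  have sym: "bin a (nat b) = (bin a (nat (a - b)) :: 'a)" if "0 \<le> b" "b \<le> a" for a b
  proof -
    have "nat a choose nat b = nat a choose (nat a - nat b)" using that by (intro binomial_symmetric) auto
    moreover have "nat a - nat b = nat (a - b)" using that by auto
    moreover have "bin a n = (of_nat (nat a choose n) :: 'a)" for n using bin_of_nat[of "nat a" n] that by simp
    ultimately show ?thesis by simp
  qed
  have sb: "sbin a (nat b) = (bin (b - a - 1) (nat b) :: 'a)" if "0 \<le> b" for a b
  proof -
    have "sbin a (nat b) = ((-1) ^ nat b * ((-1) ^ nat b * bin (int (nat b) - a - 1) (nat b)) :: 'a)"
      unfolding sbin_def by (subst bin_negated_upper) simp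
    then show ?thesis using that by (simp add: mult.assoc[symmetric] power_add[symmetric])
  qed
  have ep: "eps (k + 1) * sbin a (nat b) = (eps (k + 1 + b) * bin a (nat b) :: 'a)" if "0 \<le> b" for a b
    using that by (simp add: sbin_def eps_add minus_one_power_eq_eps)
  consider "j \<in> {-1,0,1}" | "j \<ge> 2" | "j \<le> -2" by force
  then show ?thesis
  proof cases
    case 1
    have "?D = 0"
    proof (cases "k \<le> -2")
      case True
      then show ?thesis using trin triv[OF 1] by simp
    next
      case False
      then have "k \<le> 1 \<Longrightarrow> - k \<in> {-1,0,1}" by auto
      then show ?thesis using triv by auto
    qed
    then show ?thesis using triv[OF 1] by simp
  next
    case 2
    show ?thesis
    proof (cases "k \<le> -2")
      case False
      then have "k \<le> 1 \<Longrightarrow> - k \<in> {-1,0,1}" by auto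
      then have "?D = 0" using triv by auto
      moreover have "bin (k + 1) (nat (j + k)) = (0::'a)" using 2 False by (intro pos0) auto
      ultimately show ?thesis using 2 by (simp add: sbin_def)
    next
      case True
      have "sb1 k (nat (j + k)) = (bin (j - 2) (nat (-2 - k)) :: 'a)" if "j + k \<ge> 0"
        using sb[OF that, of "k + 1"] sym[of "j + k" "j - 2"] that 2 True by simp
      moreover have "bin (j - 2) (nat (-2 - k)) = (0::'a)" if "j + k < 0"
        using that 2 by (intro pos0) auto
      ultimately show ?thesis using 2 True trin[OF True] by (auto simp: mult.commute)
    qed
  next
    case 3
    show ?thesis
    proof (cases "k \<le> -2")
      case False
      then have "k \<le> 1 \<Longrightarrow> - k \<in> {-1,0,1}" by auto
      then have D: "?D = 0" using triv by auto
      have B: "?B = eps (j + k) * bin (k + 1) (nat (1 - j)) * vir_cocycle j"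
        using 3 ep[of "1 - j" "k + 1"] by (simp add: mult.assoc[symmetric] eps_add eps_diff)
      show ?thesis
      proof (cases "j + k \<ge> 0")
        case True
        have "bin (k + 1) (nat (j + k)) = (bin (k + 1) (nat (1 - j)) :: 'a)"
          using sym[of "j + k" "k + 1"] True 3 by simp
        then show ?thesis unfolding D B using True by (simp add: sbin_def minus_one_power_eq_eps)
      next
        case F: False
        then have "bin (k + 1) (nat (1 - j)) = (0::'a)" using False by (intro pos0) auto
        then show ?thesis unfolding D B using F by simp
      qed
    next
      case True
      have "bin (j - 2) (nat (-2 - k)) = (eps k * bin (- k - j - 1) (nat (-2 - k)) :: 'a)"
      proof -
        have "bin (j - 2) (nat (-2 - k)) = ((-1) ^ nat (-2 - k) * sbin (j - 2) (nat (-2 - k)) :: 'a)"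
          by (simp add: sbin_def mult.assoc[symmetric] power_add[symmetric])
        also have "\<dots> = eps k * bin (- k - j - 1) (nat (-2 - k))"
          using True sb[of "-2 - k" "j - 2"] by (simp add: minus_one_power_eq_eps eps_diff algebra_simps)
        finally show ?thesis .
      qed
      moreover have "bin (- k - j - 1) (nat (-2 - k)) = (bin (- k - j - 1) (nat (1 - j)) :: 'a)"
        using sym[of "-2 - k" "- k - j - 1"] True 3 by simp
      moreover have "sb1 k (nat (1 - j)) = (bin (- k - j - 1) (nat (1 - j)) :: 'a)"
      proof -
        have "1 - j - (k + 1) - 1 = - k - j - 1" by simp
        then show ?thesis using sb[of "1 - j" "k + 1"] 3 by (simp only:)
      qed
      ultimately show ?thesis using 3 True trin[OF True] by (simp add: eps_add)
    qed
  qed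
qed

text \<open>The recursion is multiplication by x_0 = x_1 - x_2 on coefficients. It propagates zeros
  upwards from the plane l = 0 directly; downwards it only says that a level is constant along m +
  n, and the plane m = 0 then fixes the constant.\<close>

lemma pascal_recursion_zero:
  fixes D :: "int \<Rightarrow> int \<Rightarrow> int \<Rightarrow> 'w::ab_group_add"
  assumes rec: "\<And>l m n. D (l + 1) m n = D l (m + 1) n - D l m (n + 1)"
    and m0: "\<And>l n. D l 0 n = 0" and l0: "\<And>m n. D 0 m n = 0"
  shows "D l m n = 0"
proof -
  have pos: "\<forall>m n. D (int k) m n = 0" for k
  proof (induction k)
    case (Suc k)
    then show ?case using rec[of "int k"] by (simp add: add.commute)
  qed (simp add: l0)
  have neg: "\<forall>m n. D (- int k) m n = 0" for k
  proof (induction k)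
    case (Suc k)
    let ?l = "- int (Suc k)"
    \<comment> \<open>The level above is zero already, so the recursion becomes invariance under (m,
      n) -> (m - 1, n + 1).\<close>
    have e: "D ?l (m + 1) n = D ?l m (n + 1)" for m n
      using rec[of ?l m n] Suc by simp
    have up: "\<forall>n. D ?l (int i) n = 0" for i
    proof (induction i)
      case (Suc i)
      then show ?case using e[of "int i"] by (simp add: add.commute)
    qed (use m0 in simp)
    have down: "\<forall>n. D ?l (- int i) n = 0" for i
    proof (induction i)
      case (Suc i)
      have "D ?l (- int (Suc i)) n = 0" for n
        using e[of "- int (Suc i)" "n - 1"] Suc by simp
      then show ?case by blast
    qed (use m0 in simp)
    have "D ?l m n = 0" for m n
      using up[of "nat m"] down[of "nat (- m)"] by (cases "m \<ge> 0") auto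
    then show ?case by blast
  qed (simp add: l0)
  show ?thesis using pos[of "nat l"] neg[of "nat (- l)"] by (cases "l \<ge> 0") auto
qed

lemma fs_Suc: "fs f \<Longrightarrow> fs (\<lambda>i. f (Suc i))"
  unfolding fs_def by (meson le_SucI)

lemma fs_shift_down: "fs g \<Longrightarrow> g' 0 = (0::'w::zero) \<Longrightarrow> (\<And>i. g' (Suc i) = g i) \<Longrightarrow> fs g'"
proof -
  assume "fs g" "\<And>i. g' (Suc i) = g i"
  then obtain N where "\<And>i. N \<le> i \<Longrightarrow> g' (Suc i) = 0" by (auto simp: fs_def)
  then show ?thesis by (intro fsI[of "Suc N"]) (metis Suc_le_D Suc_le_mono)
qed

context vir_rep
begin

lemma SA_pascal:
  assumes g: "fs g"
  shows "(\<Sum>i. sb1 l i *s g i) =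
      (\<Sum>i. sbin l i *s g i) - (\<Sum>i. sbin l i *s g (Suc i))"
    and "(\<Sum>i. bin (l + 1) i *s g i) =
      (\<Sum>i. bin l i *s g i) + (\<Sum>i. bin l i *s g (Suc i))"
proof -
  define h where "h a i = (case i of 0 \<Rightarrow> 0 | Suc j \<Rightarrow> a j *s g (Suc j))" for a :: "nat \<Rightarrow> 'a" and i
  have fh: "fs (h a)" for a
    by (rule fs_shift_down[of "\<lambda>i. a i *s g (Suc i)"]) (simp_all add: h_def fs_scale fs_Suc g)
  have sh: "Sum_any (h a) = (\<Sum>i. a i *s g (Suc i))" for a
    by (subst SA_shift[of 1]) (simp_all add: h_def)
  have "sb1 l i *s g i = sbin l i *s g i - h (sbin l) i" for i
    by (cases i) (simp_all add: h_def sbin_Suc_Suc scale_left_diff_distrib)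
  then show "(\<Sum>i. sb1 l i *s g i) =
      (\<Sum>i. sbin l i *s g i) - (\<Sum>i. sbin l i *s g (Suc i))"
    by (simp add: SA_diff fs_scale g fh sh)
  have "bin (l + 1) i *s g i = bin l i *s g i + h (bin l) i" for i
    by (cases i) (simp_all add: h_def bin_Suc_Suc scale_left_distrib)
  then show "(\<Sum>i. bin (l + 1) i *s g i) =
      (\<Sum>i. bin l i *s g i) + (\<Sum>i. bin l i *s g (Suc i))"
    by (simp add: SA_add fs_scale g fh sh)
qed

section \<open>From fields to elements of the enveloping algebra\<close>

definition idf :: "int \<Rightarrow> 'w \<Rightarrow> 'w" where
  "idf q x = (if q = -1 then P x else 0)"

definition gact :: "vir_gen \<Rightarrow> (int \<Rightarrow> 'w \<Rightarrow> 'w) \<Rightarrow> int \<Rightarrow> 'w \<Rightarrow> 'w" where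
  "gact g f = (case g of L k \<Rightarrow> modeA k f | C \<Rightarrow> (\<lambda>q x. c *s f q x))"

lemma fld_idf: "fld idf"
  unfolding fld_def idf_def
proof (intro conjI allI)
  show "\<exists>N. \<forall>q\<ge>N::int. (if q = -1 then P x else 0) = 0" for x by (rule exI[of _ 0]) simp
qed simp_all

lemma fld_lin:
  assumes f: "fld f" and g: "fld g" shows "fld (\<lambda>q x. a *s f q x + b *s g q x)"
  unfolding fld_def
proof (intro conjI allI)
  fix x
  obtain M N where "\<forall>q\<ge>M. f q x = 0" "\<forall>q\<ge>N. g q x = 0" using f g fld_trunc by meson
  then show "\<exists>N. \<forall>q\<ge>N. a *s f q x + b *s g q x = 0" by (intro exI[of _ "max M N"]) simp
qed (simp_all add: fldD[OF f] fldD[OF g] scale_right_distrib mult.commute)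

lemma fld_gact: "fld f \<Longrightarrow> fld (gact g f)"
  using fld_lin[of f f c 0] by (cases g) (simp_all add: gact_def fld_modeA)

lemma modeA_lin:
  assumes f: "fld f" and g: "fld g"
  shows "modeA k (\<lambda>q x. a *s f q x + b *s g q x) q x = a *s modeA k f q x + b *s modeA k g q x"
proof -
  have 1: "(\<Sum>i. sb1 k i *s Lop (k - int i) (a *s f (q + int i) x + b *s g (q + int i) x)) =
      a *s (\<Sum>i. sb1 k i *s Lop (k - int i) (f (q + int i) x)) +
      b *s (\<Sum>i. sb1 k i *s Lop (k - int i) (g (q + int i) x))"
    unfolding SA_scale[OF fs_A1[OF f]] SA_scale[OF fs_A1[OF g]]
    by (subst SA_add[symmetric]) (simp_all add: fs_scale fs_A1[OF f] fs_A1[OF g] scale_right_distrib mult_ac)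
  have 2: "(\<Sum>i. sb1 k i *s (a *s f (q + k + 1 - int i) (Lop (int i - 1) x) + b *s g (q + k + 1 - int i) (Lop (int i - 1) x))) =
      a *s (\<Sum>i. sb1 k i *s f (q + k + 1 - int i) (Lop (int i - 1) x)) +
      b *s (\<Sum>i. sb1 k i *s g (q + k + 1 - int i) (Lop (int i - 1) x))"
    unfolding SA_scale[OF fs_A2[OF f]] SA_scale[OF fs_A2[OF g]]
    by (subst SA_add[symmetric]) (simp_all add: fs_scale fs_A2[OF f] fs_A2[OF g] scale_right_distrib mult_ac)
  show ?thesis
    unfolding modeA_def 1 2 by (simp add: scale_right_diff_distrib scale_right_distrib mult.commute)
qed

lemma gact_lin:
  assumes "fld f" "fld h"
  shows "gact g (\<lambda>q x. a *s f q x + b *s h q x) = (\<lambda>q x. a *s gact g f q x + b *s gact g h q x)"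
  by (intro ext) (cases g; simp add: gact_def modeA_lin assms scale_right_distrib mult.commute)

lemma fld_gacts: "fld f \<Longrightarrow> fld (foldr gact gs f)"
  by (induction gs) (simp_all add: fld_gact)

lemma gacts_lin:
  assumes "fld f" "fld h"
  shows "foldr gact gs (\<lambda>q x. a *s f q x + b *s h q x) =
    (\<lambda>q x. a *s foldr gact gs f q x + b *s foldr gact gs h q x)"
  by (induction gs) (simp_all add: gact_lin fld_gacts assms)

lemma fld_zero: "fld (\<lambda>q x. 0)"
  using fld_lin[OF fld_idf fld_idf, of 0 0] by simp

lemma gacts_zero: "foldr gact gs (\<lambda>q x. 0) = (\<lambda>q x. 0)"
  using gacts_lin[OF fld_idf fld_idf, of gs 0 0] by simp

definition Yw :: "vir_word \<Rightarrow> int \<Rightarrow> 'w \<Rightarrow> 'w" where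
  "Yw w = (case w of Word gs \<Rightarrow> foldr gact gs idf)"

definition Yt :: "'a vir_tensor \<Rightarrow> int \<Rightarrow> 'w \<Rightarrow> 'w" where
  "Yt t q x = (\<Sum>w\<in>supp t. coef t w *s Yw w q x)"

lemma Yt_superset:
  "finite S \<Longrightarrow> supp t \<subseteq> S \<Longrightarrow> Yt t q x = (\<Sum>w\<in>S. coef t w *s Yw w q x)"
  unfolding Yt_def by (rule sum.mono_neutral_left) (auto simp: in_keys_iff)

lemma Yt_add: "Yt (s + t) q x = Yt s q x + Yt t q x"
proof -
  let ?S = "supp s \<union> supp t"
  have "supp (s + t) \<subseteq> ?S" by (rule keys_add)
  then show ?thesis
    by (simp add: Yt_superset[of ?S] lookup_add scale_left_distrib sum.distrib)
qed

lemma Yt_single: "Yt (tmon w a) q x = a *s Yw w q x"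
  by (subst Yt_superset[of "{w}"]) auto

lemma Yt_zero [simp]: "Yt 0 q x = 0"
  by (simp add: Yt_def)

lemma fld_Yw: "fld (Yw w)"
  by (cases w) (simp add: Yw_def fld_gacts fld_idf)

lemma fld_Yt: "fld (Yt t)"
proof (induction t rule: vir_tensor_induct)
  case zero
  then show ?case using fld_zero by (simp add: fun_eq_iff[symmetric] Yt_def[abs_def])
next
  case (add s t)
  then show ?case using fld_lin[of "Yt s" "Yt t" 1 1] by (simp add: Yt_add[abs_def])
next
  case (single gs a)
  have "Yt (tmon (Word gs) a) = (\<lambda>q x. a *s Yw (Word gs) q x + 0 *s Yw (Word gs) q x)"
    by (intro ext) (simp add: Yt_single)
  then show ?case using fld_lin[OF fld_Yw[of "Word gs"] fld_Yw[of "Word gs"], of a 0] by simp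
qed

lemma Yt_single_mult:
  "Yt (tmon (Word gs) a * t) q x = a *s foldr gact gs (Yt t) q x"
proof (induction t arbitrary: q x rule: vir_tensor_induct)
  case zero
  have "Yt 0 = (\<lambda>q x. 0)" by (intro ext) simp
  then show ?case by (simp add: gacts_zero)
next
  case (add s t)
  have "Yt (s + t) = (\<lambda>q x. 1 *s Yt s q x + 1 *s Yt t q x)" by (intro ext) (simp add: Yt_add)
  then show ?case
    by (simp only: distrib_left Yt_add[of "tmon _ _ * s"] add gacts_lin[OF fld_Yt fld_Yt])
      (simp add: scale_right_distrib)
next
  case (single hs b)
  have "Yt (tmon (Word hs) b) = (\<lambda>q x. b *s Yw (Word hs) q x + 0 *s Yw (Word hs) q x)"
    by (intro ext) (simp add: Yt_single)
  then show ?case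
    by (simp only: mult_single plus_vir_word.simps Yt_single gacts_lin[OF fld_Yw fld_Yw])
      (simp add: Yw_def)
qed

lemma gact_commutator:
  assumes f: "fld f"
  shows "gact (L j) (gact (L k) f) q x = gact (L k) (gact (L j) f) q x +
     (of_int (j - k) *s gact (L (j + k)) f q x + (if j + k = 0 then vir_cocycle j *s gact C f q x else 0))"
  using modeA_commutator[OF f, of j k q x] by (auto simp: gact_def algebra_simps)

lemma gact_C_commute:
  assumes f: "fld f" shows "gact g (gact C f) = gact C (gact g f)"
  using gact_lin[OF f f, of g c 0] by (simp add: gact_def[of C])

text \<open>A relation of U, applied to any field, gives zero by \<open>gact_commutator\<close>;
  letters to its right only change that field, and letters to its left preserve zero. Hence Y
  descends from the tensor algebra to U.\<close>

lemma Yt_env_ideal: "t \<in> env_ideal \<Longrightarrow> Yt t q x = 0"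
proof (induction t rule: env_ideal.induct)
  case (step t a g h b)
  define R :: "'a vir_tensor" where "R = tensor_gen g * tensor_gen h - tensor_gen h * tensor_gen g - vir_bracket g h"
  have rel: "Yt (tensor_gen g * (tensor_gen h * b)) q x =
      Yt (tensor_gen h * (tensor_gen g * b) + vir_bracket g h * b) q x" for b q x
  proof -
    have tg: "Yt (tensor_gen g * b) = gact g (Yt b)" for g b
      by (intro ext) (simp add: Yt_single_mult)
    show ?thesis
    proof (cases g)
      case (L j)
      show ?thesis
      proof (cases h)
        case (L k)
        have "vir_bracket (L j) (L k) * b = tmon (Word [L (j + k)]) (of_int (j - k)) * b +
            tmon (Word [C]) (if j + k = 0 then vir_cocycle j else 0) * b"
          by (simp add: distrib_right vir_cocycle_def)
        then have "Yt (vir_bracket (L j) (L k) * b) q x = of_int (j - k) *s gact (L (j + k)) (Yt b) q x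
          + (if j + k = 0 then vir_cocycle j *s gact C (Yt b) q x else 0)"
          by (simp only: Yt_add Yt_single_mult) simp
        then show ?thesis
          unfolding \<open>g = L j\<close> L Yt_add tg gact_commutator[OF fld_Yt, of j k] by simp
      qed (simp add: L tg gact_C_commute[OF fld_Yt])
    qed (simp add: tg gact_C_commute[OF fld_Yt])
  qed
  have Rb: "Yt (R * b) = (\<lambda>q x. 0)" for b
  proof (intro ext)
    fix q x
    have "tensor_gen g * (tensor_gen h * b) = R * b + (tensor_gen h * (tensor_gen g * b) + vir_bracket g h * b)"
      by (simp add: R_def algebra_simps)
    then show "Yt (R * b) q x = 0" using rel[of b q x] unfolding Yt_add by (metis Yt_add add_cancel_left_left)
  qed
  have "Yt (a * (R * b)) q x = 0"
  proof (induction a rule: vir_tensor_induct)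
    case (single gs e)
    then show ?case by (simp add: Yt_single_mult Rb gacts_zero)
  qed (simp_all add: distrib_right Yt_add)
  with step show ?case by (simp add: Yt_add R_def mult.assoc)
qed simp

definition Y :: "'a vir_env \<Rightarrow> int \<Rightarrow> 'w \<Rightarrow> 'w" where
  "Y u = Yt (rep_vir_env u)"

lemma Y_abs: "Y (abs_vir_env t) q x = Yt t q x"
proof -
  have "rep_vir_env (abs_vir_env t) - t \<in> env_ideal"
    using env_rel_rep_abs[of t] by (simp add: env_rel_def)
  then have "Yt (t + (rep_vir_env (abs_vir_env t) - t)) q x = Yt t q x"
    unfolding Yt_add by (simp add: Yt_env_ideal)
  then show ?thesis by (simp add: Y_def)
qed

lemma fld_Y: "fld (Y u)"
  by (simp add: Y_def fld_Yt)

lemma Y_add: "Y (u + v) q x = Y u q x + Y v q x"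
  using Y_abs[of "rep_vir_env u + rep_vir_env v" q x] by (simp add: abs_vir_env_add Yt_add Y_def)

lemma Y_scalar: "Y (env_scalar a * u) q x = a *s Y u q x"
  using Y_abs[of "tmon 0 a * rep_vir_env u" q x] Yt_single_mult[of "[]" a]
  by (simp add: abs_vir_env_mult env_scalar_abs[symmetric, unfolded zero_vir_word_def] Y_def
      zero_vir_word_def)

lemma Y_one: "Y 1 = idf"
proof (intro ext)
  fix q x
  have "Y (abs_vir_env (tmon 0 1)) q x = idf q x"
    unfolding Y_abs Yt_single by (simp add: Yw_def zero_vir_word_def)
  then show "Y 1 q x = idf q x" by (simp add: abs_vir_env_1)
qed

lemma Y_gen: "Y (env_gen g * u) = gact g (Y u)"
proof (intro ext)
  fix q x
  show "Y (env_gen g * u) q x = gact g (Y u) q x"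
    using Y_abs[of "tensor_gen g * rep_vir_env u" q x] Yt_single_mult[of "[g]" 1]
    by (simp add: abs_vir_env_mult env_gen_abs[symmetric] Y_def)
qed

lemma Y_L: "Y (EL k * u) = modeA k (Y u)"
  by (simp add: Y_gen gact_def)

lemma Y_C: "Y (env_gen C * u) q x = c *s Y u q x"
  by (simp add: Y_gen gact_def)

lemma Y_zero [simp]: "Y 0 q x = 0"
  using Y_scalar[of 0 1] by simp

lemma Y_minus: "Y (- u) q x = - Y u q x"
  using Y_add[of u "- u" q x] by (simp add: eq_neg_iff_add_eq_0 add.commute)

lemma Y_diff: "Y (u - v) q x = Y u q x - Y v q x"
  using Y_add[of u "- v"] by (simp add: Y_minus)

lemma Y_of_int: "Y (of_int n * u) q x = of_int n *s Y u q x"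
  by (simp add: env_scalar_of_int[symmetric] Y_scalar)

text \<open>Each of the two sums has a single possible term, at i = -1 - q and i' = q + k + 2. Both
  carry the operator L_(q+k+1), and i + i' = k + 1 makes the coefficients cancel by symmetry of the
  binomials.\<close>

lemma modeA_idf:
  assumes "k \<ge> -1" shows "modeA k idf q x = 0"
proof (cases "q \<le> -1 \<and> q + k + 1 \<ge> -1")
  case False
  have b: "sb1 k i = (0::'a)" if "k + 1 < int i" for i
    using bin_of_nat_0[of "nat (k + 1)" i, where ?'a = 'a] assms that by (simp add: sbin_def)
  have "idf (q + int i) x = 0 \<or> (sb1 k i :: 'a) = 0" for i
    using False assms by (cases "q + int i = -1") (auto simp: idf_def b)
  moreover have "idf (q + k + 1 - int i) y = 0 \<or> (sb1 k i :: 'a) = 0" for i y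
    using False assms by (cases "q + k + 1 - int i = -1") (auto simp: idf_def b)
  ultimately have "sb1 k i *s Lop (k - int i) (idf (q + int i) x) = 0"
    "sb1 k i *s idf (q + k + 1 - int i) (Lop (int i - 1) x) = 0" for i
    by (metis L_zero scale_zero_left scale_zero_right)+
  then show ?thesis unfolding modeA_def by (simp only: Sum_any.neutral scale_zero_right diff_self)
next
  case True
  define i where "i = nat (- 1 - q)"
  define i' where "i' = nat (q + k + 2)"
  have i: "int i = - 1 - q" "int i' = q + k + 2" using True by (auto simp: i_def i'_def)
  have "(\<Sum>i. sb1 k i *s Lop (k - int i) (idf (q + int i) x)) = sb1 k i *s Lop (k - int i) (idf (q + int i) x)"
    by (rule SA_single) (use i in \<open>auto simp: idf_def\<close>)
  moreover have "(\<Sum>i. sb1 k i *s idf (q + k + 1 - int i) (Lop (int i - 1) x)) =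
      sb1 k i' *s idf (q + k + 1 - int i') (Lop (int i' - 1) x)"
    by (rule SA_single) (use i in \<open>auto simp: idf_def\<close>)
  moreover have "bin (k + 1) i = (bin (k + 1) i' :: 'a)"
  proof -
    have "nat (k + 1) = i + i'" using i assms by auto
    then have "nat (k + 1) choose i = nat (k + 1) choose i'" using binomial_symmetric[of i "i + i'"] by simp
    then show ?thesis using bin_of_nat[of "nat (k + 1)", where ?'a = 'a] assms by simp
  qed
  moreover have "eps (k + 1) * ((-1) ^ i') = ((-1) ^ i :: 'a)"
  proof -
    have "k + 1 = int i + int i'" using i by simp
    then show ?thesis by (simp add: eps_add eps_nat mult.assoc power_mult_distrib[symmetric])
  qed
  ultimately show ?thesis
    using i unfolding modeA_def by (simp add: idf_def sbin_def mult.assoc[symmetric] algebra_simps)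
qed

text \<open>The generators of the ideal have zero fields, by \<open>modeA_idf\<close> and because C
  acts as c, and left multiplication keeps a zero field zero. Thus Y depends only on the class in
  the vacuum module.\<close>

lemma Y_vacuum_ideal: "u \<in> vacuum_ideal c \<Longrightarrow> Y u q x = 0"
  unfolding vacuum_ideal_def
proof (induction u arbitrary: q x rule: left_ideal.induct)
  case (step y s u)
  have g0: "gact g (\<lambda>q x. 0) = (\<lambda>q x. 0)" for g using gacts_zero[of "[g]"] by simp
  have s: "Y s = (\<lambda>q x. 0)"
  proof (intro ext)
    fix q x
    from step(2) consider "s = env_gen C * 1 - env_scalar c * 1" | n where "s = EL n * 1" "n \<ge> -1" by auto
    then show "Y s q x = 0"
    proof cases
      case 1 then show ?thesis by (simp only: Y_diff Y_C Y_scalar) simp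
    next
      case 2 then show ?thesis by (simp only: Y_L Y_one modeA_idf)
    qed
  qed
  have "\<forall>q x. Y (u * s) q x = 0"
  proof (induction u)
    case (gen g u)
    then have "Y (u * s) = (\<lambda>q x. 0)" by (intro ext) simp
    then show ?case by (simp add: mult.assoc Y_gen g0)
  qed (simp_all add: s distrib_right Y_add mult.assoc Y_scalar)
  with step show ?case by (simp add: Y_add)
qed simp

lemma Y_cong_vacuum: "u - v \<in> vacuum_ideal c \<Longrightarrow> Y u q x = Y v q x"
  using Y_vacuum_ideal[of "u - v" q x] by (simp add: Y_diff)

lemma fs_Y_L: "fs (\<lambda>i. Y (EL (r + int i) * u) (q i) x)"
proof -
  obtain N where N: "\<And>n. n \<ge> N \<Longrightarrow> EL n * u \<in> vacuum_ideal c"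
    using vacuum_ideal_truncated by blast
  show ?thesis by (rule fsI[of "nat (N - r)"]) (intro Y_vacuum_ideal N, auto)
qed

section \<open>The Jacobi identity for the conformal vector\<close>

text \<open>\<open>JL\<close> and \<open>JR\<close> are the two sides of the Jacobi identity for
  omega and u; the shifts by one come from omega_n = L_(n-1).\<close>

definition JL :: "'a vir_env \<Rightarrow> int \<Rightarrow> int \<Rightarrow> int \<Rightarrow> 'w \<Rightarrow> 'w" where
  "JL u l m n x = (\<Sum>i. sbin l i *s Lop (m + l - 1 - int i) (Y u (n + int i) x)) -
     eps l *s (\<Sum>i. sbin l i *s Y u (n + l - int i) (Lop (m - 1 + int i) x))"

definition JR :: "'a vir_env \<Rightarrow> int \<Rightarrow> int \<Rightarrow> int \<Rightarrow> 'w \<Rightarrow> 'w" where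
  "JR u l m n x = (\<Sum>i. bin m i *s Y (EL (l - 1 + int i) * u) (m + n - int i) x)"

text \<open>The coefficient form of x_0 = x_1 - x_2, obtained from Pascal's rule in each sum;
  \<open>JR_pascal\<close> is the counterpart on the other side.\<close>

lemma JL_pascal: "JL u (l + 1) m n x = JL u l (m + 1) n x - JL u l m (n + 1) x"
proof -
  have f1: "fs (\<lambda>i. Lop (m + l - int i) (Y u (n + int i) x))"
    by (rule fs_mono[OF fs_fld[OF fld_Y, of u n x]]) simp
  have f2: "fs (\<lambda>i. Y u (n + l + 1 - int i) (Lop (m - 1 + int i) x))"
    by (rule fs_mono[OF fs_L[of "m - 1" x]]) (simp add: add.commute fldD[OF fld_Y])
  have 1: "(\<Sum>i. sb1 l i *s Lop (m + (l + 1) - 1 - int i) (Y u (n + int i) x)) =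
      (\<Sum>i. sbin l i *s Lop (m + 1 + l - 1 - int i) (Y u (n + int i) x)) -
      (\<Sum>i. sbin l i *s Lop (m + l - 1 - int i) (Y u (n + 1 + int i) x))"
    using SA_pascal(1)[OF f1, of l] by (simp add: add_ac diff_diff_add[symmetric] diff_add_eq)
  have 2: "(\<Sum>i. sb1 l i *s Y u (n + (l + 1) - int i) (Lop (m - 1 + int i) x)) =
      (\<Sum>i. sbin l i *s Y u (n + 1 + l - int i) (Lop (m - 1 + int i) x)) -
      (\<Sum>i. sbin l i *s Y u (n + l - int i) (Lop (m + 1 - 1 + int i) x))"
  proof -
    have e: "n + l + 1 - int (Suc i) = n + l - int i" "m - 1 + int (Suc i) = m + 1 - 1 + int i"
      "n + (l + 1) - int i = n + l + 1 - int i" "n + 1 + l - int i = n + l + 1 - int i" for i by simp_all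
    show ?thesis using SA_pascal(1)[OF f2, of l] unfolding e .
  qed
  show ?thesis
    unfolding JL_def 1 2 eps_add_1 by (simp add: scale_right_diff_distrib algebra_simps)
qed

lemma JR_pascal: "JR u (l + 1) m n x = JR u l (m + 1) n x - JR u l m (n + 1) x"
proof -
  have e: "l - 1 + int (Suc i) = l + 1 - 1 + int i" "m + (n + 1) - int (Suc i) = m + n - int i"
    "m + 1 + n - int i = m + (n + 1) - int i" for i by simp_all
  have "fs (\<lambda>i. Y (EL (l - 1 + int i) * u) (m + 1 + n - int i) x)" by (rule fs_Y_L)
  from SA_pascal(2)[OF this, of m] show ?thesis
    unfolding JR_def e by (simp only: eq_diff_eq add.commute)
qed

definition Jom :: "'a vir_env \<Rightarrow> bool" where
  "Jom u \<longleftrightarrow> (\<forall>l m n x. JL u l m n x = JR u l m n x)"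

lemma JR_m0: "JR u l 0 n x = Y (EL (l - 1) * u) n x"
  unfolding JR_def by (subst SA_single[of 0]) (simp_all add: bin_0_left)

text \<open>For m = 0 the Jacobi identity holds by construction: it is the recursion that defines
  the field of L_(l-1) u.\<close>

lemma JL_m0: "JL u l 0 n x = Y (EL (l - 1) * u) n x"
  unfolding Y_L modeA_def JL_def by (simp add: add_ac)

lemma JL_l0: "JL u 0 m n x = Lop (m - 1) (Y u n x) - Y u n (Lop (m - 1) x)"
  unfolding JL_def by (subst (1 2) SA_single[of 0]) (simp_all add: sbin_0_left)

lemma JR_l0: "JR u 0 m n x = (\<Sum>r. bin m r *s Y (EL (int r - 1) * u) (m + n - int r) x)"
  by (simp add: JR_def)

text \<open>By \<open>pascal_recursion_zero\<close> and the built-in case m = 0, only the commutator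
  formula l = 0 has to be proved.\<close>

lemma JomI:
  assumes "\<And>m n x. JL u 0 m n x = JR u 0 m n x" shows "Jom u"
proof -
  have "JL u l m n x - JR u l m n x = 0" for l m n x
    by (rule pascal_recursion_zero[of "\<lambda>l m n. JL u l m n x - JR u l m n x"])
      (simp_all add: JL_pascal JR_pascal JL_m0 JR_m0 assms)
  then show ?thesis by (simp add: Jom_def)
qed

end

context vir_rep
begin

lemma Y_mult_zero: "u \<in> vacuum_ideal c \<Longrightarrow> Y (v * u) q x = 0"
  by (intro Y_vacuum_ideal vacuum_ideal_mult)

lemma fs_Y_shifted_L: "fs (\<lambda>i. a i *s Y (w i * (EL (r + int i) * u)) (q i) x)"
proof -
  obtain N where N: "\<And>n. n \<ge> N \<Longrightarrow> EL n * u \<in> vacuum_ideal c"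
    using vacuum_ideal_truncated by blast
  have "Y (w i * (EL (r + int i) * u)) (q i) x = 0" if "nat (N - r) \<le> i" for i
    by (intro Y_mult_zero N) (use that in auto)
  then show ?thesis by (intro fsI[of "nat (N - r)"]) simp
qed

lemma fs_Y_L_minus: "fs (\<lambda>i. a i *s Y (EL (int i - 1) * u) (q i) x)"
  using fs_Y_shifted_L[of a "\<lambda>_. 1" "-1" u q x] by simp

lemma Jom_commutator:
  "Jom u \<Longrightarrow> Lop j (Y u q x) - Y u q (Lop j x) =
    (\<Sum>r. bin (j + 1) r *s Y (EL (int r - 1) * u) (j + 1 + q - int r) x)"
  unfolding Jom_def using JL_l0[of u "j + 1" q x] JR_l0[of u "j + 1" q x] by simp

text \<open>The commutator of L_j with the recursion for L_k u splits in two. Moving L_j through the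
  field of u uses the hypothesis and yields the terms L_k L_(r-1) u; moving it through L_(k-i) and
  L_(i-1) uses the Virasoro relations and has to reproduce the terms [L_(r-1), L_k] u. The sums T1
  to T6 record the possible positions of L_j.\<close>

lemma Jom_L:
  assumes J: "Jom u" shows "Jom (EL k * u)"
proof (rule JomI)
  fix m q :: int and x
  define j where "j = m - 1"
  define f where "f = Y u"
  define g where "g r = Y (EL (int r - 1) * u)" for r :: nat
  have f: "fld f" by (simp add: f_def fld_Y)
  have g: "fld (g r)" for r by (simp add: g_def fld_Y)
  note fd = fldD[OF f]
  have comm: "Lop j (f q x) - f q (Lop j x) = (\<Sum>r. bin (j + 1) r *s g r (j + 1 + q - int r) x)" for q x
    unfolding f_def g_def by (rule Jom_commutator[OF J])
  define T1 where "T1 = (\<Sum>i. sb1 k i *s Lop j (Lop (k - int i) (f (q + int i) x)))"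
  define T2 where "T2 = (\<Sum>i. sb1 k i *s Lop j (f (q + k + 1 - int i) (Lop (int i - 1) x)))"
  define T3 where "T3 = (\<Sum>i. sb1 k i *s Lop (k - int i) (f (q + int i) (Lop j x)))"
  define T4 where "T4 = (\<Sum>i. sb1 k i *s f (q + k + 1 - int i) (Lop (int i - 1) (Lop j x)))"
  define T5 where "T5 = (\<Sum>i. sb1 k i *s Lop (k - int i) (Lop j (f (q + int i) x)))"
  define T6 where "T6 = (\<Sum>i. sb1 k i *s f (q + k + 1 - int i) (Lop j (Lop (int i - 1) x)))"
  have ff: "fs (\<lambda>i. sb1 k i *s h i (f (q + int i) x))" if "\<And>i. h i 0 = 0" for h x
    by (rule fs_mono[OF fs_fld[OF f, of q x]]) (simp add: that)
  have fL: "fs (\<lambda>i. sb1 k i *s h i (Lop (int i - 1) x))" if "\<And>i. h i 0 = 0" for h x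
    by (rule fs_mono[OF fs_L'[of x]]) (simp add: that)
  have lhs: "Lop j (modeA k f q x) - modeA k f q (Lop j x) = T1 - eps (k + 1) *s T2 - T3 + eps (k + 1) *s T4"
    unfolding modeA_def T1_def T2_def T3_def T4_def
    by (simp add: SA_L fs_A1[OF f] fs_A2[OF f])
  \<comment> \<open>For each fixed i the sum over r is the commutator formula for u, so exchanging
    the sums evaluates the double sum.\<close>
  have swap1: "(\<Sum>r. (\<Sum>i. (bin (j + 1) r * sb1 k i) *s Lop (k - int i) (g r (j + 1 + q - int r + int i) x))) = T5 - T3"
  proof -
    have fr: "fs (\<lambda>r. bin (j + 1) r *s g r (j + 1 + (q + int i) - int r) x)" for i
      unfolding g_def by (rule fs_Y_L_minus)
    obtain R where R: "\<And>r. r \<ge> R \<Longrightarrow> EL r * u \<in> vacuum_ideal c" using vacuum_ideal_truncated by blast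
    have "fs2 (\<lambda>r i. (bin (j + 1) r * sb1 k i) *s Lop (k - int i) (g r (j + 1 + q - int r + int i) x))"
    proof (rule fs2I[of "nat (R + 1)"])
      fix r i assume "nat (R + 1) \<le> r"
      then have "g r q x = 0" for q unfolding g_def by (intro Y_vacuum_ideal R) auto
      then show "(bin (j + 1) r * sb1 k i) *s Lop (k - int i) (g r (j + 1 + q - int r + int i) x) = 0" by simp
    next
      fix r
      show "fs (\<lambda>i. (bin (j + 1) r * sb1 k i) *s Lop (k - int i) (g r (j + 1 + q - int r + int i) x))"
        by (rule fs_A1[OF g])
    qed
    note sw = SA_swap[OF this]
    have "(\<Sum>r. (bin (j + 1) r * sb1 k i) *s Lop (k - int i) (g r (j + 1 + q - int r + int i) x)) =
      sb1 k i *s Lop (k - int i) (Lop j (f (q + int i) x)) - sb1 k i *s Lop (k - int i) (f (q + int i) (Lop j x))" for i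
    proof -
      have "sb1 k i *s Lop (k - int i) (Lop j (f (q + int i) x) - f (q + int i) (Lop j x)) =
         (\<Sum>r. sb1 k i *s Lop (k - int i) (bin (j + 1) r *s g r (j + 1 + (q + int i) - int r) x))"
        unfolding comm by (rule SA_hom[OF _ fr]) (simp add: scale_right_distrib)
      moreover have "j + 1 + (q + int i) - int r = j + 1 + q - int r + int i" for r by simp
      ultimately show ?thesis by (simp add: scale_right_diff_distrib mult.commute)
    qed
    then show ?thesis unfolding sw T5_def T3_def
      by (simp add: SA_diff ff[of "\<lambda>i x. Lop (k - int i) (Lop j x)"] fs_A1[OF f])
  qed
  have swap2: "(\<Sum>r. (\<Sum>i. (bin (j + 1) r * sb1 k i) *s g r (j + 1 + q - int r + k + 1 - int i) (Lop (int i - 1) x))) = T2 - T6"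
  proof -
    have fr: "fs (\<lambda>r. bin (j + 1) r *s g r (j + 1 + (q + k + 1 - int i) - int r) (Lop (int i - 1) x))" for i
      unfolding g_def by (rule fs_Y_L_minus)
    obtain R where R: "\<And>r. r \<ge> R \<Longrightarrow> EL r * u \<in> vacuum_ideal c" using vacuum_ideal_truncated by blast
    have "fs2 (\<lambda>r i. (bin (j + 1) r * sb1 k i) *s g r (j + 1 + q - int r + k + 1 - int i) (Lop (int i - 1) x))"
    proof (rule fs2I[of "nat (R + 1)"])
      fix r i assume "nat (R + 1) \<le> r"
      then have "g r q x = 0" for q x unfolding g_def by (intro Y_vacuum_ideal R) auto
      then show "(bin (j + 1) r * sb1 k i) *s g r (j + 1 + q - int r + k + 1 - int i) (Lop (int i - 1) x) = 0" by simp
    next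
      fix r
      show "fs (\<lambda>i. (bin (j + 1) r * sb1 k i) *s g r (j + 1 + q - int r + k + 1 - int i) (Lop (int i - 1) x))"
        by (rule fs_A2[OF g])
    qed
    note sw = SA_swap[OF this]
    have "(\<Sum>r. (bin (j + 1) r * sb1 k i) *s g r (j + 1 + q - int r + k + 1 - int i) (Lop (int i - 1) x)) =
      sb1 k i *s Lop j (f (q + k + 1 - int i) (Lop (int i - 1) x)) - sb1 k i *s f (q + k + 1 - int i) (Lop j (Lop (int i - 1) x))" for i
    proof -
      have "sb1 k i *s (Lop j (f (q + k + 1 - int i) (Lop (int i - 1) x)) - f (q + k + 1 - int i) (Lop j (Lop (int i - 1) x))) =
         (\<Sum>r. sb1 k i *s (bin (j + 1) r *s g r (j + 1 + (q + k + 1 - int i) - int r) (Lop (int i - 1) x)))"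
        unfolding comm by (rule SA_hom[OF _ fr]) (simp add: scale_right_distrib)
      moreover have e: "j + 1 + (q + k + 1 - int i) - int r = j + 1 + q - int r + k + 1 - int i" for r by simp
      ultimately show ?thesis unfolding e scale_right_diff_distrib[symmetric]
        by (simp only: scale_scale mult.commute)
    qed
    then show ?thesis unfolding sw T2_def T6_def
      by (simp add: SA_diff fL[of "\<lambda>i y. Lop j (f (q + k + 1 - int i) y)"] fL[of "\<lambda>i y. f (q + k + 1 - int i) (Lop j y)"] fd)
  qed
  have R1: "(\<Sum>r. bin (j + 1) r *s Y (EL k * (EL (int r - 1) * u)) (j + 1 + q - int r) x) =
     T5 - T3 - eps (k + 1) *s (T2 - T6)"
  proof -
    have e: "bin (j + 1) r *s Y (EL k * (EL (int r - 1) * u)) (j + 1 + q - int r) x =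
      (\<Sum>i. (bin (j + 1) r * sb1 k i) *s Lop (k - int i) (g r (j + 1 + q - int r + int i) x)) -
      eps (k + 1) *s (\<Sum>i. (bin (j + 1) r * sb1 k i) *s g r (j + 1 + q - int r + k + 1 - int i) (Lop (int i - 1) x))" for r
      unfolding Y_L[of k] g_def[symmetric] modeA_def
      by (simp add: scale_right_diff_distrib SA_scale fs_A1[OF g] fs_A2[OF g] mult.left_commute)
    obtain R where R: "\<And>r. r \<ge> R \<Longrightarrow> EL r * u \<in> vacuum_ideal c" using vacuum_ideal_truncated by blast
    have z: "g r q x = 0" if "nat (R + 1) \<le> r" for q x r unfolding g_def by (intro Y_vacuum_ideal R) (use that in auto)
    have f1: "fs (\<lambda>r. (\<Sum>i. (bin (j + 1) r * sb1 k i) *s Lop (k - int i) (g r (j + 1 + q - int r + int i) x)))"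
      by (rule fsI[of "nat (R + 1)"]) (simp add: z)
    have f2: "fs (\<lambda>r. (\<Sum>i. (bin (j + 1) r * sb1 k i) *s g r (j + 1 + q - int r + k + 1 - int i) (Lop (int i - 1) x)))"
      by (rule fsI[of "nat (R + 1)"]) (simp add: z)
    show ?thesis unfolding e swap1[symmetric] swap2[symmetric] SA_scale[OF f2]
      by (rule SA_diff[OF f1 fs_scale[OF f2]])
  qed
  define S1 where "S1 = (\<Sum>r. bin (j + 1) r *s (of_int (int r - 1 - k) *s Y (EL (int r - 1 + k) * u) (j + 1 + q - int r) x))"
  define S2 where "S2 = (if k \<le> 1 then (bin (j + 1) (nat (1 - k)) * (vir_cocycle (- k) * c)) *s f (j + k + q) x else 0)"
  \<comment> \<open>L_(r-1) L_k u is reordered to L_k L_(r-1) u; S1 collects the brackets and S2 the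
    central term, which occurs only at r = 1 - k.\<close>
  have rhs: "(\<Sum>r. bin (j + 1) r *s Y (EL (int r - 1) * (EL k * u)) (j + 1 + q - int r) x) =
     T5 - T3 - eps (k + 1) *s (T2 - T6) + (S1 + S2)"
  proof -
    define C where "C r = (if int r - 1 + k = 0 then (bin (j + 1) r * (vir_cocycle (int r - 1) * c)) *s f (j + 1 + q - int r) x else 0)" for r
    have e: "bin (j + 1) r *s Y (EL (int r - 1) * (EL k * u)) (j + 1 + q - int r) x =
      bin (j + 1) r *s Y (EL k * (EL (int r - 1) * u)) (j + 1 + q - int r) x +
      (bin (j + 1) r *s (of_int (int r - 1 - k) *s Y (EL (int r - 1 + k) * u) (j + 1 + q - int r) x) + C r)" for r
      unfolding env_gen_L_L_mult[of "int r - 1" k] C_def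
      by (auto simp: Y_add Y_of_int Y_scalar Y_C f_def scale_right_distrib simp del: of_int_diff)
    have f1: "fs (\<lambda>r. bin (j + 1) r *s Y (EL k * (EL (int r - 1) * u)) (j + 1 + q - int r) x)"
      using fs_Y_shifted_L[of "bin (j + 1)" "\<lambda>_. EL k" "-1"] by simp
    have f2: "fs (\<lambda>r. bin (j + 1) r *s (of_int (int r - 1 - k) *s Y (EL (int r - 1 + k) * u) (j + 1 + q - int r) x))"
      by (rule fs_mono[OF fs_Y_L[of "k - 1" u "\<lambda>r. j + 1 + q - int r" x]]) (simp add: algebra_simps)
    have f3: "fs C" by (rule fsI[of "nat (2 - k)"]) (auto simp: C_def)
    have "Sum_any C = S2"
    proof (cases "k \<le> 1")
      case True
      then have "Sum_any C = C (nat (1 - k))" by (intro SA_single) (auto simp: C_def)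
      with True show ?thesis by (simp add: C_def S2_def add_ac)
    next
      case False
      then have "C = (\<lambda>_. 0)" by (auto simp: C_def)
      then show ?thesis using False by (simp add: S2_def)
    qed
    then show ?thesis unfolding e
      by (simp only: SA_add[OF f1 fs_add[OF f2 f3]] SA_add[OF f2 f3] R1 S1_def)
  qed
  define V1 where "V1 = (\<Sum>i. (of_int (j - (k - int i)) * sb1 k i) *s Lop (j + k - int i) (f (q + int i) x))"
  define V2 where "V2 = (\<Sum>i. (of_int (j - (int i - 1)) * sb1 k i) *s f (q + k + 1 - int i) (Lop (j + int i - 1) x))"
  have fb: "fs (\<lambda>i. a i *s f (b i) (Lop (j + int i - 1) x))" for a b
    by (rule fs_mono[OF fs_L[of "j - 1" x]]) (simp add: algebra_simps fd)
  \<comment> \<open>The bracket terms are matched by a combination of two instances of the Jacobi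
    identity for u: j + 1 times the one at l = k + 1, m = j, minus k + 1 times the one at l = k, m =
    j + 1.\<close>
  have V: "V1 - eps (k + 1) *s V2 = S1"
  proof -
    have 1: "JL u (k + 1) j q x = JR u (k + 1) j q x" and 2: "JL u k (j + 1) q x = JR u k (j + 1) q x"
      using J by (simp_all add: Jom_def)
    \<comment> \<open>Absorption rewrites a weight linear in i as a combination of coefficients with
      upper entries k + 1 and k, which are those of the two instances.\<close>
    have w1: "(of_int (j - (k - int i)) * sb1 k i :: 'a) = of_int (j + 1) * sb1 k i - of_int (k + 1) * sbin k i" for i
    proof -
      have "(of_int (k + 1) - of_nat i) * sb1 k i = (of_int (k + 1) * sbin k i :: 'a)"
        using bin_absorb_comp[of "k + 1" i, where ?'a = 'a] by (simp add: sbin_def mult.left_commute)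
      then show ?thesis by (simp add: algebra_simps)
    qed
    have V1e: "V1 = of_int (j + 1) *s (\<Sum>i. sb1 k i *s Lop (j + k - int i) (f (q + int i) x))
       - of_int (k + 1) *s (\<Sum>i. sbin k i *s Lop (j + k - int i) (f (q + int i) x))"
      unfolding V1_def w1 SA_scale[OF fs_A1[OF f]] scale_scale scale_left_diff_distrib
      by (rule SA_diff; rule fs_A1[OF f])
    define h where "h i = (case i of 0 \<Rightarrow> 0 | Suc i' \<Rightarrow> sbin k i' *s f (q + k + 1 - int i) (Lop (j + int i - 1) x))" for i
    have fh: "fs h"
    proof (rule fs_shift_down)
      show "fs (\<lambda>i'. sbin k i' *s f (q + k + 1 - int (Suc i')) (Lop (j + int (Suc i') - 1) x))"
        by (rule fs_mono[OF fs_L[of j x]]) (simp add: algebra_simps fd)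
    qed (simp_all add: h_def)
    have sh: "Sum_any h = (\<Sum>i. sbin k i *s f (q + k - int i) (Lop (j + int i) x))"
      by (subst SA_shift[of 1]) (simp_all add: h_def algebra_simps)
    have w2: "(of_int (j - (int i - 1)) * sb1 k i) *s f (q + k + 1 - int i) (Lop (j + int i - 1) x) =
       of_int (j + 1) *s (sb1 k i *s f (q + k + 1 - int i) (Lop (j + int i - 1) x)) + of_int (k + 1) *s h i" for i
    proof (cases i)
      case (Suc i')
      have "of_nat i * sb1 k i = (- of_int (k + 1) * sbin k i' :: 'a)"
      proof -
        have "of_nat i * sb1 k i = (-1) ^ i * (of_nat (Suc i') * bin (k + 1) (Suc i') :: 'a)"
          by (simp add: Suc sbin_def)
        also have "\<dots> = (-1) ^ i * (of_int (k + 1) * bin k i')" unfolding bin_absorption by simp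
        finally show ?thesis by (simp add: Suc sbin_def algebra_simps)
      qed
      then have "(of_int (j - (int i - 1)) * sb1 k i :: 'a) = of_int (j + 1) * sb1 k i + of_int (k + 1) * sbin k i'"
        by (simp add: algebra_simps)
      then show ?thesis by (simp only: Suc h_def nat.case scale_scale scale_left_distrib)
    qed (simp add: h_def)
    have V2e: "V2 = of_int (j + 1) *s (\<Sum>i. sb1 k i *s f (q + k + 1 - int i) (Lop (j + int i - 1) x))
       + of_int (k + 1) *s (\<Sum>i. sbin k i *s f (q + k - int i) (Lop (j + int i) x))"
      unfolding V2_def w2 sh[symmetric] SA_scale[OF fb] SA_scale[OF fh]
      by (rule SA_add; intro fs_scale fb fh)
    define g' where "g' i = (case i of 0 \<Rightarrow> 0 | Suc i' \<Rightarrow> bin j i' *s Y (EL (int i - 1 + k) * u) (j + 1 + q - int i) x)" for i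
    have fg': "fs g'"
    proof (rule fs_shift_down)
      show "fs (\<lambda>i'. bin j i' *s Y (EL (int (Suc i') - 1 + k) * u) (j + 1 + q - int (Suc i')) x)"
        by (rule fs_mono[OF fs_Y_L[of k u "\<lambda>i'. j + 1 + q - int (Suc i')" x]]) (simp add: algebra_simps)
    qed (simp_all add: g'_def)
    have shg: "Sum_any g' = JR u (k + 1) j q x"
      unfolding JR_def by (subst SA_shift[of 1]) (simp_all add: g'_def algebra_simps)
    have fk: "fs (\<lambda>r. bin (j + 1) r *s Y (EL (int r - 1 + k) * u) (j + 1 + q - int r) x)"
      by (rule fs_mono[OF fs_Y_L[of "k - 1" u "\<lambda>r. j + 1 + q - int r" x]]) (simp add: algebra_simps)
    have jr2: "JR u k (j + 1) q x = (\<Sum>r. bin (j + 1) r *s Y (EL (int r - 1 + k) * u) (j + 1 + q - int r) x)"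
      unfolding JR_def by (simp add: algebra_simps)
    have w3: "bin (j + 1) r *s (of_int (int r - 1 - k) *s Y (EL (int r - 1 + k) * u) (j + 1 + q - int r) x) =
      of_int (j + 1) *s g' r - of_int (k + 1) *s (bin (j + 1) r *s Y (EL (int r - 1 + k) * u) (j + 1 + q - int r) x)" for r
    proof (cases r)
      case (Suc r')
      have "of_nat (Suc r') * bin (j + 1) (Suc r') = (of_int (j + 1) * bin j r' :: 'a)"
        using bin_absorption[of r' "j + 1", where ?'a = 'a] by simp
      then have "bin (j + 1) r * of_int (int r - 1 - k) = (of_int (j + 1) * bin j r' - of_int (k + 1) * bin (j + 1) r :: 'a)"
        by (simp add: Suc algebra_simps)
      then show ?thesis by (simp only: Suc g'_def nat.case scale_scale scale_left_diff_distrib)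
    qed (simp add: g'_def algebra_simps scale_left_distrib)
    have S1e: "S1 = of_int (j + 1) *s JR u (k + 1) j q x - of_int (k + 1) *s JR u k (j + 1) q x"
      unfolding S1_def w3 shg[symmetric] jr2 SA_scale[OF fk] SA_scale[OF fg']
      by (rule SA_diff; intro fs_scale fk fg')
    have l1: "JL u (k + 1) j q x = (\<Sum>i. sb1 k i *s Lop (j + k - int i) (f (q + int i) x))
       - eps (k + 1) *s (\<Sum>i. sb1 k i *s f (q + k + 1 - int i) (Lop (j + int i - 1) x))"
      unfolding JL_def f_def by (simp add: algebra_simps)
    have l2: "JL u k (j + 1) q x = (\<Sum>i. sbin k i *s Lop (j + k - int i) (f (q + int i) x))
       - eps k *s (\<Sum>i. sbin k i *s f (q + k - int i) (Lop (j + int i) x))"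
      unfolding JL_def f_def by (simp add: algebra_simps)
    show ?thesis
      unfolding S1e 1[symmetric] 2[symmetric] l1 l2 V1e V2e
      by (simp add: scale_right_diff_distrib scale_right_distrib eps_add_1 mult.commute)
  qed
  have c1: "T1 - T5 = V1 + (if j + k \<ge> 0 then (sb1 k (nat (j + k)) * (vir_cocycle j * c)) *s f (j + k + q) x else 0)"
  proof -
    define D where "D i = (if j + (k - int i) = 0 then (sb1 k i * (vir_cocycle j * c)) *s f (q + int i) x else 0)" for i
    have "sb1 k i *s Lop j (Lop (k - int i) (f (q + int i) x)) - sb1 k i *s Lop (k - int i) (Lop j (f (q + int i) x))
       = (of_int (j - (k - int i)) * sb1 k i) *s Lop (j + k - int i) (f (q + int i) x) + D i" for i
      unfolding scale_right_diff_distrib[symmetric] vir_rel D_def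
      by (simp add: scale_right_distrib fd mult.commute add_diff_eq del: of_int_diff)
    then have "T1 - T5 = (\<Sum>i. (of_int (j - (k - int i)) * sb1 k i) *s Lop (j + k - int i) (f (q + int i) x) + D i)"
      unfolding T1_def T5_def
      by (subst SA_diff[symmetric]) (simp_all add: ff[of "\<lambda>i y. Lop j (Lop (k - int i) y)"] ff[of "\<lambda>i y. Lop (k - int i) (Lop j y)"])
    moreover have "fs D" by (rule fsI[of "nat (j + k + 1)"]) (auto simp: D_def)
    moreover have "Sum_any D = (if j + k \<ge> 0 then (sb1 k (nat (j + k)) * (vir_cocycle j * c)) *s f (j + k + q) x else 0)"
    proof (cases "j + k \<ge> 0")
      case True
      then have "Sum_any D = D (nat (j + k))" by (intro SA_single) (auto simp: D_def)
      with True show ?thesis by (simp add: D_def add_ac)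
    next
      case False
      then have "D = (\<lambda>_. 0)" by (auto simp: D_def)
      then show ?thesis using False by simp
    qed
    ultimately show ?thesis by (simp add: SA_add fs_A1[OF f] V1_def)
  qed
  have c2: "T6 - T4 = V2 + (if j \<le> 1 then (sb1 k (nat (1 - j)) * (vir_cocycle j * c)) *s f (j + k + q) x else 0)"
  proof -
    define D where "D i = (if j + (int i - 1) = 0 then (sb1 k i * (vir_cocycle j * c)) *s f (q + k + 1 - int i) x else 0)" for i
    have "sb1 k i *s f (q + k + 1 - int i) (Lop j (Lop (int i - 1) x)) - sb1 k i *s f (q + k + 1 - int i) (Lop (int i - 1) (Lop j x))
       = (of_int (j - (int i - 1)) * sb1 k i) *s f (q + k + 1 - int i) (Lop (j + int i - 1) x) + D i" for i
      unfolding scale_right_diff_distrib[symmetric] fd(7)[symmetric] vir_rel D_def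
      by (simp add: scale_right_distrib fd mult.commute add_diff_eq del: of_int_diff)
    then have "T6 - T4 = (\<Sum>i. (of_int (j - (int i - 1)) * sb1 k i) *s f (q + k + 1 - int i) (Lop (j + int i - 1) x) + D i)"
      unfolding T6_def T4_def
      by (subst SA_diff[symmetric]) (simp_all add: fL[of "\<lambda>i y. f (q + k + 1 - int i) (Lop j y)"] fs_A2[OF f] fd)
    moreover have "fs D" by (rule fsI[of "nat (2 - j)"]) (auto simp: D_def)
    moreover have "Sum_any D = (if j \<le> 1 then (sb1 k (nat (1 - j)) * (vir_cocycle j * c)) *s f (j + k + q) x else 0)"
    proof (cases "j \<le> 1")
      case True
      then have "Sum_any D = D (nat (1 - j))" by (intro SA_single) (auto simp: D_def)
      with True show ?thesis by (simp add: D_def add_ac)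
    next
      case False
      then have "D = (\<lambda>_. 0)" by (auto simp: D_def)
      then show ?thesis using False by simp
    qed
    ultimately show ?thesis by (simp add: SA_add fb V2_def)
  qed
  \<comment> \<open>What remains after T2 and T3 have cancelled: the bracket parts agree by
    \<open>V\<close>, the central parts by \<open>cocycle_identity\<close>.\<close>
  have "(T1 - T5) - eps (k + 1) *s (T6 - T4) = S1 + S2"
  proof -
    have "(if j + k \<ge> 0 then (sb1 k (nat (j + k)) * (vir_cocycle j * c)) *s f (j + k + q) x else 0)
      - eps (k + 1) *s (if j \<le> 1 then (sb1 k (nat (1 - j)) * (vir_cocycle j * c)) *s f (j + k + q) x else 0) =
      (c * ((if j + k \<ge> 0 then sb1 k (nat (j + k)) * vir_cocycle j else 0)
       - eps (k + 1) * (if j \<le> 1 then sb1 k (nat (1 - j)) * vir_cocycle j else 0))) *s f (j + k + q) x"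
      by (simp add: algebra_simps scale_left_diff_distrib)
    also have "\<dots> = S2" unfolding cocycle_identity S2_def by (simp add: algebra_simps)
    finally show ?thesis unfolding c1 c2 V[symmetric]
      by (simp add: scale_right_distrib algebra_simps)
  qed
  then have "Lop j (modeA k f q x) - modeA k f q (Lop j x) =
     T5 - T3 - eps (k + 1) *s (T2 - T6) + (S1 + S2)"
    unfolding lhs by (simp add: scale_right_diff_distrib algebra_simps)
  then show "JL (EL k * u) 0 m q x = JR (EL k * u) 0 m q x"
    unfolding rhs[symmetric] JL_l0 JR_l0 Y_L[of k] f_def[symmetric] j_def by simp
qed

lemma Jom_all: "Jom u"
proof (induction u)
  case one
  show ?case
  proof (rule JomI)
    fix m n x
    have "Y (EL (int r - 1) * 1) q y = 0" for r q y
      by (simp only: Y_L Y_one) (rule modeA_idf, simp)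
    then show "JL 1 0 m n x = JR 1 0 m n x"
      unfolding JL_l0 JR_l0 by (simp add: Y_one idf_def)
  qed
next
  case (add u v)
  show ?case
  proof (rule JomI)
    fix m n x
    have "JL u 0 m n x + JL v 0 m n x = JR u 0 m n x + JR v 0 m n x" using add by (simp add: Jom_def)
    then show "JL (u + v) 0 m n x = JR (u + v) 0 m n x"
      unfolding JL_l0 JR_l0
      by (simp add: distrib_left Y_add scale_right_distrib SA_add fs_Y_L_minus algebra_simps)
  qed
next
  case (scale a u)
  show ?case
  proof (rule JomI)
    fix m n x
    have "a *s JL u 0 m n x = a *s JR u 0 m n x" using scale by (simp add: Jom_def)
    then show "JL (env_scalar a * u) 0 m n x = JR (env_scalar a * u) 0 m n x"
      unfolding JL_l0 JR_l0
      by (simp add: mult_env_scalar Y_scalar SA_scale fs_Y_L_minus scale_right_diff_distrib fldD[OF fld_Y] mult.commute)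
  qed
next
  case (gen g u)
  show ?case
  proof (cases g)
    case C
    show ?thesis unfolding C
    proof (rule JomI)
      fix m n x
      have "c *s JL u 0 m n x = c *s JR u 0 m n x" using gen by (simp add: Jom_def)
      then show "JL (env_gen C * u) 0 m n x = JR (env_gen C * u) 0 m n x"
        unfolding JL_l0 JR_l0
        by (simp add: env_gen_C_mult Y_C SA_scale fs_Y_L_minus scale_right_diff_distrib fldD[OF fld_Y] mult.commute)
    qed
  qed (simp add: Jom_L gen)
qed

lemma Y_commutator:
  "Lop j (Y u q x) - Y u q (Lop j x) =
    (\<Sum>r. bin (j + 1) r *s Y (EL (int r - 1) * u) (j + 1 + q - int r) x)"
  by (rule Jom_commutator[OF Jom_all])

end

section \<open>The Jacobi identity\<close>

text \<open>The coefficient form of the three-term identity of delta functions, x_0^(-1)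
  delta((x_1-x_2)/x_0) - x_0^(-1) delta((x_2-x_1)/(-x_0)) = x_2^(-1) delta((x_1-x_0)/x_2), to which
  the Jacobi identity reduces for u = 1.\<close>

lemma delta_identity:
  "(if m + l + 1 \<ge> 0 then sbin l (nat (m + l + 1)) else 0)
   - (if m \<le> -1 then eps l * sbin l (nat (- 1 - m)) else 0)
   = (if l \<le> -1 then bin m (nat (- 1 - l)) else 0 :: 'a::field)"
  (is "?A - ?B = ?D")
proof -
  have pos0: "bin a (nat b) = (0::'a)" if "0 \<le> a" "a < b" for a b
  proof -
    have "bin a (nat b) = (bin (int (nat a)) (nat b) :: 'a)" using that by simp
    also have "\<dots> = 0" by (rule bin_of_nat_0) (use that in auto)
    finally show ?thesis .
  qed
  have sym: "bin a (nat b) = (bin a (nat (a - b)) :: 'a)" if "0 \<le> b" "b \<le> a" for a b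
  proof -
    have "nat a choose nat b = nat a choose (nat a - nat b)" using that by (intro binomial_symmetric) auto
    moreover have "nat a - nat b = nat (a - b)" using that by auto
    moreover have "bin a n = (of_nat (nat a choose n) :: 'a)" for n using bin_of_nat[of "nat a" n] that by simp
    ultimately show ?thesis by simp
  qed
  have sb: "sbin a (nat b) = (bin (b - a - 1) (nat b) :: 'a)" if "0 \<le> b" for a b
  proof -
    have "sbin a (nat b) = ((-1) ^ nat b * ((-1) ^ nat b * bin (int (nat b) - a - 1) (nat b)) :: 'a)"
      unfolding sbin_def by (subst bin_negated_upper) simp
    then show ?thesis using that by (simp add: mult.assoc[symmetric] power_add[symmetric])
  qed
  consider "l \<ge> 0" "m \<ge> 0" | "l \<ge> 0" "m \<le> -1" | "l \<le> -1" "m \<ge> 0" | "l \<le> -1" "m \<le> -1" by force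
  then show ?thesis
  proof cases
    case 1
    then have "bin l (nat (m + l + 1)) = (0::'a)" by (intro pos0) auto
    with 1 show ?thesis by (simp add: sbin_def)
  next
    case 2
    have B: "?B = eps (m + l + 1) * bin l (nat (- 1 - m))"
      using 2 by (simp add: sbin_def minus_one_power_eq_eps mult.assoc[symmetric] eps_add eps_diff)
    show ?thesis
    proof (cases "m + l + 1 \<ge> 0")
      case True
      have e: "l - (m + l + 1) = - 1 - m" and le: "m + l + 1 \<le> l" using 2 by simp_all
      have "bin l (nat (m + l + 1)) = (bin l (nat (- 1 - m)) :: 'a)"
        using sym[OF True le] unfolding e .
      with 2 True show ?thesis unfolding B by (simp add: sbin_def minus_one_power_eq_eps)
    next
      case False
      then have "bin l (nat (- 1 - m)) = (0::'a)" using 2 by (intro pos0) auto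
      with 2 False show ?thesis unfolding B by simp
    qed
  next
    case 3
    show ?thesis
    proof (cases "m + l + 1 \<ge> 0")
      case True
      have e: "m - (m + l + 1) = - 1 - l" "m + l + 1 - l - 1 = m" and le: "m + l + 1 \<le> m" using 3 by simp_all
      have "sbin l (nat (m + l + 1)) = (bin m (nat (- 1 - l)) :: 'a)"
        using sb[OF True, of l] sym[OF True le] unfolding e by simp
      with 3 True show ?thesis by simp
    next
      case False
      then have "bin m (nat (- 1 - l)) = (0::'a)" using 3 by (intro pos0) auto
      with 3 False show ?thesis by simp
    qed
  next
    case 4
    have "bin m (nat (- 1 - l)) = ((-1) ^ nat (- 1 - l) * sbin m (nat (- 1 - l)) :: 'a)"
      by (simp add: sbin_def mult.assoc[symmetric] power_add[symmetric])
    also have "sbin m (nat (- 1 - l)) = (bin (- 2 - l - m) (nat (- 1 - l)) :: 'a)"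
    proof -
      have "- 1 - l - m - 1 = - 2 - l - m" by simp
      then show ?thesis using sb[of "- 1 - l" m] 4 by (simp only:)
    qed
    also have "\<dots> = bin (- 2 - l - m) (nat (- 1 - m))"
      using sym[of "- 1 - l" "- 2 - l - m"] 4 by simp
    also have "\<dots> = sbin l (nat (- 1 - m))"
    proof -
      have "- 1 - m - l - 1 = - 2 - l - m" by simp
      then show ?thesis using sb[of "- 1 - m" l] 4 by (simp only:)
    qed
    also have "(-1) ^ nat (- 1 - l) = (- eps l :: 'a)"
      using 4 by (simp add: minus_one_power_eq_eps eps_diff)
    finally show ?thesis using 4 by simp
  qed
qed

definition envsc :: "'a::field \<Rightarrow> 'a vir_env \<Rightarrow> 'a vir_env" where
  "envsc a u = env_scalar a * u"

text \<open>
  \<open>V\<close> is the vacuum module itself, its elements being represented in the enveloping algebra, and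
  \<open>W\<close> is any module of the same central charge.
\<close>

locale vir_pair = W: vir_rep scale Lop P c + V: vir_rep envsc LV PV c
  for scale :: "'a::field \<Rightarrow> 'w::ab_group_add \<Rightarrow> 'w" (infixr \<open>*s\<close> 75)
    and Lop P c LV PV +
  assumes LV_cong: "LV k v - EL k * v \<in> vacuum_ideal c"
    and PV_cong: "PV v - v \<in> vacuum_ideal c"
    and PV_kill: "v \<in> vacuum_ideal c \<Longrightarrow> PV v = 0"
begin

abbreviation YW where "YW \<equiv> W.Y"
abbreviation YV where "YV \<equiv> V.Y"

lemmas fW = W.fldD[OF W.fld_Y]
lemmas fV = V.fldD[OF V.fld_Y]

lemma YW_LV: "YW (LV k v) = W.modeA k (YW v)"
  using W.Y_cong_vacuum[OF LV_cong] by (auto simp: W.Y_L[symmetric] fun_eq_iff)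

lemma YV_cong: "v - v' \<in> vacuum_ideal c \<Longrightarrow> YV u q v = YV u q v'"
proof -
  assume "v - v' \<in> vacuum_ideal c"
  then have "PV (v - v') = 0" by (rule PV_kill)
  then have "YV u q (v - v') = 0" using fV(4)[of u q "v - v'"] fV(5) by simp
  then show ?thesis by (simp add: fV)
qed

lemma YV_LV: "YV u q (LV k v) = YV u q (EL k * v)"
  by (rule YV_cong[OF LV_cong])

definition J1 :: "'a vir_env \<Rightarrow> 'a vir_env \<Rightarrow> int \<Rightarrow> int \<Rightarrow> int \<Rightarrow> 'w \<Rightarrow> 'w" where
  "J1 u v l m n w = (\<Sum>s. sbin l s *s YW u (m + l - int s) (YW v (n + int s) w))"

definition J2 :: "'a vir_env \<Rightarrow> 'a vir_env \<Rightarrow> int \<Rightarrow> int \<Rightarrow> int \<Rightarrow> 'w \<Rightarrow> 'w" where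
  "J2 u v l m n w = (\<Sum>s. (eps l * sbin l s) *s YW v (n + l - int s) (YW u (m + int s) w))"

definition J3 :: "'a vir_env \<Rightarrow> 'a vir_env \<Rightarrow> int \<Rightarrow> int \<Rightarrow> int \<Rightarrow> 'w \<Rightarrow> 'w" where
  "J3 u v l m n w = (\<Sum>s. bin m s *s YW (YV u (l + int s) v) (m + n - int s) w)"

text \<open>
  The contour deformation that moves \<open>L\<^sub>k\<close> from the first argument onto the others. Each of the
  three terms of the Jacobi identity satisfies the same recursion, so that no locality argument
  is needed.
\<close>

definition deform :: "int \<Rightarrow> ('a vir_env \<Rightarrow> int \<Rightarrow> int \<Rightarrow> int \<Rightarrow> 'w \<Rightarrow> 'w) \<Rightarrow>
    'a vir_env \<Rightarrow> int \<Rightarrow> int \<Rightarrow> int \<Rightarrow> 'w \<Rightarrow> 'w" where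
  "deform k F v l m n w =
     (\<Sum>i. sb1 k i *s Lop (k - int i) (F v l (m + int i) n w))
     - eps (k + 1) *s (\<Sum>i. sb1 k i *s F v l (m + k + 1 - int i) n (Lop (int i - 1) w))
     - eps (k + 1) *s (\<Sum>i. sb1 k i *s F (EL (int i - 1) * v) (l + k + 1 - int i) m n w)"

lemma W_bound: "\<exists>N. \<forall>s\<ge>N. YW v (n + int s) w = 0"
  using W.fs_fld[OF W.fld_Y, of v n w] by (simp add: fs_def)

lemma V_bound: "\<exists>N. \<forall>s\<ge>N. YV u (n + int s) v = 0"
  using V.fs_fld[OF V.fld_Y, of u n v] by (simp add: fs_def)

lemma L_bound: "\<exists>R. \<forall>r\<ge>R. EL (int r - 1) * v \<in> vacuum_ideal c"
proof -
  obtain N where "\<And>n. n \<ge> N \<Longrightarrow> EL n * v \<in> vacuum_ideal c"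
    using vacuum_ideal_truncated by blast
  then show ?thesis by (intro exI[of _ "nat (N + 1)"]) auto
qed

lemma LW_bound: "\<exists>I. \<forall>i\<ge>I. Lop (int i - 1) w = 0"
  using W.fs_L'[of w] by (simp add: fs_def)

text \<open>Turns truncation for each i into truncation uniform in i, as only finitely many i impose
  a condition.\<close>

lemma uniform_bound:
  assumes "\<And>i t. (I::nat) \<le> i \<Longrightarrow> Q i t" and "\<And>i. \<exists>T. \<forall>t\<ge>T. Q i (t::nat)"
  shows "\<exists>T. \<forall>t\<ge>T. \<forall>i. Q i t"
proof -
  from assms(2) obtain M where M: "\<And>i t. M i \<le> t \<Longrightarrow> Q i t" by metis
  have "Q i t" if "(\<Sum>i<I. M i) \<le> t" for i t
  proof (cases "I \<le> i")
    case False
    then have "M i \<le> (\<Sum>i<I. M i)" by (intro member_le_sum) auto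
    with that show ?thesis by (intro M) simp
  qed (rule assms(1))
  then show ?thesis by blast
qed

lemma J1_zero:
  "J1 u v l m n 0 = 0" "v \<in> vacuum_ideal c \<Longrightarrow> J1 u v l m n w = 0"
  by (simp_all add: J1_def fW W.Y_vacuum_ideal)

lemma J2_zero:
  "J2 u v l m n 0 = 0" "v \<in> vacuum_ideal c \<Longrightarrow> J2 u v l m n w = 0"
  by (simp_all add: J2_def fW W.Y_vacuum_ideal)

lemma J3_zero:
  "J3 u v l m n 0 = 0" "v \<in> vacuum_ideal c \<Longrightarrow> J3 u v l m n w = 0"
  by (simp_all add: J3_def fW fV YV_cong[of v 0])

lemma J1_trunc: "\<exists>N. \<forall>i\<ge>N. J1 u v l (m + int i) n w = 0"
proof -
  obtain S where S: "\<And>s. S \<le> s \<Longrightarrow> YW v (n + int s) w = 0" using W_bound by blast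
  have "\<exists>T. \<forall>t\<ge>T. \<forall>s. YW u (m + int t + l - int s) (YW v (n + int s) w) = 0"
  proof (rule uniform_bound[of S])
    fix s
    show "\<exists>T. \<forall>t\<ge>T. YW u (m + int t + l - int s) (YW v (n + int s) w) = 0"
      using W_bound[of u "m + l - int s" "YW v (n + int s) w"] by (simp add: algebra_simps)
  qed (simp add: S fW)
  then obtain T where "\<forall>t\<ge>T. \<forall>s. YW u (m + int t + l - int s) (YW v (n + int s) w) = 0" by blast
  then show ?thesis by (intro exI[of _ T]) (simp add: J1_def)
qed

lemma J2_trunc: "\<exists>N. \<forall>i\<ge>N. J2 u v l (m + int i) n w = 0"
proof -
  obtain S where S: "\<And>s. S \<le> s \<Longrightarrow> YW u (m + int s) w = 0" using W_bound by blast
  have "YW u (m + int i + int s) w = 0" if "S \<le> i" for i s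
    using S[of "i + s"] that by (simp add: add.assoc)
  then show ?thesis by (intro exI[of _ S]) (simp add: J2_def fW)
qed

lemma deform_diff:
  assumes z: "\<And>v l m n. F v l m n 0 = 0" "\<And>v l m n w. v \<in> vacuum_ideal c \<Longrightarrow> F v l m n w = 0"
    "\<And>v l m n w. \<exists>N. \<forall>i\<ge>N. F v l (m + int i) n w = 0"
    and z': "\<And>v l m n. G v l m n 0 = 0" "\<And>v l m n w. v \<in> vacuum_ideal c \<Longrightarrow> G v l m n w = 0"
    "\<And>v l m n w. \<exists>N. \<forall>i\<ge>N. G v l (m + int i) n w = 0"
  shows "deform k (\<lambda>v l m n w. F v l m n w - G v l m n w) v l m n w = deform k F v l m n w - deform k G v l m n w"
proof -
  have 1: "fs (\<lambda>i. sb1 k i *s Lop (k - int i) (F v l (m + int i) n w))"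
    if "\<exists>N. \<forall>i\<ge>N. F v l (m + int i) n w = 0" for F :: "'a vir_env \<Rightarrow> int \<Rightarrow> int \<Rightarrow> int \<Rightarrow> 'w \<Rightarrow> 'w"
    using that unfolding fs_def by (metis W.L_zero W.scale_zero_right)
  have 2: "fs (\<lambda>i. sb1 k i *s F v l (m + k + 1 - int i) n (Lop (int i - 1) w))"
    if "\<And>v l m n. F v l m n 0 = 0" for F :: "'a vir_env \<Rightarrow> int \<Rightarrow> int \<Rightarrow> int \<Rightarrow> 'w \<Rightarrow> 'w"
    by (rule fs_mono[OF W.fs_L'[of w]]) (simp add: that)
  have 3: "fs (\<lambda>i. sb1 k i *s F (EL (int i - 1) * v) (l + k + 1 - int i) m n w)"
    if "\<And>v l m n w. v \<in> vacuum_ideal c \<Longrightarrow> F v l m n w = 0" for F :: "'a vir_env \<Rightarrow> int \<Rightarrow> int \<Rightarrow> int \<Rightarrow> 'w \<Rightarrow> 'w"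
    using L_bound[of v] that unfolding fs_def by (metis W.scale_zero_right)
  show ?thesis unfolding deform_def
    by (simp add: W.scale_right_diff_distrib SA_diff 1[of F, OF z(3)] 1[of G, OF z'(3)] 2[of F, OF z(1)] 2[of G, OF z'(1)]
        3[of F, OF z(2)] 3[of G, OF z'(2)])
qed

text \<open>In the recursion for L_k u the operators L_(k-i) already stand outermost, while the
  L_(i-1) still have to pass the field of v to reach w. The corrections contain L_(r-1) v and depend
  on the indices s, i only through s + i; \<open>sbin_bin_sum\<close> sums their
  coefficients.\<close>

lemma J1_L: "J1 (EL k * u) v l m n w = deform k (J1 u) v l m n w"
proof -
  define Z where "Z r = YW (EL (int r - 1) * v)" for r :: nat
  define M where "M = m + l + k + 1"
  obtain S where S: "\<And>s. S \<le> s \<Longrightarrow> YW v (n + int s) w = 0" using W_bound by blast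
  obtain R where R: "\<And>r. R \<le> r \<Longrightarrow> EL (int r - 1) * v \<in> vacuum_ideal c" using L_bound by blast
  obtain I where I: "\<And>i. I \<le> i \<Longrightarrow> Lop (int i - 1) w = 0" using LW_bound by blast
  have Z0: "Z r q x = 0" if "R \<le> r" for r q x unfolding Z_def by (rule W.Y_vacuum_ideal[OF R[OF that]])
  have "\<exists>T. \<forall>t\<ge>T. \<forall>r. Z r (n + int t - int r) w = 0"
  proof (rule uniform_bound[of R])
    fix r show "\<exists>T. \<forall>t\<ge>T. Z r (n + int t - int r) w = 0"
      using W_bound[of "EL (int r - 1) * v" "n - int r" w] by (simp add: Z_def algebra_simps)
  qed (rule Z0)
  then obtain T where T: "\<And>t r. T \<le> t \<Longrightarrow> Z r (n + int t - int r) w = 0" by blast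
  define A1 where "A1 s i = (sbin l s * sb1 k i) *s Lop (k - int i) (YW u (m + int i + l - int s) (YW v (n + int s) w))" for s i
  define A2 where "A2 s i = (sbin l s * sb1 k i) *s YW u (m + k + 1 - int i + l - int s) (YW v (n + int s) (Lop (int i - 1) w))" for s i
  define H where "H t r = YW u (M - int t) (Z r (n + int t - int r) w)" for t r
  define A3 where "A3 s i = (sbin l s * sb1 k i) *s (\<Sum>r. bin (int i) r *s H (s + i) r)" for s i
  have s1: "fs2 A1"
  proof (rule fs2I[of S])
    fix s show "fs (A1 s)" unfolding A1_def
      by (rule fs_mono[OF W.fs_fld[OF W.fld_Y, of u "m + l - int s" "YW v (n + int s) w"]]) (simp add: algebra_simps)
  qed (simp add: A1_def S fW)
  have s2: "fs2 A2"
  proof (rule fs2I'[of I])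
    fix i show "fs (\<lambda>s. A2 s i)" unfolding A2_def
      by (rule fs_mono[OF W.fs_fld[OF W.fld_Y, of v n "Lop (int i - 1) w"]]) (simp add: fW)
  qed (simp add: A2_def I fW)
  have HT: "H t r = 0" if "T \<le> t" for t r using T[OF that] by (simp add: H_def fW)
  have HR: "H t r = 0" if "R \<le> r" for t r using Z0[OF that] by (simp add: H_def fW)
  have s3: "fs2 A3" by (rule fs2_diag[of T]) (simp add: A3_def HT)
  have trm: "sbin l s *s YW (EL k * u) (m + l - int s) (YW v (n + int s) w) =
    Sum_any (A1 s) - eps (k + 1) *s Sum_any (A2 s) - eps (k + 1) *s Sum_any (A3 s)" for s
  proof -
    have e1: "sbin l s *s (\<Sum>i. sb1 k i *s Lop (k - int i) (YW u (m + l - int s + int i) (YW v (n + int s) w))) = Sum_any (A1 s)"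
      unfolding A1_def
      by (subst W.SA_scale[OF W.fs_A1[OF W.fld_Y]]) (simp add: algebra_simps)
    have x: "Lop (int i - 1) (YW v (n + int s) w) = YW v (n + int s) (Lop (int i - 1) w) + (\<Sum>r. bin (int i) r *s Z r (n + int (s + i) - int r) w)" for i
      using W.Y_commutator[of "int i - 1" v "n + int s" w] by (simp add: Z_def algebra_simps)
    have fz: "fs (\<lambda>r. bin (int i) r *s Z r (q r) w)" for i :: nat and q by (rule fsI[of R]) (simp add: Z0)
    have y: "(sbin l s * sb1 k i) *s YW u (m + l - int s + k + 1 - int i) (Lop (int i - 1) (YW v (n + int s) w)) = A2 s i + A3 s i" for i
    proof -
      have "YW u (m + l - int s + k + 1 - int i) ((\<Sum>r. bin (int i) r *s Z r (n + int (s + i) - int r) w)) =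
          (\<Sum>r. YW u (m + l - int s + k + 1 - int i) (bin (int i) r *s Z r (n + int (s + i) - int r) w))"
        by (rule W.SA_fld[OF W.fld_Y fz])
      also have "\<dots> = (\<Sum>r. bin (int i) r *s H (s + i) r)"
        by (simp add: H_def fW M_def algebra_simps)
      finally show ?thesis unfolding x fW A2_def A3_def W.scale_right_distrib
        by (simp add: algebra_simps)
    qed
    have f2: "fs (A2 s)" by (rule fs2_row[OF s2])
    have f3: "fs (A3 s)" by (rule fs2_row[OF s3])
    have e2: "sbin l s *s (\<Sum>i. sb1 k i *s YW u (m + l - int s + k + 1 - int i) (Lop (int i - 1) (YW v (n + int s) w))) = Sum_any (A2 s) + Sum_any (A3 s)"
      unfolding SA_add[OF f2 f3, symmetric] y[symmetric]
      by (subst W.SA_scale[OF W.fs_A2[OF W.fld_Y]]) simp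
    have "sbin l s *s YW (EL k * u) (m + l - int s) (YW v (n + int s) w) = Sum_any (A1 s) -
        eps (k + 1) *s (sbin l s *s (\<Sum>i. sb1 k i *s YW u (m + l - int s + k + 1 - int i) (Lop (int i - 1) (YW v (n + int s) w))))"
      unfolding W.Y_L W.modeA_def e1[symmetric] by (simp add: W.scale_right_diff_distrib mult.commute)
    then show ?thesis unfolding e2 by (simp add: W.scale_right_distrib)
  qed
  note r = fs2_SA[where ?'a = 'w]
  have "J1 (EL k * u) v l m n w = (\<Sum>s. Sum_any (A1 s)) - eps (k + 1) *s (\<Sum>s. Sum_any (A2 s))
      - eps (k + 1) *s (\<Sum>s. Sum_any (A3 s))"
    unfolding J1_def trm W.SA_scale[OF r[OF s2]] W.SA_scale[OF r[OF s3]]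
    by (simp add: SA_diff fs_diff r[OF s1] W.fs_scale[OF r[OF s2]] W.fs_scale[OF r[OF s3]])
  also have "(\<Sum>s. Sum_any (A1 s)) = (\<Sum>i. sb1 k i *s Lop (k - int i) (J1 u v l (m + int i) n w))"
  proof -
    have "(\<Sum>s. A1 s i) = sb1 k i *s Lop (k - int i) (J1 u v l (m + int i) n w)" for i
    proof -
      have "fs (\<lambda>s. sbin l s *s YW u (m + int i + l - int s) (YW v (n + int s) w))"
        by (rule fsI[of S]) (simp add: S fW)
      then have "sb1 k i *s Lop (k - int i) (J1 u v l (m + int i) n w) =
          (\<Sum>s. sb1 k i *s Lop (k - int i) (sbin l s *s YW u (m + int i + l - int s) (YW v (n + int s) w)))"
        unfolding J1_def by (intro SA_hom) (simp_all add: W.scale_right_distrib)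
      then show ?thesis by (simp add: A1_def mult.commute)
    qed
    then show ?thesis unfolding SA_swap[OF s1] by simp
  qed
  also have "(\<Sum>s. Sum_any (A2 s)) = (\<Sum>i. sb1 k i *s J1 u v l (m + k + 1 - int i) n (Lop (int i - 1) w))"
  proof -
    have "(\<Sum>s. A2 s i) = sb1 k i *s J1 u v l (m + k + 1 - int i) n (Lop (int i - 1) w)" for i
    proof -
      have "fs (\<lambda>s. sbin l s *s YW u (m + k + 1 - int i + l - int s) (YW v (n + int s) (Lop (int i - 1) w)))"
        by (rule fs_mono[OF W.fs_fld[OF W.fld_Y, of v n "Lop (int i - 1) w"]]) (simp add: fW)
      then have "sb1 k i *s J1 u v l (m + k + 1 - int i) n (Lop (int i - 1) w) =
          (\<Sum>s. sb1 k i *s (sbin l s *s YW u (m + k + 1 - int i + l - int s) (YW v (n + int s) (Lop (int i - 1) w))))"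
        unfolding J1_def by (intro SA_hom) (simp_all add: W.scale_right_distrib)
      then show ?thesis by (simp add: A2_def mult.commute)
    qed
    then show ?thesis unfolding SA_swap[OF s2] by simp
  qed
  also have "(\<Sum>s. Sum_any (A3 s)) =
      (\<Sum>r. sb1 k r *s J1 u (EL (int r - 1) * v) (l + k + 1 - int r) m n w)"
  proof -
    have fH: "fs (\<lambda>r. bin (int i) r *s H t r)" for t i :: nat by (rule fsI[of R]) (simp add: HR)
    have "(\<Sum>i\<le>t. A3 (t - i) i) = (\<Sum>r. (\<Sum>i\<le>t. sbin l (t - i) * sb1 k i * bin (int i) r) *s H t r)" for t
    proof -
      have "(\<Sum>i\<le>t. A3 (t - i) i) = (\<Sum>i\<le>t. (\<Sum>r. (sbin l (t - i) * sb1 k i * bin (int i) r) *s H t r))"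
        by (rule sum.cong[OF refl]) (simp add: A3_def W.SA_scale[OF fH])
      also have "\<dots> = (\<Sum>i\<le>t. \<Sum>r<R. (sbin l (t - i) * sb1 k i * bin (int i) r) *s H t r)"
        by (rule sum.cong[OF refl], rule SA_bound) (simp add: HR)
      also have "\<dots> = (\<Sum>r<R. \<Sum>i\<le>t. (sbin l (t - i) * sb1 k i * bin (int i) r) *s H t r)"
        by (rule sum.swap)
      also have "\<dots> = (\<Sum>r. (\<Sum>i\<le>t. sbin l (t - i) * sb1 k i * bin (int i) r) *s H t r)"
        unfolding W.scale_sum_left by (rule SA_bound[symmetric]) (simp add: HR)
      finally show ?thesis .
    qed
    then have "(\<Sum>s. Sum_any (A3 s)) = (\<Sum>t. Sum_any (\<lambda>r.
       (if r \<le> t then (-1) ^ r * bin (k + 1) r * sbin (l + (k + 1) - int r) (t - r) else 0) *s H t r))"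
      unfolding SA_diag[OF s3] sbin_bin_sum by simp
    also have "\<dots> = (\<Sum>r. Sum_any (\<lambda>t.
       (if r \<le> t then (-1) ^ r * bin (k + 1) r * sbin (l + (k + 1) - int r) (t - r) else 0) *s H t r))"
      by (rule SA_swap, rule fs2I[of T], simp add: HT, rule fsI[of R], simp add: HR)
    also have "\<dots> = (\<Sum>r. sb1 k r *s J1 u (EL (int r - 1) * v) (l + k + 1 - int r) m n w)"
    proof (rule SA_cong)
      fix r
      have f: "fs (\<lambda>s. sbin (l + k + 1 - int r) s *s H (s + r) r)"
        by (rule fsI[of T]) (simp add: HT)
      have "(\<Sum>t. (if r \<le> t then (-1) ^ r * bin (k + 1) r * sbin (l + (k + 1) - int r) (t - r) else 0) *s H t r)
        = (\<Sum>s. sb1 k r *s (sbin (l + k + 1 - int r) s *s H (s + r) r))"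
        by (subst SA_shift[of r]) (simp_all add: sbin_def add.assoc)
      also have "\<dots> = sb1 k r *s J1 u (EL (int r - 1) * v) (l + k + 1 - int r) m n w"
        unfolding W.SA_scale[OF f, symmetric] J1_def by (simp add: H_def Z_def M_def algebra_simps)
      finally show "(\<Sum>t. (if r \<le> t then (-1) ^ r * bin (k + 1) r * sbin (l + (k + 1) - int r) (t - r) else 0) *s H t r)
        = sb1 k r *s J1 u (EL (int r - 1) * v) (l + k + 1 - int r) m n w" .
    qed
    finally show ?thesis .
  qed
  finally show ?thesis by (simp add: deform_def)
qed

text \<open>Here the L_(i-1) already act on w, and the L_(k-i) must be moved out to the left past
  the field of v. The corrections are summed by \<open>sbin_bin_sum'\<close>.\<close>

lemma J2_L: "J2 (EL k * u) v l m n w = deform k (J2 u) v l m n w"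
proof -
  define Z where "Z r = YW (EL (int r - 1) * v)" for r :: nat
  define M where "M = n + l + k + 1"
  obtain R where R: "\<And>r. R \<le> r \<Longrightarrow> EL (int r - 1) * v \<in> vacuum_ideal c" using L_bound by blast
  obtain I where I: "\<And>i. I \<le> i \<Longrightarrow> Lop (int i - 1) w = 0" using LW_bound by blast
  obtain T where T: "\<And>t. T \<le> t \<Longrightarrow> YW u (m + int t) w = 0" using W_bound by blast
  have Z0: "Z r q x = 0" if "R \<le> r" for r q x unfolding Z_def by (rule W.Y_vacuum_ideal[OF R[OF that]])
  define A1 where "A1 s i = (eps l * sbin l s * sb1 k i) *s Lop (k - int i) (YW v (n + l - int s) (YW u (m + int i + int s) w))" for s i
  define A2 where "A2 s i = (eps l * sbin l s * sb1 k i) *s YW v (n + l - int s) (YW u (m + k + 1 - int i + int s) (Lop (int i - 1) w))" for s i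
  define H where "H t r = Z r (M - int t - int r) (YW u (m + int t) w)" for t r
  define A3 where "A3 s i = (eps l * sbin l s * sb1 k i) *s (\<Sum>r. bin (k + 1 - int i) r *s H (s + i) r)" for s i
  have T': "YW u (m + int i + int s) w = 0" if "T \<le> s + i" for s i
    using T[OF that] by (simp add: add_ac)
  have s1: "fs2 A1" by (rule fs2_diag[of T]) (simp add: A1_def T' fW)
  have s2: "fs2 A2"
  proof (rule fs2I'[of I])
    fix i show "fs (\<lambda>s. A2 s i)" unfolding A2_def
      by (rule fs_mono[OF W.fs_fld[OF W.fld_Y, of u "m + k + 1 - int i" "Lop (int i - 1) w"]]) (simp add: fW)
  qed (simp add: A2_def I fW)
  have HT: "H t r = 0" if "T \<le> t" for t r using T[OF that] by (simp add: H_def Z_def fW)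
  have HR: "H t r = 0" if "R \<le> r" for t r using Z0[OF that] by (simp add: H_def)
  have s3: "fs2 A3" by (rule fs2_diag[of T]) (simp add: A3_def HT)
  have trm: "(eps l * sbin l s) *s YW v (n + l - int s) (YW (EL k * u) (m + int s) w) =
    Sum_any (A1 s) - Sum_any (A3 s) - eps (k + 1) *s Sum_any (A2 s)" for s
  proof -
    let ?a = "eps l * sbin l s :: 'a" and ?q = "n + l - int s"
    have f2: "fs (A2 s)" by (rule fs2_row[OF s2])
    have f1: "fs (A1 s)" by (rule fs2_row[OF s1])
    have f3: "fs (A3 s)" by (rule fs2_row[OF s3])
    have e2: "?a *s YW v ?q ((\<Sum>i. sb1 k i *s YW u (m + int s + k + 1 - int i) (Lop (int i - 1) w))) = Sum_any (A2 s)"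
    proof -
      have "?a *s YW v ?q ((\<Sum>i. sb1 k i *s YW u (m + int s + k + 1 - int i) (Lop (int i - 1) w))) =
        (\<Sum>i. ?a *s YW v ?q (sb1 k i *s YW u (m + int s + k + 1 - int i) (Lop (int i - 1) w)))"
        by (rule SA_hom[OF _ W.fs_A2[OF W.fld_Y]]) (simp add: fW W.scale_right_distrib)
      then show ?thesis by (simp add: A2_def fW algebra_simps)
    qed
    have x: "YW v ?q (Lop (k - int i) y) = Lop (k - int i) (YW v ?q y) -
        (\<Sum>r. bin (k + 1 - int i) r *s Z r (M - int (s + i) - int r) y)" for i y
      using W.Y_commutator[of "k - int i" v ?q y] by (simp add: Z_def M_def algebra_simps)
    have y: "?a *s YW v ?q (sb1 k i *s Lop (k - int i) (YW u (m + int s + int i) w)) = A1 s i - A3 s i" for i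
      unfolding fW x A1_def A3_def H_def by (simp add: W.scale_right_diff_distrib algebra_simps)
    have e1: "?a *s YW v ?q ((\<Sum>i. sb1 k i *s Lop (k - int i) (YW u (m + int s + int i) w))) = Sum_any (A1 s) - Sum_any (A3 s)"
    proof -
      have "?a *s YW v ?q ((\<Sum>i. sb1 k i *s Lop (k - int i) (YW u (m + int s + int i) w))) =
        (\<Sum>i. ?a *s YW v ?q (sb1 k i *s Lop (k - int i) (YW u (m + int s + int i) w)))"
        by (rule SA_hom[OF _ W.fs_A1[OF W.fld_Y]]) (simp add: fW W.scale_right_distrib)
      then show ?thesis unfolding y by (simp add: SA_diff f1 f3)
    qed
    have "?a *s YW v ?q (YW (EL k * u) (m + int s) w) =
        ?a *s YW v ?q ((\<Sum>i. sb1 k i *s Lop (k - int i) (YW u (m + int s + int i) w))) -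
        eps (k + 1) *s (?a *s YW v ?q ((\<Sum>i. sb1 k i *s YW u (m + int s + k + 1 - int i) (Lop (int i - 1) w))))"
      unfolding W.Y_L W.modeA_def fW W.scale_right_diff_distrib by (simp add: mult.commute)
    then show ?thesis unfolding e1 e2 .
  qed
  have "J2 (EL k * u) v l m n w = (\<Sum>s. Sum_any (A1 s)) - (\<Sum>s. Sum_any (A3 s)) - eps (k + 1) *s (\<Sum>s. Sum_any (A2 s))"
    unfolding J2_def trm W.SA_scale[OF fs2_SA[OF s2]]
    by (simp add: SA_diff fs_diff fs2_SA[OF s1] fs2_SA[OF s3] W.fs_scale[OF fs2_SA[OF s2]])
  also have "(\<Sum>s. Sum_any (A1 s)) = (\<Sum>i. sb1 k i *s Lop (k - int i) (J2 u v l (m + int i) n w))"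
  proof -
    have "(\<Sum>s. A1 s i) = sb1 k i *s Lop (k - int i) (J2 u v l (m + int i) n w)" for i
    proof -
      have "fs (\<lambda>s. (eps l * sbin l s) *s YW v (n + l - int s) (YW u (m + int i + int s) w))"
        by (rule fsI[of T]) (simp add: T' fW)
      then have "sb1 k i *s Lop (k - int i) (J2 u v l (m + int i) n w) =
          (\<Sum>s. sb1 k i *s Lop (k - int i) ((eps l * sbin l s) *s YW v (n + l - int s) (YW u (m + int i + int s) w)))"
        unfolding J2_def by (intro SA_hom) (simp_all add: W.scale_right_distrib)
      then show ?thesis by (simp add: A1_def mult_ac)
    qed
    then show ?thesis unfolding SA_swap[OF s1] by simp
  qed
  also have "(\<Sum>s. Sum_any (A2 s)) = (\<Sum>i. sb1 k i *s J2 u v l (m + k + 1 - int i) n (Lop (int i - 1) w))"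
  proof -
    have "(\<Sum>s. A2 s i) = sb1 k i *s J2 u v l (m + k + 1 - int i) n (Lop (int i - 1) w)" for i
    proof -
      have "fs (\<lambda>s. (eps l * sbin l s) *s YW v (n + l - int s) (YW u (m + k + 1 - int i + int s) (Lop (int i - 1) w)))"
        by (rule fs_mono[OF W.fs_fld[OF W.fld_Y, of u "m + k + 1 - int i" "Lop (int i - 1) w"]]) (simp add: fW)
      then have "sb1 k i *s J2 u v l (m + k + 1 - int i) n (Lop (int i - 1) w) =
          (\<Sum>s. sb1 k i *s ((eps l * sbin l s) *s YW v (n + l - int s) (YW u (m + k + 1 - int i + int s) (Lop (int i - 1) w))))"
        unfolding J2_def by (intro SA_hom) (simp_all add: W.scale_right_distrib)
      then show ?thesis by (simp add: A2_def mult_ac)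
    qed
    then show ?thesis unfolding SA_swap[OF s2] by simp
  qed
  also have "(\<Sum>s. Sum_any (A3 s)) =
      eps (k + 1) *s (\<Sum>r. sb1 k r *s J2 u (EL (int r - 1) * v) (l + k + 1 - int r) m n w)"
  proof -
    have fH: "fs (\<lambda>r. bin i r *s H t r)" for t :: nat and i by (rule fsI[of R]) (simp add: HR)
    have "(\<Sum>i\<le>t. A3 (t - i) i) = (\<Sum>r. eps l *s (\<Sum>i\<le>t. sbin l (t - i) * sb1 k i * bin (k + 1 - int i) r) *s H t r)" for t
    proof -
      have "(\<Sum>i\<le>t. A3 (t - i) i) = (\<Sum>i\<le>t. (\<Sum>r. (sbin l (t - i) * sb1 k i * bin (k + 1 - int i) r) *s eps l *s H t r))"
        by (rule sum.cong[OF refl]) (simp add: A3_def W.SA_scale[OF fH] mult_ac)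
      also have "\<dots> = (\<Sum>i\<le>t. \<Sum>r<R. (sbin l (t - i) * sb1 k i * bin (k + 1 - int i) r) *s eps l *s H t r)"
        by (rule sum.cong[OF refl], rule SA_bound) (simp add: HR)
      also have "\<dots> = (\<Sum>r<R. \<Sum>i\<le>t. (sbin l (t - i) * sb1 k i * bin (k + 1 - int i) r) *s eps l *s H t r)"
        by (rule sum.swap)
      also have "\<dots> = (\<Sum>r. (\<Sum>i\<le>t. sbin l (t - i) * sb1 k i * bin (k + 1 - int i) r) *s eps l *s H t r)"
        unfolding W.scale_sum_left by (rule SA_bound[symmetric]) (simp add: HR)
      finally show ?thesis by (simp add: mult.commute)
    qed
    then have "(\<Sum>s. Sum_any (A3 s)) = (\<Sum>t. Sum_any (\<lambda>r.
       eps l *s (bin (k + 1) r * sbin (l + (k + 1) - int r) t) *s H t r))"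
      unfolding SA_diag[OF s3] sbin_bin_sum' by simp
    also have "\<dots> = (\<Sum>r. (\<Sum>t. eps l *s (bin (k + 1) r * sbin (l + (k + 1) - int r) t) *s H t r))"
      by (rule SA_swap, rule fs2I[of T], simp add: HT, rule fsI[of R], simp add: HR)
    also have "\<dots> = (\<Sum>r. eps (k + 1) *s sb1 k r *s J2 u (EL (int r - 1) * v) (l + k + 1 - int r) m n w)"
    proof (rule SA_cong)
      fix r
      have f: "fs (\<lambda>s. a s *s H s r)" for a
        by (rule fsI[of T]) (simp add: HT)
      \<comment> \<open>The sign (-1)^r inside \<open>sb1 k r\<close> and the sign of the shifted
        exponent l + k + 1 - r combine to \<open>eps l\<close>.\<close>
      have e: "eps (k + 1) * (sb1 k r * (eps (l + k + 1 - int r) * x)) = (eps l * (bin (k + 1) r * x) :: 'a)" for x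
        by (simp add: sbin_def minus_one_power_eq_eps eps_add eps_diff mult_ac)
      have "eps (k + 1) *s sb1 k r *s J2 u (EL (int r - 1) * v) (l + k + 1 - int r) m n w =
         eps (k + 1) *s sb1 k r *s (\<Sum>s. (eps (l + k + 1 - int r) * sbin (l + k + 1 - int r) s) *s H s r)"
        unfolding J2_def by (simp add: H_def Z_def M_def algebra_simps)
      then show "(\<Sum>t. eps l *s (bin (k + 1) r * sbin (l + (k + 1) - int r) t) *s H t r)
        = eps (k + 1) *s sb1 k r *s J2 u (EL (int r - 1) * v) (l + k + 1 - int r) m n w"
      proof -
        assume F: "eps (k + 1) *s sb1 k r *s J2 u (EL (int r - 1) * v) (l + k + 1 - int r) m n w =
         eps (k + 1) *s sb1 k r *s (\<Sum>s. (eps (l + k + 1 - int r) * sbin (l + k + 1 - int r) s) *s H s r)"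
        have i: "l + (k + 1) - int r = l + k + 1 - int r" by simp
        show ?thesis
          unfolding F i by (simp only: W.SA_scale[OF f] W.scale_scale e mult.assoc)
      qed
    qed
    also have "\<dots> = eps (k + 1) *s (\<Sum>r. sb1 k r *s J2 u (EL (int r - 1) * v) (l + k + 1 - int r) m n w)"
      by (rule W.SA_scale[symmetric]) (rule fsI[of R], simp add: R J2_zero)
    finally show ?thesis .
  qed
  finally show ?thesis by (simp add: deform_def algebra_simps)
qed

lemma Y_SA: "fs g \<Longrightarrow> YW (Sum_any g) q x = (\<Sum>i. YW (g i) q x)"
  by (rule SA_hom) (simp_all add: W.Y_add)

lemma YW_envsc: "YW (envsc a u) q x = a *s YW u q x"
  by (simp add: envsc_def W.Y_scalar)

text \<open>The recursion is used twice, once in V for L_k u and once in W for the elements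
  L_(k-i)(u_q v) that appear. The terms with L_(i-1) v already have the required form; in the others
  the inner summation index collapses.\<close>

lemma J3_L: "J3 (EL k * u) v l m n w = deform k (J3 u) v l m n w"
proof -
  define y where "y t = YW (YV u (l + int t) v)" for t :: nat
  obtain T where T: "\<And>t. T \<le> t \<Longrightarrow> YV u (l + int t) v = 0" using V_bound by blast
  obtain R where R: "\<And>r. R \<le> r \<Longrightarrow> EL (int r - 1) * v \<in> vacuum_ideal c" using L_bound by blast
  obtain I where I: "\<And>i. I \<le> i \<Longrightarrow> Lop (int i - 1) w = 0" using LW_bound by blast
  have y0: "y t q x = 0" if "T \<le> t" for t q x using T[OF that] by (simp add: y_def)
  define A where "A s i = (bin m s * sb1 k i) *s W.modeA (k - int i) (y (s + i)) (m + n - int s) w" for s i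
  define B where "B s i = (bin m s * sb1 k i) *s YW (YV u (l + k + 1 - int i + int s) (EL (int i - 1) * v)) (m + n - int s) w" for s i
  have m0: "W.modeA j (y t) q x = 0" if "T \<le> t" for j t q x
    by (simp add: W.modeA_def y0[OF that])
  have sA: "fs2 A" by (rule fs2_diag[of T]) (simp add: A_def m0)
  have sB: "fs2 B"
  proof (rule fs2I'[of R])
    fix s i assume "R \<le> i"
    then show "B s i = 0" using YV_cong[of "EL (int i - 1) * v" 0] R by (simp add: B_def fV)
  next
    fix i
    obtain N where "\<And>s. N \<le> s \<Longrightarrow> YV u (l + k + 1 - int i + int s) (EL (int i - 1) * v) = 0" using V_bound by blast
    then show "fs (\<lambda>s. B s i)" by (intro fsI[of N]) (simp add: B_def)
  qed
  have trm: "bin m s *s YW (YV (EL k * u) (l + int s) v) (m + n - int s) w =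
     Sum_any (A s) - eps (k + 1) *s Sum_any (B s)" for s
  proof -
    have fe1: "fs (\<lambda>i. envsc (sb1 k i) (LV (k - int i) (YV u (l + int s + int i) v)))" by (rule V.fs_A1[OF V.fld_Y])
    have fe2: "fs (\<lambda>i. envsc (sb1 k i) (YV u (l + int s + k + 1 - int i) (LV (int i - 1) v)))" by (rule V.fs_A2[OF V.fld_Y])
    have "YW (YV (EL k * u) (l + int s) v) q w =
      (\<Sum>i. sb1 k i *s W.modeA (k - int i) (y (s + i)) q w)
      - eps (k + 1) *s (\<Sum>i. sb1 k i *s YW (YV u (l + k + 1 - int i + int s) (EL (int i - 1) * v)) q w)" for q
      unfolding V.Y_L V.modeA_def W.Y_diff YW_envsc Y_SA[OF fe1] Y_SA[OF fe2]
      unfolding YW_LV YV_LV YW_envsc y_def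
      by (simp add: algebra_simps)
    note main = this
    have f1: "fs (\<lambda>i. sb1 k i *s W.modeA (k - int i) (y (s + i)) q w)" for q
      by (rule fsI[of T]) (simp add: m0)
    have f2: "fs (\<lambda>i. a i *s YW (YV u (l + k + 1 - int i + int s) (EL (int i - 1) * v)) q w)" for q a
      by (rule fsI[of R]) (use YV_cong[of "EL (int _ - 1) * v" 0] R in \<open>simp add: fV\<close>)
    show ?thesis
      unfolding main W.scale_right_diff_distrib A_def[abs_def] B_def[abs_def]
      by (simp only: W.SA_scale[OF f1] W.SA_scale[OF f2] W.scale_scale mult.left_commute)
  qed
  have "J3 (EL k * u) v l m n w = (\<Sum>s. Sum_any (A s)) - eps (k + 1) *s (\<Sum>s. Sum_any (B s))"
    unfolding J3_def trm W.SA_scale[OF fs2_SA[OF sB]]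
    by (simp add: SA_diff fs2_SA[OF sA] W.fs_scale[OF fs2_SA[OF sB]])
  also have "(\<Sum>s. Sum_any (B s)) = (\<Sum>i. sb1 k i *s J3 u (EL (int i - 1) * v) (l + k + 1 - int i) m n w)"
  proof -
    have "(\<Sum>s. B s i) = sb1 k i *s J3 u (EL (int i - 1) * v) (l + k + 1 - int i) m n w" for i
    proof -
      obtain N where N: "\<And>s. N \<le> s \<Longrightarrow> YV u (l + k + 1 - int i + int s) (EL (int i - 1) * v) = 0" using V_bound by blast
      have "fs (\<lambda>s. bin m s *s YW (YV u (l + k + 1 - int i + int s) (EL (int i - 1) * v)) (m + n - int s) w)"
        by (rule fsI[of N]) (simp add: N)
      from W.SA_scale[OF this] show ?thesis unfolding J3_def by (simp add: B_def mult.commute)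
    qed
    then show ?thesis unfolding SA_swap[OF sB] by simp
  qed
  also have "(\<Sum>s. Sum_any (A s)) =
      (\<Sum>i. sb1 k i *s Lop (k - int i) (J3 u v l (m + int i) n w))
     - eps (k + 1) *s (\<Sum>i. sb1 k i *s J3 u v l (m + k + 1 - int i) n (Lop (int i - 1) w))"
  proof -
    define E where "E t i = Lop (k - int i) (y t (m + int i + n - int t) w)" for t i
    define G where "G t j = y t (m + k + 1 - int j + n - int t) (Lop (int j - 1) w)" for t j
    have fE: "fs (\<lambda>i. a i *s E t i)" for t a
      by (rule fs_mono[OF W.fs_fld[OF W.fld_Y, of "YV u (l + int t) v" "m + n - int t" w]]) (simp add: E_def y_def algebra_simps)
    have ET: "E t i = 0" "G t i = 0" if "T \<le> t" for t i by (simp_all add: E_def G_def y0[OF that])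
    have GI: "G t i = 0" if "I \<le> i" for t i by (simp add: G_def I[OF that] y_def fW)
    have fG: "fs (\<lambda>i. a i *s G t i)" for t a by (rule fsI[of I]) (simp add: GI)
    have 1: "(bin m (t - i) * sb1 k i) *s (\<Sum>j. sbin (k + 1 - int i) j *s Lop (k - int i - int j) (y t (m + n - int (t - i) + int j) w))
      = (\<Sum>i'. (bin m (t - i) * sb1 k i' * bin (int i') i) *s E t i')" if i: "i \<le> t" for i t
    proof -
      have "(\<Sum>i'. (bin m (t - i) * sb1 k i' * bin (int i') i) *s E t i') =
         (\<Sum>j. (bin m (t - i) * sb1 k (j + i) * bin (int (j + i)) i) *s E t (j + i))"
        by (rule SA_shift) (simp add: bin_of_nat_0)
      also have "\<dots> = (\<Sum>j. (bin m (t - i) * sb1 k i) *s (sbin (k + 1 - int i) j *s Lop (k - int i - int j) (y t (m + n - int (t - i) + int j) w)))"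
      proof (rule SA_cong)
        fix j
        have "sb1 k (j + i) * bin (int (j + i)) i = (sb1 k i * sbin (k + 1 - int i) j :: 'a)"
          using bin_trinomial[of "k + 1" i j, where ?'a = 'a] by (simp add: sbin_def power_add add.commute[of j i] mult_ac)
        moreover have "E t (j + i) = Lop (k - int i - int j) (y t (m + n - int (t - i) + int j) w)"
          using i by (simp add: E_def of_nat_diff algebra_simps)
        ultimately show "(bin m (t - i) * sb1 k (j + i) * bin (int (j + i)) i) *s E t (j + i) =
           (bin m (t - i) * sb1 k i) *s (sbin (k + 1 - int i) j *s Lop (k - int i - int j) (y t (m + n - int (t - i) + int j) w))"
          by (simp add: mult.assoc)
      qed
      finally show ?thesis
        by (subst W.SA_scale) (simp_all add: y_def W.fs_A1[OF W.fld_Y])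
    qed
    have 2: "(bin m (t - i) * sb1 k i) *s (eps (k - int i + 1) *s (\<Sum>j. sbin (k - int i + 1) j *s y t (m + n - int (t - i) + (k - int i) + 1 - int j) (Lop (int j - 1) w)))
      = (\<Sum>j. (eps (k + 1) * (-1) ^ j * (bin m (t - i) * bin (k + 1) i * bin (k + 1 - int i) j)) *s G t j)" if i: "i \<le> t" for i t
    proof -
      have g: "y t (m + n - int (t - i) + (k - int i) + 1 - int j) (Lop (int j - 1) w) = G t j" for j
        using i by (simp add: G_def of_nat_diff algebra_simps)
      have coef: "bin m (t - i) * sb1 k i * (eps (k - int i + 1) * sbin (k - int i + 1) j) =
         (eps (k + 1) * (-1) ^ j * (bin m (t - i) * bin (k + 1) i * bin (k + 1 - int i) j) :: 'a)" for j
        by (simp add: sbin_def minus_one_power_eq_eps eps_add eps_diff mult_ac diff_add_eq)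
      show ?thesis by (simp only: g W.SA_scale[OF fG] W.scale_scale coef)
    qed
    \<comment> \<open>After trinomial revision the inner index occurs only in a Vandermonde
      convolution, and this produces the shifted upper entries m + i and m + k + 1 - i of
      \<open>deform\<close>.\<close>
    have A_eq: "(\<Sum>i\<le>t. A (t - i) i) = (\<Sum>i. (sb1 k i * bin (m + int i) t) *s E t i)
       - (\<Sum>j. (eps (k + 1) * sb1 k j * bin (m + k + 1 - int j) t) *s G t j)" for t
    proof -
      have fsum: "(\<Sum>i\<le>t. Sum_any (h i)) = (\<Sum>j. \<Sum>i\<le>t. h i j)" if "\<And>i. fs (h i)" for h :: "nat \<Rightarrow> nat \<Rightarrow> 'w"
      proof -
        have "(\<Sum>i\<le>n. Sum_any (h i)) = (\<Sum>j. \<Sum>i\<le>n. h i j) \<and> fs (\<lambda>j. \<Sum>i\<le>n. h i j)" for n :: nat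
          by (induction n) (simp_all add: SA_add that fs_add)
        then show ?thesis by blast
      qed
      have "(\<Sum>i\<le>t. A (t - i) i) = (\<Sum>i\<le>t. (\<Sum>i'. (bin m (t - i) * sb1 k i' * bin (int i') i) *s E t i')) -
         (\<Sum>i\<le>t. (\<Sum>j. (eps (k + 1) * (-1) ^ j * (bin m (t - i) * bin (k + 1) i * bin (k + 1 - int i) j)) *s G t j))"
        unfolding sum_subtractf[symmetric]
      proof (rule sum.cong[OF refl])
        fix i assume "i \<in> {..t}"
        then have i: "i \<le> t" by simp
        have e: "k - int i + 1 = k + 1 - int i" by simp
        show "A (t - i) i = (\<Sum>i'. (bin m (t - i) * sb1 k i' * bin (int i') i) *s E t i') -
           (\<Sum>j. (eps (k + 1) * (-1) ^ j * (bin m (t - i) * bin (k + 1) i * bin (k + 1 - int i) j)) *s G t j)"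
          unfolding 1[OF i, symmetric] 2[OF i, symmetric] A_def W.modeA_def W.scale_right_diff_distrib
          using i by (simp add: e)
      qed
      also have "(\<Sum>i\<le>t. (\<Sum>i'. (bin m (t - i) * sb1 k i' * bin (int i') i) *s E t i')) = (\<Sum>i. (sb1 k i * bin (m + int i) t) *s E t i)"
      proof -
        have "(\<Sum>i\<le>t. bin m (t - i) * sb1 k i' * bin (int i') i) = (sb1 k i' * bin (m + int i') t :: 'a)" for i'
          unfolding bin_Vandermonde[symmetric] sum_distrib_left by (simp add: mult_ac)
        then show ?thesis by (simp add: fsum fE W.scale_sum_left[symmetric])
      qed
      also have "(\<Sum>i\<le>t. (\<Sum>j. (eps (k + 1) * (-1) ^ j * (bin m (t - i) * bin (k + 1) i * bin (k + 1 - int i) j)) *s G t j))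
        = (\<Sum>j. (eps (k + 1) * sb1 k j * bin (m + k + 1 - int j) t) *s G t j)"
      proof -
        have "(\<Sum>i\<le>t. eps (k + 1) * (-1) ^ j * (bin m (t - i) * bin (k + 1) i * bin (k + 1 - int i) j)) = (eps (k + 1) * sb1 k j * bin (m + k + 1 - int j) t :: 'a)" for j
          unfolding sum_distrib_left[symmetric] bin_bin_sum' by (simp add: sbin_def mult_ac add.assoc)
        then show ?thesis by (simp add: fsum fG W.scale_sum_left[symmetric])
      qed
      finally show ?thesis .
    qed
    have s1: "fs2 (\<lambda>t i. (sb1 k i * bin (m + int i) t) *s E t i)"
      by (rule fs2I[of T]) (simp_all add: ET fE)
    have s2: "fs2 (\<lambda>t j. (eps (k + 1) * sb1 k j * bin (m + k + 1 - int j) t) *s G t j)"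
      by (rule fs2I[of T]) (simp_all add: ET fG)
    have c1: "(\<Sum>t. (sb1 k i * bin (m + int i) t) *s E t i) = sb1 k i *s Lop (k - int i) (J3 u v l (m + int i) n w)" for i
    proof -
      have "fs (\<lambda>t. bin (m + int i) t *s y t (m + int i + n - int t) w)" by (rule fsI[of T]) (simp add: y0)
      then have "sb1 k i *s Lop (k - int i) (J3 u v l (m + int i) n w) =
         (\<Sum>t. sb1 k i *s Lop (k - int i) (bin (m + int i) t *s y t (m + int i + n - int t) w))"
        unfolding J3_def y_def[symmetric] by (intro SA_hom) (simp_all add: W.scale_right_distrib)
      then show ?thesis by (simp add: E_def)
    qed
    have c2: "(\<Sum>t. (eps (k + 1) * sb1 k j * bin (m + k + 1 - int j) t) *s G t j) =
       eps (k + 1) *s sb1 k j *s J3 u v l (m + k + 1 - int j) n (Lop (int j - 1) w)" for j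
    proof -
      have f: "fs (\<lambda>t. a t *s y t (m + k + 1 - int j + n - int t) (Lop (int j - 1) w))" for a
        by (rule fsI[of T]) (simp add: y0)
      show ?thesis
        unfolding J3_def y_def[symmetric] G_def
        by (simp only: W.SA_scale[OF f] W.scale_scale mult.assoc)
    qed
    have fJ: "fs (\<lambda>j. sb1 k j *s J3 u v l (m + k + 1 - int j) n (Lop (int j - 1) w))"
      by (rule fsI[of I]) (simp add: I J3_zero)
    show ?thesis
      unfolding SA_diag[OF sA] A_eq W.SA_scale[OF fJ]
      by (subst SA_diff[OF fs2_SA[OF s1] fs2_SA[OF s2]])
        (simp add: SA_swap[OF s1] SA_swap[OF s2] c1 c2)
  qed
  finally show ?thesis by (simp add: deform_def)
qed

end

context vir_pair
begin

lemma fs_J1: "fs (\<lambda>s. a s *s YW u (m + l - int s) (YW v (n + int s) w))"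
  by (rule fs_mono[OF W.fs_fld[OF W.fld_Y, of v n w]]) (simp add: fW)

lemma fs_J2: "fs (\<lambda>s. a s *s YW v (n + l - int s) (YW u (m + int s) w))"
  by (rule fs_mono[OF W.fs_fld[OF W.fld_Y, of u m w]]) (simp add: fW)

lemma fs_J3: "fs (\<lambda>s. a s *s YW (YV u (l + int s) v) (m + n - int s) w)"
  by (rule fs_mono[OF V.fs_fld[OF V.fld_Y, of u l v]]) simp

lemma J_one: "J1 1 v l m n w - J2 1 v l m n w = J3 1 v l m n w"
proof -
  let ?y = "YW v (m + n + l + 1) w"
  have 1: "J1 1 v l m n w = (if m + l + 1 \<ge> 0 then sbin l (nat (m + l + 1)) else 0) *s ?y"
  proof (cases "m + l + 1 \<ge> 0")
    case True
    have "J1 1 v l m n w = sbin l (nat (m + l + 1)) *s W.idf (m + l - int (nat (m + l + 1))) (YW v (n + int (nat (m + l + 1))) w)"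
      unfolding J1_def W.Y_one by (rule SA_single) (auto simp: W.idf_def)
    then show ?thesis using True by (simp add: W.idf_def fW add_ac)
  next
    case False
    then have "m + l - int s \<noteq> -1" for s by auto
    then show ?thesis using False by (simp add: J1_def W.Y_one W.idf_def)
  qed
  have 2: "J2 1 v l m n w = (if m \<le> -1 then eps l * sbin l (nat (- 1 - m)) else 0) *s ?y"
  proof (cases "m \<le> -1")
    case True
    have "J2 1 v l m n w = (eps l * sbin l (nat (- 1 - m))) *s YW v (n + l - int (nat (- 1 - m))) (W.idf (m + int (nat (- 1 - m))) w)"
      unfolding J2_def W.Y_one by (rule SA_single) (auto simp: W.idf_def fW)
    then show ?thesis using True by (simp add: W.idf_def fW algebra_simps)
  next
    case False
    then have "m + int s \<noteq> -1" for s by auto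
    then show ?thesis using False by (simp add: J2_def W.Y_one W.idf_def fW)
  qed
  have 3: "J3 1 v l m n w = (if l \<le> -1 then bin m (nat (- 1 - l)) else 0) *s ?y"
  proof (cases "l \<le> -1")
    case True
    have "J3 1 v l m n w = bin m (nat (- 1 - l)) *s YW (V.idf (l + int (nat (- 1 - l))) v) (m + n - int (nat (- 1 - l))) w"
      unfolding J3_def V.Y_one by (rule SA_single) (auto simp: V.idf_def)
    then show ?thesis using True W.Y_cong_vacuum[OF PV_cong, of v] by (simp add: V.idf_def algebra_simps)
  next
    case False
    then have "l + int s \<noteq> -1" for s by auto
    then show ?thesis using False by (simp add: J3_def V.Y_one V.idf_def)
  qed
  show ?thesis unfolding 1 2 3 W.scale_left_diff_distrib[symmetric] delta_identity ..
qed

theorem jacobi: "J1 u v l m n w - J2 u v l m n w = J3 u v l m n w"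
proof (induction u arbitrary: v l m n w)
  case one
  show ?case by (rule J_one)
next
  case (add u u')
  have 1: "J1 (u + u') v l m n w = J1 u v l m n w + J1 u' v l m n w"
    unfolding J1_def by (simp add: W.Y_add W.scale_right_distrib SA_add fs_J1)
  have 2: "J2 (u + u') v l m n w = J2 u v l m n w + J2 u' v l m n w"
    unfolding J2_def by (simp add: W.Y_add fW W.scale_right_distrib SA_add fs_J2)
  have 3: "J3 (u + u') v l m n w = J3 u v l m n w + J3 u' v l m n w"
    unfolding J3_def by (simp add: W.Y_add V.Y_add W.scale_right_distrib SA_add fs_J3)
  show ?case unfolding 1 2 3 add[symmetric] by simp
next
  case (scale a u)
  have 1: "J1 (env_scalar a * u) v l m n w = a *s J1 u v l m n w"
    unfolding J1_def by (simp add: W.Y_scalar W.SA_scale fs_J1 mult.commute)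
  have 2: "J2 (env_scalar a * u) v l m n w = a *s J2 u v l m n w"
    unfolding J2_def by (simp add: W.Y_scalar fW W.SA_scale fs_J2 mult_ac)
  have 3: "J3 (env_scalar a * u) v l m n w = a *s J3 u v l m n w"
    unfolding J3_def by (simp add: V.Y_scalar YW_envsc W.SA_scale fs_J3 mult.commute)
  show ?case unfolding 1 2 3 scale[symmetric] by (simp add: W.scale_right_diff_distrib)
next
  case (gen g u)
  show ?case
  proof (cases g)
    case (L k)
    have "J3 u = (\<lambda>v l m n w. J1 u v l m n w - J2 u v l m n w)"
      using gen by (intro ext) simp
    then have "deform k (J3 u) v l m n w = deform k (J1 u) v l m n w - deform k (J2 u) v l m n w"
      by (simp only:) (intro deform_diff J1_zero J2_zero J1_trunc J2_trunc)
    then show ?thesis unfolding L J1_L J2_L J3_L by simp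
  next
    case C
    have 1: "J1 (env_gen C * u) v l m n w = c *s J1 u v l m n w"
      unfolding J1_def by (simp add: W.Y_C W.SA_scale fs_J1 mult.commute)
    have 2: "J2 (env_gen C * u) v l m n w = c *s J2 u v l m n w"
      unfolding J2_def by (simp add: W.Y_C fW W.SA_scale fs_J2 mult_ac)
    have 3: "J3 (env_gen C * u) v l m n w = c *s J3 u v l m n w"
      unfolding J3_def by (simp add: V.Y_C YW_envsc W.SA_scale fs_J3 mult.commute)
    show ?thesis unfolding C 1 2 3 gen[symmetric] by (simp add: W.scale_right_diff_distrib)
  qed
qed

end

section \<open>Quotients of the enveloping algebra as modules\<close>

lemma vector_space_envsc: "Vector_Spaces.vector_space (envsc :: 'a::field \<Rightarrow> 'a vir_env \<Rightarrow> 'a vir_env)"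
  by unfold_locales
    (simp_all add: envsc_def distrib_left distrib_right env_scalar_add env_scalar_mult mult.assoc)

text \<open>A linear projection of U with kernel I. Its range is a complement of I, a copy of U/I
  inside U, so that \<open>vir_rep\<close> applies with this idempotent as \<open>P\<close>.\<close>

definition quot_proj :: "'a::field vir_env set \<Rightarrow> 'a vir_env \<Rightarrow> 'a vir_env" where
  "quot_proj I = (SOME f. (\<forall>x y. f (x + y) = f x + f y) \<and> (\<forall>a x. f (env_scalar a * x) = env_scalar a * f x) \<and>
     (\<forall>x. f x - x \<in> I) \<and> (\<forall>x\<in>I. f x = 0))"

definition quot_L :: "'a::field vir_env set \<Rightarrow> int \<Rightarrow> 'a vir_env \<Rightarrow> 'a vir_env" where
  "quot_L I n x = quot_proj I (EL n * x)"

locale vir_quot =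
  fixes I :: "'a::field vir_env set" and c :: 'a
  assumes I_zero: "0 \<in> I"
    and I_add: "x \<in> I \<Longrightarrow> y \<in> I \<Longrightarrow> x + y \<in> I"
    and I_mult: "x \<in> I \<Longrightarrow> u * x \<in> I"
    and charge: "env_gen C * u - env_scalar c * u \<in> I"
    and trunc: "\<exists>N. \<forall>n\<ge>N. EL n * u \<in> I"
begin

lemma I_minus: "x \<in> I \<Longrightarrow> - x \<in> I"
  using I_mult[of x "- 1"] by simp

lemma I_diff: "x \<in> I \<Longrightarrow> y \<in> I \<Longrightarrow> x - y \<in> I"
  using I_add[of x "- y"] I_minus by simp

lemma quot_proj_exists:
  "\<exists>f. (\<forall>x y. f (x + y) = f x + f y) \<and> (\<forall>a x. f (env_scalar a * x) = env_scalar a * f x) \<and>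
     (\<forall>x. f x - x \<in> I) \<and> (\<forall>x\<in>I. f x = 0)"
proof -
  interpret vs: Vector_Spaces.vector_space "envsc :: 'a \<Rightarrow> _" by (rule vector_space_envsc)
  interpret vp: vector_space_pair "envsc :: 'a \<Rightarrow> _" "envsc :: 'a \<Rightarrow> _" ..
  have sub: "vs.subspace I"
    by (simp add: vs.subspace_def I_zero I_add I_mult envsc_def)
  obtain B where B: "B \<subseteq> I" "vs.independent B" "I \<subseteq> vs.span B"
    by (rule vs.basis_exists[of I])
  have sp: "vs.span B = I" using B(1,3) vs.span_minimal[OF B(1) sub] by blast
  \<comment> \<open>Extending the identity on a basis of I by \<open>construct\<close> gives a
    projection onto I; subtracting it from the identity yields the map sought.\<close>
  define r where "r = vp.construct B id"
  have lin: "Vector_Spaces.linear envsc envsc r" unfolding r_def by (rule vp.linear_construct[OF B(2)])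
  interpret r: Vector_Spaces.linear envsc envsc r by (rule lin)
  have rI: "r x \<in> I" for x
    using vp.construct_in_span[OF B(2), of id x] by (simp add: r_def sp)
  have rid: "r x = x" if "x \<in> I" for x
  proof -
    have "r x = id x"
    proof (rule vp.linear_eq_on[OF lin vs.linear_id])
      show "x \<in> vs.span B" using that sp by simp
      show "r b = id b" if "b \<in> B" for b using vp.construct_basis[OF B(2) that] by (simp add: r_def)
    qed
    then show ?thesis by simp
  qed
  have rs: "r (env_scalar a * x) = env_scalar a * r x" for a x
    using r.scale[of a x] by (simp add: envsc_def)
  have "(x - r x) - x \<in> I" for x using I_minus[OF rI[of x]] by simp
  then show ?thesis
    by (intro exI[of _ "\<lambda>x. x - r x"]) (simp add: r.add rs rid right_diff_distrib)
qed

lemma quot_proj: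
  shows quot_proj_add: "quot_proj I (x + y) = quot_proj I x + quot_proj I y"
    and quot_proj_scalar: "quot_proj I (env_scalar a * x) = env_scalar a * quot_proj I x"
    and quot_proj_cong: "quot_proj I x - x \<in> I"
    and quot_proj_kill: "x \<in> I \<Longrightarrow> quot_proj I x = 0"
proof -
  have "(\<forall>x y. quot_proj I (x + y) = quot_proj I x + quot_proj I y) \<and>
    (\<forall>a x. quot_proj I (env_scalar a * x) = env_scalar a * quot_proj I x) \<and>
     (\<forall>x. quot_proj I x - x \<in> I) \<and> (\<forall>x\<in>I. quot_proj I x = 0)"
    unfolding quot_proj_def by (rule someI_ex[OF quot_proj_exists])
  then show "quot_proj I (x + y) = quot_proj I x + quot_proj I y"
    "quot_proj I (env_scalar a * x) = env_scalar a * quot_proj I x"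
    "quot_proj I x - x \<in> I" "x \<in> I \<Longrightarrow> quot_proj I x = 0" by blast+
qed

lemma quot_proj_eq: "x - y \<in> I \<Longrightarrow> quot_proj I x = quot_proj I y"
  using quot_proj_kill[of "x - y"] quot_proj_add[of "x - y" y] by simp

lemma vir_rep: "vir_rep envsc (quot_L I) (quot_proj I) c"
proof -
  have mult_cong: "quot_proj I (u * quot_proj I x) = quot_proj I (u * x)" for u x
    using I_mult[OF quot_proj_cong, of u x] by (intro quot_proj_eq) (simp add: right_diff_distrib)
  have idem: "quot_proj I (quot_proj I x) = quot_proj I x" for x
    by (rule quot_proj_eq[OF quot_proj_cong])
  have p0: "quot_proj I 0 = 0" by (rule quot_proj_kill[OF I_zero])
  have pC: "quot_proj I (env_gen C * x) = env_scalar c * quot_proj I x" for x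
    unfolding quot_proj_scalar[symmetric] by (rule quot_proj_eq[OF charge])
  have rel: "quot_L I m (quot_L I n x) - quot_L I n (quot_L I m x) =
      envsc (of_int (m - n)) (quot_L I (m + n) x) + (if m + n = 0 then envsc (vir_cocycle m * c) (quot_proj I x) else 0)" for m n x
  proof -
    have "quot_L I m (quot_L I n x) = quot_L I n (quot_L I m x) +
      quot_proj I (env_scalar (of_int (m - n)) * (EL (m + n) * x)) +
      quot_proj I (if m + n = 0 then env_scalar (vir_cocycle m) * (env_gen C * x) else 0)"
      unfolding quot_L_def mult_cong env_gen_L_L_mult[of m n] quot_proj_add env_scalar_of_int by simp
    then show ?thesis
      by (simp add: quot_proj_scalar quot_L_def envsc_def p0 pC env_scalar_mult mult.assoc del: of_int_diff)
  qed
  interpret vs: Vector_Spaces.vector_space "envsc :: 'a \<Rightarrow> _" by (rule vector_space_envsc)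
  show ?thesis
  proof
    fix n x
    show "\<exists>N. \<forall>n\<ge>N. quot_L I n x = 0" using trunc[of x] quot_proj_kill unfolding quot_L_def by blast
    show "quot_L I n (x + y) = quot_L I n x + quot_L I n y" for y
      by (simp add: quot_L_def distrib_left quot_proj_add)
    show "quot_L I n (envsc a x) = envsc a (quot_L I n x)" for a
      by (simp add: quot_L_def envsc_def mult_env_scalar quot_proj_scalar)
    show "quot_proj I (quot_L I n x) = quot_L I n x" by (simp add: quot_L_def idem)
    show "quot_L I n (quot_proj I x) = quot_L I n x" by (simp add: quot_L_def mult_cong)
  qed (simp_all add: quot_proj_add envsc_def quot_proj_scalar idem rel[unfolded envsc_def])
qed

end

lemma vir_quot_vacuum: "vir_quot (vacuum_ideal c) c"
proof
  show "0 \<in> vacuum_ideal c" by (simp add: vacuum_ideal_def left_ideal.zero)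
qed (auto intro: vacuum_ideal_add vacuum_ideal_mult vacuum_ideal_C vacuum_ideal_truncated)

lemma vir_pair_quot:
  assumes "vir_quot I c"
  shows "vir_pair envsc (quot_L I) (quot_proj I) c (quot_L (vacuum_ideal c)) (quot_proj (vacuum_ideal c))"
proof -
  interpret vir_quot I c by fact
  interpret V: vir_quot "vacuum_ideal c" c by (rule vir_quot_vacuum)
  interpret W: vir_rep envsc "quot_L I" "quot_proj I" c by (rule vir_rep)
  interpret VV: vir_rep envsc "quot_L (vacuum_ideal c)" "quot_proj (vacuum_ideal c)" c by (rule V.vir_rep)
  show ?thesis
    by unfold_locales (simp_all add: quot_L_def V.quot_proj_cong V.quot_proj_kill)
qed

definition quot_Y :: "'a::field vir_env set \<Rightarrow> 'a \<Rightarrow> 'a vir_env \<Rightarrow> int \<Rightarrow> 'a vir_env \<Rightarrow> 'a vir_env" where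
  "quot_Y I c = vir_rep.Y envsc (quot_L I) (quot_proj I) c"

definition vac_Y :: "'a::field \<Rightarrow> 'a vir_env \<Rightarrow> int \<Rightarrow> 'a vir_env \<Rightarrow> 'a vir_env" where
  "vac_Y c = quot_Y (vacuum_ideal c) c"

context vir_quot
begin

interpretation vp: vir_pair envsc "quot_L I" "quot_proj I" c "quot_L (vacuum_ideal c)" "quot_proj (vacuum_ideal c)"
  by (rule vir_pair_quot) unfold_locales

lemma quot_Y_W: "quot_Y I c = vp.W.Y"
  by (simp add: quot_Y_def)

lemma vac_Y_V: "vac_Y c = vp.V.Y"
  by (simp add: vac_Y_def quot_Y_def)

lemma quot_Y_linear:
  "quot_Y I c (u + v) n w = quot_Y I c u n w + quot_Y I c v n w"
  "quot_Y I c (env_scalar a * u) n w = env_scalar a * quot_Y I c u n w"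
  "quot_Y I c u n (w + w') = quot_Y I c u n w + quot_Y I c u n w'"
  "quot_Y I c u n (env_scalar a * w) = env_scalar a * quot_Y I c u n w"
  unfolding quot_Y_W
  by (simp_all only: vp.W.Y_add vp.YW_envsc vp.fW(1) vp.fW(2) envsc_def[symmetric])

lemma quot_Y_cong:
  "u - u' \<in> vacuum_ideal c \<Longrightarrow> quot_Y I c u n w = quot_Y I c u' n w"
  "w - w' \<in> I \<Longrightarrow> quot_Y I c u n w = quot_Y I c u n w'"
proof -
  show "u - u' \<in> vacuum_ideal c \<Longrightarrow> quot_Y I c u n w = quot_Y I c u' n w"
    unfolding quot_Y_W by (rule vp.W.Y_cong_vacuum)
  assume "w - w' \<in> I"
  then have "quot_proj I w = quot_proj I w'" by (rule quot_proj_eq)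
  then show "quot_Y I c u n w = quot_Y I c u n w'" unfolding quot_Y_W by (metis vp.fW(4))
qed

lemma quot_Y_zero [simp]: "quot_Y I c u n 0 = 0" "quot_Y I c 0 n w = 0"
  unfolding quot_Y_W by (simp_all add: vp.fW)

lemma quot_Y_diff: "quot_Y I c (u - v) n w = quot_Y I c u n w - quot_Y I c v n w"
  unfolding quot_Y_W by (rule vp.W.Y_diff)

lemma quot_Y_diff_right: "quot_Y I c u n (w - w') = quot_Y I c u n w - quot_Y I c u n w'"
  unfolding quot_Y_W by (rule vp.fW)

lemma quot_Y_trunc: "\<exists>N. \<forall>n\<ge>N. quot_Y I c u n w = 0"
  unfolding quot_Y_W by (rule vp.W.fld_trunc[OF vp.W.fld_Y])

lemma quot_Y_proj: "quot_proj I (quot_Y I c u n w) = quot_Y I c u n w"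
  unfolding quot_Y_W by (rule vp.fW)

lemma quot_Y_one: "quot_Y I c 1 n w = (if n = -1 then quot_proj I w else 0)"
  unfolding quot_Y_W vp.W.Y_one vp.W.idf_def ..

lemma quot_Y_C: "quot_Y I c (env_gen C * u) n w = env_scalar c * quot_Y I c u n w"
  unfolding quot_Y_W vp.W.Y_C by (simp add: envsc_def)

lemma quot_Y_L: "quot_Y I c (EL k * u) q x =
     (\<Sum>i. env_scalar (sb1 k i) * quot_L I (k - int i) (quot_Y I c u (q + int i) x)) -
     env_scalar (eps (k + 1)) * (\<Sum>i. env_scalar (sb1 k i) * quot_Y I c u (q + k + 1 - int i) (quot_L I (int i - 1) x))"
  unfolding quot_Y_W vp.W.Y_L vp.W.modeA_def by (simp add: envsc_def)

lemma quot_Y_commutator: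
  "quot_L I j (quot_Y I c u q x) - quot_Y I c u q (quot_L I j x) =
    (\<Sum>r. env_scalar (bin (j + 1) r) * quot_Y I c (EL (int r - 1) * u) (j + 1 + q - int r) x)"
  unfolding quot_Y_W vp.W.Y_commutator by (simp add: envsc_def)

lemma quot_Y_jacobi:
  "(\<Sum>s. env_scalar (sbin l s) * quot_Y I c u (m + l - int s) (quot_Y I c v (n + int s) w)) -
   (\<Sum>s. env_scalar (eps l * sbin l s) * quot_Y I c v (n + l - int s) (quot_Y I c u (m + int s) w)) =
   (\<Sum>s. env_scalar (bin m s) * quot_Y I c (vac_Y c u (l + int s) v) (m + n - int s) w)"
  using vp.jacobi[of u v l m n w]
  unfolding quot_Y_W vac_Y_V vp.J1_def vp.J2_def vp.J3_def by (simp add: envsc_def)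

lemma fs_jacobi:
  "fs (\<lambda>s. env_scalar (a s) * quot_Y I c u (m + l - int s) (quot_Y I c v (n + int s) w))"
  "fs (\<lambda>s. env_scalar (a s) * quot_Y I c v (n + l - int s) (quot_Y I c u (m + int s) w))"
  "fs (\<lambda>s. env_scalar (a s) * quot_Y I c (vac_Y c u (l + int s) v) (m + n - int s) w)"
proof -
  have e: "env_scalar a * x = envsc a x" for a :: 'a and x by (simp add: envsc_def)
  show "fs (\<lambda>s. env_scalar (a s) * quot_Y I c u (m + l - int s) (quot_Y I c v (n + int s) w))"
    unfolding quot_Y_W e by (rule vp.fs_J1)
  show "fs (\<lambda>s. env_scalar (a s) * quot_Y I c v (n + l - int s) (quot_Y I c u (m + int s) w))"
    unfolding quot_Y_W e by (rule vp.fs_J2)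
  show "fs (\<lambda>s. env_scalar (a s) * quot_Y I c (vac_Y c u (l + int s) v) (m + n - int s) w)"
    unfolding quot_Y_W vac_Y_V e by (rule vp.fs_J3)
qed

lemma quot_L_cong: "quot_L I n x - EL n * x \<in> I"
  by (simp add: quot_L_def quot_proj_cong)

text \<open>In the recursion for L_-2 1 all coefficients \<open>sbin (-1) i\<close> are 1, and
  exactly one of the two sums contributes L_n: the first for n <= -2, the second for n >=
  -1.\<close>

lemma quot_Y_conformal: "quot_Y I c (EL (-2)) (n + 1) w = quot_L I n w"
proof -
  have p0: "quot_proj I 0 = 0" by (rule quot_proj_kill[OF I_zero])
  have s1: "sbin (-1) i = (1::'a)" for i
  proof -
    have "bin (-1) i = ((-1) ^ i * bin (int i) i :: 'a)" by (subst bin_negated_upper) simp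
    then show ?thesis by (simp add: sbin_def bin_of_nat power_add[symmetric] mult.assoc[symmetric])
  qed
  have 1: "(\<Sum>i. env_scalar (sbin (-1) i) * quot_L I (- 2 - int i) (quot_Y I c 1 (n + 1 + int i) w)) =
     (if n \<le> -2 then quot_L I n w else 0)"
  proof (cases "n \<le> -2")
    case True
    have "(\<Sum>i. env_scalar (sbin (-1) i) * quot_L I (- 2 - int i) (quot_Y I c 1 (n + 1 + int i) w)) =
      env_scalar (sbin (-1) (nat (- 2 - n))) * quot_L I (- 2 - int (nat (- 2 - n))) (quot_Y I c 1 (n + 1 + int (nat (- 2 - n))) w)"
      by (rule SA_single) (auto simp: quot_Y_one quot_L_def p0)
    then show ?thesis using True by (simp add: s1 quot_Y_one quot_Y_W[symmetric] vp.W.L_P)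
  next
    case False
    then have "n + 1 + int i \<noteq> -1" for i by auto
    then show ?thesis using False by (simp add: quot_Y_one quot_L_def p0)
  qed
  have 2: "(\<Sum>i. env_scalar (sbin (-1) i) * quot_Y I c 1 (n - int i) (quot_L I (int i - 1) w)) =
     (if n \<ge> -1 then quot_L I n w else 0)"
  proof (cases "n \<ge> -1")
    case True
    have "(\<Sum>i. env_scalar (sbin (-1) i) * quot_Y I c 1 (n - int i) (quot_L I (int i - 1) w)) =
      env_scalar (sbin (-1) (nat (n + 1))) * quot_Y I c 1 (n - int (nat (n + 1))) (quot_L I (int (nat (n + 1)) - 1) w)"
      by (rule SA_single) (auto simp: quot_Y_one)
    then show ?thesis using True by (simp add: s1 quot_Y_one vp.W.P_L)
  next
    case False
    then have "n - int i \<noteq> -1" for i by auto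
    then show ?thesis using False by (simp add: quot_Y_one)
  qed
  show ?thesis using quot_Y_L[of "-2" 1 "n + 1" w] 1 2 by (simp add: env_scalar_minus)
qed

end

text \<open>On the vacuum the second half of the recursion disappears, since L_(i-1) 1 is zero for
  all i >= 0. For n <= -2 the first equation makes no assertion; those modes are governed by the
  second one.\<close>

lemma vac_Y_creation:
  "vac_Y c v n 1 = (if n = -1 then quot_proj (vacuum_ideal c) v else if n \<ge> 0 then 0 else vac_Y c v n 1)"
  "vac_Y c (EL m * v) (- int k - 1) 1 =
     (\<Sum>i\<le>k. env_scalar (sb1 m i) * quot_L (vacuum_ideal c) (m - int i) (vac_Y c v (- int (k - i) - 1) 1))"
proof -
  interpret vir_quot "vacuum_ideal c" c by (rule vir_quot_vacuum)
  have p0: "quot_proj (vacuum_ideal c) 0 = 0" by (rule quot_proj_kill[OF I_zero])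
  have L1: "quot_L (vacuum_ideal c) (int i - 1) 1 = 0" for i
    unfolding quot_L_def by (rule quot_proj_kill) (use vacuum_ideal_L[of "int i - 1" 1] in simp)
  have A: "vac_Y c (EL m * v) q 1 =
      (\<Sum>i. env_scalar (sb1 m i) * quot_L (vacuum_ideal c) (m - int i) (vac_Y c v (q + int i) 1))" for m v q
    unfolding vac_Y_def quot_Y_L by (simp add: L1)
  have "\<forall>n\<ge>0. vac_Y c v n 1 = 0" and "vac_Y c v (-1) 1 = quot_proj (vacuum_ideal c) v" for v
  proof -
    have "(\<forall>n\<ge>0. vac_Y c v n 1 = 0) \<and> vac_Y c v (-1) 1 = quot_proj (vacuum_ideal c) v"
    proof (induction v)
      case one
      then show ?case by (simp add: vac_Y_def quot_Y_one)
    next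
      case (add u v)
      then show ?case by (simp add: vac_Y_def quot_Y_linear quot_proj_add)
    next
      case (scale a u)
      then show ?case by (simp add: vac_Y_def quot_Y_linear quot_proj_scalar)
    next
      case (gen g u)
      show ?case
      proof (cases g)
        case C
        have "quot_proj (vacuum_ideal c) (env_gen C * u) = env_scalar c * quot_proj (vacuum_ideal c) u"
          unfolding quot_proj_scalar[symmetric] by (rule quot_proj_eq[OF charge])
        with gen C show ?thesis by (simp add: vac_Y_def quot_Y_C)
      next
        case (L k)
        have "vac_Y c (EL k * u) n 1 = 0" if "n \<ge> 0" for n
          using that gen by (simp add: A quot_L_def p0)
        moreover have "vac_Y c (EL k * u) (-1) 1 = quot_proj (vacuum_ideal c) (EL k * u)"
        proof -
          have "vac_Y c (EL k * u) (-1) 1 = env_scalar (sb1 k 0) * quot_L (vacuum_ideal c) (k - int 0) (vac_Y c u (-1 + int 0) 1)"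
            unfolding A by (rule SA_single) (use gen in \<open>auto simp: quot_L_def p0\<close>)
          also have "\<dots> = quot_L (vacuum_ideal c) k (quot_proj (vacuum_ideal c) u)" using gen by simp
          also have "\<dots> = quot_proj (vacuum_ideal c) (EL k * u)"
            unfolding quot_L_def using I_mult[OF quot_proj_cong, of "EL k" u]
            by (intro quot_proj_eq) (simp add: right_diff_distrib)
          finally show ?thesis .
        qed
        ultimately show ?thesis using L by blast
      qed
    qed
    then show "\<forall>n\<ge>0. vac_Y c v n 1 = 0" and "vac_Y c v (-1) 1 = quot_proj (vacuum_ideal c) v" by blast+
  qed
  note cr = this
  show "vac_Y c v n 1 = (if n = -1 then quot_proj (vacuum_ideal c) v else if n \<ge> 0 then 0 else vac_Y c v n 1)"
    using cr by simp
  have "vac_Y c (EL m * v) (- int k - 1) 1 =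
     (\<Sum>i<Suc k. env_scalar (sb1 m i) * quot_L (vacuum_ideal c) (m - int i) (vac_Y c v (- int k - 1 + int i) 1))"
    unfolding A by (rule SA_bound) (use cr in \<open>simp add: quot_L_def p0\<close>)
  also have "\<dots> = (\<Sum>i\<le>k. env_scalar (sb1 m i) * quot_L (vacuum_ideal c) (m - int i) (vac_Y c v (- int (k - i) - 1) 1))"
    unfolding lessThan_Suc_atMost by (rule sum.cong) (auto simp: of_nat_diff algebra_simps)
  finally show "vac_Y c (EL m * v) (- int k - 1) 1 =
     (\<Sum>i\<le>k. env_scalar (sb1 m i) * quot_L (vacuum_ideal c) (m - int i) (vac_Y c v (- int (k - i) - 1) 1))" .
qed

section \<open>The grading of the enveloping algebra\<close>

lemma vir_word_deg_add: "vir_word_deg (u + v) = vir_word_deg u + vir_word_deg v"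
  by (cases u; cases v) simp

lemma vir_word_deg_0 [simp]: "vir_word_deg 0 = 0"
  by (simp add: zero_vir_word_def)

definition homog :: "int \<Rightarrow> 'a::field vir_tensor \<Rightarrow> bool" where
  "homog n t \<longleftrightarrow> (\<forall>w\<in>supp t. vir_word_deg w = n)"

lemma homog_single: "vir_word_deg w = n \<Longrightarrow> homog n (tmon w a)"
  by (simp add: homog_def)

lemma homog_0: "homog n 0"
  by (simp add: homog_def)

lemma homog_add: "homog n s \<Longrightarrow> homog n t \<Longrightarrow> homog n (s + t)"
  unfolding homog_def using keys_add[of s t] by auto

lemma homog_diff: "homog n s \<Longrightarrow> homog n t \<Longrightarrow> homog n (s - t)"
  using homog_add[of n s "- t"] by (simp add: homog_def)

lemma homog_mult: "homog m s \<Longrightarrow> homog n t \<Longrightarrow> homog (m + n) (s * t)"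
  unfolding homog_def using keys_mult[of s t] by (fastforce simp: vir_word_deg_add)

lemma homog_vir_bracket: "homog (vir_gen_deg g + vir_gen_deg h) (vir_bracket g h)"
  by (cases g; cases h) (auto intro!: homog_add homog_single simp: homog_0)

lift_definition tcomp :: "int \<Rightarrow> 'a::field vir_tensor \<Rightarrow> 'a vir_tensor" is
  "\<lambda>n f w. f w when vir_word_deg w = n"
  by (erule finite_subset[rotated]) (auto simp: when_def)

lemma lookup_tcomp: "coef (tcomp n t) w = (if vir_word_deg w = n then coef t w else 0)"
  by transfer (simp add: when_def)

lemma tcomp_add: "tcomp n (s + t) = tcomp n s + tcomp n t"
  by (rule poly_mapping_eqI) (simp add: lookup_tcomp lookup_add)

lemma tcomp_0: "tcomp n 0 = 0"
  by (rule poly_mapping_eqI) (simp add: lookup_tcomp)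

lemma tcomp_homog: "homog m t \<Longrightarrow> tcomp n t = (if n = m then t else 0)"
  by (rule poly_mapping_eqI) (auto simp: lookup_tcomp homog_def in_keys_iff)

lemma tcomp_single: "tcomp n (tmon w a) = (if vir_word_deg w = n then tmon w a else 0)"
  using tcomp_homog[OF homog_single[OF refl, of w a], of n] by auto

lemma homog_tcomp: "homog n (tcomp n t)"
  by (auto simp: homog_def in_keys_iff lookup_tcomp split: if_splits)

lemma tcomp_tcomp: "tcomp m (tcomp n t) = (if m = n then tcomp n t else 0)"
  by (rule tcomp_homog[OF homog_tcomp])

lemma tcomp_minus: "tcomp n (- t) = - tcomp n t"
  by (rule poly_mapping_eqI) (simp add: lookup_tcomp)

lemma tcomp_mult_left: "homog m s \<Longrightarrow> tcomp n (s * t) = s * tcomp (n - m) t"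
proof (induction t rule: vir_tensor_induct)
  case (single gs a)
  have "homog (m + vir_word_deg (Word gs)) (s * tmon (Word gs) a)"
    by (rule homog_mult[OF single homog_single[OF refl]])
  from tcomp_homog[OF this, of n] show ?case by (auto simp del: vir_word_deg.simps simp: tcomp_single)
qed (simp_all add: tcomp_0 distrib_left tcomp_add)

lemma tcomp_mult_right: "homog m s \<Longrightarrow> tcomp n (t * s) = tcomp (n - m) t * s"
proof (induction t rule: vir_tensor_induct)
  case (single gs a)
  have "homog (vir_word_deg (Word gs) + m) (tmon (Word gs) a * s)"
    by (rule homog_mult[OF homog_single[OF refl] single])
  from tcomp_homog[OF this, of n] show ?case by (auto simp del: vir_word_deg.simps simp: tcomp_single)
qed (simp_all add: tcomp_0 distrib_right tcomp_add)

text \<open>The relations are homogeneous, so taking components moves onto the factors a and b. This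
  is what makes the components \<open>hc\<close> on U independent of representatives.\<close>

lemma tcomp_env_ideal: "t \<in> env_ideal \<Longrightarrow> tcomp n t \<in> env_ideal"
proof (induction t rule: env_ideal.induct)
  case zero
  show ?case by (simp add: tcomp_0 env_ideal.zero)
next
  case (step t a g h b)
  define R :: "'a vir_tensor" where "R = tensor_gen g * tensor_gen h - tensor_gen h * tensor_gen g - vir_bracket g h"
  have "homog (vir_gen_deg g + vir_gen_deg h) (tensor_gen g * tensor_gen h :: 'a vir_tensor)"
    "homog (vir_gen_deg h + vir_gen_deg g) (tensor_gen h * tensor_gen g :: 'a vir_tensor)"
    by (intro homog_mult homog_single; simp)+
  then have R: "homog (vir_gen_deg g + vir_gen_deg h) R"
    unfolding R_def using homog_vir_bracket by (auto intro!: homog_diff simp: add.commute)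
  have RI: "R \<in> env_ideal" unfolding R_def using env_ideal.step[OF env_ideal.zero, of 1 g h 1] by simp
  have "tcomp n (a * (R * b)) \<in> env_ideal" for n
  proof (induction a arbitrary: n rule: vir_tensor_induct)
    case (single gs e)
    have "tcomp n (tmon (Word gs) e * (R * b)) =
       tmon (Word gs) e * (R * tcomp (n - vir_word_deg (Word gs) - (vir_gen_deg g + vir_gen_deg h)) b)"
      by (simp only: tcomp_mult_left[OF homog_single[OF refl]] tcomp_mult_left[OF R])
    then show ?case using env_ideal_mult_left env_ideal_mult_right RI by metis
  qed (simp_all add: tcomp_0 env_ideal.zero distrib_right tcomp_add env_ideal_add)
  then show ?case using step by (simp add: tcomp_add env_ideal_add R_def mult.assoc)
qed

definition hc :: "int \<Rightarrow> 'a::field vir_env \<Rightarrow> 'a vir_env" where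
  "hc n u = abs_vir_env (tcomp n (rep_vir_env u))"

lemma hc_abs: "hc n (abs_vir_env t) = abs_vir_env (tcomp n t)"
proof -
  have "rep_vir_env (abs_vir_env t) - t \<in> env_ideal"
    using env_rel_rep_abs[of t] by (simp add: env_rel_def)
  then have "tcomp n (rep_vir_env (abs_vir_env t) + - t) \<in> env_ideal" using tcomp_env_ideal by simp
  then show ?thesis unfolding hc_def abs_vir_env_eq_iff env_rel_def by (simp only: tcomp_add tcomp_minus) simp
qed

lemma vir_env_abs_cases: obtains t where "u = abs_vir_env t"
  using abs_rep_vir_env[of u] by metis

lemma hc_add: "hc n (u + v) = hc n u + hc n v"
  by (cases u rule: vir_env_abs_cases; cases v rule: vir_env_abs_cases)
    (simp add: hc_abs abs_vir_env_add[symmetric] tcomp_add)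

lemma hc_zero [simp]: "hc n 0 = 0"
  using hc_add[of n 0 0] by simp

lemma hc_minus: "hc n (- u) = - hc n u"
  using hc_add[of n u "- u"] by (simp add: eq_neg_iff_add_eq_0 add.commute)

lemma hc_diff: "hc n (u - v) = hc n u - hc n v"
  using hc_add[of n u "- v"] by (simp add: hc_minus)

definition env_gr :: "int \<Rightarrow> 'a::field vir_env set" where
  "env_gr n = {u. hc n u = u}"

lemma hc_hc: "hc m (hc n u) = (if m = n then hc n u else 0)"
  by (cases u rule: vir_env_abs_cases) (simp add: hc_abs tcomp_tcomp abs_vir_env_0)

lemma hc_in_gr [simp]: "hc n u \<in> env_gr n"
  by (simp add: env_gr_def hc_hc)

lemma env_gr_homog: "u \<in> env_gr n \<Longrightarrow> \<exists>t. homog n t \<and> u = abs_vir_env t"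
  unfolding env_gr_def hc_def by (intro exI[of _ "tcomp n (rep_vir_env u)"]) (simp add: homog_tcomp)

lemma homog_env_gr: "homog n t \<Longrightarrow> abs_vir_env t \<in> env_gr n"
  by (simp add: env_gr_def hc_abs tcomp_homog)

lemma hc_gr: "u \<in> env_gr m \<Longrightarrow> hc n u = (if n = m then u else 0)"
  using hc_hc[of n m u] by (simp add: env_gr_def)

lemma hc_mult_left: "s \<in> env_gr m \<Longrightarrow> hc n (s * u) = s * hc (n - m) u"
proof -
  assume "s \<in> env_gr m"
  then obtain t where "homog m t" "s = abs_vir_env t" using env_gr_homog by blast
  then show ?thesis
    by (cases u rule: vir_env_abs_cases) (simp add: hc_abs abs_vir_env_mult[symmetric] tcomp_mult_left)
qed

lemma hc_mult_right: "s \<in> env_gr m \<Longrightarrow> hc n (u * s) = hc (n - m) u * s"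
proof -
  assume "s \<in> env_gr m"
  then obtain t where "homog m t" "s = abs_vir_env t" using env_gr_homog by blast
  then show ?thesis
    by (cases u rule: vir_env_abs_cases) (simp add: hc_abs abs_vir_env_mult[symmetric] tcomp_mult_right)
qed

lemma env_gr_mult: "s \<in> env_gr m \<Longrightarrow> u \<in> env_gr n \<Longrightarrow> s * u \<in> env_gr (m + n)"
  by (simp add: env_gr_def[of "m + n"] hc_mult_left hc_gr)

lemma env_gr_add: "u \<in> env_gr n \<Longrightarrow> v \<in> env_gr n \<Longrightarrow> u + v \<in> env_gr n"
  by (simp add: env_gr_def hc_add)

lemma env_gr_diff: "u \<in> env_gr n \<Longrightarrow> v \<in> env_gr n \<Longrightarrow> u - v \<in> env_gr n"
  by (simp add: env_gr_def hc_diff)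

lemma env_gr_zero [simp]: "0 \<in> env_gr n"
  by (simp add: env_gr_def)

lemma env_gr_scalar [simp]: "env_scalar a \<in> env_gr 0"
  unfolding env_scalar_abs by (rule homog_env_gr, rule homog_single) simp

lemma env_gr_one [simp]: "1 \<in> env_gr 0"
  using env_gr_scalar[of 1] by simp

lemma env_gr_gen: "env_gen g \<in> env_gr (vir_gen_deg g)"
  unfolding env_gen_abs by (rule homog_env_gr, rule homog_single) simp

lemma env_gr_L [simp]: "EL n \<in> env_gr (- n)"
  using env_gr_gen[of "L n"] by simp

lemma env_gr_C [simp]: "env_gen C \<in> env_gr 0"
  using env_gr_gen[of C] by simp

lemma env_gr_scale: "u \<in> env_gr n \<Longrightarrow> env_scalar a * u \<in> env_gr n"
  using env_gr_mult[OF env_gr_scalar, of u n a] by simp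

lemma hc_scale: "hc n (env_scalar a * u) = env_scalar a * hc n u"
  using hc_mult_left[OF env_gr_scalar, of n a u] by simp

lemma env_gr_power: "u \<in> env_gr n \<Longrightarrow> u ^ k \<in> env_gr (int k * n)"
proof (induction k)
  case (Suc k)
  then show ?case using env_gr_mult[of u n "u ^ k" "int k * n"] by (simp add: algebra_simps)
qed simp

lemma hc_finite_sum: "finite {n. hc n u \<noteq> 0}" "u = (\<Sum>n\<in>{n. hc n u \<noteq> 0}. hc n u)"
proof -
  \<comment> \<open>The induction carries an unspecified finite index set, since the support itself
    may shrink when elements are added.\<close>
  have "finite {n. hc n u \<noteq> 0} \<and> (\<exists>S. finite S \<and> u = (\<Sum>n\<in>S. hc n u))"
  proof (induction u)
    case one
    have "{n. hc n 1 \<noteq> (0::'a vir_env)} \<subseteq> {0}" by (auto simp: hc_gr[OF env_gr_one])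
    then show ?case using finite_subset by (auto intro!: exI[of _ "{0}"] simp: hc_gr[OF env_gr_one])
  next
    case (add u v)
    have z: "(\<Sum>n\<in>S. hc n w) = w" if "finite {n. hc n w \<noteq> 0}" "\<exists>T. finite T \<and> w = (\<Sum>n\<in>T. hc n w)"
      "finite S" "{n. hc n w \<noteq> 0} \<subseteq> S" for S and w :: "'a vir_env"
    proof -
      from that obtain T where T: "finite T" "w = (\<Sum>n\<in>T. hc n w)" by blast
      have "(\<Sum>n\<in>S. hc n w) = (\<Sum>n\<in>{n. hc n w \<noteq> 0}. hc n w)"
        by (rule sum.mono_neutral_right) (use that in auto)
      also have "\<dots> = (\<Sum>n\<in>T. hc n w)"
      proof (rule sum.mono_neutral_left[OF T(1)])
        show "{n. hc n w \<noteq> 0} \<subseteq> T"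
        proof
          fix n assume "n \<in> {n. hc n w \<noteq> 0}"
          moreover have "hc n w = (\<Sum>m\<in>T. hc n (hc m w))"
            by (subst T(2)) (use T(1) in \<open>induction T rule: finite_induct; simp add: hc_add\<close>)
          moreover have "(\<Sum>m\<in>T. hc n (hc m w)) = 0" if "n \<notin> T"
            by (rule sum.neutral) (use that in \<open>auto simp: hc_hc\<close>)
          ultimately show "n \<in> T" by auto
        qed
      qed auto
      finally show ?thesis using T(2) by simp
    qed
    define S where "S = {n. hc n u \<noteq> 0} \<union> {n. hc n v \<noteq> 0}"
    have "{n. hc n (u + v) \<noteq> 0} \<subseteq> S" by (auto simp: S_def hc_add)
    moreover have "finite S" using add by (simp add: S_def)
    moreover have "u + v = (\<Sum>n\<in>S. hc n (u + v))"
      unfolding hc_add sum.distrib using z[of u S] z[of v S] add \<open>finite S\<close> by (auto simp: S_def)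
    ultimately show ?case using finite_subset by blast
  next
    case (scale a u)
    then obtain S where "finite S" "u = (\<Sum>n\<in>S. hc n u)" by blast
    then have "env_scalar a * u = (\<Sum>n\<in>S. hc n (env_scalar a * u))"
      by (metis (no_types, lifting) hc_scale sum.cong sum_distrib_left)
    moreover have "{n. hc n (env_scalar a * u) \<noteq> 0} \<subseteq> {n. hc n u \<noteq> 0}" by (auto simp: hc_scale)
    ultimately show ?case using scale \<open>finite S\<close> finite_subset by blast
  next
    case (gen g u)
    then obtain S where S: "finite S" "u = (\<Sum>n\<in>S. hc n u)" by blast
    let ?d = "vir_gen_deg g"
    have h: "hc n (env_gen g * u) = env_gen g * hc (n - ?d) u" for n by (rule hc_mult_left[OF env_gr_gen])
    have "(\<Sum>n\<in>(\<lambda>n. n + ?d) ` S. hc n (env_gen g * u)) = (\<Sum>n\<in>S. env_gen g * hc n u)"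
      by (subst sum.reindex) (auto simp: h inj_on_def)
    also have "\<dots> = env_gen g * u" using S(2) by (simp add: sum_distrib_left[symmetric])
    finally have "env_gen g * u = (\<Sum>n\<in>(\<lambda>n. n + ?d) ` S. hc n (env_gen g * u))" by simp
    moreover have "{n. hc n (env_gen g * u) \<noteq> 0} \<subseteq> (\<lambda>n. n + ?d) ` {n. hc n u \<noteq> 0}"
    proof
      fix n assume "n \<in> {n. hc n (env_gen g * u) \<noteq> 0}"
      then have "hc (n - ?d) u \<noteq> 0" by (auto simp: h)
      then show "n \<in> (\<lambda>n. n + ?d) ` {n. hc n u \<noteq> 0}" by (intro image_eqI[of _ _ "n - ?d"]) auto
    qed
    ultimately show ?case using gen S(1) finite_subset by blast
  qed
  then obtain S where f: "finite {n. hc n u \<noteq> 0}" and S: "finite S" "u = (\<Sum>n\<in>S. hc n u)" by blast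
  show "finite {n. hc n u \<noteq> 0}" by (rule f)
  have h0: "hc n u = 0" if "n \<notin> S" for n
  proof -
    have "hc n (\<Sum>m\<in>S. hc m u) = (\<Sum>m\<in>S. hc n (hc m u))"
      using S(1) by (induction S rule: finite_induct) (simp_all add: hc_add)
    also have "\<dots> = 0" by (rule sum.neutral) (use that in \<open>auto simp: hc_hc\<close>)
    finally show ?thesis using S(2) by metis
  qed
  have "(\<Sum>n\<in>{n. hc n u \<noteq> 0}. hc n u) = (\<Sum>n\<in>S. hc n u)"
    by (rule sum.mono_neutral_left[OF S(1)]) (use h0 in auto)
  then show "u = (\<Sum>n\<in>{n. hc n u \<noteq> 0}. hc n u)" using S(2) by simp
qed

definition graded_set :: "'a::field vir_env set \<Rightarrow> bool" where
  "graded_set I \<longleftrightarrow> (\<forall>u\<in>I. \<forall>n. hc n u \<in> I)"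

lemma graded_left_ideal:
  assumes "\<And>s. s \<in> S \<Longrightarrow> \<exists>d. s \<in> env_gr d" shows "graded_set (left_ideal S)"
  unfolding graded_set_def
proof (intro ballI allI)
  fix u n assume "u \<in> left_ideal S"
  then show "hc n u \<in> left_ideal S"
  proof (induction u rule: left_ideal.induct)
    case (step x s u)
    then obtain d where "s \<in> env_gr d" using assms by blast
    then have "hc n (x + u * s) = hc n x + hc (n - d) u * s" by (simp add: hc_add hc_mult_right)
    then show ?case using left_ideal.step[OF step(3,2)] by simp
  qed (simp add: left_ideal.zero)
qed

lemma graded_vacuum_ideal: "graded_set (vacuum_ideal c)"
  unfolding vacuum_ideal_def
  by (rule graded_left_ideal) (auto intro: env_gr_diff[OF env_gr_C env_gr_scalar] env_gr_L)

section \<open>The vacuum expectation of a lowest weight module\<close>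

text \<open>The derivation of the tensor algebra that lifts t -> [t, L_m]. In U a word w satisfies w
  L_m = L_m w + [w, L_m], and for m < 0 the term L_m w does not contribute to the lowest weight
  vector; this motivates the recursion for \<open>chi\<close>.\<close>

primrec dword :: "int \<Rightarrow> vir_gen list \<Rightarrow> 'a::field vir_tensor" where
  "dword m [] = 0"
| "dword m (g # gs) = vir_bracket g (L m) * tmon (Word gs) 1 + tensor_gen g * dword m gs"

definition tlin :: "(vir_word \<Rightarrow> 'a) \<Rightarrow> 'a::field vir_tensor \<Rightarrow> 'a" where
  "tlin f t = (\<Sum>w\<in>supp t. coef t w * f w)"

lemma tlin_superset:
  "finite S \<Longrightarrow> supp t \<subseteq> S \<Longrightarrow> tlin f t = (\<Sum>w\<in>S. coef t w * f w)"
  unfolding tlin_def by (rule sum.mono_neutral_left) (auto simp: in_keys_iff)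

lemma tlin_add: "tlin f (s + t) = tlin f s + tlin f t"
proof -
  let ?S = "supp s \<union> supp t"
  have "supp (s + t) \<subseteq> ?S" by (rule keys_add)
  then show ?thesis
    by (simp add: tlin_superset[of ?S] lookup_add distrib_right sum.distrib)
qed

lemma tlin_0 [simp]: "tlin f 0 = 0"
  by (simp add: tlin_def)

lemma tlin_single [simp]: "tlin f (tmon w a) = a * f w"
  by (subst tlin_superset[of "{w}"]) auto

lemma tlin_minus: "tlin f (- t) = - tlin f t"
  using tlin_add[of f t "- t"] by (simp add: eq_neg_iff_add_eq_0 add.commute)

lemma tlin_diff: "tlin f (s - t) = tlin f s - tlin f t"
  using tlin_add[of f s "- t"] by (simp add: tlin_minus)

lemma tlin_scale: "tlin f (tmon 0 a * t) = a * tlin f t"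
  by (induction t rule: vir_tensor_induct) (simp_all add: distrib_left tlin_add mult_single mult.assoc)

definition dten :: "int \<Rightarrow> 'a::field vir_tensor \<Rightarrow> 'a vir_tensor" where
  "dten m t = (\<Sum>w\<in>supp t. tmon 0 (coef t w) * dword m (case w of Word gs \<Rightarrow> gs))"

lemma dten_superset:
  "finite S \<Longrightarrow> supp t \<subseteq> S \<Longrightarrow>
    dten m t = (\<Sum>w\<in>S. tmon 0 (coef t w) * dword m (case w of Word gs \<Rightarrow> gs))"
  unfolding dten_def by (rule sum.mono_neutral_left) (auto simp: in_keys_iff)

lemma dten_add: "dten m (s + t) = dten m s + dten m t"
proof -
  let ?S = "supp s \<union> supp t"
  have "supp (s + t) \<subseteq> ?S" by (rule keys_add)
  then show ?thesis
    by (simp add: dten_superset[of ?S] lookup_add single_add distrib_right sum.distrib)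
qed

lemma dten_0 [simp]: "dten m 0 = 0"
  by (simp add: dten_def)

lemma dten_single: "dten m (tmon (Word gs) a) = tmon 0 a * dword m gs"
  by (subst dten_superset[of "{Word gs}"]) auto

lemma dten_minus: "dten m (- t) = - dten m t"
  using dten_add[of m t "- t"] by (simp add: eq_neg_iff_add_eq_0 add.commute)

lemma dten_diff: "dten m (s - t) = dten m s - dten m t"
  using dten_add[of m s "- t"] by (simp add: dten_minus)

lemma single_0_commute: "tmon 0 a * t = t * (tmon 0 a :: 'a::field vir_tensor)"
  by (induction t rule: vir_tensor_induct)
      (simp_all add: distrib_left distrib_right mult_single mult.commute)

lemma dword_append: "dword m (gs @ hs) = dword m gs * tmon (Word hs) 1 + tmon (Word gs) 1 * dword m hs"
  by (induction gs)
    (simp_all add: zero_vir_word_def[symmetric] distrib_left distrib_right mult.assoc[symmetric] mult_single add.assoc,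
     simp_all add: mult.assoc mult_single)

lemma dten_mult: "dten m (s * t) = dten m s * t + s * dten m t"
proof (induction s rule: vir_tensor_induct)
  case (single gs a)
  show ?case
  proof (induction t rule: vir_tensor_induct)
    case (single hs b)
    have e: "tmon (Word ks) x = tmon 0 x * (tmon (Word ks) 1 :: 'a vir_tensor)" for ks x
      by (simp add: mult_single)
    have "dten m (tmon (Word gs) a * tmon (Word hs) b) =
      tmon 0 (a * b) * (dword m gs * tmon (Word hs) 1 + tmon (Word gs) 1 * dword m hs)"
      by (simp add: mult_single dten_single dword_append)
    also have "\<dots> = (tmon 0 a * dword m gs) * (tmon 0 b * tmon (Word hs) 1)
       + (tmon 0 a * tmon (Word gs) 1) * (tmon 0 b * dword m hs)"
    proof -
      have "tmon 0 (a * b) * (x * y) = (tmon 0 a * x) * (tmon 0 b * y)" for x y :: "'a vir_tensor"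
      proof -
        have "tmon 0 (a * b) = (tmon 0 a * tmon 0 b :: 'a vir_tensor)"
          by (simp add: mult_single)
        then show ?thesis by (metis mult.assoc single_0_commute)
      qed
      then show ?thesis by (simp only: distrib_left)
    qed
    finally show ?case unfolding dten_single e[of gs a, symmetric] e[of hs b, symmetric] .
  qed (simp_all add: dten_add distrib_left)
qed (simp_all add: dten_add distrib_right)

lemma dten_gen: "dten m (tensor_gen g) = vir_bracket g (L m)"
  by (simp add: dten_single zero_vir_word_def[symmetric])

definition wlen :: "vir_word \<Rightarrow> nat" where
  "wlen w = (case w of Word gs \<Rightarrow> length gs)"

lemma wlen_add: "wlen (u + v) = wlen u + wlen v"
  by (cases u; cases v) (simp add: wlen_def)

lemma keys_vir_bracket: "w \<in> supp (vir_bracket g h) \<Longrightarrow> wlen w = 1"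
  by (cases g; cases h) (auto simp: wlen_def split: if_splits dest!: set_mp[OF keys_add])

text \<open>The derivation replaces one letter by one letter. Hence removing the last letter of a
  word and applying it gives words shorter by one, on which the recursion for \<open>chi_len\<close>
  runs.\<close>

lemma keys_dword: "w \<in> supp (dword m gs) \<Longrightarrow> wlen w = length gs"
proof (induction gs arbitrary: w)
  case (Cons g gs)
  from Cons(2) consider
    "w \<in> supp (vir_bracket g (L m) * (tmon (Word gs) 1 :: 'a vir_tensor))" |
    "w \<in> supp (tensor_gen g * (dword m gs :: 'a vir_tensor))"
    using keys_add by fastforce
  then show ?case
  proof cases
    case 1
    then obtain a where "w = a + Word gs" "a \<in> supp (vir_bracket g (L m) :: 'a vir_tensor)"
      using keys_mult[of "vir_bracket g (L m) :: 'a vir_tensor" "tmon (Word gs) 1"] by auto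
    then show ?thesis using keys_vir_bracket by (simp add: wlen_add) (simp add: wlen_def)
  next
    case 2
    then obtain b where "w = Word [g] + b" "b \<in> supp (dword m gs :: 'a vir_tensor)"
      using keys_mult[of "tensor_gen g :: 'a vir_tensor" "dword m gs"] by auto
    then show ?thesis using Cons(1) by (simp add: wlen_add) (simp add: wlen_def)
  qed
qed simp

lemma homog_dword: "homog (vir_word_deg (Word gs) - m) (dword m gs :: 'a::field vir_tensor)"
proof (induction gs)
  case (Cons g gs)
  have "homog (vir_gen_deg g + vir_gen_deg (L m) + vir_word_deg (Word gs)) (vir_bracket g (L m) * tmon (Word gs) 1 :: 'a vir_tensor)"
    by (intro homog_mult homog_vir_bracket homog_single refl)
  moreover have "homog (vir_gen_deg g + (vir_word_deg (Word gs) - m)) (tensor_gen g * dword m gs :: 'a vir_tensor)"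
    by (intro homog_mult homog_single Cons) simp
  ultimately show ?case by (auto intro!: homog_add simp: algebra_simps)
qed (simp add: homog_0)

text \<open>
  The coefficient of the lowest weight vector \<open>v\<close> in \<open>w v\<close>, computed by moving the last letter
  of \<open>w\<close> to the left, where the letters of positive degree contribute nothing. The recursion is
  on the length of the word, so no ordered basis is needed.
\<close>

primrec chi_len :: "'a::field \<Rightarrow> 'a \<Rightarrow> nat \<Rightarrow> vir_word \<Rightarrow> 'a" where
  "chi_len c h 0 w = 1"
| "chi_len c h (Suc k) w = (case w of Word gs \<Rightarrow> (case rev gs of [] \<Rightarrow> 1 | g # rs \<Rightarrow>
     (case g of C \<Rightarrow> c * chi_len c h k (Word (rev rs))
      | L m \<Rightarrow> if m > 0 then 0 else if m = 0 then h * chi_len c h k (Word (rev rs))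
               else tlin (chi_len c h k) (dword m (rev rs)))))"

definition chi_word :: "'a::field \<Rightarrow> 'a \<Rightarrow> vir_word \<Rightarrow> 'a" where
  "chi_word c h w = chi_len c h (wlen w) w"

definition chi_ten :: "'a::field \<Rightarrow> 'a \<Rightarrow> 'a vir_tensor \<Rightarrow> 'a" where
  "chi_ten c h = tlin (chi_word c h)"

lemma chi_word_snoc:
  "chi_word c h (Word (gs @ [g])) = (case g of C \<Rightarrow> c * chi_word c h (Word gs)
      | L m \<Rightarrow> if m > 0 then 0 else if m = 0 then h * chi_word c h (Word gs)
               else chi_ten c h (dword m gs))"
proof -
  have "tlin (chi_len c h (length gs)) (dword m gs) = chi_ten c h (dword m gs)" for m
    unfolding chi_ten_def tlin_def chi_word_def by (rule sum.cong) (auto simp: keys_dword)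
  then show ?thesis by (auto simp: chi_word_def wlen_def split: vir_gen.split)
qed

lemmas chi_ten_add = tlin_add[of "chi_word c h" for c h, folded chi_ten_def]
  and chi_ten_diff = tlin_diff[of "chi_word c h" for c h, folded chi_ten_def]
  and chi_ten_minus = tlin_minus[of "chi_word c h" for c h, folded chi_ten_def]
  and chi_ten_scale = tlin_scale[of "chi_word c h" for c h, folded chi_ten_def]
  and chi_ten_0 = tlin_0[of "chi_word c h" for c h, folded chi_ten_def]

lemma chi_ten_single: "chi_ten c h (tmon w a) = a * chi_word c h w"
  by (simp add: chi_ten_def)

lemma chi_ten_gen:
  "chi_ten c h (t * tensor_gen C) = c * chi_ten c h t"
  "m > 0 \<Longrightarrow> chi_ten c h (t * tensor_gen (L m)) = 0"
  "chi_ten c h (t * tensor_gen (L 0)) = h * chi_ten c h t"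
  "m < 0 \<Longrightarrow> chi_ten c h (t * tensor_gen (L m)) = chi_ten c h (dten m t)"
  by (induction t rule: vir_tensor_induct;
      simp add: distrib_right distrib_left chi_ten_add chi_ten_0 mult_single chi_ten_single chi_word_snoc mult.left_commute
        dten_add dten_single chi_ten_scale)+

text \<open>Cocycle identities become polynomial identities over the integers, where 6 may be
  cancelled; mapped to the field they then hold in characteristic 3 as well.\<close>

lemma int_binomial_cube: "6 * int_binomial (x + 1) 3 = (x + 1) * x * (x - 1)"
proof (rule int_binomial_eqI)
  have "fact 3 * ((of_int x + 1 :: rat) gchoose 3) = (\<Prod>i = 0..<3. (of_int x + 1) - of_nat i)"
    by (rule gbinomial_mult_fact)
  then show "rat_of_int (6 * int_binomial (x + 1) 3) = rat_of_int ((x + 1) * x * (x - 1))"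
    by (simp add: of_int_int_binomial fact_numeral numeral_3_eq_3 algebra_simps)
qed

lemma vir_cocycle_minus: "vir_cocycle (- x) = - (vir_cocycle x :: 'a::field)"
proof -
  have "6 * int_binomial (- x + 1) 3 = 6 * (- int_binomial (x + 1) 3)"
    unfolding int_binomial_cube mult_minus_right by (simp add: algebra_simps)
  then have "int_binomial (- x + 1) 3 = - int_binomial (x + 1) 3" by simp
  then show ?thesis by (simp add: vir_cocycle_def)
qed

lemma vir_cocycle_jacobi:
  assumes "a + b + m = 0"
  shows "of_int (a - b) * vir_cocycle m + of_int (b - m) * vir_cocycle a + of_int (m - a) * vir_cocycle b = (0::'a::field)"
proof -
  have m: "m = - a - b" using assms by simp
  have "6 * ((a - b) * int_binomial (m + 1) 3 + (b - m) * int_binomial (a + 1) 3 + (m - a) * int_binomial (b + 1) 3) =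
    (a - b) * (6 * int_binomial (m + 1) 3) + (b - m) * (6 * int_binomial (a + 1) 3) + (m - a) * (6 * int_binomial (b + 1) 3)"
    by (simp add: algebra_simps)
  also have "\<dots> = 0" unfolding int_binomial_cube m by (simp add: algebra_simps)
  finally have "(a - b) * int_binomial (m + 1) 3 + (b - m) * int_binomial (a + 1) 3 + (m - a) * int_binomial (b + 1) 3 = 0" by simp
  then have "(of_int ((a - b) * int_binomial (m + 1) 3 + (b - m) * int_binomial (a + 1) 3 + (m - a) * int_binomial (b + 1) 3) :: 'a) = 0"
    by (simp only: of_int_0)
  then show ?thesis by (simp add: vir_cocycle_def add_divide_distrib[symmetric])
qed

lemma vir_bracket_L: "vir_bracket (L m) (L n) =
    tmon (Word [L (m + n)]) (of_int (m - n)) +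
    tmon (Word [C]) (if m + n = 0 then vir_cocycle m else (0::'a::field))"
  by (simp add: vir_cocycle_def)

lemma vir_bracket_C: "vir_bracket C h = 0" "vir_bracket h C = 0"
  by simp (cases h; simp)

lemma vir_bracket_antisym: "vir_bracket g h = - (vir_bracket h g :: 'a::field vir_tensor)"
proof (cases g; cases h)
  fix m n assume "g = L m" "h = L n"
  moreover have "m + n = 0 \<Longrightarrow> vir_cocycle m = - (vir_cocycle n :: 'a)"
    using vir_cocycle_minus[of n, where ?'a = 'a] by (metis eq_neg_iff_add_eq_0)
  moreover have "(of_int (m - n) :: 'a) = - of_int (n - m)" by simp
  ultimately show ?thesis
    by (simp only: vir_bracket_L minus_add_distrib single_uminus[symmetric] add.commute[of n m]) auto
qed (simp_all add: vir_bracket_C)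

text \<open>The Jacobi identity of the Virasoro algebra, read among words of length one so that it
  is available before passing to U; its central part is the cocycle condition.\<close>

lemma vir_bracket_jacobi:
  "tmon 0 (of_int (a - b)) * vir_bracket (L (a + b)) (L m) =
   tmon 0 (of_int (a - m)) * vir_bracket (L (a + m)) (L b) +
   tmon 0 (of_int (b - m)) * vir_bracket (L a) (L (b + m))"
  (is "?l = (?r :: 'a::field vir_tensor)")
proof -
  have 1: "(of_int ((a - b) * (a + b - m)) :: 'a) = of_int ((a - m) * (a + m - b)) + of_int ((b - m) * (a - (b + m)))"
    unfolding of_int_add[symmetric] by (rule arg_cong[where f = of_int]) (simp add: algebra_simps)
  have 2: "of_int (a - b) * (if a + b + m = 0 then vir_cocycle (a + b) else 0) =
     of_int (a - m) * (if a + m + b = 0 then vir_cocycle (a + m) else 0) +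
     of_int (b - m) * (if a + (b + m) = 0 then vir_cocycle a else (0::'a))"
  proof (cases "a + b + m = 0")
    case True
    then have e: "a + b = - m" "a + m = - b" "a + (b + m) = 0" "a + m + b = 0" by simp_all
    from vir_cocycle_jacobi[OF True, where ?'a = 'a] show ?thesis
      by (simp only: e vir_cocycle_minus if_True True add.left_inverse simp_thms)
        (simp add: algebra_simps)
  next
    case False
    then have "a + m + b \<noteq> 0" "a + (b + m) \<noteq> 0" by simp_all
    with False show ?thesis by simp
  qed
  have w: "a + b + m = a + m + b" "a + (b + m) = a + m + b" by simp_all
  show ?thesis
    unfolding vir_bracket_L distrib_left mult_single add_0_left
    using 1 2 unfolding w of_int_mult
    by (simp only: single_add add_ac)
qed

lemma dten_single_gen: "dten m (tmon (Word [g]) a) = tmon 0 a * vir_bracket g (L m)"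
  by (simp add: dten_single zero_vir_word_def[symmetric])

text \<open>Both sides are derivation-like in the word, so it suffices to compare them on letters,
  where the Jacobi identity applies. No central term occurs, as bracketing with C is zero.\<close>

lemma dten_dten: "dten n (dten m t) - dten m (dten n t) = tmon 0 (of_int (m - n)) * dten (m + n) t"
proof (induction t rule: vir_tensor_induct)
  case (add s t)
  then show ?case by (simp add: dten_add distrib_left algebra_simps)
next
  case (single gs a)
  have gen: "dten n (dten m (tensor_gen g)) - dten m (dten n (tensor_gen g)) =
      tmon 0 (of_int (m - n)) * dten (m + n) (tensor_gen g :: 'a vir_tensor)" for g
  proof (cases g)
    case (L a)
    have br: "dten n (vir_bracket (L a) (L m)) = tmon 0 (of_int (a - m)) * vir_bracket (L (a + m)) (L n)" for m n
      unfolding vir_bracket_L[of a m] dten_add dten_single_gen by (simp add: vir_bracket_C)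
    have s: "tmon 0 (of_int (a - m)) * vir_bracket (L (a + m)) (L n) =
       tmon 0 (of_int (a - n)) * vir_bracket (L (a + n)) (L m) +
       tmon 0 (of_int (m - n)) * (vir_bracket (L a) (L (m + n)) :: 'a vir_tensor)"
      by (rule vir_bracket_jacobi)
    show ?thesis unfolding L dten_gen br s by simp
  qed (simp add: dten_gen)
  have "dten n (dword m gs) - dten m (dword n gs) = tmon 0 (of_int (m - n)) * (dword (m + n) gs :: 'a vir_tensor)"
  proof (induction gs)
    case (Cons g gs)
    have d: "dten k (tmon (Word gs) (1::'a)) = dword k gs" for k by (simp add: dten_single)
    have "dten n (dword m (g # gs)) - dten m (dword n (g # gs)) =
      (dten n (vir_bracket g (L m)) - dten m (vir_bracket g (L n))) * tmon (Word gs) (1::'a) +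
      tensor_gen g * (dten n (dword m gs) - dten m (dword n gs))"
      by (simp add: dten_add dten_mult d dten_gen algebra_simps)
    also have "\<dots> = tmon 0 (of_int (m - n)) * dword (m + n) (g # gs)"
      unfolding Cons gen[of g, unfolded dten_gen]
      by (simp add: distrib_left mult.assoc[symmetric] single_0_commute[of _ "tensor_gen g"])
    finally show ?case .
  qed simp
  moreover have "dten k (tmon 0 a * t) = tmon 0 a * dten k t" for k and t :: "'a vir_tensor"
    using dten_single[of k "[]" a] by (simp add: dten_mult zero_vir_word_def)
  ultimately have "dten n (dten m (tmon (Word gs) a)) - dten m (dten n (tmon (Word gs) a)) =
      tmon 0 a * (tmon 0 (of_int (m - n)) * dword (m + n) gs)"
    unfolding dten_single by (metis right_diff_distrib)
  then show ?case unfolding dten_single by (metis mult.assoc single_0_commute)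
qed simp

definition vrel :: "vir_gen \<Rightarrow> vir_gen \<Rightarrow> 'a::field vir_tensor" where
  "vrel g h = tensor_gen g * tensor_gen h - tensor_gen h * tensor_gen g - vir_bracket g h"

lemma vrel_antisym: "vrel g h = - (vrel h g :: 'a::field vir_tensor)"
  unfolding vrel_def using vir_bracket_antisym[of g h, where ?'a = 'a] by simp

text \<open>Brackets are combinations of one-letter words; this reads off the letter, so that a map
  on letters can be extended linearly to them.\<close>

definition letter_case :: "(vir_gen \<Rightarrow> 'b::zero) \<Rightarrow> vir_word \<Rightarrow> 'b" where
  "letter_case f x = (case x of Word [g] \<Rightarrow> f g | _ \<Rightarrow> 0)"

text \<open>The derivation turns the relation of g, h into the relations of [g, L_m], h and of g,
  [h, L_m]. The span of the relations is thus stable, which drives the induction for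
  \<open>chi\<close>.\<close>

lemma dten_vrel:
  "dten m (vrel g h :: 'a::field vir_tensor) = (\<Sum>x\<in>supp (vir_bracket g (L m) :: 'a vir_tensor).
      tmon 0 (coef (vir_bracket g (L m)) x) * letter_case (\<lambda>g'. vrel g' h) x) +
    (\<Sum>x\<in>supp (vir_bracket h (L m) :: 'a vir_tensor).
      tmon 0 (coef (vir_bracket h (L m)) x) * letter_case (vrel g) x)"
proof -
  define S where "S t f = (\<Sum>x\<in>supp t. tmon 0 (coef t x) *
      letter_case f x)" for t :: "'a vir_tensor" and f :: "vir_gen \<Rightarrow> 'a vir_tensor"
  have sup: "S t f = (\<Sum>x\<in>A. tmon 0 (coef t x) * letter_case f x)"
    if "finite A" "supp t \<subseteq> A" for A t f
    unfolding S_def by (rule sum.mono_neutral_left) (use that in \<open>auto simp: in_keys_iff\<close>)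
  have Sadd: "S (s + t) f = S s f + S t f" for s t f
  proof -
    let ?A = "supp s \<union> supp t"
    have "supp (s + t) \<subseteq> ?A" by (rule keys_add)
    then show ?thesis by (simp add: sup[of ?A] lookup_add single_add distrib_right sum.distrib)
  qed
  have Ssing: "S (tmon (Word [g']) a) f = tmon 0 a * f g'" for g' a f
    by (subst sup[of "{Word [g']}"]) (auto simp: letter_case_def)
  have S0: "S 0 f = 0" for f by (simp add: S_def)
  have SL: "S (vir_bracket (L a) (L b)) f = tmon 0 (of_int (a - b)) * f (L (a + b)) +
     tmon 0 (if a + b = 0 then vir_cocycle a else 0) * f C" for a b f
    unfolding vir_bracket_L Sadd Ssing ..
  have vb: "vir_bracket (L a) (L b) = tmon 0 (of_int (a - b)) * tensor_gen (L (a + b)) +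
     tmon 0 (if a + b = 0 then vir_cocycle a else 0) * (tensor_gen C :: 'a vir_tensor)" for a b
    by (simp add: vir_bracket_L mult_single del: vir_bracket.simps)
  have cm: "t * (tmon 0 x * s) = tmon 0 x * (t * s)" for x and s t :: "'a vir_tensor"
    by (metis mult.assoc single_0_commute)
  have dC: "dten m (tensor_gen C) = (0 :: 'a vir_tensor)" by (simp add: dten_gen)
  have "dten m (vrel g h) = S (vir_bracket g (L m)) (\<lambda>g'. vrel g' h) + S (vir_bracket h (L m)) (vrel g)"
  proof (cases g)
    case (L a)
    show ?thesis
    proof (cases h)
      case (L b)
      have j: "dten m (vir_bracket (L a) (L b)) = tmon 0 (of_int (a - m)) * vir_bracket (L (a + m)) (L b) +
          tmon 0 (of_int (b - m)) * (vir_bracket (L a) (L (b + m)) :: 'a vir_tensor)"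
        unfolding vir_bracket_jacobi[symmetric] vir_bracket_L[of a b] dten_add dten_single_gen
        by (simp add: vir_bracket_C)
      show ?thesis
        unfolding \<open>g = L a\<close> L vrel_def dten_diff dten_mult dten_gen SL j
        unfolding vb[of a m] vb[of b m]
        by (simp add: distrib_left distrib_right right_diff_distrib cm mult.assoc vir_bracket_C del: vir_bracket.simps(1))
    next
      case C
      show ?thesis
        unfolding \<open>g = L a\<close> C vrel_def dten_diff dten_mult dten_gen SL vir_bracket_C S0
        unfolding vb[of a m]
        by (simp add: distrib_left distrib_right right_diff_distrib cm mult.assoc vir_bracket_C)
    qed
  next
    case C
    show ?thesis
    proof (cases h)
      case (L b)
      show ?thesis
        unfolding \<open>g = C\<close> L vrel_def dten_diff dten_mult dten_gen SL vir_bracket_C S0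
        unfolding vb[of b m]
        by (simp add: distrib_left distrib_right right_diff_distrib cm mult.assoc vir_bracket_C)
    next
      case h: C
      show ?thesis unfolding \<open>g = C\<close> h by (simp add: vrel_def S0)
    qed
  qed
  then show ?thesis unfolding S_def .
qed

lemma tlin_eq_0: "(\<And>w. w \<in> supp t \<Longrightarrow> f w = 0) \<Longrightarrow> tlin f t = 0"
  by (simp add: tlin_def)

lemma chi_ten_mult_left: "chi_ten c h (t * x) = tlin (\<lambda>w. chi_ten c h (tmon w 1 * x)) t"
proof (induction t rule: vir_tensor_induct)
  case (single gs a)
  have "tmon (Word gs) a * x = tmon 0 a * (tmon (Word gs) 1 * x)"
    by (simp add: mult.assoc[symmetric] mult_single)
  then show ?case by (simp add: chi_ten_scale)
qed (simp_all add: distrib_right chi_ten_add tlin_add chi_ten_0)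

lemma chi_ten_mult_right: "chi_ten c h (x * t) = tlin (\<lambda>w. chi_ten c h (x * tmon w 1)) t"
proof (induction t rule: vir_tensor_induct)
  case (single gs a)
  have "x * tmon (Word gs) a = tmon 0 a * (x * tmon (Word gs) 1)"
    unfolding mult.assoc[symmetric] single_0_commute[of a x] by (simp add: mult.assoc mult_single)
  then show ?case by (simp add: chi_ten_scale)
qed (simp_all add: distrib_left chi_ten_add tlin_add chi_ten_0)

text \<open>For two letters of positive degree the recursion applies twice and
  \<open>dten_dten\<close> gives the bracket. If only one has positive degree, the recursion for it
  already produces the bracket. If neither has, the values c, h and 0 have to form a character of
  the subalgebra of C and the L_a with a >= 0.\<close>

lemma chi_ten_vrel_end: "chi_ten c h (u * vrel x y) = 0"
proof -
  have main: "chi_ten c h (u * vrel x (L b)) = 0" if b: "b < 0" for x b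
  proof (cases "\<exists>a<0. x = L a")
    case True
    then obtain a where a: "x = L a" "a < 0" by blast
    have br: "vir_bracket (L i) (L j) = tmon 0 (of_int (i - j)) * (tensor_gen (L (i + j)) :: 'a vir_tensor)"
      if "i < 0" "j < 0" for i j using that by (simp add: vir_bracket_L mult_single del: vir_bracket.simps)
    have e: "chi_ten c h (u * (tensor_gen (L i) * tensor_gen (L j))) =
        chi_ten c h (dten i (dten j u)) + chi_ten c h (u * vir_bracket (L i) (L j))" if "i < 0" "j < 0" for i j
      using that unfolding mult.assoc[symmetric]
      by (simp add: chi_ten_gen dten_mult dten_gen chi_ten_add del: vir_bracket.simps)
    have "chi_ten c h (u * vrel (L a) (L b)) = chi_ten c h (dten a (dten b u) - dten b (dten a u)) - chi_ten c h (u * vir_bracket (L b) (L a))"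
      using a b by (simp add: vrel_def right_diff_distrib chi_ten_diff e del: vir_bracket.simps)
    also have "\<dots> = 0"
    proof -
      have "chi_ten c h (u * vir_bracket (L b) (L a)) = of_int (b - a) * chi_ten c h (u * tensor_gen (L (b + a)))"
        unfolding br[OF b a(2)] by (metis chi_ten_scale mult.assoc single_0_commute)
      then show ?thesis using a b by (simp add: dten_dten chi_ten_scale chi_ten_gen add.commute del: of_int_diff single_of_int vir_bracket.simps)
    qed
    finally show ?thesis by (simp add: a)
  next
    case False
    define k where "k = (case x of C \<Rightarrow> c | L a \<Rightarrow> if a = 0 then h else 0)"
    have k: "chi_ten c h (t * tensor_gen x) = k * chi_ten c h t" for t
      using False by (cases x) (auto simp: k_def chi_ten_gen)
    have "chi_ten c h (u * tensor_gen x * tensor_gen (L b)) = chi_ten c h (dten b u * tensor_gen x) + chi_ten c h (u * vir_bracket x (L b))"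
      using b by (simp add: chi_ten_gen dten_mult dten_gen chi_ten_add)
    then show ?thesis using b
      by (simp add: vrel_def right_diff_distrib mult.assoc[symmetric] chi_ten_diff k chi_ten_gen)
  qed
  show ?thesis
  proof (cases "\<exists>b<0. y = L b")
    case True
    then show ?thesis using main by blast
  next
    case y: False
    show ?thesis
    proof (cases "\<exists>a<0. x = L a")
      case True
      then have "chi_ten c h (u * vrel y x) = 0" using main by blast
      then show ?thesis using vrel_antisym[of x y, where ?'a = 'a] by (simp add: chi_ten_minus)
    next
      case x: False
      have k: "chi_ten c h (t * tensor_gen z) = (case z of C \<Rightarrow> c | L a \<Rightarrow> if a = 0 then h else 0) * chi_ten c h t"
        if "\<not> (\<exists>b<0. z = L b)" for z t
        using that by (cases z) (auto simp: chi_ten_gen)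
      \<comment> \<open>For a, b >= 0 the bracket of L_a and L_b has either positive index or
        coefficient 0.\<close>
      have "chi_ten c h (u * vir_bracket x y) = 0"
      proof (cases x; cases y)
        fix a b assume ab: "x = L a" "y = L b"
        then have "a \<ge> 0" "b \<ge> 0" using x y by auto
        have "u * vir_bracket (L a) (L b) = tmon 0 (of_int (a - b)) * (u * tensor_gen (L (a + b)))"
        proof -
          have "a + b = 0 \<Longrightarrow> a = 0" using \<open>a \<ge> 0\<close> \<open>b \<ge> 0\<close> by linarith
          then have "a + b = 0 \<Longrightarrow> vir_cocycle a = (0::'a)" by auto
          then have "vir_bracket (L a) (L b) = tmon 0 (of_int (a - b)) * (tensor_gen (L (a + b)) :: 'a vir_tensor)"
            by (simp add: vir_bracket_L mult_single del: vir_bracket.simps)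
          then show ?thesis by (metis mult.assoc single_0_commute)
        qed
        moreover have "a + b = 0 \<Longrightarrow> a - b = 0" using \<open>a \<ge> 0\<close> \<open>b \<ge> 0\<close> by auto
        moreover have "chi_ten c h (u * tensor_gen (L (a + b))) = 0" if "a + b \<noteq> 0"
          using that \<open>a \<ge> 0\<close> \<open>b \<ge> 0\<close> by (intro chi_ten_gen) auto
        ultimately show ?thesis unfolding ab
          by (cases "a + b = 0") (auto simp: chi_ten_scale chi_ten_0 simp del: vir_bracket.simps single_of_int of_int_diff)
      qed (simp_all add: vir_bracket_C chi_ten_0)
      then show ?thesis
        by (simp add: vrel_def right_diff_distrib mult.assoc[symmetric] chi_ten_diff k[OF x] k[OF y])
    qed
  qed
qed

text \<open>Induction on the number of surrounding letters. If the last letter is some L_m with m <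
  0, the recursion applies the derivation to everything before it; by the Leibniz rule and
  \<open>dten_vrel\<close> only relations with fewer surrounding letters appear.\<close>

lemma chi_ten_vrel: "chi_ten c h (tmon (Word u) 1 * (vrel x y * tmon (Word v) 1)) = 0"
proof (induction "length u + length v" arbitrary: u v x y rule: less_induct)
  case less
  let ?s = "\<lambda>gs. tmon (Word gs) 1 :: 'a vir_tensor"
  show ?case
  proof (cases v rule: rev_cases)
    case Nil
    then show ?thesis using chi_ten_vrel_end by (simp add: zero_vir_word_def[symmetric])
  next
    case (snoc v' g)
    have IH: "chi_ten c h (?s u' * (vrel x' y' * ?s v'')) = 0" if "length u' = length u" "length v'' = length v'" for u' v'' x' y'
      using less[of u' v'' x' y'] that snoc by simp
    define T where "T = ?s u * (vrel x y * ?s v')"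
    have T0: "chi_ten c h T = 0" unfolding T_def by (rule IH) simp_all
    have e: "?s u * (vrel x y * ?s v) = T * tensor_gen g"
      by (simp add: T_def snoc mult.assoc mult_single)
    show ?thesis
    proof (cases "\<exists>m<0. g = L m")
      case False
      then consider "g = C" | "g = L 0" | m where "g = L m" "m > 0"
        by (cases g) (metis linorder_neqE_linordered_idom)+
      then show ?thesis unfolding e using T0 by cases (simp_all add: chi_ten_gen)
    next
      case True
      then obtain m where m: "g = L m" "m < 0" by blast
      have d1: "chi_ten c h (dword m u * (vrel x y * ?s v')) = 0"
        unfolding chi_ten_mult_left[of c h "dword m u"]
      proof (rule tlin_eq_0)
        fix w assume "w \<in> supp (dword m u :: 'a vir_tensor)"
        then have "wlen w = length u" by (rule keys_dword)
        then show "chi_ten c h (tmon w 1 * (vrel x y * ?s v')) = 0"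
          by (cases w) (simp add: IH wlen_def)
      qed
      have d3: "chi_ten c h (?s u * (vrel x y * dword m v')) = 0"
        unfolding mult.assoc[symmetric] chi_ten_mult_right[of c h _ "dword m v'"]
      proof (rule tlin_eq_0)
        fix w assume "w \<in> supp (dword m v' :: 'a vir_tensor)"
        then have "wlen w = length v'" by (rule keys_dword)
        then show "chi_ten c h (?s u * vrel x y * tmon w 1) = 0"
          by (cases w) (simp add: IH wlen_def mult.assoc)
      qed
      have S0: "chi_ten c h (?s u * ((\<Sum>z\<in>A. tmon 0 (a z) * letter_case f z) * ?s v')) = 0"
        if "\<And>g'. chi_ten c h (?s u * (f g' * ?s v')) = 0" for A :: "vir_word set" and a f
      proof (induction A rule: infinite_finite_induct)
        case (insert z A)
        have "chi_ten c h (?s u * (tmon 0 (a z) * letter_case f z * ?s v')) =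
          a z * chi_ten c h (?s u * (letter_case f z * ?s v'))"
          proof -
          have "?s u * (tmon 0 (a z) * letter_case f z * ?s v') =
              tmon 0 (a z) * (?s u * (letter_case f z * ?s v'))"
            by (simp only: mult.assoc[symmetric] single_0_commute[of "a z" "?s u"])
          then show ?thesis by (simp only: chi_ten_scale)
        qed
        also have "chi_ten c h (?s u * (letter_case f z * ?s v')) = 0"
          using that by (auto split: vir_word.split list.split simp: chi_ten_0 letter_case_def)
        finally show ?case using insert by (simp add: distrib_left distrib_right chi_ten_add)
      qed (simp_all add: chi_ten_0)
      have d2: "chi_ten c h (?s u * (dten m (vrel x y) * ?s v')) = 0"
        unfolding dten_vrel distrib_left distrib_right chi_ten_add
        using S0[of "\<lambda>g'. vrel g' y"] S0[of "vrel x"] IH[OF refl refl] by simp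
      have "dten m T = dword m u * (vrel x y * ?s v') + (?s u * (dten m (vrel x y) * ?s v') + ?s u * (vrel x y * dword m v'))"
        by (simp add: T_def dten_mult dten_single zero_vir_word_def[symmetric] distrib_left)
      then show ?thesis unfolding e using m d1 d2 d3 by (simp add: chi_ten_gen chi_ten_add)
    qed
  qed
qed

lemma chi_ten_env_ideal: "t \<in> env_ideal \<Longrightarrow> chi_ten c h t = 0"
proof (induction t rule: env_ideal.induct)
  case (step t a x y b)
  have "chi_ten c h (a * (vrel x y * b)) = 0"
    unfolding chi_ten_mult_left[of c h a]
  proof (rule tlin_eq_0)
    fix w
    show "chi_ten c h (tmon w 1 * (vrel x y * b)) = 0"
      unfolding mult.assoc[symmetric] chi_ten_mult_right[of c h _ b]
    proof (rule tlin_eq_0)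
      fix w'
      show "chi_ten c h (tmon w 1 * vrel x y * tmon w' 1) = 0"
        by (cases w; cases w') (simp add: mult.assoc chi_ten_vrel)
    qed
  qed
  with step show ?case by (simp add: chi_ten_add vrel_def[symmetric] mult.assoc)
qed (simp add: chi_ten_0)

definition chi :: "'a::field \<Rightarrow> 'a \<Rightarrow> 'a vir_env \<Rightarrow> 'a" where
  "chi c h u = chi_ten c h (rep_vir_env u)"

lemma chi_abs: "chi c h (abs_vir_env t) = chi_ten c h t"
proof -
  have "rep_vir_env (abs_vir_env t) - t \<in> env_ideal"
    using env_rel_rep_abs[of t] by (simp add: env_rel_def)
  from chi_ten_env_ideal[OF this] show ?thesis by (simp add: chi_def chi_ten_diff)
qed

lemma chi_add: "chi c h (u + v) = chi c h u + chi c h v"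
  by (cases u rule: vir_env_abs_cases; cases v rule: vir_env_abs_cases)
    (simp add: chi_abs abs_vir_env_add[symmetric] chi_ten_add)

lemma chi_scale: "chi c h (env_scalar a * u) = a * chi c h u"
  by (cases u rule: vir_env_abs_cases)
    (simp add: chi_abs env_scalar_abs abs_vir_env_mult[symmetric] chi_ten_scale)

lemma chi_zero [simp]: "chi c h 0 = 0"
  using chi_scale[of c h 0 1] by simp

lemma chi_minus: "chi c h (- u) = - chi c h u"
  using chi_add[of c h u "- u"] by (simp add: eq_neg_iff_add_eq_0 add.commute)

lemma chi_diff: "chi c h (u - v) = chi c h u - chi c h v"
  using chi_add[of c h u "- v"] by (simp add: chi_minus)

lemma chi_one [simp]: "chi c h 1 = 1"
proof -
  have "chi c h (abs_vir_env (tmon (Word []) 1)) = 1"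
    unfolding chi_abs by (simp add: chi_ten_single chi_word_def wlen_def)
  then show ?thesis by (simp add: zero_vir_word_def[symmetric] abs_vir_env_1)
qed

lemma chi_scalar [simp]: "chi c h (env_scalar a) = a"
  using chi_scale[of c h a 1] by simp

lemma chi_gen:
  "chi c h (u * env_gen C) = c * chi c h u"
  "m > 0 \<Longrightarrow> chi c h (u * EL m) = 0"
  "chi c h (u * EL 0) = h * chi c h u"
  by (cases u rule: vir_env_abs_cases;
      simp add: chi_abs env_gen_abs abs_vir_env_mult[symmetric] chi_ten_gen)+

text \<open>Each step of the recursion either removes a letter of degree 0 or shifts the degree of
  the removed letter into the rest, so the degree is preserved wherever the value can be
  nonzero.\<close>

lemma chi_word_deg: "vir_word_deg w \<noteq> 0 \<Longrightarrow> chi_word c h w = 0"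
proof (induction "wlen w" arbitrary: w rule: less_induct)
  case less
  obtain gs where w: "w = Word gs" by (cases w)
  show ?case
  proof (cases gs rule: rev_cases)
    case Nil
    then show ?thesis using less(2) w by simp
  next
    case (snoc hs g)
    have IH: "vir_word_deg (Word hs) \<noteq> 0 \<Longrightarrow> chi_word c h (Word hs) = 0"
      using less(1)[of "Word hs"] w snoc by (simp add: wlen_def)
    have "chi_ten c h (dword m hs) = 0" if "vir_word_deg (Word hs) - m \<noteq> 0" for m
      unfolding chi_ten_def
    proof (rule tlin_eq_0)
      fix x assume x: "x \<in> supp (dword m hs :: 'a vir_tensor)"
      then have "wlen x = length hs" by (rule keys_dword)
      moreover have "vir_word_deg x = vir_word_deg (Word hs) - m"
        using homog_dword[of hs m, where ?'a = 'a] x by (simp add: homog_def)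
      ultimately show "chi_word c h x = 0" using that by (intro less(1)) (simp_all add: w snoc wlen_def)
    qed
    with IH less(2) show ?thesis
      unfolding w snoc chi_word_snoc by (auto split: vir_gen.split)
  qed
qed

lemma chi_hc: "chi c h (hc n u) = (if n = 0 then chi c h u else 0)"
proof -
  have "chi_ten c h (tcomp n t) = (if n = 0 then chi_ten c h t else 0)" for t
    by (induction t rule: vir_tensor_induct)
      (auto simp: tcomp_0 tcomp_add chi_ten_add chi_ten_0 tcomp_single chi_ten_single chi_word_deg simp del: vir_word_deg.simps)
  then show ?thesis by (cases u rule: vir_env_abs_cases) (simp add: hc_abs chi_abs)
qed

section \<open>Verma modules and their simple quotients\<close>

definition verma_ideal :: "'a::field \<Rightarrow> 'a \<Rightarrow> 'a vir_env set" where
  "verma_ideal c h = left_ideal ({env_gen C - env_scalar c, EL 0 - env_scalar h} \<union> {EL m | m. m \<ge> 1})"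

text \<open>The largest left ideal contained in the kernel of \<open>chi\<close>. It describes the
  maximal graded submodule of the Verma module explicitly.\<close>

definition simple_ideal :: "'a::field \<Rightarrow> 'a \<Rightarrow> 'a vir_env set" where
  "simple_ideal c h = {u. \<forall>a. chi c h (a * u) = 0}"

lemma chi_verma_ideal: "u \<in> verma_ideal c h \<Longrightarrow> chi c h u = 0"
  unfolding verma_ideal_def
proof (induction u rule: left_ideal.induct)
  case (step x s u)
  from step(2) have "chi c h (u * s) = 0"
    by (auto simp: right_diff_distrib chi_diff chi_gen env_scalar_commute[symmetric] chi_scale)
  with step show ?case by (simp add: chi_add)
qed simp

lemma verma_subset_simple: "verma_ideal c h \<subseteq> simple_ideal c h"
proof
  fix u assume "u \<in> verma_ideal c h"
  then have "a * u \<in> verma_ideal c h" for a unfolding verma_ideal_def by (rule left_ideal_mult)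
  then show "u \<in> simple_ideal c h" by (simp add: simple_ideal_def chi_verma_ideal)
qed

lemma graded_verma_ideal: "graded_set (verma_ideal c h)"
proof -
  have "EL 0 - env_scalar h \<in> env_gr 0"
    by (rule env_gr_diff) (use env_gr_L[of 0] in simp_all)
  then show ?thesis
    unfolding verma_ideal_def
    by (intro graded_left_ideal) (auto intro: env_gr_diff[OF env_gr_C env_gr_scalar] env_gr_L)
qed

lemma verma_ideal_closed:
  "0 \<in> verma_ideal c h" "x \<in> verma_ideal c h \<Longrightarrow> y \<in> verma_ideal c h \<Longrightarrow> x + y \<in> verma_ideal c h"
  "x \<in> verma_ideal c h \<Longrightarrow> y \<in> verma_ideal c h \<Longrightarrow> x - y \<in> verma_ideal c h"
  "x \<in> verma_ideal c h \<Longrightarrow> u * x \<in> verma_ideal c h"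
  unfolding verma_ideal_def by (auto intro: left_ideal.zero left_ideal_add left_ideal_diff left_ideal_mult)

lemma verma_ideal_gens:
  "u * env_gen C - env_scalar c * u \<in> verma_ideal c h"
  "u * EL 0 - env_scalar h * u \<in> verma_ideal c h"
  "m \<ge> 1 \<Longrightarrow> u * EL m \<in> verma_ideal c h"
proof -
  have "u * (env_gen C - env_scalar c) \<in> verma_ideal c h" "u * (EL 0 - env_scalar h) \<in> verma_ideal c h"
    unfolding verma_ideal_def by (intro left_ideal_mult left_ideal_gen; blast)+
  then show "u * env_gen C - env_scalar c * u \<in> verma_ideal c h"
    "u * EL 0 - env_scalar h * u \<in> verma_ideal c h"
    by (simp_all add: right_diff_distrib env_scalar_commute)
  show "m \<ge> 1 \<Longrightarrow> u * EL m \<in> verma_ideal c h"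
    unfolding verma_ideal_def by (intro left_ideal_mult left_ideal_gen) blast
qed

text \<open>Stands in for a triangular decomposition: modulo the Verma ideal, words in the L_m with
  m < 0 applied to 1 already span U. Spanning is all that is claimed, not independence.\<close>

inductive_set neg_span :: "'a::field \<Rightarrow> 'a \<Rightarrow> 'a vir_env set" for c h where
  ideal: "x \<in> verma_ideal c h \<Longrightarrow> x \<in> neg_span c h"
| one: "1 \<in> neg_span c h"
| add: "x \<in> neg_span c h \<Longrightarrow> y \<in> neg_span c h \<Longrightarrow> x + y \<in> neg_span c h"
| scale: "x \<in> neg_span c h \<Longrightarrow> env_scalar a * x \<in> neg_span c h"
| neg: "x \<in> neg_span c h \<Longrightarrow> m < 0 \<Longrightarrow> EL m * x \<in> neg_span c h"

lemma neg_span_C: "x \<in> neg_span c h \<Longrightarrow> env_gen C * x \<in> neg_span c h"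
proof -
  assume x: "x \<in> neg_span c h"
  have "x * env_gen C - env_scalar c * x \<in> neg_span c h" by (intro neg_span.ideal verma_ideal_gens)
  from neg_span.add[OF this neg_span.scale[OF x, of c]] show ?thesis by (simp add: env_gen_C_commute)
qed

lemma neg_span_L: "x \<in> neg_span c h \<Longrightarrow> EL m * x \<in> neg_span c h"
proof (induction x arbitrary: m rule: neg_span.induct)
  case (ideal x)
  then show ?case by (intro neg_span.ideal verma_ideal_closed)
next
  case one
  consider "m < 0" | "m = 0" | "m \<ge> 1" by linarith
  then show ?case
  proof cases
    case 1
    then show ?thesis by (intro neg_span.neg neg_span.one)
  next
    case 2
    have "1 * EL 0 - env_scalar h * 1 \<in> neg_span c h" by (intro neg_span.ideal verma_ideal_gens)
    from neg_span.add[OF this neg_span.scale[OF neg_span.one, of h]] 2 show ?thesis by simp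
  next
    case 3
    have "1 * EL m \<in> neg_span c h" by (intro neg_span.ideal verma_ideal_gens 3)
    then show ?thesis by simp
  qed
next
  case (add x y)
  then show ?case by (simp add: distrib_left neg_span.add)
next
  case (scale x a)
  then show ?case by (simp add: mult_env_scalar neg_span.scale)
next
  case (neg x n)
  have "(if m + n = 0 then env_scalar (vir_cocycle m) * (env_gen C * x) else 0) \<in> neg_span c h"
    using neg_span.scale[OF neg_span_C[OF neg(1)], of "vir_cocycle m"] neg_span.ideal[OF verma_ideal_closed(1), of c h] by simp
  moreover have "of_int (m - n) * (EL (m + n) * x) \<in> neg_span c h"
    unfolding env_scalar_of_int[symmetric] by (intro neg_span.scale neg(3))
  moreover have "EL n * (EL m * x) \<in> neg_span c h" by (intro neg_span.neg neg)
  ultimately show ?case unfolding env_gen_L_L_mult[of m n] by (intro neg_span.add)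
qed

lemma neg_span_UNIV: "u \<in> neg_span c h"
proof (induction u)
  case (gen g u)
  then show ?case by (cases g) (simp_all add: neg_span_L neg_span_C)
qed (auto intro: neg_span.one neg_span.add neg_span.scale)

text \<open>Generation by negative L_m leaves nothing below degree 0 and only scalars in degree 0.
  The scalar is determined by applying \<open>chi\<close>, which vanishes on the Verma
  ideal.\<close>

lemma verma_low_degree:
  "(n < 0 \<longrightarrow> hc n u \<in> verma_ideal c h) \<and> hc 0 u - env_scalar (chi c h u) \<in> verma_ideal c h"
  using neg_span_UNIV[of u c h]
proof -
  have "(\<forall>n<0. hc n u \<in> verma_ideal c h) \<and> (\<exists>a. hc 0 u - env_scalar a \<in> verma_ideal c h)"
    using neg_span_UNIV[of u c h]
  proof (induction u rule: neg_span.induct)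
    case (ideal x)
    then show ?case using graded_verma_ideal by (auto simp: graded_set_def intro: exI[of _ 0])
  next
    case one
    show ?case by (auto simp: hc_gr[OF env_gr_one] verma_ideal_closed intro: exI[of _ 1])
  next
    case (add x y)
    then obtain a b where "hc 0 x - env_scalar a \<in> verma_ideal c h" "hc 0 y - env_scalar b \<in> verma_ideal c h" by blast
    from verma_ideal_closed(2)[OF this] have "hc 0 (x + y) - env_scalar (a + b) \<in> verma_ideal c h"
      by (simp add: hc_add env_scalar_add algebra_simps)
    with add show ?case by (auto simp: hc_add verma_ideal_closed)
  next
    case (scale x b)
    then obtain a where "hc 0 x - env_scalar a \<in> verma_ideal c h" by blast
    from verma_ideal_closed(4)[OF this, of "env_scalar b"] have "hc 0 (env_scalar b * x) - env_scalar (b * a) \<in> verma_ideal c h"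
      by (simp add: hc_scale env_scalar_mult right_diff_distrib)
    with scale show ?case by (auto simp: hc_scale verma_ideal_closed)
  next
    case (neg x m)
    have "hc n (EL m * x) = EL m * hc (n + m) x" for n
      using hc_mult_left[OF env_gr_L, of n m x] by simp
    with neg show ?case by (auto intro!: exI[of _ 0] verma_ideal_closed(4))
  qed
  then obtain a where a: "\<forall>n<0. hc n u \<in> verma_ideal c h" "hc 0 u - env_scalar a \<in> verma_ideal c h" by blast
  from chi_verma_ideal[OF a(2)] have "chi c h u = a" by (simp add: chi_diff chi_hc)
  with a show ?thesis by blast
qed

lemma simple_ideal_closed:
  "0 \<in> simple_ideal c h" "x \<in> simple_ideal c h \<Longrightarrow> y \<in> simple_ideal c h \<Longrightarrow> x + y \<in> simple_ideal c h"
  "x \<in> simple_ideal c h \<Longrightarrow> y \<in> simple_ideal c h \<Longrightarrow> x - y \<in> simple_ideal c h"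
  "x \<in> simple_ideal c h \<Longrightarrow> u * x \<in> simple_ideal c h"
proof -
  show "0 \<in> simple_ideal c h" by (simp add: simple_ideal_def)
  show "x + y \<in> simple_ideal c h" if "x \<in> simple_ideal c h" "y \<in> simple_ideal c h"
    using that by (simp add: simple_ideal_def distrib_left chi_add)
  show "x - y \<in> simple_ideal c h" if "x \<in> simple_ideal c h" "y \<in> simple_ideal c h"
    using that by (simp add: simple_ideal_def right_diff_distrib chi_diff)
  assume "x \<in> simple_ideal c h"
  then have "chi c h ((a * u) * x) = 0" for a unfolding simple_ideal_def by blast
  then show "u * x \<in> simple_ideal c h" by (simp add: simple_ideal_def mult.assoc)
qed

lemma one_notin_simple_ideal: "1 \<notin> simple_ideal c h"
proof
  assume "1 \<in> simple_ideal c h"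
  then have "chi c h (1 * 1) = 0" unfolding simple_ideal_def by blast
  then show False by simp
qed

text \<open>Since \<open>chi\<close> sees degree 0 only, the component of u of degree n is tested
  against the component of a of degree -n, and this equals a test of u itself.\<close>

lemma graded_simple_ideal: "graded_set (simple_ideal c h)"
  unfolding graded_set_def simple_ideal_def
proof (clarsimp)
  fix u n a assume u: "\<forall>a. chi c h (a * u) = 0"
  have "chi c h (a * hc n u) = chi c h (hc 0 (a * hc n u))" by (simp add: chi_hc)
  also have "\<dots> = chi c h (hc (- n) a * hc n u)" by (simp add: hc_mult_right[OF hc_in_gr])
  also have "\<dots> = chi c h (hc 0 (hc (- n) a * u))" by (simp add: hc_mult_left[OF hc_in_gr])
  also have "\<dots> = 0" using u by (simp add: chi_hc)
  finally show "chi c h (a * hc n u) = 0" .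
qed

lemma vir_quot_simple: "vir_quot (simple_ideal c h) c"
proof
  show "env_gen C * u - env_scalar c * u \<in> simple_ideal c h" for u
    using verma_ideal_gens(1)[of u c h] verma_subset_simple[of c h] by (auto simp: env_gen_C_commute)
  fix u
  have "\<exists>N. \<forall>n\<ge>N. EL n * u \<in> verma_ideal c h"
    unfolding verma_ideal_def by (rule left_ideal_truncated[of 1], rule left_ideal_gen) auto
  then show "\<exists>N. \<forall>n\<ge>N. EL n * u \<in> simple_ideal c h"
    using verma_subset_simple by blast
qed (auto intro: simple_ideal_closed)

text \<open>If some a u had nonzero value under \<open>chi\<close>, its component of degree 0 would
  be a nonzero scalar modulo the Verma ideal, and N would contain 1.\<close>

lemma simple_ideal_maximal:
  assumes "verma_ideal c h \<subseteq> N" and add: "\<And>x y. x \<in> N \<Longrightarrow> y \<in> N \<Longrightarrow> x + y \<in> N"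
    and mult: "\<And>u x. x \<in> N \<Longrightarrow> u * x \<in> N" and gr: "graded_set N" and "1 \<notin> N"
  shows "N \<subseteq> simple_ideal c h"
proof
  fix u assume "u \<in> N"
  have "chi c h (a * u) = 0" for a
  proof (rule ccontr)
    assume n: "chi c h (a * u) \<noteq> 0"
    let ?x = "chi c h (a * u)"
    have "hc 0 (a * u) \<in> N" using mult[OF \<open>u \<in> N\<close>] gr by (auto simp: graded_set_def)
    moreover have "- 1 * (hc 0 (a * u) - env_scalar ?x) \<in> N"
      using verma_low_degree[of 0 "a * u" c h] assms(1) by (intro mult) auto
    ultimately have "hc 0 (a * u) + - 1 * (hc 0 (a * u) - env_scalar ?x) \<in> N" by (rule add)
    then have "env_scalar (inverse ?x) * env_scalar ?x \<in> N" by (intro mult) simp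
    then show False using \<open>1 \<notin> N\<close> n by (simp add: env_scalar_mult[symmetric])
  qed
  then show "u \<in> simple_ideal c h" by (simp add: simple_ideal_def)
qed

section \<open>Frobenius powers in an associative algebra\<close>

definition ad :: "'r::ring_1 \<Rightarrow> 'r \<Rightarrow> 'r" where
  "ad a x = a * x - x * a"

lemma ad_power:
  "(ad a ^^ m) x = (\<Sum>j\<le>m. of_int ((-1) ^ j * int (m choose j)) * (a ^ (m - j) * x * a ^ j))"
proof (induction m)
  case (Suc m)
  let ?s = "\<lambda>m j. (-1) ^ j * int (m choose j)"
  let ?t = "\<lambda>j. a ^ (Suc m - j) * x * a ^ j"
  have cf: "?s m (Suc j) - ?s m j = ?s (Suc m) (Suc j)" for j
    by (simp add: algebra_simps)
  have comm: "y * (of_int z * w) = of_int z * (y * w)" for y w :: 'a and z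
    by (metis mult.assoc mult_of_int_commute)
  have "(ad a ^^ Suc m) x = a * (ad a ^^ m) x - (ad a ^^ m) x * a" by (simp add: ad_def)
  also have "a * (ad a ^^ m) x = (\<Sum>j\<le>m. of_int (?s m j) * ?t j)"
    unfolding Suc sum_distrib_left comm
    by (rule sum.cong[OF refl]) (simp add: mult.assoc[symmetric] Suc_diff_le)
  also have "(ad a ^^ m) x * a = (\<Sum>j\<le>m. of_int (?s m j) * ?t (Suc j))"
    unfolding Suc sum_distrib_right
    by (rule sum.cong[OF refl]) (simp add: mult.assoc power_commutes)
  also have "(\<Sum>j\<le>m. of_int (?s m j) * ?t j) = (\<Sum>j\<le>Suc m. of_int (?s m j) * ?t j)"
    by (simp add: binomial_eq_0)
  also have "\<dots> = ?t 0 + (\<Sum>j\<le>m. of_int (?s m (Suc j)) * ?t (Suc j))"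
    by (simp only: sum.atMost_Suc_shift) simp
  also have "?t 0 + (\<Sum>j\<le>m. of_int (?s m (Suc j)) * ?t (Suc j)) - (\<Sum>j\<le>m. of_int (?s m j) * ?t (Suc j)) =
     ?t 0 + (\<Sum>j\<le>m. of_int (?s (Suc m) (Suc j)) * ?t (Suc j))"
    unfolding add_diff_eq[symmetric] sum_subtractf[symmetric] left_diff_distrib[symmetric] of_int_diff[symmetric] cf ..
  also have "\<dots> = (\<Sum>j\<le>Suc m. of_int (?s (Suc m) j) * ?t j)"
    by (simp only: sum.atMost_Suc_shift) simp
  finally show ?case .
qed simp

lemma of_nat_prime_zero_dvd: "of_nat p = (0::'r::ring_1) \<Longrightarrow> p dvd n \<Longrightarrow> of_nat n = (0::'r)"
  by (auto elim!: dvdE)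

text \<open>Left and right multiplication by a commute, so the binomial formula applies; modulo p
  its inner coefficients vanish, and p odd gives the sign.\<close>

lemma ad_prime_power:
  assumes "prime p" "of_nat p = (0::'r::ring_1)" "odd p"
  shows "(ad a ^^ p) x = a ^ p * x - x * (a::'r) ^ p"
proof -
  have "of_int ((-1) ^ j * int (p choose j)) = (0::'r)" if "0 < j" "j < p" for j
  proof -
    have "p dvd (p choose j)" using that assms(1) by (intro dvd_choose_prime) auto
    then show ?thesis using of_nat_prime_zero_dvd[OF assms(2)] by simp
  qed
  then have "(ad a ^^ p) x = (\<Sum>j\<in>{0, p}. of_int ((-1) ^ j * int (p choose j)) * (a ^ (p - j) * x * a ^ j))"
    unfolding ad_power by (intro sum.mono_neutral_right) (auto simp: le_less)
  also have "\<dots> = a ^ p * x - x * a ^ p"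
    using assms(1,3) prime_gt_0_nat[of p] by simp
  finally show ?thesis .
qed

text \<open>Modulo p the signed coefficients (-1)^j binom(p-1, j) are all 1, because neighbouring
  binomials add up to binom(p, j+1). The right-hand side is the shape of the derivative of a p-th
  power.\<close>

lemma ad_prime_power_minus_one:
  assumes "prime p" "of_nat p = (0::'r::ring_1)"
  shows "(ad a ^^ (p - 1)) x = (\<Sum>j\<le>p - 1. a ^ (p - 1 - j) * x * (a::'r) ^ j)"
proof -
  have "j \<le> p - 1 \<Longrightarrow> of_int ((-1) ^ j * int ((p - 1) choose j)) = (1::'r)" for j
  proof (induction j)
    case (Suc j)
    have "p dvd (p choose Suc j)" using Suc assms(1) by (intro dvd_choose_prime) auto
    moreover have "p choose Suc j = ((p - 1) choose j) + ((p - 1) choose Suc j)"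
      using prime_gt_0_nat[OF assms(1)] by (cases p) auto
    ultimately have "of_nat ((p - 1) choose j) + of_nat ((p - 1) choose Suc j) = (0::'r)"
      using of_nat_prime_zero_dvd[OF assms(2)] by (metis of_nat_add)
    then have "of_nat ((p - 1) choose Suc j) = - (of_nat ((p - 1) choose j) :: 'r)"
      by (simp add: add.commute eq_neg_iff_add_eq_0)
    then show ?case using Suc by simp
  qed simp
  then show ?thesis unfolding ad_power by (intro sum.cong) (simp_all del: of_int_mult of_int_power)
qed

definition euler :: "'r::ring_1 fps \<Rightarrow> 'r fps" where
  "euler f = Abs_fps (\<lambda>i. of_nat i * f $ i)"

lemma euler_mult: "euler (f * g) = euler f * g + f * euler g"
proof (rule fps_ext)
  fix n
  have "of_nat n * (f $ i * g $ (n - i)) = of_nat i * f $ i * g $ (n - i) + f $ i * (of_nat (n - i) * g $ (n - i))"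
    if "i \<le> n" for i
  proof -
    have "of_nat n = (of_nat i + of_nat (n - i) :: 'a)" using that by (simp flip: of_nat_add)
    then show ?thesis by (metis distrib_right mult.assoc mult_of_nat_commute)
  qed
  then show "euler (f * g) $ n = (euler f * g + f * euler g) $ n"
    by (simp add: euler_def fps_mult_nth sum_distrib_left sum.distrib[symmetric])
qed

lemma euler_power: "euler (g ^ Suc m) = (\<Sum>j\<le>m. g ^ (m - j) * euler g * g ^ j)"
proof (induction m)
  case (Suc m)
  have "euler (g ^ Suc (Suc m)) = g * euler (g ^ Suc m) + euler g * g ^ Suc m"
    using euler_mult[of g "g ^ Suc m"] by (simp add: add.commute)
  also have "\<dots> = (\<Sum>j\<le>m. g ^ (Suc m - j) * euler g * g ^ j) + euler g * g ^ Suc m"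
    unfolding Suc sum_distrib_left
    by (intro arg_cong2[where f = "(+)"] sum.cong) (simp_all add: Suc_diff_le mult.assoc)
  also have "\<dots> = (\<Sum>j\<le>Suc m. g ^ (Suc m - j) * euler g * g ^ j)" by simp
  finally show ?case .
qed (simp)

text \<open>The ring carries no scalars here, so that the power series ring is again an instance;
  natural multiples suffice to invert the exponents prime to p.\<close>

locale prime_char_lie =
  fixes p :: nat and Lie :: "'r::ring_1 set"
  assumes p: "prime p" "odd p" "of_nat p = (0::'r)"
    and Lie_zero: "0 \<in> Lie"
    and Lie_add: "x \<in> Lie \<Longrightarrow> y \<in> Lie \<Longrightarrow> x + y \<in> Lie"
    and Lie_minus: "x \<in> Lie \<Longrightarrow> - x \<in> Lie"
    and Lie_bracket: "x \<in> Lie \<Longrightarrow> y \<in> Lie \<Longrightarrow> x * y - y * x \<in> Lie"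
begin

lemma Lie_diff: "x \<in> Lie \<Longrightarrow> y \<in> Lie \<Longrightarrow> x - y \<in> Lie"
  using Lie_add[of x "- y"] Lie_minus by simp

lemma Lie_of_nat: "x \<in> Lie \<Longrightarrow> of_nat n * x \<in> Lie"
  by (induction n) (simp_all add: Lie_zero distrib_right Lie_add)

lemma Lie_sum: "(\<And>i. i \<in> A \<Longrightarrow> f i \<in> Lie) \<Longrightarrow> sum f A \<in> Lie"
  by (induction A rule: infinite_finite_induct) (simp_all add: Lie_zero Lie_add)

text \<open>
  Jacobson's formula modulo Lie elements: apply the Euler derivation to \<open>(b + a t)\<^sup>p\<close> and compare
  coefficients; the exponents \<open>0 < i < p\<close> are invertible.
\<close>

lemma jacobson:
  assumes a: "a \<in> Lie" and b: "b \<in> Lie"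
  shows "(a + b) ^ p - a ^ p - b ^ p \<in> Lie"
proof -
  define g where "g = fps_const b + fps_X * fps_const a"
  have g_nth: "(g * f) $ i = b * f $ i + (if i = 0 then 0 else a * f $ (i - 1))" for f i
    by (simp add: g_def distrib_right mult.assoc)
  have g_nth': "(f * g) $ i = f $ i * b + (if i = 0 then 0 else f $ (i - 1) * a)" for f i
  proof -
    have "f * g = f * fps_const b + fps_X * (f * fps_const a)"
      by (simp add: g_def distrib_left mult.assoc[symmetric] fps_mult_fps_X_commute[symmetric])
    then show ?thesis by simp
  qed
  have g0: "g $ 0 = b" by (simp add: g_def)
  \<comment> \<open>The power is a polynomial in t of degree at most m: the sum of its coefficients
    is the value at t = 1, and the outer coefficients are pure powers of b and a.\<close>
  have pw: "(\<Sum>i\<le>m. (g ^ m) $ i) = (a + b) ^ m \<and> (\<forall>i>m. (g ^ m) $ i = 0) \<and> (g ^ m) $ m = a ^ m \<and> (g ^ m) $ 0 = b ^ m" for m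
  proof (induction m)
    case (Suc m)
    have "(\<Sum>i\<le>Suc m. (g ^ Suc m) $ i) = (\<Sum>i\<le>Suc m. b * (g ^ m) $ i) + (\<Sum>i\<le>Suc m. if i = 0 then 0 else a * (g ^ m) $ (i - 1))"
      by (simp only: power_Suc g_nth sum.distrib)
    also have "\<dots> = (\<Sum>i\<le>m. b * (g ^ m) $ i) + (\<Sum>i\<le>m. a * (g ^ m) $ i)"
      using Suc by (simp only: sum.atMost_Suc_shift[of "\<lambda>i. if i = 0 then 0 else a * (g ^ m) $ (i - 1)"]) simp
    also have "\<dots> = (a + b) ^ Suc m"
      using Suc by (simp add: sum_distrib_left[symmetric] distrib_right)
    finally have "(\<Sum>i\<le>Suc m. (g ^ Suc m) $ i) = (a + b) ^ Suc m" .
    with Suc show ?case by (simp add: g_nth g0 del: sum.atMost_Suc)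
  qed simp
  define LT where "LT = {f. \<forall>i. f $ i \<in> Lie}"
  have ad_LT: "ad g f \<in> LT" if "f \<in> LT" for f
  proof -
    have "ad g f $ i = (b * f $ i - f $ i * b) + (if i = 0 then 0 else a * f $ (i - 1) - f $ (i - 1) * a)" for i
      by (simp add: ad_def g_nth g_nth')
    then show ?thesis using that a b by (auto simp: LT_def intro!: Lie_add Lie_bracket Lie_zero)
  qed
  have eg: "euler g = fps_X * fps_const a"
  proof (rule fps_ext)
    fix i show "euler g $ i = (fps_X * fps_const a) $ i"
      by (cases i; cases "i - 1") (auto simp: euler_def g_def)
  qed
  have "euler g \<in> LT" unfolding eg using a by (auto simp: LT_def Lie_zero)
  then have "(ad g ^^ m) (euler g) \<in> LT" for m by (induction m) (simp_all add: ad_LT)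
  moreover have pfps: "of_nat p = (0 :: 'r fps)"
    using p(3) by (simp add: fps_of_nat[symmetric])
  \<comment> \<open>The derivative of g^p is an iterated commutator of g with the derivative of g,
    hence has coefficients in \<open>Lie\<close>.\<close>
  have "euler (g ^ p) = (ad g ^^ (p - 1)) (euler g)"
    unfolding ad_prime_power_minus_one[OF p(1) pfps]
    using euler_power[of g "p - 1"] prime_gt_0_nat[OF p(1)] by simp
  ultimately have E: "of_nat i * (g ^ p) $ i \<in> Lie" for i
    unfolding LT_def by (metis (mono_tags, lifting) euler_def fps_nth_Abs_fps mem_Collect_eq)
  have inner: "(g ^ p) $ i \<in> Lie" if i: "0 < i" "i < p" for i
  proof -
    have "coprime i p" using i p(1) by (metis coprime_commute nat_dvd_not_less prime_imp_coprime)
    then obtain j q where "i * j = p * q + 1"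
      using bezout_nat[of i p] i by auto
    then have "of_nat (i * j) = of_nat p * of_nat q + (1::'r)"
      by (metis of_nat_1 of_nat_add of_nat_mult)
    then have "of_nat (i * j) = (1::'r)" by (simp add: p(3))
    then have "of_nat j * (of_nat i * (g ^ p) $ i) = (g ^ p) $ i"
      by (metis mult.assoc mult.commute of_nat_mult mult_1)
    then show ?thesis using Lie_of_nat[OF E[of i], of j] by simp
  qed
  have "(a + b) ^ p = (\<Sum>i\<le>p. (g ^ p) $ i)" using pw by simp
  also have "\<dots> = (g ^ p) $ 0 + (g ^ p) $ p + (\<Sum>i\<in>{0<..<p}. (g ^ p) $ i)"
  proof -
    have "{..p} = insert 0 (insert p {0<..<p})" using prime_gt_0_nat[OF p(1)] by auto
    then show ?thesis using prime_gt_0_nat[OF p(1)] by (simp add: add.assoc)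
  qed
  finally have "(a + b) ^ p - a ^ p - b ^ p = (\<Sum>i\<in>{0<..<p}. (g ^ p) $ i)"
    using pw[of p] by simp
  then show ?thesis using inner by (auto intro!: Lie_sum)
qed

text \<open>Series with Lie coefficients are closed under commutators, since the coefficients of a
  commutator are sums of commutators. Jacobson's formula thus becomes available for whole
  series.\<close>

lemma prime_char_lie_fps: "prime_char_lie p {f :: 'r fps. \<forall>k. f $ k \<in> Lie}"
proof
  show "of_nat p = (0 :: 'r fps)" using p(3) by (simp add: fps_of_nat[symmetric])
  fix f h :: "'r fps" assume fh: "f \<in> {f. \<forall>k. f $ k \<in> Lie}" "h \<in> {f. \<forall>k. f $ k \<in> Lie}"
  have "(f * h - h * f) $ k \<in> Lie" for k
  proof -
    have "(\<Sum>i=0..k. h $ i * f $ (k - i)) = (\<Sum>i=0..k. h $ (k - i) * f $ i)"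
      by (rule sum.reindex_bij_witness[of _ "\<lambda>i. k - i" "\<lambda>i. k - i"]) auto
    then have "(f * h - h * f) $ k = (\<Sum>i=0..k. f $ i * h $ (k - i) - h $ (k - i) * f $ i)"
      by (simp add: fps_mult_nth sum_subtractf)
    then show ?thesis using fh by (auto intro!: Lie_sum Lie_bracket)
  qed
  then show "f * h - h * f \<in> {f. \<forall>k. f $ k \<in> Lie}" by simp
qed (use p in \<open>auto simp: Lie_zero Lie_add Lie_minus\<close>)

text \<open>Write f as its constant term plus X f'. Jacobson's formula separates the two p-th powers
  up to Lie coefficients, X is central, so (X f')^p = X^p f'^p, and the induction continues with f'
  and k - p.\<close>

lemma fps_prime_power:
  assumes "\<forall>k. f $ k \<in> Lie"
  shows "(f ^ p) $ k - (if p dvd k then (f $ (k div p)) ^ p else 0) \<in> Lie"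
  using assms
proof (induction k arbitrary: f rule: less_induct)
  case (less k)
  interpret F: prime_char_lie p "{f :: 'r fps. \<forall>k. f $ k \<in> Lie}" by (rule prime_char_lie_fps)
  define f' where "f' = fps_shift 1 f"
  have f: "f = fps_const (f $ 0) + fps_X * f'"
    by (rule fps_ext) (simp add: f'_def)
  have p0: "p > 0" using prime_gt_0_nat[OF p(1)] .
  have "(fps_const (f $ 0) + fps_X * f') ^ p - fps_const (f $ 0) ^ p - (fps_X * f') ^ p \<in> {f. \<forall>k. f $ k \<in> Lie}"
    by (rule F.jacobson) (use less(2) in \<open>auto simp: Lie_zero f'_def\<close>)
  then have 1: "(f ^ p) $ k - (if k = 0 then (f $ 0) ^ p else 0) - ((fps_X * f') ^ p) $ k \<in> Lie"
    using f by simp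
  have xp: "(fps_X * f') ^ m = fps_X ^ m * f' ^ m" for m
  proof (induction m)
    case (Suc m)
    have "(fps_X * f') ^ Suc m = fps_X * (f' * fps_X ^ m) * f' ^ m" by (simp add: Suc mult.assoc)
    also have "\<dots> = fps_X * (fps_X ^ m * f') * f' ^ m"
      by (simp only: fps_mult_fps_X_power_commute)
    also have "\<dots> = fps_X ^ Suc m * f' ^ Suc m" by (simp add: mult.assoc)
    finally show ?case .
  qed simp
  show ?case
  proof (cases "k < p")
    case True
    then have "p dvd k \<longleftrightarrow> k = 0" by (auto dest: nat_dvd_not_less)
    then show ?thesis using 1 True p0 unfolding xp fps_X_power_mult_nth by (cases "k = 0") simp_all
  next
    case False
    have "(f' ^ p) $ (k - p) - (if p dvd (k - p) then (f' $ ((k - p) div p)) ^ p else 0) \<in> Lie"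
      by (rule less(1)) (use False p0 less(2) in \<open>auto simp: f'_def\<close>)
    moreover have "p dvd (k - p) \<longleftrightarrow> p dvd k" using False by (simp add: dvd_minus_self)
    moreover have "f' $ ((k - p) div p) = f $ (k div p)"
      using False p0 by (simp add: f'_def div_add_self2 le_div_geq)
    ultimately have 2: "(f' ^ p) $ (k - p) - (if p dvd k then (f $ (k div p)) ^ p else 0) \<in> Lie"
      by (simp only:)
    have "(f ^ p) $ k - (f' ^ p) $ (k - p) \<in> Lie"
      using 1 False p0 unfolding xp fps_X_power_mult_nth by auto
    from Lie_add[OF this 2] show ?thesis by simp
  qed
qed

end

section \<open>The restricted vacuum ideal\<close>

text \<open>\<open>restr_gen (- int n)\<close> is the element z_n of the overview; other signs of
  the index are allowed since centrality holds for all of them.\<close>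

definition restr_gen :: "int \<Rightarrow> 'a::field vir_env" where
  "restr_gen k = EL k ^ CHAR('a) - (if int CHAR('a) dvd k then EL (int CHAR('a) * k) else 0)"

definition restricted_ideal :: "'a::field \<Rightarrow> 'a vir_env set" where
  "restricted_ideal c = left_ideal ({env_gen C - env_scalar c} \<union> {EL n | n. n \<ge> -1} \<union>
     {restr_gen (- int n) | n. n \<ge> 2})"

lemma vacuum_subset_restricted: "vacuum_ideal c \<subseteq> restricted_ideal c"
  unfolding vacuum_ideal_def restricted_ideal_def by (rule left_ideal_mono) auto

lemma vir_quot_restricted: "vir_quot (restricted_ideal c) c"
proof
  show "0 \<in> restricted_ideal c" by (simp add: restricted_ideal_def left_ideal.zero)
  show "env_gen C * u - env_scalar c * u \<in> restricted_ideal c" for u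
    using vacuum_ideal_C vacuum_subset_restricted by blast
  show "\<exists>N. \<forall>n\<ge>N. EL n * u \<in> restricted_ideal c" for u
    using vacuum_ideal_truncated[of u c] vacuum_subset_restricted[of c] by blast
qed (auto simp: restricted_ideal_def intro: left_ideal_add left_ideal_mult)

lemma Sum_any_closed:
  assumes "0 \<in> H" "\<And>x y. x \<in> H \<Longrightarrow> y \<in> H \<Longrightarrow> x + y \<in> H" "\<And>i. f i \<in> H"
  shows "Sum_any f \<in> H"
proof -
  have "sum f A \<in> H" for A
    by (induction A rule: infinite_finite_induct) (simp_all add: assms)
  then show ?thesis by (simp only: Sum_any.expand_set)
qed

text \<open>The span of the L_-n with n >= 2. Being a Lie algebra it absorbs the error terms of
  Jacobson's formula, and it is small enough to contain no nonzero singular vector.\<close>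

inductive_set neg_lie :: "'a::field vir_env set" where
  zero: "0 \<in> neg_lie"
| step: "x \<in> neg_lie \<Longrightarrow> n \<ge> 2 \<Longrightarrow> x + env_scalar a * EL (- n) \<in> neg_lie"

lemma neg_lie_gen: "n \<ge> 2 \<Longrightarrow> env_scalar a * EL (- n) \<in> neg_lie"
  using neg_lie.step[OF neg_lie.zero] by simp

lemma neg_lie_add: "y \<in> neg_lie \<Longrightarrow> x \<in> neg_lie \<Longrightarrow> x + y \<in> neg_lie"
proof (induction y rule: neg_lie.induct)
  case (step y n a)
  then show ?case using neg_lie.step[of "x + y" n a] by (simp add: add.assoc)
qed simp

lemma neg_lie_scale: "x \<in> neg_lie \<Longrightarrow> env_scalar b * x \<in> neg_lie"
proof (induction x rule: neg_lie.induct)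
  case (step x n a)
  then show ?case using neg_lie.step[of "env_scalar b * x" n "b * a"]
    by (simp add: distrib_left env_scalar_mult mult.assoc)
qed (simp add: neg_lie.zero)

lemma neg_lie_bracket_gen:
  assumes "x \<in> neg_lie" "n \<ge> 2"
  shows "x * EL (- n) - EL (- n) * x \<in> neg_lie"
  using assms(1)
proof (induction x rule: neg_lie.induct)
  case (step x m a)
  have "(x + env_scalar a * EL (- m)) * EL (- n) - EL (- n) * (x + env_scalar a * EL (- m))
     = (x * EL (- n) - EL (- n) * x) + env_scalar (a * of_int (n - m)) * EL (- (m + n))"
    using env_gen_L_L[of "- m" "- n", where ?'a = 'a] step(2) assms(2)
    by (simp add: distrib_left distrib_right mult.assoc mult_env_scalar env_scalar_mult env_scalar_of_int del: of_int_diff)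
  moreover have "m + n \<ge> 2" using step(2) assms(2) by simp
  ultimately show ?case using neg_lie.step[OF step(3), of "m + n"] by (simp only:)
qed (simp add: neg_lie.zero)

lemma neg_lie_bracket:
  assumes "y \<in> neg_lie" "x \<in> neg_lie"
  shows "x * y - y * x \<in> neg_lie"
  using assms(1)
proof (induction y rule: neg_lie.induct)
  case (step y n a)
  have "x * (y + env_scalar a * EL (- n)) - (y + env_scalar a * EL (- n)) * x =
    (x * y - y * x) + env_scalar a * (x * EL (- n) - EL (- n) * x)"
    by (simp add: distrib_left distrib_right mult.assoc mult_env_scalar right_diff_distrib)
  with step neg_lie_bracket_gen[OF assms(2)] show ?case by (simp add: neg_lie_add neg_lie_scale)
qed (simp add: neg_lie.zero)

lemma neg_lie_hc:
  assumes "x \<in> neg_lie"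
  shows "hc n x = 0 \<or> (n \<ge> 2 \<and> (\<exists>a. hc n x = env_scalar a * EL (- n)))"
proof -
  have "\<exists>a. hc n x = (if n \<ge> 2 then env_scalar a * EL (- n) else 0)"
    using assms
  proof (induction x rule: neg_lie.induct)
    case (step x m b)
    then obtain a where a: "hc n x = (if n \<ge> 2 then env_scalar a * EL (- n) else 0)" by blast
    have "hc n (EL (- m) :: 'a vir_env) = (if n = m then EL (- m) else 0)"
      using hc_gr[OF env_gr_L[of "- m", where ?'a = 'a], of n] by simp
    with a step(2) show ?case
      by (intro exI[of _ "if n = m then a + b else a"]) (auto simp: hc_add hc_scale env_scalar_add distrib_right)
  qed (auto intro: exI[of _ 0])
  then show ?thesis by (metis)
qed

text \<open>If L_-2 were in the ideal, omega would act as zero on every quotient module; but on L(c,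
  1) its mode L_0 has eigenvalue 1 on the lowest weight vector.\<close>

lemma L2_notin_vacuum_ideal: "EL (-2) \<notin> vacuum_ideal c"
proof
  assume "EL (-2) \<in> vacuum_ideal c"
  interpret S: vir_quot "simple_ideal c 1" c by (rule vir_quot_simple)
  have "quot_L (simple_ideal c 1) 0 1 = quot_Y (simple_ideal c 1) c (EL (-2)) 1 1"
    using S.quot_Y_conformal[of 0 1] by simp
  also have "\<dots> = 0" using S.quot_Y_cong(1)[of "EL (-2)" 0] \<open>_ \<in> vacuum_ideal c\<close> by simp
  finally have "EL 0 \<in> simple_ideal c 1"
    using S.quot_L_cong[of 0 1] S.I_minus by fastforce
  then have "chi c 1 (1 * EL 0) = 0" unfolding simple_ideal_def by blast
  then show False by (subst (asm) chi_gen(3)) simp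
qed

lemma (in vir_quot) quot_Y_left_ideal:
  assumes "\<And>q x. quot_Y I c u q x = 0"
  shows "quot_Y I c (a * u) q x = 0"
proof (induction a arbitrary: q x)
  case (add v w)
  then show ?case by (simp add: distrib_right quot_Y_linear)
next
  case (scale b v)
  then show ?case by (simp add: mult.assoc quot_Y_linear)
next
  case (gen g v)
  show ?case
  proof (cases g)
    case (L k)
    show ?thesis unfolding L mult.assoc quot_Y_L
      by (simp add: gen quot_L_def quot_proj_kill[OF I_zero])
  next
    case C
    then show ?thesis by (simp add: mult.assoc quot_Y_C gen)
  qed
qed (simp add: assms)

lemma (in vir_quot) quot_Y_restricted:
  assumes "\<And>n q x. n \<ge> 2 \<Longrightarrow> quot_Y I c (restr_gen (- int n)) q x = 0" and "u \<in> restricted_ideal c"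
  shows "quot_Y I c u q x = 0"
  using assms(2) unfolding restricted_ideal_def
proof (induction u arbitrary: q x rule: left_ideal.induct)
  case (step y s a)
  have "quot_Y I c (a * s) q x = 0" for q x
  proof (cases "s \<in> {env_gen C - env_scalar c} \<union> {EL n | n. n \<ge> -1}")
    case True
    then have "a * s \<in> vacuum_ideal c" unfolding vacuum_ideal_def by (intro left_ideal_mult left_ideal_gen)
    then show ?thesis using quot_Y_cong(1)[of "a * s" 0] by simp
  next
    case False
    then show ?thesis using step(2) assms(1) by (intro quot_Y_left_ideal) auto
  qed
  with step show ?case by (simp add: quot_Y_linear)
qed simp

section \<open>The central elements and the ideal they generate\<close>

locale odd_prime_char =
  fixes p :: nat and c :: "'a::field"
  assumes p_prime: "prime p" and p_odd: "odd p" and p_char: "CHAR('a) = p"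
begin

lemma p_ge_3: "p \<ge> 3"
  using p_odd prime_ge_2_nat[OF p_prime] by (cases "p = 2") auto

lemma of_int_0_iff: "of_int k = (0::'a) \<longleftrightarrow> int p dvd k"
  using of_int_eq_0_iff_char_dvd[where ?'a = 'a] p_char by simp

lemma of_nat_p_env: "of_nat p = (0::'a vir_env)"
  using env_scalar_of_nat[of p, where ?'a = 'a] of_nat_CHAR[where ?'a = 'a] p_char by simp

lemma power_p_of_int: "(of_int k :: 'a) ^ p = of_int k"
proof -
  have n: "(of_nat n :: 'a) ^ p = of_nat n" for n
  proof (induction n)
    case (Suc n)
    have "(1 + of_nat n :: 'a) ^ p = 1 ^ p + of_nat n ^ p"
      by (rule freshmans_dream) (simp_all add: p_char p_prime)
    then show ?case using Suc by simp
  qed (use p_ge_3 in simp)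
  show ?thesis by (cases k rule: int_cases2) (simp_all add: n p_odd power_minus_odd)
qed

lemma solve_mod:
  assumes "\<not> int p dvd k"
  shows "\<exists>i<p. int p dvd a + int i * k"
proof -
  have "coprime (int p) k"
    using assms p_prime by (intro prime_imp_coprime) auto
  then obtain u v where "u * int p + v * k = 1"
    using bezout_int[of "int p" k] by auto
  then have uv: "v * k = 1 - u * int p" by simp
  define i where "i = nat ((- a * v) mod int p)"
  have p0: "int p > 0" using p_ge_3 by simp
  have i: "int i = - a * v - int p * ((- a * v) div int p)"
    unfolding i_def using p0 by (simp add: minus_mult_div_eq_mod)
  have "a + int i * k = a - a * (v * k) - int p * ((- a * v) div int p) * k"
    unfolding i by (simp add: algebra_simps)
  also have "\<dots> = int p * (a * u - ((- a * v) div int p) * k)"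
    unfolding uv by (simp add: algebra_simps)
  finally have "int p dvd a + int i * k" by simp
  moreover have "i < p" unfolding i_def using p0 by (simp add: nat_less_iff)
  ultimately show ?thesis by blast
qed

text \<open>For p dividing k the index is divisible by p^2, hence so is the cubic product equal to
  six times the binomial. The second factor p is what settles p = 3, where 6 is not a unit.\<close>

lemma vir_cocycle_p_squared:
  assumes "int p dvd k"
  shows "vir_cocycle (int p * k) = (0::'a)"
proof -
  let ?b = "int_binomial (int p * k + 1) 3"
  have "int p * int p dvd int p * k" using assms by simp
  then have d: "int p * int p dvd 6 * ?b"
    unfolding int_binomial_cube by (simp add: dvd_mult dvd_mult2)
  have pp: "prime (int p)" using p_prime by simp
  have "int p dvd ?b"
  proof (cases "p = 3")
    case True
    then have "9 dvd 6 * ?b" using d by simp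
    moreover have "3 dvd b" if "9 dvd 6 * b" for b :: int using that by presburger
    ultimately show ?thesis using True by simp
  next
    case False
    have "\<not> int p dvd 6"
    proof
      assume "int p dvd 6"
      then have "int p dvd 2 * 3" by simp
      then have "int p dvd 2 \<or> int p dvd 3" using prime_dvd_multD[OF pp] by blast
      then have "p \<le> 3" using zdvd_imp_le by force
      then show False using False p_ge_3 by simp
    qed
    moreover have "int p dvd 6 * ?b" using d by (rule dvd_mult_left)
    ultimately show ?thesis using prime_dvd_multD[OF pp] by blast
  qed
  then show ?thesis by (simp add: vir_cocycle_def of_int_0_iff)
qed

text \<open>A central term created before the last step is killed by the next commutator, so at most
  the last step contributes one.\<close>

lemma ad_L_iter:
  "(ad (EL k) ^^ Suc j) (EL m) =
    env_scalar (\<Prod>i<Suc j. of_int (k - m - int i * k)) * EL (m + int (Suc j) * k) +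
    env_scalar ((\<Prod>i<j. of_int (k - m - int i * k)) * (if m + int (Suc j) * k = 0 then vir_cocycle k else 0)) *
      (env_gen C :: 'a vir_env)"
proof (induction j)
  have ad_add: "ad a (x + y) = ad a x + ad a y" for a x y :: "'a vir_env"
    by (simp add: ad_def algebra_simps)
  have ad_scale: "ad a (env_scalar s * x) = env_scalar s * ad a x" for a x :: "'a vir_env" and s
    by (simp add: ad_def mult_env_scalar mult.assoc right_diff_distrib)
  have ad_C: "ad a (env_gen C) = (0::'a vir_env)" for a
    by (simp add: ad_def env_gen_C_commute)
  have ad_L: "ad (EL k) (EL m) = env_scalar (of_int (k - m)) * EL (m + k) +
    env_scalar (if m + k = 0 then vir_cocycle k else 0) * (env_gen C :: 'a vir_env)" for m
    unfolding ad_def env_gen_L_L[of k m] by (simp add: env_scalar_of_int add.commute del: of_int_diff)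
  {
    case 0
    then show ?case by (simp add: ad_L del: of_int_diff)
  next
    case (Suc j)
    have e: "k - (m + int (Suc j) * k) = k - m - int (Suc j) * k" "m + int (Suc j) * k + k = m + int (Suc (Suc j)) * k"
      by (simp_all add: algebra_simps)
    show ?case
      unfolding funpow.simps(2)[of "Suc j"] o_apply Suc ad_add ad_scale ad_C ad_L e prod.lessThan_Suc[of _ "Suc j"] env_scalar_mult
      by (simp only: distrib_left mult.assoc ad_scale ad_C mult_zero_right add_0_right)
  }
qed

text \<open>Commuting with the p-th power of L_k is the p-fold commutator with L_k, which sends L_m
  to a product of p linear factors times L_(m+pk). It remains to compare this product with the
  structure constant of the correction term.\<close>

lemma restr_gen_commute_L: "EL m * restr_gen k = restr_gen k * (EL m :: 'a vir_env)"
proof -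
  let ?P = "\<Prod>i<p. of_int (k - m - int i * k) :: 'a"
  obtain j where j: "p = Suc j" "j > 1" using p_ge_3 by (cases p) auto
  have "EL k ^ p * EL m - EL m * EL k ^ p = (ad (EL k) ^^ p) (EL m :: 'a vir_env)"
    by (rule ad_prime_power[OF p_prime of_nat_p_env p_odd, symmetric])
  also have "\<dots> = env_scalar ?P * EL (m + int p * k)"
  proof -
    \<comment> \<open>A central term would force m = -pk; then the factor with i = 1, which is -m,
      vanishes in the field.\<close>
    have "(\<Prod>i<j. of_int (k - m - int i * k)) = (0::'a)" if "m + int p * k = 0"
    proof (rule prod_zero)
      have "int p dvd - m" using that by (metis add_eq_0_iff dvd_triv_left minus_minus)
      then show "\<exists>i\<in>{..<j}. of_int (k - m - int i * k) = (0::'a)"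
        using j by (intro bexI[of _ 1]) (simp_all add: of_int_0_iff del: of_int_minus)
    qed simp
    then have z: "(\<Prod>i<j. of_int (k - m - int i * k)) * (if m + int p * k = 0 then vir_cocycle k else 0) = (0::'a)"
      by (cases "m + int p * k = 0") (simp_all only: if_True if_False mult_zero_left mult_zero_right)
    show ?thesis using ad_L_iter[of j k m] unfolding j(1)[symmetric] z by simp
  qed
  also have "\<dots> = ad (if int p dvd k then EL (int p * k) else 0) (EL m)"
  proof (cases "int p dvd k")
    case True
    \<comment> \<open>All p factors equal -m, and (-m)^p = -m for elements of the prime
      field.\<close>
    have "of_int (k - m - int i * k) = (- of_int m :: 'a)" for i
      using True by (simp add: of_int_0_iff[THEN iffD2])
    then have P: "?P = of_int (int p * k - m)"
      using p_odd True by (simp add: power_p_of_int power_minus_odd of_int_0_iff[THEN iffD2])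
    have "ad (EL (int p * k)) (EL m :: 'a vir_env) = env_scalar (of_int (int p * k - m)) * EL (int p * k + m)"
      unfolding ad_def env_gen_L_L[of "int p * k" m] by (simp add: env_scalar_of_int vir_cocycle_p_squared[OF True] del: of_int_diff)
    then show ?thesis using True unfolding P by (simp add: add.commute)
  next
    case False
    \<comment> \<open>As k is invertible modulo p, the factors run through all residues and one of
      them is zero.\<close>
    obtain i where "i < p" "int p dvd (m - k) + int i * k" using solve_mod[OF False] by blast
    moreover have "k - m - int i * k = - ((m - k) + int i * k)" by simp
    ultimately have "of_int (k - m - int i * k) = (0::'a)" unfolding of_int_0_iff by (simp only: dvd_minus_iff)
    then have P0: "?P = 0" using \<open>i < p\<close> by (intro prod_zero) auto
    show ?thesis unfolding P0 using False by (simp add: ad_def)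
  qed
  finally show ?thesis
    unfolding restr_gen_def p_char left_diff_distrib right_diff_distrib
    by (simp only: ad_def diff_eq_eq eq_diff_eq add_diff_eq diff_add_eq) (simp only: add.commute)
qed

lemma restr_gen_central: "u * restr_gen k = restr_gen k * (u :: 'a vir_env)"
proof (induction u)
  case (add u v)
  then show ?case by (simp add: distrib_left distrib_right)
next
  case (scale a u)
  then show ?case by (simp add: mult_env_scalar mult.assoc)
next
  case (gen g u)
  have "env_gen g * restr_gen k = restr_gen k * (env_gen g :: 'a vir_env)"
    by (cases g) (simp_all add: restr_gen_commute_L env_gen_C_commute)
  with gen show ?case by (metis mult.assoc)
qed simp

lemma L_restr_gen_vacuum: "j \<ge> -1 \<Longrightarrow> EL j * restr_gen k \<in> vacuum_ideal c"
  unfolding restr_gen_central[of "EL j"] by (rule vacuum_ideal_L)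

text \<open>In the commutator of L_j with a mode only the elements L_(r-1) z with r >= 0 occur. For
  central z they equal z L_(r-1) and lie in the vacuum ideal. So the modes commute with the Virasoro
  action and are determined by their value at 1.\<close>

lemma quot_Y_restr_gen:
  assumes "vir_quot I c"
  shows "quot_Y I c (restr_gen k) q v - v * quot_Y I c (restr_gen k) q 1 \<in> I"
    and "quot_L I j (quot_Y I c (restr_gen k) q v) = quot_Y I c (restr_gen k) q (EL j * v)"
proof -
  interpret vir_quot I c by fact
  have "quot_Y I c (EL (int r - 1) * restr_gen k) s x = 0" for r s x
    using quot_Y_cong(1)[of "EL (int r - 1) * restr_gen k" 0] L_restr_gen_vacuum by simp
  then have "quot_L I j (quot_Y I c (restr_gen k) q v) = quot_Y I c (restr_gen k) q (quot_L I j v)" for j v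
    using quot_Y_commutator[of j "restr_gen k" q v] by simp
  then show L: "quot_L I j (quot_Y I c (restr_gen k) q v) = quot_Y I c (restr_gen k) q (EL j * v)"
    using quot_Y_cong(2)[OF quot_L_cong] by metis
  have L': "quot_L I j (quot_Y I c (restr_gen k) q v) = quot_Y I c (restr_gen k) q (EL j * v)" for j v
    using quot_Y_cong(2)[OF quot_L_cong] \<open>\<And>j v. _ = quot_Y I c (restr_gen k) q (quot_L I j v)\<close> by metis
  show "quot_Y I c (restr_gen k) q v - v * quot_Y I c (restr_gen k) q 1 \<in> I"
  proof (induction v)
    case one
    then show ?case by (simp add: I_zero)
  next
    case (add u v)
    from I_add[OF this] show ?case by (simp add: quot_Y_linear distrib_right algebra_simps)
  next
    case (scale a u)
    from I_mult[OF this, of "env_scalar a"] show ?case by (simp add: quot_Y_linear right_diff_distrib mult.assoc)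
  next
    case (gen g v)
    let ?y = "quot_Y I c (restr_gen k) q"
    have "?y (env_gen g * v) - env_gen g * ?y v \<in> I"
    proof (cases g)
      case (L j)
      then show ?thesis using quot_L_cong[of j "?y v"] by (simp add: L')
    next
      case C
      have "?y (env_gen C * v) = env_scalar c * ?y v"
        using quot_Y_cong(2)[OF charge, of "restr_gen k" q v] by (simp add: quot_Y_linear)
      then show ?thesis using C I_minus[OF charge, of "?y v"] by simp
    qed
    from I_add[OF this I_mult[OF gen, of "env_gen g"]] show ?case
      by (simp add: right_diff_distrib mult.assoc)
  qed
qed

lemma prime_char_lie_neg_lie: "prime_char_lie p (neg_lie :: 'a vir_env set)"
proof
  show "- x \<in> neg_lie" if "x \<in> neg_lie" for x :: "'a vir_env"
    using neg_lie_scale[OF that, of "- 1"] by (simp add: env_scalar_minus)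
qed (auto simp: p_prime p_odd of_nat_p_env neg_lie.zero neg_lie_add neg_lie_bracket)

text \<open>In a component a L_-n the operators L_(n-2) and L_(n-3) give (2n-2) L_-2 and (2n-3) L_-3
  up to the factor a. As L_-2 is nonzero on the vacuum, 2n - 2 = 0 in the field; then 2n - 3 is a
  unit, L_-3 is zero on the vacuum, and L_1 L_-3 yields 4 L_-2 = 0, impossible for odd p.\<close>

lemma neg_lie_singular:
  assumes x: "x \<in> neg_lie" and sing: "\<And>j. j \<ge> -1 \<Longrightarrow> EL j * x \<in> vacuum_ideal c"
  shows "x = (0::'a vir_env)"
proof -
  interpret V: vir_quot "vacuum_ideal c" c by (rule vir_quot_vacuum)
  have "hc n x = 0" for n
  proof (rule ccontr)
    assume nz: "hc n x \<noteq> 0"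
    then obtain a where n: "n \<ge> 2" and a: "hc n x = env_scalar a * EL (- n)"
      using neg_lie_hc[OF x] by blast
    have a0: "a \<noteq> 0" using nz a by auto
    have red: "of_int (j + n) * EL (j - n) \<in> vacuum_ideal c" if j: "j \<ge> -1" "j \<noteq> n" for j
    proof -
      have "hc (n - j) (EL j * x) \<in> vacuum_ideal c"
        using sing[OF j(1)] graded_vacuum_ideal by (auto simp: graded_set_def)
      then have "EL j * (env_scalar a * EL (- n)) \<in> vacuum_ideal c"
        using a by (simp add: hc_mult_left[OF env_gr_L])
      from vacuum_ideal_mult[OF this, of "env_scalar (inverse a)"]
      have "EL j * EL (- n) \<in> vacuum_ideal c"
        using a0 unfolding mult_env_scalar[of "env_gen _"] mult.assoc[of "env_scalar _", symmetric] env_scalar_mult[symmetric] by simp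
      then have "EL j * EL (- n) - EL (- n) * EL j \<in> vacuum_ideal c"
        using vacuum_ideal_L[OF j(1)] by (rule V.I_diff)
      then show ?thesis using env_gen_L_L[of j "- n", where ?'a = 'a] j(2) by simp
    qed
    have unit: "y \<in> vacuum_ideal c" if "of_int k * y \<in> vacuum_ideal c" "of_int k \<noteq> (0::'a)" for k and y :: "'a vir_env"
      using vacuum_ideal_mult[OF that(1), of "env_scalar (inverse (of_int k))"] that(2)
      unfolding env_scalar_of_int[symmetric, where ?'a = 'a] mult.assoc[symmetric] env_scalar_mult[symmetric] by simp
    have "of_int (2 * n - 2) * EL (- 2) \<in> vacuum_ideal c"
      using red[of "n - 2"] n by simp
    then have 1: "of_int (2 * n - 2) = (0::'a)" using unit L2_notin_vacuum_ideal by blast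
    have "EL (-3) \<in> vacuum_ideal c"
    proof (rule unit)
      show "of_int (2 * n - 3) * EL (-3) \<in> vacuum_ideal c" using red[of "n - 3"] n by simp
      have "of_int (2 * n - 3) = of_int (2 * n - 2) - (1::'a)" by simp
      then show "of_int (2 * n - 3) \<noteq> (0::'a)" using 1 by (simp del: of_int_diff of_int_mult)
    qed
    then have "EL 1 * EL (-3) - EL (-3) * EL 1 \<in> vacuum_ideal c"
      by (intro V.I_diff[OF V.I_mult vacuum_ideal_L]) simp_all
    then have "of_int 4 * EL (- 2) \<in> vacuum_ideal c"
      using env_gen_L_L[of 1 "- 3", where ?'a = 'a] by simp
    moreover have "of_int 4 \<noteq> (0::'a)"
    proof
      assume "of_int 4 = (0::'a)"
      then have "int p dvd 2 * 2" unfolding of_int_0_iff by simp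
      then have "int p dvd 2" using prime_dvd_multD[of "int p" 2 2] p_prime by simp
      then show False using p_ge_3 zdvd_imp_le by force
    qed
    ultimately show False using unit L2_notin_vacuum_ideal by blast
  qed
  then show ?thesis using hc_finite_sum(2)[of x] by simp
qed

text \<open>By \<open>vac_Y_creation\<close>, passing from Y(v,x)1 to Y(L_m v,x)1 amounts to left
  multiplication by this power series in x, the coefficient of x^k being the mode -k - 1. Powers of
  L_m thus turn into powers of one series.\<close>

definition U :: "int \<Rightarrow> 'a vir_env fps" where
  "U m = Abs_fps (\<lambda>i. env_scalar (sb1 m i) * EL (m - int i))"

lemma vac_Y_power_one:
  "vac_Y c (EL m ^ j) (- int k - 1) 1 - (U m ^ j) $ k \<in> vacuum_ideal c"
proof (induction j arbitrary: k)
  interpret V: vir_quot "vacuum_ideal c" c by (rule vir_quot_vacuum)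
  case 0
  show ?case using V.quot_proj_cong[of 1] by (cases k) (auto simp: vac_Y_def V.quot_Y_one V.I_zero)
next
  interpret V: vir_quot "vacuum_ideal c" c by (rule vir_quot_vacuum)
  case (Suc j)
  let ?d = "\<lambda>i. vac_Y c (EL m ^ j) (- int (k - i) - 1) 1"
  have d: "env_scalar s * quot_L (vacuum_ideal c) n (?d i) - env_scalar s * EL n * (U m ^ j) $ (k - i) \<in> vacuum_ideal c" for s n i
  proof -
    have "(quot_L (vacuum_ideal c) n (?d i) - EL n * ?d i) + EL n * (?d i - (U m ^ j) $ (k - i)) \<in> vacuum_ideal c"
      by (intro V.I_add V.quot_L_cong V.I_mult Suc)
    from V.I_mult[OF this, of "env_scalar s"] show ?thesis by (simp add: algebra_simps)
  qed
  have sm: "(\<And>i. f i \<in> vacuum_ideal c) \<Longrightarrow> sum f A \<in> vacuum_ideal c" for f :: "nat \<Rightarrow> 'a vir_env" and A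
    by (induction A rule: infinite_finite_induct) (auto intro: V.I_add V.I_zero)
  have "(\<Sum>i\<le>k. env_scalar (sb1 m i) * quot_L (vacuum_ideal c) (m - int i) (?d i) -
      env_scalar (sb1 m i) * EL (m - int i) * (U m ^ j) $ (k - i)) \<in> vacuum_ideal c"
    by (rule sm) (rule d)
  then show ?case
    by (simp add: vac_Y_creation(2) sum_subtractf fps_mult_nth U_def atLeast0AtMost)
qed

end

lemma env_scalar_mult_power: "(env_scalar s * x) ^ j = env_scalar (s ^ j) * x ^ j"
  by (induction j) (simp_all add: env_scalar_mult mult.assoc mult_env_scalar[of x])

context odd_prime_char
begin

text \<open>The coefficient in question agrees modulo the vacuum ideal with an explicit member of
  the restricted ideal: their difference lies in \<open>neg_lie\<close> and is singular, hence
  zero.\<close>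

lemma vac_Y_restr_gen:
  assumes "n \<ge> 2"
  shows "vac_Y c (restr_gen (- int n)) (- int k - 1) 1 \<in> restricted_ideal c"
proof -
  interpret V: vir_quot "vacuum_ideal c" c by (rule vir_quot_vacuum)
  interpret R: vir_quot "restricted_ideal c" c by (rule vir_quot_restricted)
  interpret N: prime_char_lie p "neg_lie :: 'a vir_env set" by (rule prime_char_lie_neg_lie)
  define m where "m = - int n"
  define r where "r = k div p"
  define s :: 'a where "s = sb1 m r"
  \<comment> \<open>The p-th power of the coefficient of index k/p, with L^p replaced by the central
    element; the discrepancy is a multiple of one L_-n and thus belongs to
    \<open>neg_lie\<close>.\<close>
  define t where "t = (if p dvd k then env_scalar (s ^ p) * restr_gen (m - int r) else 0)"
  define x where "x = (U m ^ p) $ k - (if int p dvd m then U (int p * m) $ k else 0)"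
  let ?D = "vac_Y c (restr_gen m) (- int k - 1) 1"
  have "vac_Y c (EL (int p * m)) (- int k - 1) 1 - U (int p * m) $ k \<in> vacuum_ideal c"
    using vac_Y_power_one[of "int p * m" 1 k] by simp
  from V.I_diff[OF vac_Y_power_one[of m p k] this] vac_Y_power_one[of m p k]
  have Dx: "?D - x \<in> vacuum_ideal c"
    by (simp add: restr_gen_def p_char x_def vac_Y_def V.quot_Y_diff algebra_simps)
  have gL: "env_scalar b * EL i \<in> neg_lie" if "i \<le> -2" for b :: 'a and i
    using neg_lie_gen[of "- i" b] that by simp
  have Ul: "U m $ i \<in> neg_lie" for i
    unfolding U_def fps_nth_Abs_fps by (rule gL) (use assms in \<open>simp add: m_def\<close>)
  have pm: "int p * i \<le> -2" if "i \<le> -2" for i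
  proof -
    have "int p * i \<le> int p * (-2)" using that by (intro mult_left_mono) auto
    then show ?thesis using p_ge_3 by simp
  qed
  have Up: "U (int p * m) $ i \<in> neg_lie" for i
    unfolding U_def fps_nth_Abs_fps by (rule gL) (use assms pm[of m] in \<open>simp add: m_def\<close>)
  have 1: "(U m ^ p) $ k - (if p dvd k then (U m $ r) ^ p else 0) \<in> neg_lie"
    unfolding r_def using Ul by (intro N.fps_prime_power) blast
  have 2: "(if p dvd k then (U m $ r) ^ p else 0) - t \<in> neg_lie"
  proof -
    have "(U m $ r) ^ p - env_scalar (s ^ p) * restr_gen (m - int r) =
      (if int p dvd m - int r then env_scalar (s ^ p) * EL (int p * (m - int r)) else 0)"
      by (simp add: U_def s_def env_scalar_mult_power restr_gen_def p_char right_diff_distrib)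
    moreover have "int p * (m - int r) \<le> -2" using assms by (intro pm) (simp add: m_def)
    ultimately show ?thesis by (auto simp: t_def neg_lie.zero gL)
  qed
  have 3: "(if int p dvd m then U (int p * m) $ k else 0) \<in> neg_lie"
    using Up neg_lie.zero by auto
  from N.Lie_diff[OF N.Lie_add[OF 1 2] 3] have xt: "x - t \<in> neg_lie" by (simp add: x_def algebra_simps)
  have "x - t = 0"
  proof (rule neg_lie_singular[OF xt])
    fix j :: int assume j: "j \<ge> -1"
    \<comment> \<open>L_j passes through the modes of a central element and reaches the vacuum,
      which it annihilates for j >= -1; t is singular as well, by
      \<open>L_restr_gen_vacuum\<close>.\<close>
    have "quot_L (vacuum_ideal c) j ?D = vac_Y c (restr_gen m) (- int k - 1) (EL j * 1)"
      unfolding vac_Y_def by (rule quot_Y_restr_gen(2)[OF vir_quot_vacuum])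
    also have "\<dots> = 0"
      using V.quot_Y_cong(2)[of "EL j" 0 "restr_gen m"] vacuum_ideal_L[OF j, of 1 c] by (simp add: vac_Y_def)
    finally have "EL j * ?D \<in> vacuum_ideal c"
      using V.quot_L_cong[of j ?D] V.I_minus by fastforce
    moreover have "EL j * t \<in> vacuum_ideal c"
      unfolding t_def using V.I_mult[OF L_restr_gen_vacuum[OF j]] V.I_zero
      by (simp add: mult_env_scalar[of "env_gen _"])
    ultimately have "EL j * ?D - EL j * t - EL j * (?D - x) \<in> vacuum_ideal c"
      using V.I_diff[OF V.I_diff V.I_mult[OF Dx]] by blast
    then show "EL j * (x - t) \<in> vacuum_ideal c" by (simp add: algebra_simps)
  qed
  moreover have "t \<in> restricted_ideal c"
  proof -
    have "m - int r = - int (n + r)" "n + r \<ge> 2" using assms by (auto simp: m_def)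
    then have "restr_gen (m - int r) \<in> {restr_gen (- int n) :: 'a vir_env | n. n \<ge> 2}" by (intro CollectI exI[of _ "n + r"]) simp
    then have "restr_gen (m - int r) \<in> restricted_ideal c"
      unfolding restricted_ideal_def by (intro left_ideal_gen) blast
    then show ?thesis by (simp add: t_def R.I_mult R.I_zero)
  qed
  moreover have "?D - x \<in> restricted_ideal c" using Dx vacuum_subset_restricted by blast
  ultimately have "(?D - x) + t \<in> restricted_ideal c" "x - t = 0" by (simp_all only: R.I_add)
  then have "?D \<in> restricted_ideal c" by simp
  then show ?thesis by (simp only: m_def)
qed

end

section \<open>Comparison of quotients and homogeneity of the modes\<close>

context vir_quot
begin

lemma quot_L_0 [simp]: "quot_L I n 0 = 0"
  by (simp add: quot_L_def quot_proj_kill[OF I_zero])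

lemma fs_quot_Y_L:
  "fs (\<lambda>i. env_scalar (a i) * quot_L I (k - int i) (quot_Y I c u (q + int i) x))"
  "fs (\<lambda>i. env_scalar (a i) * quot_Y I c u (q - int i) (quot_L I (int i - 1) x))"
proof -
  obtain N where "\<forall>n\<ge>N. quot_Y I c u n x = 0" using quot_Y_trunc by blast
  then show "fs (\<lambda>i. env_scalar (a i) * quot_L I (k - int i) (quot_Y I c u (q + int i) x))"
    unfolding fs_def by (intro exI[of _ "nat (N - q)"]) auto
  obtain N where "\<forall>n\<ge>N. EL n * x \<in> I" using trunc by blast
  then show "fs (\<lambda>i. env_scalar (a i) * quot_Y I c u (q - int i) (quot_L I (int i - 1) x))"
    unfolding fs_def by (intro exI[of _ "nat (N + 1)"]) (auto simp: quot_L_def quot_proj_kill)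
qed

lemma quot_Y_mem: "w \<in> I \<Longrightarrow> quot_Y I c u n w = 0"
  using quot_Y_cong(2)[of w 0] by simp

lemma quot_Y_mem_0: "quot_Y I c u n w \<in> I \<Longrightarrow> quot_Y I c u n w = 0"
  using quot_Y_proj[of u n w] by (simp add: quot_proj_kill)

end

text \<open>The fields on U/I induce those on U/J. The projections for I and J are chosen
  independently of each other, so the two can only agree modulo J.\<close>

lemma quot_Y_mono:
  assumes "vir_quot I c" "vir_quot J c" "I \<subseteq> J"
  shows "quot_Y I c u q x - quot_Y J c u q x \<in> J"
proof (induction u arbitrary: q x)
  interpret I: vir_quot I c by fact
  interpret J: vir_quot J c by fact
  {
    case one
    have "quot_proj I x - x \<in> J" using I.quot_proj_cong[of x] assms(3) by (rule rev_subsetD)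
    from J.I_diff[OF this J.quot_proj_cong[of x]] show ?case by (simp add: I.quot_Y_one J.quot_Y_one J.I_zero)
  next
    case (add u v)
    from J.I_add[OF add] show ?case by (simp add: I.quot_Y_linear J.quot_Y_linear algebra_simps)
  next
    case (scale a u)
    from J.I_mult[OF scale, of "env_scalar a"] show ?case
      by (simp add: I.quot_Y_linear J.quot_Y_linear right_diff_distrib)
  next
    case (gen g u)
    show ?case
    proof (cases g)
      case C
      from J.I_mult[OF gen, of "env_scalar c"] show ?thesis
        by (simp add: C I.quot_Y_C J.quot_Y_C right_diff_distrib)
    next
      case (L k)
      have LL: "quot_L I n y - quot_L J n y' \<in> J" if "y - y' \<in> J" for n y y'
      proof -
        have "quot_L I n y - EL n * y \<in> J" using I.quot_L_cong[of n y] assms(3) by (rule rev_subsetD)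
        from J.I_add[OF J.I_diff[OF this J.quot_L_cong[of n y']] J.I_mult[OF that, of "EL n"]] show ?thesis by (simp add: algebra_simps)
      qed
      have SA: "Sum_any f - Sum_any g \<in> J" if "fs f" "fs g" "\<And>i. f i - g i \<in> J" for f g :: "nat \<Rightarrow> 'a vir_env"
        unfolding SA_diff[OF that(1,2), symmetric] by (rule Sum_any_closed) (auto intro: J.I_zero J.I_add that(3))
      have YY: "quot_Y I c u n (quot_L I i x) - quot_Y J c u n (quot_L J i x) \<in> J" for n i
      proof -
        have "quot_Y J c u n (quot_L I i x) = quot_Y J c u n (quot_L J i x)"
          using LL[of x x] J.I_zero by (intro J.quot_Y_cong) simp
        then show ?thesis using gen[of n "quot_L I i x"] by simp
      qed
      let ?s = "\<lambda>i. env_scalar (sb1 k i)"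
      have 1: "(\<Sum>i. ?s i * quot_L I (k - int i) (quot_Y I c u (q + int i) x)) -
         (\<Sum>i. ?s i * quot_L J (k - int i) (quot_Y J c u (q + int i) x)) \<in> J"
        by (rule SA[OF I.fs_quot_Y_L(1) J.fs_quot_Y_L(1)]) (unfold right_diff_distrib[symmetric], intro J.I_mult LL gen)
      have 2: "(\<Sum>i. ?s i * quot_Y I c u (q + k + 1 - int i) (quot_L I (int i - 1) x)) -
         (\<Sum>i. ?s i * quot_Y J c u (q + k + 1 - int i) (quot_L J (int i - 1) x)) \<in> J"
        by (rule SA[OF I.fs_quot_Y_L(2) J.fs_quot_Y_L(2)]) (unfold right_diff_distrib[symmetric], intro J.I_mult YY)
      from J.I_diff[OF 1 J.I_mult[OF 2, of "env_scalar (eps (k + 1))"]] show ?thesis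
        unfolding L I.quot_Y_L J.quot_Y_L by (simp add: right_diff_distrib algebra_simps)
    qed
  }
qed

lemma vac_Y_ideal_right:
  assumes "vir_quot I c" "vacuum_ideal c \<subseteq> I" "v \<in> I"
  shows "vac_Y c u n v \<in> I"
  using quot_Y_mono[OF vir_quot_vacuum assms(1,2), of u n v] vir_quot.quot_Y_mem[OF assms(1,3)]
  by (simp add: vac_Y_def)

text \<open>\<open>quot_proj\<close> is an arbitrary projection that need not respect the grading;
  homogeneity can therefore be claimed modulo I only.\<close>

lemma quot_Y_graded:
  assumes "vir_quot I c" "graded_set I" "u \<in> env_gr m" "v \<in> env_gr n"
  shows "quot_Y I c u k v - hc (m + n - k - 1) (quot_Y I c u k v) \<in> I"
proof -
  interpret vir_quot I c by fact
  \<comment> \<open>The elements homogeneous of degree N modulo I; unlike \<open>env_gr N\<close>,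
    this set is closed under changes by elements of I.\<close>
  define H where "H N = {x. x - hc N x \<in> I}" for N
  have H0: "0 \<in> H N" for N by (simp add: H_def I_zero)
  have H_I: "x \<in> H N" if "y \<in> H N" "x - y \<in> I" for x y N
  proof -
    have "(x - y) + (y - hc N y) - hc N (x - y) \<in> I"
      using that assms(2) by (intro I_diff[OF I_add[OF that(2)]]) (simp_all add: H_def graded_set_def)
    then show ?thesis by (simp add: H_def hc_diff)
  qed
  have H_add: "x \<in> H N \<Longrightarrow> y \<in> H N \<Longrightarrow> x + y \<in> H N" for x y N
    unfolding H_def using I_add[of "x - hc N x" "y - hc N y"] by (simp add: hc_add algebra_simps)
  have H_diff: "x \<in> H N \<Longrightarrow> y \<in> H N \<Longrightarrow> x - y \<in> H N" for x y N
    unfolding H_def using I_diff[of "x - hc N x" "y - hc N y"] by (simp add: hc_diff algebra_simps)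
  have H_scale: "x \<in> H N \<Longrightarrow> env_scalar a * x \<in> H N" for a x N
    unfolding H_def using I_mult[of "x - hc N x" "env_scalar a"] by (simp add: hc_scale right_diff_distrib)
  have H_L: "quot_L I j x \<in> H (N - j)" if "x \<in> H N" for j x N
  proof (rule H_I[OF _ quot_L_cong])
    show "EL j * x \<in> H (N - j)"
      using that I_mult[of "x - hc N x" "EL j"]
      by (simp add: H_def hc_mult_left[OF env_gr_L] right_diff_distrib)
  qed
  have "\<forall>m k n. \<forall>v\<in>env_gr n. quot_Y I c (hc m u) k v \<in> H (m + n - k - 1)"
  proof (induction u)
    case one
    have "quot_proj I v \<in> H n" if "v \<in> env_gr n" for v n
      using that by (intro H_I[OF _ quot_proj_cong]) (simp add: H_def hc_gr I_zero)
    then show ?case by (auto simp: hc_gr[OF env_gr_one] quot_Y_one H0)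
  next
    case (add u v)
    then show ?case by (simp add: hc_add quot_Y_linear H_add)
  next
    case (scale a u)
    then show ?case by (simp add: hc_scale quot_Y_linear H_scale)
  next
    case (gen g u)
    show ?case
    proof (cases g)
      case C
      with gen show ?thesis by (simp add: hc_mult_left[OF env_gr_C] quot_Y_C H_scale)
    next
      case (L j)
      show ?thesis
      proof (intro allI ballI)
        fix m k n :: int and v :: "'a vir_env" assume v: "v \<in> env_gr n"
        let ?u = "hc (m + j) u" and ?N = "m + n - k - 1"
        have 1: "quot_L I (j - int i) (quot_Y I c ?u (k + int i) v) \<in> H ?N" for i
        proof -
          have "quot_Y I c ?u (k + int i) v \<in> H (m + j + n - (k + int i) - 1)" using gen v by blast
          from H_L[OF this, of "j - int i"] show ?thesis by (simp add: algebra_simps)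
        qed
        have 2: "quot_Y I c ?u (k + j + 1 - int i) (quot_L I (int i - 1) v) \<in> H ?N" for i
        proof -
          have "EL (int i - 1) * v \<in> env_gr (- (int i - 1) + n)" by (intro env_gr_mult v env_gr_L)
          then have "quot_Y I c ?u (k + j + 1 - int i) (EL (int i - 1) * v) \<in>
            H (m + j + (- (int i - 1) + n) - (k + j + 1 - int i) - 1)" using gen by blast
          moreover have "m + j + (- (int i - 1) + n) - (k + j + 1 - int i) - 1 = ?N" by simp
          ultimately show ?thesis unfolding quot_Y_cong(2)[OF quot_L_cong] by (simp only:)
        qed
        have "hc m (env_gen g * u) = EL j * ?u"
          unfolding L by (simp add: hc_mult_left[OF env_gr_L])
        then show "quot_Y I c (hc m (env_gen g * u)) k v \<in> H ?N"
          by (auto simp: quot_Y_L intro!: H_diff H_scale Sum_any_closed H0 H_add 1 2)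
      qed
    qed
  qed
  then have "quot_Y I c (hc m u) k v \<in> H (m + n - k - 1)" using assms(4) by blast
  then show ?thesis by (simp add: H_def hc_gr[OF assms(3)])
qed

lemma mult_of_int_left: "a * (of_int n * b) = of_int n * (a * (b :: 'r::ring_1))"
  by (metis mult.assoc mult_of_int_commute)

lemma L0_commute:
  assumes "u \<in> env_gr d"
  shows "EL 0 * u = u * EL 0 + env_scalar (of_int d) * (u :: 'a::field vir_env)"
proof -
  have "\<forall>n. EL 0 * hc n u = hc n u * EL 0 + env_scalar (of_int n) * hc n u"
  proof (induction u)
    case one
    show ?case by (simp add: hc_gr[OF env_gr_one])
  next
    case (add u v)
    then show ?case by (simp add: hc_add distrib_left distrib_right)
  next
    case (scale a u)
    then show ?case
      by (simp add: hc_scale mult_env_scalar[of "env_gen _"] mult.assoc distrib_left)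
        (simp add: mult.assoc[symmetric] env_scalar_mult[symmetric] mult.commute)
  next
    case (gen g u)
    show ?case
    proof (cases g)
      case (L j)
      show ?thesis
      proof
        fix n
        have e: "EL 0 * (EL j * y) = EL j * y * EL 0 + env_scalar (of_int n) * (EL j * y)"
          if "EL 0 * y = y * EL 0 + env_scalar (of_int (n + j)) * y" for y :: "'a vir_env"
          unfolding env_gen_L_L_mult[of 0 j] that distrib_left mult_env_scalar[of "EL j"] env_scalar_of_int
          by (simp add: mult.assoc algebra_simps mult_of_int_left)
        have "hc n (env_gen g * u) = EL j * hc (n + j) u"
          unfolding L by (simp add: hc_mult_left[OF env_gr_L])
        then show "EL 0 * hc n (env_gen g * u) = hc n (env_gen g * u) * EL 0 + env_scalar (of_int n) * hc n (env_gen g * u)"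
          using e gen by simp
      qed
    next
      case C
      with gen show ?thesis
        by (simp add: hc_mult_left[OF env_gr_C] env_gen_C_mult[of "EL 0"] distrib_left mult.assoc env_gen_C_mult[of "env_scalar _"])
    qed
  qed
  then show ?thesis using hc_gr[OF assms, of d] by metis
qed

lemma restr_gen_gr: "(restr_gen k :: 'a::field vir_env) \<in> env_gr (- (int CHAR('a) * k))"
  unfolding restr_gen_def
  using env_gr_power[OF env_gr_L[of k, where ?'a = 'a], of "CHAR('a)"] env_gr_L[of "int CHAR('a) * k", where ?'a = 'a]
  by (auto intro!: env_gr_diff)

lemma simple_idealI: "(\<And>a. chi c h (a * u) = 0) \<Longrightarrow> u \<in> simple_ideal c h"
  by (simp add: simple_ideal_def)

lemma simple_idealD: "u \<in> simple_ideal c h \<Longrightarrow> chi c h (a * u) = 0"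
  by (simp add: simple_ideal_def)

abbreviation simple_Y :: "'a::field \<Rightarrow> 'a \<Rightarrow> 'a vir_env \<Rightarrow> int \<Rightarrow> 'a vir_env \<Rightarrow> 'a vir_env" where
  "simple_Y c h \<equiv> quot_Y (simple_ideal c h) c"

section \<open>Restricted simple quotients of Verma modules\<close>

context
  fixes c h :: "'a::field"
begin

interpretation S: vir_quot "simple_ideal c h" c by (rule vir_quot_simple)

lemma simple_Y_negative:
  assumes "u \<in> env_gr d" "v \<in> env_gr n" "d + n < q + 1"
  shows "simple_Y c h u q v = 0"
proof (rule S.quot_Y_mem_0)
  let ?y = "simple_Y c h u q v"
  have "?y - hc (d + n - q - 1) ?y \<in> simple_ideal c h"
    by (rule quot_Y_graded[OF vir_quot_simple graded_simple_ideal assms(1,2)])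
  moreover have "hc (d + n - q - 1) ?y \<in> simple_ideal c h"
    using verma_low_degree[of "d + n - q - 1" ?y c h] verma_subset_simple assms(3) by auto
  ultimately have "(?y - hc (d + n - q - 1) ?y) + hc (d + n - q - 1) ?y \<in> simple_ideal c h" by (rule simple_ideal_closed)
  then show "?y \<in> simple_ideal c h" by simp
qed

text \<open>A mode of degree 0 preserves the lowest degree, which is one-dimensional by
  \<open>verma_low_degree\<close>.\<close>

lemma simple_Y_zero_mode:
  assumes "u \<in> env_gr d"
  shows "simple_Y c h u (d - 1) 1 =
    env_scalar (chi c h (simple_Y c h u (d - 1) 1)) * quot_proj (simple_ideal c h) 1"
proof -
  let ?y = "simple_Y c h u (d - 1) 1"
  have "?y - hc 0 ?y \<in> simple_ideal c h"
    using quot_Y_graded[OF vir_quot_simple graded_simple_ideal assms env_gr_one, of c h "d - 1"] by simp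
  moreover have "hc 0 ?y - env_scalar (chi c h ?y) \<in> simple_ideal c h"
    using verma_low_degree[of 0 ?y c h] verma_subset_simple by auto
  ultimately have "(?y - hc 0 ?y) + (hc 0 ?y - env_scalar (chi c h ?y)) \<in> simple_ideal c h" by (rule simple_ideal_closed)
  then have "?y - env_scalar (chi c h ?y) * 1 \<in> simple_ideal c h" by simp
  then have "quot_proj (simple_ideal c h) ?y = quot_proj (simple_ideal c h) (env_scalar (chi c h ?y) * 1)" by (rule S.quot_proj_eq)
  then show ?thesis unfolding S.quot_Y_proj S.quot_proj_scalar .
qed

lemma L0_simple: "EL 0 - env_scalar h \<in> simple_ideal c h"
  using verma_ideal_gens(2)[of 1 h c] verma_subset_simple by auto

text \<open>This rests on \<open>[L\<^sub>0, u\<^bsub>d-1\<^esub>] = (L\<^bsub>-1\<^esub>u)\<^sub>d + (L\<^sub>0u)\<^bsub>d-1\<^esub>\<close>, which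
  vanishes on the vector of lowest degree.\<close>

lemma simple_Y_recursion:
  assumes u: "u \<in> env_gr d" and m: "m \<le> -1"
  shows "simple_Y c h (EL m * u) (d - m - 1) 1 =
    env_scalar (- eps (m + 1) * (of_int d - of_int (m + 1) * h)) * simple_Y c h u (d - 1) 1"
proof -
  let ?Y = "simple_Y c h" and ?L = "quot_L (simple_ideal c h)"
  let ?y = "?Y u (d - 1) 1"
  have Lproj: "?L n x = ?L n x'" if "x - x' \<in> simple_ideal c h" for n x x'
    unfolding quot_L_def using simple_ideal_closed(4)[OF that, of "EL n"]
    by (intro S.quot_proj_eq) (simp add: right_diff_distrib)
  have L01: "?Y v q (?L 0 1) = env_scalar h * ?Y v q 1" for v q
  proof -
    have "(?L 0 1 - EL 0 * 1) + (EL 0 - env_scalar h) \<in> simple_ideal c h"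
      by (intro simple_ideal_closed(2) S.quot_L_cong L0_simple)
    then have "?Y v q (?L 0 1) = ?Y v q (env_scalar h * 1)" by (intro S.quot_Y_cong) simp
    then show ?thesis by (simp only: S.quot_Y_linear)
  qed
  have Ly: "?L 0 ?y = env_scalar h * ?y"
  proof -
    define t where "t = chi c h ?y"
    have y: "?y = env_scalar t * quot_proj (simple_ideal c h) 1" unfolding t_def by (rule simple_Y_zero_mode[OF u])
    have "?L 0 ?y = env_scalar t * ?L 0 1"
      unfolding y quot_L_def mult_env_scalar[of "env_gen _"] S.quot_proj_scalar
      using Lproj[OF S.quot_proj_cong[of 1], of 0] by (simp add: quot_L_def)
    also have "?L 0 1 = quot_proj (simple_ideal c h) (env_scalar h * 1)"
      unfolding quot_L_def by (rule S.quot_proj_eq) (use L0_simple in simp)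
    also have "env_scalar t * \<dots> = env_scalar h * (env_scalar t * quot_proj (simple_ideal c h) 1)"
      unfolding S.quot_proj_scalar by (simp only: mult.assoc[symmetric] env_scalar_mult[symmetric] mult.commute)
    finally show ?thesis unfolding y[symmetric] .
  qed
  have L0u: "?Y (EL 0 * u) q x = env_scalar (of_int d) * ?Y u q x" for q x
  proof -
    have "EL 0 * u - env_scalar (of_int d) * u \<in> vacuum_ideal c"
      unfolding L0_commute[OF u] using vacuum_ideal_L[of 0 u c] by simp
    then have "?Y (EL 0 * u) q x = ?Y (env_scalar (of_int d) * u) q x" by (rule S.quot_Y_cong)
    then show ?thesis by (simp only: S.quot_Y_linear)
  qed
  have "?L 0 ?y - ?Y u (d - 1) (?L 0 1) = ?Y (EL (-1) * u) d 1 + ?Y (EL 0 * u) (d - 1) 1"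
    unfolding S.quot_Y_commutator by (subst SA_bound[of 2]) (auto simp: bin_1_left numeral_2_eq_2)
  then have trans: "?Y (EL (-1) * u) d 1 = - (env_scalar (of_int d) * ?y)"
    unfolding Ly L01 L0u by (simp add: eq_neg_iff_add_eq_0)
  \<comment> \<open>The vector u_d 1 would have degree -1 and is zero, so the commutator with L_-1
    evaluates u_d on L_-1 1.\<close>
  have "?L (-1) (?Y u d 1) - ?Y u d (?L (-1) 1) = ?Y (EL (-1) * u) d 1"
    unfolding S.quot_Y_commutator by (subst SA_bound[of 1]) (auto simp: bin_0_left)
  then have neg: "?Y u d (?L (-1) 1) = env_scalar (of_int d) * ?y"
    using simple_Y_negative[OF u env_gr_one, of d] by (simp add: trans)
  have 1: "(\<Sum>i. env_scalar (sb1 m i) * ?L (m - int i) (?Y u (d - m - 1 + int i) 1)) = 0"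
    using simple_Y_negative[OF u env_gr_one] m by simp
  have b1: "sbin x 1 = (- of_int x :: 'a)" for x
    by (simp add: sbin_def bin_def int_binomial_def)
  \<comment> \<open>Only the terms of L_-1 and L_0 survive on the lowest weight vector; they are
    given by \<open>neg\<close> and by the eigenvalue h.\<close>
  have "?L (int i - 1) 1 = 0" if "i \<ge> 2" for i
    unfolding quot_L_def using verma_ideal_gens(3)[of "int i - 1" 1 c h] verma_subset_simple[of c h] that
    by (intro S.quot_proj_kill) auto
  then have 2: "(\<Sum>i. env_scalar (sb1 m i) * ?Y u (d - int i) (?L (int i - 1) 1)) =
     env_scalar (of_int d - of_int (m + 1) * h) * ?y"
    by (subst SA_bound[of 2])
      (simp_all add: numeral_2_eq_2 neg L01 b1[simplified] mult.assoc[symmetric] env_scalar_mult[symmetric]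
        distrib_right[symmetric] env_scalar_add[symmetric] algebra_simps)
  have "d - m - 1 + m + 1 - int i = d - int i" for i by simp
  then show ?thesis unfolding S.quot_Y_L 1 using 2
    by (simp only: env_scalar_minus env_scalar_mult mult.assoc mult_minus_left diff_0)
qed

end

context odd_prime_char
begin

lemma eps_power_p: "eps k ^ p = (eps k :: 'a)" and eps_p_mult: "eps (int p * k) = (eps k :: 'a)"
proof -
  obtain q where q: "p = 2 * q + 1" using p_odd by (elim oddE)
  show "eps k ^ p = (eps k :: 'a)" by (simp add: q power_mult power2_eq_square)
  have "int p * k = (int q * k + int q * k) + k" by (simp add: q algebra_simps)
  then show "eps (int p * k) = (eps k :: 'a)" by (simp only: eps_add eps_mult_self mult_1)
qed

lemma simple_Y_L_power:
  assumes "m \<le> -1"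
  shows "simple_Y c h (EL m ^ j) (- (int j * m) - 1) 1 =
    env_scalar (\<Prod>i<j. - eps (m + 1) * (of_int (- int i * m) - of_int (m + 1) * h)) * quot_proj (simple_ideal c h) 1"
proof (induction j)
  case 0
  interpret S: vir_quot "simple_ideal c h" c by (rule vir_quot_simple)
  show ?case by (simp add: S.quot_Y_one)
next
  case (Suc j)
  have "EL m ^ j \<in> env_gr (- int j * m)"
    using env_gr_power[OF env_gr_L[of m], of j] by simp
  have e: "- int j * m - m - 1 = - (int (Suc j) * m) - 1" "- int j * m - 1 = - (int j * m) - 1"
    by (simp_all add: algebra_simps)
  from simple_Y_recursion[OF \<open>_ \<in> env_gr _\<close> assms, of c h, unfolded e]
  have "simple_Y c h (EL m ^ Suc j) (- (int (Suc j) * m) - 1) 1 =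
    env_scalar (- eps (m + 1) * (of_int (- int j * m) - of_int (m + 1) * h)) *
    simple_Y c h (EL m ^ j) (- (int j * m) - 1) 1"
    by (simp only: power_Suc)
  then show ?case
    unfolding Suc prod.lessThan_Suc by (simp only: env_scalar_mult env_scalar_commute[of "prod _ _"] mult.assoc)
qed

text \<open>According to the degree d - q - 1 of the vector there are three cases: below 0 nothing
  exists, in degree 0 the scalar is computed, and above 0 the vector is singular and hence zero in a
  simple module.\<close>

lemma simple_Y_restr_gen_one:
  assumes h: "h = of_int a" and n: "n \<ge> 2"
  shows "simple_Y c h (restr_gen (- int n)) q 1 \<in> simple_ideal c h"
proof -
  interpret S: vir_quot "simple_ideal c h" c by (rule vir_quot_simple)
  define m where "m = - int n"
  have m1: "m \<le> -1" using n by (simp add: m_def)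
  define d where "d = - (int p * m)"
  define z :: "'a vir_env" where "z = restr_gen m"
  let ?y = "simple_Y c h z q 1"
  have z: "z \<in> env_gr d" using restr_gen_gr[of m, where ?'a = 'a] by (simp add: d_def p_char z_def)
  have gr: "?y - hc (d - q - 1) ?y \<in> simple_ideal c h"
    using quot_Y_graded[OF vir_quot_simple graded_simple_ideal z env_gr_one, of c h q] by simp
  consider "d < q + 1" | "d = q + 1" | "d > q + 1" by linarith
  then have "?y \<in> simple_ideal c h"
  proof cases
    case 1
    then show ?thesis using simple_Y_negative[OF z env_gr_one, of q c h] by (simp add: S.I_zero)
  next
    case 2
    let ?f = "\<lambda>i. - eps (m + 1) * (of_int (- int i * m) - of_int (m + 1) * h) :: 'a"
    have "?y = simple_Y c h (EL m ^ p) (- (int p * m) - 1) 1 -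
      (if int p dvd m then simple_Y c h (EL (int p * m) ^ 1) (- (int 1 * (int p * m)) - 1) 1 else 0)"
      using 2 by (auto simp: z_def restr_gen_def p_char S.quot_Y_diff d_def algebra_simps)
    also have "\<dots> = env_scalar ((\<Prod>i<p. ?f i) - (if int p dvd m then eps (int p * m + 1) * h else 0)) * quot_proj (simple_ideal c h) 1"
    proof -
      have pm: "int p * m \<le> -1" using m1 p_ge_3 mult_mono[of 1 "int p" 1 "- m"] by simp
      have "simple_Y c h (EL (int p * m) ^ 1) (- (int 1 * (int p * m)) - 1) 1 =
        env_scalar (eps (int p * m + 1) * h) * quot_proj (simple_ideal c h) 1" if "int p dvd m"
        unfolding simple_Y_L_power[OF pm] using that by (simp add: of_int_0_iff[THEN iffD2])
      then show ?thesis unfolding simple_Y_L_power[OF m1]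
        by (simp only: env_scalar_diff left_diff_distrib split: if_split) simp
    qed
    \<comment> \<open>If p divides m, all factors equal \<open>eps (m + 1) * h\<close>, which is its
      own p-th power and cancels against the correction. Otherwise the factors run through an
      arithmetic progression of length p in the prime field, and one of them is zero.\<close>
    also have "(\<Prod>i<p. ?f i) - (if int p dvd m then eps (int p * m + 1) * h else 0) = 0"
    proof (cases "int p dvd m")
      case True
      then have "?f i = eps (m + 1) * h" for i by (simp add: of_int_0_iff[THEN iffD2])
      then have "(\<Prod>i<p. ?f i) = eps (m + 1) * h"
        by (simp only: prod_constant card_lessThan power_mult_distrib eps_power_p h power_p_of_int)
      then show ?thesis using True by (simp only: eps_add eps_p_mult if_True) simp
    next
      case False
      then have "\<not> int p dvd - m" by simp
      then obtain i where i: "i < p" "int p dvd (- (m + 1) * a) + int i * - m" using solve_mod by blast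
      then have "of_int ((- (m + 1) * a) + int i * - m) = (0::'a)" by (simp only: of_int_0_iff)
      moreover have "of_int (- int i * m) - of_int (m + 1) * h = of_int ((- (m + 1) * a) + int i * - m)"
        by (simp add: h algebra_simps)
      ultimately have "?f i = 0" by (simp only: mult_zero_right)
      then have "(\<Prod>i<p. ?f i) = 0" using i(1) by (intro prod_zero) auto
      then show ?thesis using False by (simp only: if_False diff_0_right)
    qed
    finally show ?thesis by (simp add: S.I_zero)
  next
    case 3
    \<comment> \<open>An element b of degree -e lies in the simple ideal. As the mode commutes with
      U, b times the vector is the mode applied to b, hence zero, and \<open>chi\<close> detects
      nothing.\<close>
    let ?e = "d - q - 1"
    have "hc ?e ?y \<in> simple_ideal c h"
    proof (rule simple_idealI)
      fix b :: "'a vir_env"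
      let ?b = "hc (- ?e) b"
      have b: "?b \<in> simple_ideal c h"
        using verma_low_degree[of "- ?e" b c h] verma_subset_simple 3 by auto
      have "?b * ?y \<in> simple_ideal c h"
        using S.I_minus[OF quot_Y_restr_gen(1)[of "simple_ideal c h" m q ?b, OF vir_quot_simple]] S.quot_Y_mem[OF b, of z q] by (simp add: z_def)
      from S.I_diff[OF this S.I_mult[OF gr, of ?b]] have "?b * hc ?e ?y \<in> simple_ideal c h"
        by (simp add: algebra_simps)
      from simple_idealD[OF this, of 1] have "chi c h (?b * hc ?e ?y) = 0" by simp
      moreover have "chi c h (b * hc ?e ?y) = chi c h (hc 0 (b * hc ?e ?y))" by (simp add: chi_hc)
      ultimately show "chi c h (b * hc ?e ?y) = 0" by (simp add: hc_mult_right[OF hc_in_gr])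
    qed
    from S.I_add[OF gr this] show ?thesis by simp
  qed
  then show ?thesis by (simp add: z_def m_def)
qed

lemma simple_Y_restricted:
  assumes "h \<in> prime_subfield" "u \<in> restricted_ideal c"
  shows "simple_Y c h u q x = 0"
proof -
  interpret S: vir_quot "simple_ideal c h" c by (rule vir_quot_simple)
  obtain a where a: "h = of_int (int a)" using assms(1) by (auto simp: prime_subfield_def)
  show ?thesis
  proof (rule S.quot_Y_restricted[OF _ assms(2)])
    fix n :: nat and q x assume "n \<ge> 2"
    then have "simple_Y c h (restr_gen (- int n)) q 1 \<in> simple_ideal c h"
      by (rule simple_Y_restr_gen_one[OF a])
    from S.I_add[OF quot_Y_restr_gen(1)[of "simple_ideal c h" "- int n" q x, OF vir_quot_simple] S.I_mult[OF this, of x]]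
    show "simple_Y c h (restr_gen (- int n)) q x = 0"
      by (intro S.quot_Y_mem_0) simp
  qed
qed

text \<open>By centrality it suffices to know the modes of the z_n on the vacuum, which
  \<open>vac_Y_restr_gen\<close> provides. With \<open>vac_Y_ideal_right\<close> this makes the
  restricted ideal two-sided for the vertex product.\<close>

lemma vac_Y_ideal_left:
  assumes "u \<in> restricted_ideal c"
  shows "vac_Y c u q v \<in> restricted_ideal c"
proof -
  interpret R: vir_quot "restricted_ideal c" c by (rule vir_quot_restricted)
  interpret V: vir_quot "vacuum_ideal c" c by (rule vir_quot_vacuum)
  have cmp: "vac_Y c u q v - quot_Y (restricted_ideal c) c u q v \<in> restricted_ideal c" for u q v
    unfolding vac_Y_def by (rule quot_Y_mono[OF vir_quot_vacuum vir_quot_restricted vacuum_subset_restricted])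
  have "quot_Y (restricted_ideal c) c u q v = 0"
  proof (rule R.quot_Y_restricted[OF _ assms])
    fix n :: nat and q x assume n: "n \<ge> 2"
    let ?z = "restr_gen (- int n) :: 'a vir_env"
    have "vac_Y c ?z q 1 \<in> restricted_ideal c"
    proof (cases "q \<ge> 0")
      case True
      then show ?thesis using vac_Y_creation(1)[of c ?z q] by (simp add: R.I_zero)
    next
      case False
      then have "q = - int (nat (- q - 1)) - 1" by simp
      then show ?thesis using vac_Y_restr_gen[OF n] by metis
    qed
    from R.I_diff[OF this cmp[of ?z q 1]] have "quot_Y (restricted_ideal c) c ?z q 1 \<in> restricted_ideal c" by simp
    from R.I_add[OF quot_Y_restr_gen(1)[of "restricted_ideal c" "- int n" q x, OF vir_quot_restricted] R.I_mult[OF this, of x]]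
    show "quot_Y (restricted_ideal c) c ?z q x = 0" by (intro R.quot_Y_mem_0) simp
  qed
  with cmp[of u q v] show ?thesis by simp
qed

end

section \<open>Graded spaces presented as quotients of the enveloping algebra\<close>

lemma scalars_simps [simp]:
  "carrier (scalars :: 'a::field ring) = UNIV" "add (scalars :: 'a ring) = (+)"
  "monoid.mult (scalars :: 'a ring) = (*)" "one (scalars :: 'a ring) = 1" "zero (scalars :: 'a ring) = 0"
  by (simp_all add: ring_of_type_algebra_def)

text \<open>The spaces of the definitions consist of cosets, or of cosets of cosets, in U. The
  locale hides this behind a surjection q from U whose kernel is the graded left ideal I, so that
  all later work takes place in U.\<close>

locale env_quot =
  fixes M :: "('a::field, 'w, 'm) graded_space_scheme" and q :: "'a vir_env \<Rightarrow> 'w" and I :: "'a vir_env set"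
  assumes car: "carrier M = range q"
    and q_eq_iff: "q u = q v \<longleftrightarrow> u - v \<in> I"
    and q_add: "q u \<oplus>\<^bsub>M\<^esub> q v = q (u + v)"
    and q_smult: "a \<odot>\<^bsub>M\<^esub> q u = q (env_scalar a * u)"
    and q_zero: "\<zero>\<^bsub>M\<^esub> = q 0"
    and q_gr: "gr M n = q ` env_gr n"
    and I_mult: "x \<in> I \<Longrightarrow> u * x \<in> I"
    and I_graded: "graded_set I"
begin

lemma I_iff: "u \<in> I \<longleftrightarrow> q u = \<zero>\<^bsub>M\<^esub>"
  using q_eq_iff[of u 0] by (simp add: q_zero)

lemma I_zero: "0 \<in> I" by (simp add: I_iff q_zero)

lemma I_add: "x \<in> I \<Longrightarrow> y \<in> I \<Longrightarrow> x + y \<in> I"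
  using q_add[of x y] q_add[of 0 0] by (simp add: I_iff q_zero)

lemma I_diff: "x \<in> I \<Longrightarrow> y \<in> I \<Longrightarrow> x - y \<in> I"
  using I_add[of x "- 1 * y"] I_mult[of y "- 1"] by simp

lemma I_sum: "(\<And>i. i \<in> A \<Longrightarrow> f i \<in> I) \<Longrightarrow> sum f A \<in> I"
  by (induction A rule: infinite_finite_induct) (simp_all add: I_zero I_add)

lemma q_carrier [simp]: "q u \<in> carrier M" by (simp add: car)

lemma carrier_cases: assumes "w \<in> carrier M" obtains u where "w = q u"
  using assms by (auto simp: car)

lemma vector_space: "vector_space M"
proof (rule moduleI)
  show "cring (scalars :: 'a ring)" by (rule cring_from_type_algebra)
  show "abelian_group M"
  proof (rule abelian_groupI)
    fix x assume "x \<in> carrier M"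
    then obtain u where "x = q u" by (rule carrier_cases)
    then show "\<exists>y\<in>carrier M. y \<oplus>\<^bsub>M\<^esub> x = \<zero>\<^bsub>M\<^esub>"
      by (intro bexI[of _ "q (- u)"]) (simp_all add: q_add q_zero)
  qed (auto simp: car q_add q_zero add_ac)
qed (auto simp: car q_add q_smult env_scalar_add env_scalar_mult distrib_left distrib_right mult.assoc)

sublocale Mod: Module.module "scalars :: 'a ring" M by (rule vector_space)

lemma q_minus: "\<ominus>\<^bsub>M\<^esub> q u = q (- u)"
  by (rule Mod.minus_equality) (simp_all add: q_add q_zero)

lemma q_diff: "q u \<ominus>\<^bsub>M\<^esub> q v = q (u - v)"
  by (simp add: a_minus_def q_minus q_add)

lemma finsum_q: "finite A \<Longrightarrow> finsum M (\<lambda>i. q (g i)) A = q (sum g A)"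
  by (induction A rule: finite_induct) (simp_all add: q_zero q_add)

lemma fsum_q:
  assumes "finite A" "\<And>i. i \<notin> A \<Longrightarrow> g i \<in> I"
  shows "fsum M (\<lambda>i. q (g i)) = q (sum g A)"
proof -
  let ?B = "{i. q (g i) \<noteq> \<zero>\<^bsub>M\<^esub>}"
  have B: "?B \<subseteq> A" using assms(2) by (auto simp: I_iff)
  have "fsum M (\<lambda>i. q (g i)) = q (sum g ?B)"
    unfolding fsum_def by (rule finsum_q) (rule finite_subset[OF B assms(1)])
  also have "sum g A = sum g (A - ?B) + sum g ?B" using sum.subset_diff[OF B assms(1)] .
  then have "q (sum g ?B) = q (sum g A)"
    using I_sum[of "A - ?B" "\<lambda>i. - 1 * g i"] I_mult[of _ "- 1"] unfolding q_eq_iff by (simp add: I_iff sum_negf)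
  finally show ?thesis .
qed

lemma fsum_SA: "fs g \<Longrightarrow> fsum M (\<lambda>i. q (g i)) = q (Sum_any g)"
  unfolding Sum_any.expand_set by (rule fsum_q) (auto simp: fs_iff I_zero)

lemma vector_subspace_image:
  assumes "0 \<in> J" "\<And>x y. x \<in> J \<Longrightarrow> y \<in> J \<Longrightarrow> x + y \<in> J" "\<And>a x. x \<in> J \<Longrightarrow> env_scalar a * x \<in> J"
  shows "vector_subspace (q ` J) M"
proof (rule Mod.submoduleI)
  show "\<ominus>\<^bsub>M\<^esub> x \<in> q ` J" if "x \<in> q ` J" for x
    using that assms(3)[of _ "- 1"] by (auto simp: q_minus env_scalar_minus)
qed (use assms in \<open>auto simp: q_zero q_add q_smult\<close>)

lemma vector_subspace_preimage:
  assumes "vector_subspace N M"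
  shows "N = q ` {u. q u \<in> N}" "q 0 \<in> N" "q u \<in> N \<Longrightarrow> q v \<in> N \<Longrightarrow> q (u + v) \<in> N" "q u \<in> N \<Longrightarrow> q (env_scalar a * u) \<in> N"
proof -
  have N: "N \<subseteq> carrier M" using Mod.submoduleE(1)[OF assms] .
  then show "N = q ` {u. q u \<in> N}" by (auto simp: car)
  have s: "a \<odot>\<^bsub>M\<^esub> x \<in> N" if "x \<in> N" for a x using Mod.submoduleE(4)[OF assms] that by simp
  show "q (env_scalar a * u) \<in> N" if "q u \<in> N" for u a using s[OF that, of a] by (simp add: q_smult)
  show "q u \<in> N \<Longrightarrow> q v \<in> N \<Longrightarrow> q (u + v) \<in> N"
    using Mod.submoduleE(5)[OF assms, of "q u" "q v"] by (simp add: q_add)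
  obtain u where "q u \<in> N" using Mod.submoduleE(2)[OF assms] N by (auto simp: car)
  from s[OF this, of 0] show "q 0 \<in> N" by (simp add: q_smult)
qed

lemma component_unique:
  assumes "\<And>n. f n \<in> gr M n" "finite {n. f n \<noteq> \<zero>\<^bsub>M\<^esub>}" "q u = fsum M f"
  shows "f n = q (hc n u)"
proof -
  have "\<exists>x. x \<in> env_gr n \<and> f n = q x \<and> (f n = \<zero>\<^bsub>M\<^esub> \<longrightarrow> x = 0)" for n
  proof (cases "f n = \<zero>\<^bsub>M\<^esub>")
    case False
    then show ?thesis using assms(1)[of n] by (auto simp: q_gr)
  qed (auto intro: exI[of _ 0] simp: q_zero)
  then obtain g where g: "\<And>n. g n \<in> env_gr n" "\<And>n. f n = q (g n)" "\<And>n. f n = \<zero>\<^bsub>M\<^esub> \<Longrightarrow> g n = 0" by metis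
  have A: "finite {n. g n \<noteq> 0}" by (rule finite_subset[OF _ assms(2)]) (use g(3) in auto)
  have "q u = q (sum g {n. g n \<noteq> 0})"
    using assms(3) unfolding g(2) by (subst (asm) fsum_q[OF A]) (auto simp: I_zero)
  then have "hc n (u - sum g {n. g n \<noteq> 0}) \<in> I" using I_graded by (simp add: q_eq_iff graded_set_def)
  moreover have "hc n (sum g {n. g n \<noteq> 0}) = g n"
  proof -
    have s: "hc n (sum g A) = (\<Sum>m\<in>A. hc n (g m))" for A
      by (induction A rule: infinite_finite_induct) (simp_all add: hc_add)
    show ?thesis unfolding s hc_gr[OF g(1)] using A by (simp add: sum.delta')
  qed
  ultimately show ?thesis using I_diff[OF I_zero] by (simp add: g(2) q_eq_iff hc_diff) (metis diff_0 minus_diff_eq)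
qed

lemma component_exists:
  "finite {n. q (hc n u) \<noteq> \<zero>\<^bsub>M\<^esub>}" "q u = fsum M (\<lambda>n. q (hc n u))"
proof -
  show "finite {n. q (hc n u) \<noteq> \<zero>\<^bsub>M\<^esub>}"
    by (rule finite_subset[OF _ hc_finite_sum(1)[of u]]) (auto simp: q_zero)
  show "q u = fsum M (\<lambda>n. q (hc n u))"
    by (subst fsum_q[OF hc_finite_sum(1)[of u]]) (auto simp: I_zero hc_finite_sum(2)[symmetric])
qed

lemma direct_sum_image:
  assumes "graded_set J" "0 \<in> J" "\<And>x y. x \<in> J \<Longrightarrow> y \<in> J \<Longrightarrow> x + y \<in> J"
    "\<And>a x. x \<in> J \<Longrightarrow> env_scalar a * x \<in> J" "I \<subseteq> J"
  shows "direct_sum M (q ` J) (\<lambda>n. q ` J \<inter> gr M n)"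
  unfolding direct_sum_def
proof (intro conjI allI ballI)
  show "vector_subspace (q ` J) M" by (rule vector_subspace_image[OF assms(2-4)])
  \<comment> \<open>A vector of the image with a homogeneous representative v and another one u in J
    has v itself in J, since u - v lies in I and I is contained in J.\<close>
  have e: "q ` J \<inter> gr M n = q ` (J \<inter> env_gr n)" for n
  proof -
    have "q u \<in> q ` (J \<inter> env_gr n)" if "u \<in> J" "v \<in> env_gr n" "q u = q v" for u v
    proof -
      have "u - (u - v) \<in> J" unfolding diff_conv_add_uminus
        using that assms(3)[OF that(1), of "- (u - v)"] assms(4)[of "u - v" "- 1"] assms(5)
        by (auto simp: q_eq_iff env_scalar_minus)
      with that show ?thesis by (auto intro!: imageI simp: that(3))
    qed
    then show ?thesis unfolding q_gr by blast
  qed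
  show "vector_subspace (q ` J \<inter> gr M n) M" for n
    unfolding e by (rule vector_subspace_image) (use assms in \<open>auto intro: env_gr_add env_gr_scale\<close>)
  fix w assume "w \<in> q ` J"
  then obtain u where u: "u \<in> J" "w = q u" by blast
  show "\<exists>!f. (\<forall>n. f n \<in> q ` J \<inter> gr M n) \<and> finite {n. f n \<noteq> \<zero>\<^bsub>M\<^esub>} \<and> w = fsum M f"
  proof (rule ex1I[of _ "\<lambda>n. q (hc n u)"])
    show "(\<forall>n. q (hc n u) \<in> q ` J \<inter> gr M n) \<and> finite {n. q (hc n u) \<noteq> \<zero>\<^bsub>M\<^esub>} \<and> w = fsum M (\<lambda>n. q (hc n u))"
      using component_exists[of u] u assms(1) by (auto simp: q_gr graded_set_def)
  qed (use component_unique u in fastforce)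
qed simp

lemma is_graded: "is_graded M"
proof -
  have "gr M n \<subseteq> carrier M" for n by (auto simp: q_gr car)
  then have "(\<lambda>n. carrier M \<inter> gr M n) = gr M" by blast
  then show ?thesis using direct_sum_image[of UNIV] by (simp add: is_graded_def car graded_set_def)
qed

lemma graded_subspace_image:
  assumes "graded_set J" "0 \<in> J" "\<And>x y. x \<in> J \<Longrightarrow> y \<in> J \<Longrightarrow> x + y \<in> J"
    "\<And>a x. x \<in> J \<Longrightarrow> env_scalar a * x \<in> J" "I \<subseteq> J"
  shows "graded_subspace (q ` J) M"
  unfolding graded_subspace_def by (rule direct_sum_image) (use assms in auto)

lemma graded_subspace_preimage:
  assumes "graded_subspace N M"
  shows "vector_subspace N M" "graded_set {u. q u \<in> N}" "I \<subseteq> {u. q u \<in> N}"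
proof -
  show N: "vector_subspace N M" using assms by (simp add: graded_subspace_def direct_sum_def)
  from vector_subspace_preimage(2)[OF N] show "I \<subseteq> {u. q u \<in> N}" by (auto simp: I_iff q_zero)
  show "graded_set {u. q u \<in> N}"
    unfolding graded_set_def
  proof (clarify)
    fix u n assume "q u \<in> N"
    then obtain f where "\<forall>n. f n \<in> N \<inter> gr M n" "finite {n. f n \<noteq> \<zero>\<^bsub>M\<^esub>}" "q u = fsum M f"
      using assms unfolding graded_subspace_def direct_sum_def by blast
    then show "q (hc n u) \<in> N" using component_unique[of f u n] by (metis IntD1 IntD2)
  qed
qed

lemma coset: "q ` J +>\<^bsub>M\<^esub> q u = q ` {v. v - u \<in> J}"
proof -
  have "q ` J +>\<^bsub>M\<^esub> q u = q ` {x + u | x. x \<in> J}"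
    unfolding a_r_coset_def' by (auto simp: q_add)
  also have "{x + u | x. x \<in> J} = {v. v - u \<in> J}"
    by (auto intro: exI[of _ "_ - u"])
  finally show ?thesis .
qed

end

locale env_subquot = env_quot M q I
  for M :: "('a::field, 'w, 'm) graded_space_scheme" and q I +
  fixes J :: "'a vir_env set"
  assumes IJ: "I \<subseteq> J" and J_add: "x \<in> J \<Longrightarrow> y \<in> J \<Longrightarrow> x + y \<in> J" and J_mult: "x \<in> J \<Longrightarrow> u * x \<in> J"
    and J_graded: "graded_set J"
begin

definition qJ :: "'a vir_env \<Rightarrow> 'w set" where "qJ u = q ` J +>\<^bsub>M\<^esub> q u"

lemma J_zero: "0 \<in> J" using I_zero IJ by blast

lemma J_minus: "x \<in> J \<Longrightarrow> - x \<in> J" using J_mult[of x "- 1"] by simp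

lemma q_in_qJ: "q v \<in> qJ u \<longleftrightarrow> v - u \<in> J"
proof
  assume "q v \<in> qJ u"
  then obtain x where x: "x - u \<in> J" "v - x \<in> I" unfolding qJ_def coset by (auto simp: q_eq_iff)
  then have "(v - x) + (x - u) \<in> J" using IJ J_add by blast
  then show "v - u \<in> J" by simp
qed (auto simp: qJ_def coset)

lemma qJ_eq: "qJ u = q ` {v. v - u \<in> J}" by (simp add: qJ_def coset)

lemma qJ_eq_iff: "qJ u = qJ v \<longleftrightarrow> u - v \<in> J"
proof
  assume "qJ u = qJ v"
  then show "u - v \<in> J" using q_in_qJ[of u u] q_in_qJ[of u v] J_zero by simp
next
  assume d: "u - v \<in> J"
  have "x - u \<in> J \<longleftrightarrow> x - v \<in> J" for x
    using J_add[of "x - u" "u - v"] J_add[of "x - v" "- (u - v)"] J_minus[OF d] d by auto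
  then show "qJ u = qJ v" by (simp add: qJ_eq)
qed

lemma qJ_add: "qJ u <+>\<^bsub>M\<^esub> qJ v = qJ (u + v)"
proof -
  have "qJ u <+>\<^bsub>M\<^esub> qJ v = q ` {x + y | x y. x - u \<in> J \<and> y - v \<in> J}"
    unfolding set_add_def' qJ_eq by (auto simp: q_add)
  also have "{x + y | x y. x - u \<in> J \<and> y - v \<in> J} = {x. x - (u + v) \<in> J}"
  proof (intro equalityI subsetI)
    fix z assume "z \<in> {x + y | x y. x - u \<in> J \<and> y - v \<in> J}"
    then obtain x y where "z = x + y" "x - u \<in> J" "y - v \<in> J" by blast
    with J_add[of "x - u" "y - v"] show "z \<in> {x. x - (u + v) \<in> J}" by (simp add: algebra_simps)
  next
    fix x assume "x \<in> {x. x - (u + v) \<in> J}"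
    then show "x \<in> {x + y | x y. x - u \<in> J \<and> y - v \<in> J}"
      by (intro CollectI exI[of _ "x - v"] exI[of _ v]) (simp add: J_zero algebra_simps)
  qed
  finally show ?thesis by (simp add: qJ_eq)
qed

text \<open>\<open>quot_map\<close> is a union over all elements of a coset; it collapses to a
  single coset when the lift F respects congruence modulo J.\<close>

lemma quot_map_qJ:
  assumes "\<And>v. v - u \<in> J \<Longrightarrow> f (q v) = q (F v)" "\<And>v. v - u \<in> J \<Longrightarrow> F v - F u \<in> J"
  shows "quot_map M (q ` J) f (qJ u) = qJ (F u)"
proof -
  have "q ` J +>\<^bsub>M\<^esub> f x = qJ (F u)" if x: "x \<in> qJ u" for x
  proof -
    obtain v where v: "x = q v" "v - u \<in> J" using x by (auto simp: qJ_eq)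
    then have "q ` J +>\<^bsub>M\<^esub> f x = qJ (F v)" by (simp add: assms(1) qJ_def)
    then show ?thesis using assms(2)[OF v(2)] qJ_eq_iff by simp
  qed
  moreover have "q u \<in> qJ u" by (simp add: q_in_qJ J_zero)
  ultimately show ?thesis unfolding quot_map_def by auto
qed

lemma env_quot_quot_space: "env_quot (quot_space M (q ` J)) qJ J"
proof
  show "carrier (quot_space M (q ` J)) = range qJ"
    by (auto simp: quot_space_def A_RCOSETS_def' car qJ_def)
  show "qJ u \<oplus>\<^bsub>quot_space M (q ` J)\<^esub> qJ v = qJ (u + v)" for u v
    by (simp add: quot_space_def qJ_add)
  have "quot_map M (q ` J) ((\<odot>\<^bsub>M\<^esub>) a) (qJ u) = qJ (env_scalar a * u)" for a u
    by (rule quot_map_qJ) (auto simp: q_smult right_diff_distrib[symmetric] J_mult)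
  then show "a \<odot>\<^bsub>quot_space M (q ` J)\<^esub> qJ u = qJ (env_scalar a * u)" for a u
    by (simp add: quot_space_def)
  show "\<zero>\<^bsub>quot_space M (q ` J)\<^esub> = qJ 0"
    by (simp add: quot_space_def qJ_eq)
  show "gr (quot_space M (q ` J)) n = qJ ` env_gr n" for n
    by (auto simp: quot_space_def q_gr qJ_def)
qed (auto simp: qJ_eq_iff J_mult J_graded)

end

lemma env_quot_cong:
  assumes "env_quot M q I" "carrier N = carrier M" "add N = add M" "zero N = zero M"
    "module.smult N = module.smult M" "gr N = gr M"
  shows "env_quot N q I"
  using assms by (simp add: env_quot_def)

locale vir_mod_quot = env_quot M q I
  for M :: "('a::field, 'w, 'm) vir_mod_scheme" and q I +
  assumes q_vir: "vir M g (q u) = q (env_gen g * u)"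
begin

lemma vir_submodule_preimage:
  assumes "vir_submodule N M" and N: "q u \<in> N"
  shows "q (a * u) \<in> N"
proof (induction a)
  case (add a b)
  then show ?case using vector_subspace_preimage(3)[of N] assms(1) by (simp add: vir_submodule_def distrib_right)
next
  case (scale s a)
  then show ?case using vector_subspace_preimage(4)[of N] assms(1) by (simp add: vir_submodule_def mult.assoc)
next
  case (gen g a)
  then have "vir M g (q (a * u)) \<in> N" using assms(1) by (simp add: vir_submodule_def)
  then show ?case by (simp add: q_vir mult.assoc)
qed (simp add: N)

lemma vir_submodule_image:
  assumes "0 \<in> J" "\<And>x y. x \<in> J \<Longrightarrow> y \<in> J \<Longrightarrow> x + y \<in> J" "\<And>a x. x \<in> J \<Longrightarrow> a * x \<in> J"
  shows "vir_submodule (q ` J) M"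
  unfolding vir_submodule_def using assms by (auto simp: q_vir intro!: vector_subspace_image)

lemma quot_vir_mod:
  assumes "I \<subseteq> J" "\<And>x y. x \<in> J \<Longrightarrow> y \<in> J \<Longrightarrow> x + y \<in> J" "\<And>a x. x \<in> J \<Longrightarrow> a * x \<in> J" "graded_set J"
  shows "vir_mod_quot (quot_vir_mod M (q ` J)) (\<lambda>u. q ` J +>\<^bsub>M\<^esub> q u) J"
proof -
  interpret env_subquot M q I J by unfold_locales (use assms in auto)
  have e: "(\<lambda>u. q ` J +>\<^bsub>M\<^esub> q u) = qJ" by (simp add: qJ_def fun_eq_iff)
  interpret Q: env_quot "quot_vir_mod M (q ` J)" qJ J
    by (rule env_quot_cong[OF env_quot_quot_space]) (simp_all add: quot_vir_mod_def graded_space.defs)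
  have "quot_map M (q ` J) (vir M g) (qJ u) = qJ (env_gen g * u)" for g u
    by (rule quot_map_qJ) (auto simp: q_vir right_diff_distrib[symmetric] J_mult)
  then show ?thesis unfolding e
    by unfold_locales (simp add: quot_vir_mod_def graded_space.defs vir_mod.defs)
qed

end

lemma vir_mod_quot_env_module: "vir_mod_quot (env_module :: ('a::field, 'a vir_env) vir_mod) id {0}"
proof
  show "gr (env_module :: ('a, 'a vir_env) vir_mod) n = id ` env_gr n" for n
  proof -
    have "env_gr n = abs_vir_env ` {x :: 'a vir_tensor. homog n x}" using env_gr_homog homog_env_gr by blast
    then show ?thesis by (simp add: env_module_def homog_def)
  qed
qed (auto simp: env_module_def graded_set_def)

definition verma_map :: "'a::field \<Rightarrow> 'a \<Rightarrow> 'a vir_env \<Rightarrow> 'a vir_env set" where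
  "verma_map c h u = verma_ideal c h +>\<^bsub>env_module\<^esub> u"

definition vac_map :: "'a::field \<Rightarrow> 'a vir_env \<Rightarrow> 'a vir_env set" where
  "vac_map c u = vacuum_ideal c +>\<^bsub>env_module\<^esub> u"

definition simple_map :: "'a::field \<Rightarrow> 'a \<Rightarrow> 'a vir_env \<Rightarrow> 'a vir_env set set" where
  "simple_map c h u = verma_map c h ` simple_ideal c h +>\<^bsub>verma c h\<^esub> verma_map c h u"

lemma vir_mod_quot_verma: "vir_mod_quot (verma c h) (verma_map c h) (verma_ideal c h)"
proof -
  interpret vir_mod_quot "env_module :: ('a, 'a vir_env) vir_mod" id "{0}" by (rule vir_mod_quot_env_module)
  have "vir_mod_quot (quot_vir_mod env_module (id ` verma_ideal c h)) (\<lambda>u. id ` verma_ideal c h +>\<^bsub>env_module\<^esub> id u) (verma_ideal c h)"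
    by (rule quot_vir_mod) (auto intro: verma_ideal_closed graded_verma_ideal)
  then show ?thesis unfolding verma_map_def[abs_def] by (simp add: verma_def verma_ideal_def)
qed

lemma vir_mod_quot_vacuum: "vir_mod_quot (vacuum_module c) (vac_map c) (vacuum_ideal c)"
proof -
  interpret vir_mod_quot "env_module :: ('a, 'a vir_env) vir_mod" id "{0}" by (rule vir_mod_quot_env_module)
  interpret V: vir_quot "vacuum_ideal c" c by (rule vir_quot_vacuum)
  have "vir_mod_quot (quot_vir_mod env_module (id ` vacuum_ideal c)) (\<lambda>u. id ` vacuum_ideal c +>\<^bsub>env_module\<^esub> id u) (vacuum_ideal c)"
    by (rule quot_vir_mod) (auto intro: V.I_zero V.I_add V.I_mult graded_vacuum_ideal)
  then show ?thesis unfolding vac_map_def[abs_def] by (simp add: vacuum_module_def)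
qed

text \<open>A proper graded submodule pulls back to a graded left ideal without 1 and so lies in the
  image of \<open>simple_ideal\<close>. This gives existence and uniqueness, as needed to evaluate
  the \<open>THE\<close> in \<open>vir_simple\<close>.\<close>

lemma maximal_graded_submodule_verma:
  "maximal_graded_submodule N (verma c h) \<longleftrightarrow> N = verma_map c h ` simple_ideal c h"
proof -
  interpret vir_mod_quot "verma c h" "verma_map c h" "verma_ideal c h" by (rule vir_mod_quot_verma)
  let ?S = "verma_map c h ` simple_ideal c h"
  have S: "vir_graded_submodule ?S (verma c h)"
    unfolding vir_graded_submodule_def
    by (intro conjI vir_submodule_image graded_subspace_image verma_subset_simple simple_ideal_closed graded_simple_ideal)
  have proper: "?S \<noteq> carrier (verma c h)"
  proof
    assume "?S = carrier (verma c h)"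
    then have "verma_map c h 1 \<in> ?S" by simp
    then obtain x where x: "x \<in> simple_ideal c h" "1 - x \<in> verma_ideal c h" by (auto simp: q_eq_iff)
    then have "(1 - x) + x \<in> simple_ideal c h" using verma_subset_simple by (intro simple_ideal_closed(2)) auto
    then show False using one_notin_simple_ideal by auto
  qed
  have sub: "N \<subseteq> ?S" if N: "vir_graded_submodule N (verma c h)" "N \<noteq> carrier (verma c h)" for N
  proof -
    let ?J = "{u. verma_map c h u \<in> N}"
    have vs: "vir_submodule N (verma c h)" "graded_subspace N (verma c h)"
      using N(1) by (auto simp: vir_graded_submodule_def)
    have NJ: "N = verma_map c h ` ?J" using vector_subspace_preimage(1) vs(1) by (simp add: vir_submodule_def)
    have "?J \<subseteq> simple_ideal c h"
    proof (rule simple_ideal_maximal)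
      show "1 \<notin> ?J"
      proof
        assume "1 \<in> ?J"
        then have "verma_map c h (u * 1) \<in> N" for u using vir_submodule_preimage[OF vs(1)] by blast
        then have "carrier (verma c h) \<subseteq> N" by (auto simp: car)
        moreover have "N \<subseteq> carrier (verma c h)" using vs(1) Mod.submoduleE(1) unfolding vir_submodule_def by blast
        ultimately show False using N(2) by blast
      qed
    qed (use graded_subspace_preimage[OF vs(2)] vir_submodule_preimage[OF vs(1)] vector_subspace_preimage(3) vs(1) in
        \<open>auto simp: vir_submodule_def\<close>)
    then show ?thesis using NJ by blast
  qed
  show ?thesis
    unfolding maximal_graded_submodule_def using S proper sub by (metis order_antisym)
qed

lemma vir_mod_quot_simple: "vir_mod_quot (vir_simple c h) (simple_map c h) (simple_ideal c h)"
proof -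
  interpret vir_mod_quot "verma c h" "verma_map c h" "verma_ideal c h" by (rule vir_mod_quot_verma)
  have "(THE N. maximal_graded_submodule N (verma c h)) = verma_map c h ` simple_ideal c h"
    unfolding maximal_graded_submodule_verma by simp
  moreover have "vir_mod_quot (quot_vir_mod (verma c h) (verma_map c h ` simple_ideal c h))
     (\<lambda>u. verma_map c h ` simple_ideal c h +>\<^bsub>verma c h\<^esub> verma_map c h u) (simple_ideal c h)"
    by (rule quot_vir_mod) (auto intro: simple_ideal_closed graded_simple_ideal subsetD[OF verma_subset_simple])
  ultimately show ?thesis unfolding simple_map_def[abs_def] vir_simple_def by simp
qed

section \<open>The vertex algebras and their simple modules\<close>

text \<open>A common frame for four situations: the universal vertex algebra acting on itself, its
  quotient acting on itself, on L(c, h), and on an irreducible module regraded to start in degree 0.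
  The ideal K may be larger than the vacuum ideal, but the fields are always those built on
  U.\<close>

locale vir_vertex = V: env_quot V qV K + W: env_quot W q I + Q: vir_quot I c
  for V :: "('a::field, 'v, 'm) graded_space_scheme" and qV K
    and W :: "('a, 'w, 'k) graded_space_scheme" and q I c +
  assumes vacuum_K: "vacuum_ideal c \<subseteq> K"
begin

lemma coefficients:
  "(-1) ^ i * of_int (int_binomial l i) = (sbin l i :: 'a)"
  "(-1) powi l * (-1) ^ i * of_int (int_binomial l i) = (eps l * sbin l i :: 'a)"
  "of_int (int_binomial l i) = (bin l i :: 'a)"
  by (simp_all add: sbin_def bin_def eps_def)

lemma module_structure:
  assumes Y: "\<And>u n w. Y (qV u) n (q w) = q (quot_Y I c u n w)"
  shows "vertex_operators V W Y"
    and "w \<in> carrier W \<Longrightarrow> Y (qV 1) n w = (if n = -1 then w else \<zero>\<^bsub>W\<^esub>)"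
    and "x \<in> gr V k \<Longrightarrow> y \<in> gr W n \<Longrightarrow> Y x m y \<in> gr W (k + n - m - 1)"
proof -
  show "vertex_operators V W Y"
    unfolding vertex_operators_def V.car W.car
  proof (intro conjI ballI allI; clarify)
    fix u w
    obtain N where "\<forall>n\<ge>N. quot_Y I c u n w = 0" using Q.quot_Y_trunc by blast
    then show "\<exists>N. \<forall>n\<ge>N. Y (qV u) n (q w) = \<zero>\<^bsub>W\<^esub>" by (intro exI[of _ N]) (simp add: Y W.q_zero)
  qed (auto simp: Y V.q_add W.q_add V.q_smult W.q_smult Q.quot_Y_linear)
  show "w \<in> carrier W \<Longrightarrow> Y (qV 1) n w = (if n = -1 then w else \<zero>\<^bsub>W\<^esub>)"
    using Q.quot_proj_cong by (auto simp: W.car Y Q.quot_Y_one W.q_zero W.q_eq_iff)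
  assume "x \<in> gr V k" "y \<in> gr W n"
  then obtain u w where u: "u \<in> env_gr k" "x = qV u" and w: "w \<in> env_gr n" "y = q w"
    by (auto simp: V.q_gr W.q_gr)
  have "q (quot_Y I c u m w) = q (hc (k + n - m - 1) (quot_Y I c u m w))"
    unfolding W.q_eq_iff by (rule quot_Y_graded[OF Q.vir_quot_axioms W.I_graded u(1) w(1)])
  then show "Y x m y \<in> gr W (k + n - m - 1)" by (simp add: u w Y W.q_gr)
qed

lemma jacobi:
  assumes Y: "\<And>u n w. Y (qV u) n (q w) = q (quot_Y I c u n w)"
    and P: "\<And>u n v. P (qV u) n (qV v) = qV (vac_Y c u n v)"
    and "x \<in> carrier V" "y \<in> carrier V" "z \<in> carrier W"
  shows "jacobi_identity W P Y x y z"
proof -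
  obtain u v w where "x = qV u" "y = qV v" "z = q w" using assms(3-5) by (auto simp: V.car W.car)
  then show ?thesis
    unfolding jacobi_identity_def coefficients(1,2) unfolding coefficients(3)
    by (simp only: Y P W.q_smult W.fsum_SA[OF Q.fs_jacobi(1)] W.fsum_SA[OF Q.fs_jacobi(2)] W.fsum_SA[OF Q.fs_jacobi(3)]
        W.q_diff Q.quot_Y_jacobi simp_thms)
qed

text \<open>The Jacobi identity for \<open>\<omega>\<close> with \<open>m = 0\<close> expresses \<open>Y(L\<^sub>kv, x)\<close> by \<open>Y(v, x)\<close> and the \<open>L\<^sub>j\<close>.\<close>

lemma unique:
  assumes op: "vertex_operators V W Y"
    and vac: "\<And>n w. w \<in> carrier W \<Longrightarrow> Y (qV 1) n w = (if n = -1 then w else \<zero>\<^bsub>W\<^esub>)"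
    and jac: "\<And>u v w. u \<in> carrier V \<Longrightarrow> v \<in> carrier V \<Longrightarrow> w \<in> carrier W \<Longrightarrow> jacobi_identity W P Y u v w"
    and P: "\<And>k v. P (qV (EL (-2))) (k + 1) (qV v) = qV (EL k * v)"
    and Y: "\<And>k w. Y (qV (EL (-2))) (k + 1) (q w) = q (EL k * w)"
  shows "Y (qV u) n (q w) = q (quot_Y I c u n w)"
proof (induction u arbitrary: n w)
  case one
  show ?case using vac[of "q w" n] Q.quot_proj_cong[of w] W.q_eq_iff[of "quot_proj I w" w]
    by (simp add: Q.quot_Y_one W.q_zero)
next
  case (add u v)
  have "Y (qV u \<oplus>\<^bsub>V\<^esub> qV v) n (q w) = Y (qV u) n (q w) \<oplus>\<^bsub>W\<^esub> Y (qV v) n (q w)"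
    using op unfolding vertex_operators_def by simp
  with add show ?case by (simp add: V.q_add W.q_add Q.quot_Y_linear)
next
  case (scale a u)
  have "Y (a \<odot>\<^bsub>V\<^esub> qV u) n (q w) = a \<odot>\<^bsub>W\<^esub> Y (qV u) n (q w)"
    using op unfolding vertex_operators_def by simp
  with scale show ?case by (simp add: V.q_smult W.q_smult Q.quot_Y_linear)
next
  case (gen g u)
  show ?case
  proof (cases g)
    case C
    have "qV (env_gen C * u) = c \<odot>\<^bsub>V\<^esub> qV u"
      using vacuum_ideal_C[of u c] vacuum_K by (auto simp: V.q_smult V.q_eq_iff)
    moreover have "Y (c \<odot>\<^bsub>V\<^esub> qV u) n (q w) = c \<odot>\<^bsub>W\<^esub> Y (qV u) n (q w)"
      using op unfolding vertex_operators_def by simp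
    ultimately show ?thesis using gen by (simp add: C W.q_smult Q.quot_Y_C)
  next
    case (L k)
    let ?o = "qV (EL (-2))"
    have Yo: "Y ?o j (q x) = q (quot_L I (j - 1) x)" for j x
      using Y[of "j - 1" x] W.q_eq_iff[of "quot_L I (j - 1) x" "EL (j - 1) * x"] Q.quot_L_cong[of "j - 1" x] by simp
    have Po: "P ?o (k + 1 + int i) (qV u) = qV (EL (k + int i) * u)" for i
      using P[of "k + int i" u] by (simp add: algebra_simps)
    have cl: "Y (qV v) j (q x) \<in> carrier W" for v j x
      using op unfolding vertex_operators_def by simp
    have "\<forall>i. \<exists>y. Y (qV (EL (k + int i) * u)) (0 + n - int i) (q w) = q y"
    proof
      fix i show "\<exists>y. Y (qV (EL (k + int i) * u)) (0 + n - int i) (q w) = q y"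
        using cl[of "EL (k + int i) * u" "0 + n - int i" w] unfolding W.car by (rule imageE) blast
    qed
    from choice[OF this] obtain y where y: "\<And>i. Y (qV (EL (k + int i) * u)) (0 + n - int i) (q w) = q (y i)" by blast
    have "fsum W (\<lambda>i. q (env_scalar (bin 0 i) * y i)) = q (sum (\<lambda>i. env_scalar (bin 0 i) * y i) {0})"
      by (rule W.fsum_q) (auto simp: bin_0_left W.I_zero)
    then have R: "fsum W (\<lambda>i. q (env_scalar (bin 0 i) * y i)) = Y (qV (EL k * u)) n (q w)"
      using y[of 0] by simp
    have e: "0 + (k + 1) - int i - 1 = k - int i" "n + (k + 1) - int i = n + k + 1 - int i" "0 + int i - 1 = int i - 1" for i
      by simp_all
    have fs': "fs (\<lambda>i. env_scalar (eps (k + 1) * sb1 k i) * quot_Y I c u (n + k + 1 - int i) (quot_L I (int i - 1) w))"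
      by (rule Q.fs_quot_Y_L(2))
    have S: "(\<Sum>i. env_scalar (eps (k + 1) * sb1 k i) * quot_Y I c u (n + k + 1 - int i) (quot_L I (int i - 1) w)) =
      env_scalar (eps (k + 1)) * (\<Sum>i. env_scalar (sb1 k i) * quot_Y I c u (n + k + 1 - int i) (quot_L I (int i - 1) w))"
      by (subst SA_hom[where h = "\<lambda>x. env_scalar (eps (k + 1)) * x"])
        (simp_all add: distrib_left Q.fs_quot_Y_L(2) env_scalar_mult mult.assoc)
    have "jacobi_identity W P Y ?o (qV u) (q w)" by (rule jac) simp_all
    then have "fsum W (\<lambda>i. sb1 k i \<odot>\<^bsub>W\<^esub> Y ?o (0 + (k + 1) - int i) (Y (qV u) (n + int i) (q w)))
     \<ominus>\<^bsub>W\<^esub> fsum W (\<lambda>i. (eps (k + 1) * sb1 k i) \<odot>\<^bsub>W\<^esub> Y (qV u) (n + (k + 1) - int i) (Y ?o (0 + int i) (q w)))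
     = fsum W (\<lambda>i. bin 0 i \<odot>\<^bsub>W\<^esub> Y (P ?o (k + 1 + int i) (qV u)) (0 + n - int i) (q w))"
      unfolding jacobi_identity_def coefficients(1,2) unfolding coefficients(3) by blast
    then show ?thesis
      unfolding Po y Yo e gen W.q_smult R W.fsum_SA[OF Q.fs_quot_Y_L(1)] W.fsum_SA[OF fs'] W.q_diff S L Q.quot_Y_L by simp
  qed
qed

end

lemma vac_map_structure:
  "env_quot (vir_vertex_structure c Y) (vac_map c) (vacuum_ideal c)"
  "carrier (vir_vertex_structure c Y) = carrier (vacuum_module c)"
  "vprod (vir_vertex_structure c Y) = Y" "vacuum (vir_vertex_structure c Y) = vac_map c 1"
proof -
  show "env_quot (vir_vertex_structure c Y) (vac_map c) (vacuum_ideal c)"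
    by (rule env_quot_cong[OF vir_mod_quot.axioms(1)[OF vir_mod_quot_vacuum]])
      (simp_all add: vir_vertex_structure_def graded_space.defs)
qed (simp_all add: vir_vertex_structure_def graded_space.defs vertex_alg.defs vacuum_vector_def vac_map_def)

lemma vir_vertex_vacuum: "vir_vertex (vir_vertex_structure c Y) (vac_map c) (vacuum_ideal c)
    (vir_vertex_structure c Y) (vac_map c) (vacuum_ideal c) c"
  using vac_map_structure(1) vir_quot_vacuum by (auto simp: vir_vertex_def vir_vertex_axioms_def)

lemma conformal_vector_eq: "conformal_vector c = vac_map c (EL (-2))"
proof -
  interpret vir_mod_quot "vacuum_module c" "vac_map c" "vacuum_ideal c" by (rule vir_mod_quot_vacuum)
  show ?thesis using q_vir[of "L (-2)" 1] by (simp add: conformal_vector_def vacuum_vector_def vac_map_def)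
qed

text \<open>The product of \<open>V_Vir\<close> is selected by \<open>SOME\<close>. The explicit
  product on representatives shows that an admissible choice exists, and \<open>unique\<close>
  forces whichever was selected to agree with it on the carrier.\<close>

lemma V_Vir_vprod: "vprod (V_Vir c) (vac_map c u) n (vac_map c v) = vac_map c (vac_Y c u n v)"
proof -
  interpret M: vir_mod_quot "vacuum_module c" "vac_map c" "vacuum_ideal c" by (rule vir_mod_quot_vacuum)
  interpret Q: vir_quot "vacuum_ideal c" c by (rule vir_quot_vacuum)
  let ?good = "\<lambda>Y. vertex_algebra (vir_vertex_structure c Y) \<and>
        (\<forall>n. \<forall>w\<in>carrier (vacuum_module c). Y (conformal_vector c) (n + 1) w = vir (vacuum_module c) (L n) w)"
  define r where "r A = (SOME u. vac_map c u = A)" for A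
  have r: "vac_map c (r (vac_map c u)) = vac_map c u" for u
    unfolding r_def by (rule someI[of "\<lambda>x. vac_map c x = vac_map c u"]) simp
  define Y where "Y A n B = vac_map c (vac_Y c (r A) n (r B))" for A n B
  have Y: "Y (vac_map c u) n (vac_map c v) = vac_map c (quot_Y (vacuum_ideal c) c u n v)" for u n v
  proof -
    have "r (vac_map c u) - u \<in> vacuum_ideal c" for u using r[of u] by (simp add: M.q_eq_iff)
    then show ?thesis unfolding Y_def vac_Y_def using Q.quot_Y_cong by metis
  qed
  interpret S: vir_vertex "vir_vertex_structure c Z" "vac_map c" "vacuum_ideal c"
    "vir_vertex_structure c Z" "vac_map c" "vacuum_ideal c" c for Z by (rule vir_vertex_vacuum)
  have "vertex_algebra (vir_vertex_structure c Y)"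
    unfolding vertex_algebra_def
  proof (intro conjI ballI allI impI)
    show "vector_space (vir_vertex_structure c Y)" by (rule S.V.vector_space)
    show "vertex_operators (vir_vertex_structure c Y) (vir_vertex_structure c Y) (vprod (vir_vertex_structure c Y))"
      unfolding vac_map_structure by (rule S.module_structure(1)[OF Y])
    show "vacuum (vir_vertex_structure c Y) \<in> carrier (vir_vertex_structure c Y)"
      by (simp add: vac_map_structure)
    fix u assume u: "u \<in> carrier (vir_vertex_structure c Y)"
    then obtain u' where u': "u = vac_map c u'" by (auto simp: S.V.car)
    show "vprod (vir_vertex_structure c Y) (vacuum (vir_vertex_structure c Y)) n u =
        (if n = - 1 then u else \<zero>\<^bsub>vir_vertex_structure c Y\<^esub>)" for n
      using S.module_structure(2)[of Y, OF Y u] by (simp add: vac_map_structure)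
    show "vprod (vir_vertex_structure c Y) u (- 1) (vacuum (vir_vertex_structure c Y)) = u"
      using vac_Y_creation(1)[of c u' "-1"] Q.quot_proj_cong[of u']
      by (simp add: vac_map_structure u' Y vac_Y_def[symmetric] M.q_eq_iff)
    show "vprod (vir_vertex_structure c Y) u n (vacuum (vir_vertex_structure c Y)) = \<zero>\<^bsub>vir_vertex_structure c Y\<^esub>" if "n \<ge> 0" for n
      using vac_Y_creation(1)[of c u' n] that
      by (simp add: vac_map_structure(3,4) u' Y vac_Y_def[symmetric] S.V.q_zero)
    fix v w assume "v \<in> carrier (vir_vertex_structure c Y)" "w \<in> carrier (vir_vertex_structure c Y)"
    with u show "jacobi_identity (vir_vertex_structure c Y) (vprod (vir_vertex_structure c Y)) (vprod (vir_vertex_structure c Y)) u v w"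
      unfolding vac_map_structure(3) by (intro S.jacobi) (simp_all add: Y vac_Y_def)
  qed
  moreover have "Y (conformal_vector c) (n + 1) w = vir (vacuum_module c) (L n) w" if "w \<in> carrier (vacuum_module c)" for n w
    using that by (elim M.carrier_cases) (simp add: conformal_vector_eq Y Q.quot_Y_conformal M.q_vir M.q_eq_iff Q.quot_L_cong)
  ultimately have "?good Y" by blast
  then have "?good (SOME Y. ?good Y)" by (rule someI[of ?good])
  then obtain Y' where V: "V_Vir c = vir_vertex_structure c Y'" and good: "?good Y'"
    unfolding V_Vir_def by blast
  have conf: "Y' (vac_map c (EL (-2))) (k + 1) (vac_map c w) = vac_map c (EL k * w)" for k w
    using good by (simp add: conformal_vector_eq[symmetric] M.q_vir)
  show ?thesis
    unfolding V vac_map_structure(3) vac_Y_def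
    by (rule S.unique[where Y = Y' and P = Y' and Z = Y'])
      (use good conf in \<open>simp_all add: vertex_algebra_def vac_map_structure(3,4)\<close>)
qed

lemma env_quot_V_Vir: "env_quot (V_Vir c) (vac_map c) (vacuum_ideal c)"
  unfolding V_Vir_def by (rule vac_map_structure(1))

lemma vacuum_V_Vir: "vacuum (V_Vir c) = vac_map c 1"
  unfolding V_Vir_def by (rule vac_map_structure)

text \<open>A Virasoro submodule of a quotient of U corresponds to a left ideal, so generating a
  submodule by the z_n 1 means adding the z_n to the generators of the vacuum ideal.\<close>

lemma I0_eq: "I0 (c::'a::field) = vac_map c ` restricted_ideal c"
proof -
  interpret M: vir_mod_quot "vacuum_module c" "vac_map c" "vacuum_ideal c" by (rule vir_mod_quot_vacuum)
  interpret R: vir_quot "restricted_ideal c" c by (rule vir_quot_restricted)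
  let ?S = "{vac_map c (restr_gen (- int n)) | n. n \<ge> 2}"
  have pw: "(vir (vacuum_module c) g ^^ k) (vac_map c 1) = vac_map c (env_gen g ^ k)" for g k
    by (induction k) (simp_all add: M.q_vir)
  have "I0 c = vir_generated (vacuum_module c) ?S"
    unfolding I0_def vac_map_def[symmetric] vacuum_vector_def
    by (rule arg_cong[where f = "vir_generated (vacuum_module c)"])
      (auto simp: pw M.q_vir M.q_zero M.q_diff restr_gen_def mult.commute)
  also have "\<dots> = vac_map c ` restricted_ideal c"
  proof (rule antisym)
    have "vir_submodule (vac_map c ` restricted_ideal c) (vacuum_module c)"
      by (rule M.vir_submodule_image[OF R.I_zero R.I_add R.I_mult])
    moreover have "?S \<subseteq> vac_map c ` restricted_ideal c"
    proof -
      have "restr_gen (- int n) \<in> restricted_ideal c" if "n \<ge> 2" for n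
        using that unfolding restricted_ideal_def by (intro left_ideal_gen) auto
      then show ?thesis by blast
    qed
    ultimately show "vir_generated (vacuum_module c) ?S \<subseteq> vac_map c ` restricted_ideal c"
      unfolding vir_generated_def by blast
    show "vac_map c ` restricted_ideal c \<subseteq> vir_generated (vacuum_module c) ?S"
      unfolding vir_generated_def
    proof clarify
      fix u N assume u: "u \<in> restricted_ideal c" and N: "vir_submodule N (vacuum_module c)" "?S \<subseteq> N"
      note vs = M.vector_subspace_preimage[OF conjunct1[OF N(1)[unfolded vir_submodule_def]]]
      from u show "vac_map c u \<in> N"
        unfolding restricted_ideal_def
      proof (induction u rule: left_ideal.induct)
        case (step x s a)
        have "vac_map c (a * s) \<in> N"
        proof (cases "s \<in> {env_gen C - env_scalar c} \<union> {EL n | n. n \<ge> -1}")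
          case True
          then have "a * s \<in> vacuum_ideal c" unfolding vacuum_ideal_def by (intro left_ideal_mult left_ideal_gen)
          then show ?thesis using vs(2) M.q_eq_iff[of "a * s" 0] by simp
        next
          case False
          then have "vac_map c s \<in> N" using step(2) N(2) by blast
          then show ?thesis by (rule M.vir_submodule_preimage[OF N(1)])
        qed
        with step show ?case by (intro vs(3))
      qed (rule vs(2))
    qed
  qed
  finally show ?thesis .
qed

definition v0_map :: "'a::field \<Rightarrow> 'a vir_env \<Rightarrow> 'a vir_env set set" where
  "v0_map c u = I0 c +>\<^bsub>V_Vir c\<^esub> vac_map c u"

lemma v0_conformal: "I0 c +>\<^bsub>V_Vir c\<^esub> conformal_vector c = v0_map c (EL (-2))"
  by (simp add: v0_map_def conformal_vector_eq)

lemma simple_map_structure: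
  "env_quot (vir_simple_structure c h Y) (simple_map c h) (simple_ideal c h)"
  "carrier (vir_simple_structure c h Y) = carrier (vir_simple c h)"
  "vact (vir_simple_structure c h Y) = Y"
proof -
  show "env_quot (vir_simple_structure c h Y) (simple_map c h) (simple_ideal c h)"
    by (rule env_quot_cong[OF vir_mod_quot.axioms(1)[OF vir_mod_quot_simple]])
      (simp_all add: vir_simple_structure_def graded_space.defs)
qed (simp_all add: vir_simple_structure_def graded_space.defs vertex_mod.defs)

lemma graded_restricted_ideal: "graded_set (restricted_ideal c)"
  unfolding restricted_ideal_def
proof (rule graded_left_ideal)
  fix s assume "s \<in> {env_gen C - env_scalar c} \<union> {EL n | n. n \<ge> -1} \<union> {restr_gen (- int n) | n. n \<ge> 2}"
  then show "\<exists>d. s \<in> env_gr d"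
    using restr_gen_gr env_gr_diff[OF env_gr_C env_gr_scalar] env_gr_L by blast
qed

section \<open>The quotient vertex algebra and its action on L(c, h)\<close>

context odd_prime_char
begin

text \<open>The product in the quotient is a union over representatives of both factors; it is a
  single coset because the restricted ideal absorbs products on either side.\<close>

lemma V0_presentation:
  "env_quot (V0_Vir c) (v0_map c) (restricted_ideal c)"
  "vprod (V0_Vir c) (v0_map c u) n (v0_map c v) = v0_map c (vac_Y c u n v)"
  "vacuum (V0_Vir c) = v0_map c 1"
proof -
  interpret R: vir_quot "restricted_ideal c" c by (rule vir_quot_restricted)
  interpret Q: vir_quot "vacuum_ideal c" c by (rule vir_quot_vacuum)
  interpret env_subquot "V_Vir c" "vac_map c" "vacuum_ideal c" "restricted_ideal c"
    using env_quot_V_Vir vacuum_subset_restricted graded_restricted_ideal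
    by (auto simp: env_subquot_def env_subquot_axioms_def R.I_add R.I_mult)
  have q: "v0_map c = qJ" by (simp add: v0_map_def qJ_def fun_eq_iff I0_eq)
  show "env_quot (V0_Vir c) (v0_map c) (restricted_ideal c)"
    unfolding q V0_Vir_def I0_eq
    by (rule env_quot_cong[OF env_quot_quot_space]) (simp_all add: quot_vertex_algebra_def graded_space.defs)
  show "vacuum (V0_Vir c) = v0_map c 1"
    by (simp add: V0_Vir_def quot_vertex_algebra_def graded_space.defs vertex_alg.defs v0_map_def vacuum_V_Vir)
  have 1: "quot_map (V_Vir c) (I0 c) (vprod (V_Vir c) (vac_map c u') n) (qJ v) = qJ (vac_Y c u' n v)" for u'
    unfolding I0_eq
  proof (rule quot_map_qJ)
    show "vac_Y c u' n v' - vac_Y c u' n v \<in> restricted_ideal c" if "v' - v \<in> restricted_ideal c" for v'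
      using vac_Y_ideal_right[OF vir_quot_restricted vacuum_subset_restricted that, of u' n]
      by (simp add: vac_Y_def Q.quot_Y_diff_right)
  qed (rule V_Vir_vprod)
  have 2: "qJ (vac_Y c u' n v) = qJ (vac_Y c u n v)" if "u' - u \<in> restricted_ideal c" for u'
    using vac_Y_ideal_left[OF that, of n v] by (simp add: qJ_eq_iff vac_Y_def Q.quot_Y_diff)
  have "vprod (V0_Vir c) (qJ u) n (qJ v) = (\<Union>a\<in>qJ u. quot_map (V_Vir c) (I0 c) (vprod (V_Vir c) a n) (qJ v))"
    by (simp add: V0_Vir_def quot_vertex_algebra_def graded_space.defs vertex_alg.defs)
  also have "\<dots> = (\<Union>a\<in>qJ u. qJ (vac_Y c u n v))"
    by (rule SUP_cong) (auto simp: qJ_eq[of u] 1 2)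
  also have "\<dots> = qJ (vac_Y c u n v)" using q_in_qJ[of u u] J_zero by auto
  finally show "vprod (V0_Vir c) (v0_map c u) n (v0_map c v) = v0_map c (vac_Y c u n v)" by (simp add: q)
qed

lemma V0_conformal:
  "vprod (V0_Vir c) (v0_map c (EL (-2))) (k + 1) (v0_map c v) = v0_map c (EL k * v)"
proof -
  interpret Q: vir_quot "vacuum_ideal c" c by (rule vir_quot_vacuum)
  show ?thesis
    unfolding V0_presentation(2) vac_Y_def Q.quot_Y_conformal env_quot.q_eq_iff[OF V0_presentation(1)]
    by (rule subsetD[OF vacuum_subset_restricted Q.quot_L_cong])
qed

lemma vir_vertex_V0:
  assumes "env_quot W q I" "vir_quot I c"
  shows "vir_vertex (V0_Vir c) (v0_map c) (restricted_ideal c) W q I c"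
  using V0_presentation(1) assms vacuum_subset_restricted by (auto simp: vir_vertex_def vir_vertex_axioms_def)

lemma graded_vertex_algebra_V0: "graded_vertex_algebra (V0_Vir c)"
proof -
  let ?V = "V0_Vir c"
  interpret R: vir_quot "restricted_ideal c" c by (rule vir_quot_restricted)
  interpret Q: vir_quot "vacuum_ideal c" c by (rule vir_quot_vacuum)
  interpret S: vir_vertex ?V "v0_map c" "restricted_ideal c" ?V "v0_map c" "restricted_ideal c" c
    by (rule vir_vertex_V0[OF V0_presentation(1) vir_quot_restricted])
  have Y: "vprod ?V (v0_map c u) n (v0_map c v) = v0_map c (quot_Y (restricted_ideal c) c u n v)" for u n v
    unfolding V0_presentation S.V.q_eq_iff vac_Y_def
    by (rule quot_Y_mono[OF vir_quot_vacuum vir_quot_restricted vacuum_subset_restricted])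
  show ?thesis
    unfolding graded_vertex_algebra_def vertex_algebra_def
  proof (intro conjI ballI allI impI)
    show "vector_space ?V" by (rule S.V.vector_space)
    show "vertex_operators ?V ?V (vprod ?V)" by (rule S.module_structure(1)[OF Y])
    show "vacuum ?V \<in> carrier ?V" by (simp add: V0_presentation)
    show "is_graded ?V" by (rule S.V.is_graded)
    show "vacuum ?V \<in> gr ?V 0" by (simp add: V0_presentation S.V.q_gr)
    show "vprod ?V u k v \<in> gr ?V (m + n - k - 1)" if "u \<in> gr ?V m" "v \<in> gr ?V n" for u k v m n
      by (rule S.module_structure(3)[OF Y that])
    fix u assume u: "u \<in> carrier ?V"
    then obtain u' where u': "u = v0_map c u'" by (auto simp: S.V.car)
    show "vprod ?V (vacuum ?V) n u = (if n = - 1 then u else \<zero>\<^bsub>?V\<^esub>)" for n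
      using S.module_structure(2)[of "vprod ?V", OF Y u] by (simp add: V0_presentation)
    show "vprod ?V u (- 1) (vacuum ?V) = u"
      using vac_Y_creation(1)[of c u' "-1"] Q.quot_proj_cong[of u'] vacuum_subset_restricted[of c]
      by (auto simp: V0_presentation u' S.V.q_eq_iff)
    show "vprod ?V u n (vacuum ?V) = \<zero>\<^bsub>?V\<^esub>" if "n \<ge> 0" for n
      using vac_Y_creation(1)[of c u' n] that by (simp add: V0_presentation u' S.V.q_zero)
    fix v w assume "v \<in> carrier ?V" "w \<in> carrier ?V"
    with u show "jacobi_identity ?V (vprod ?V) (vprod ?V) u v w"
      by (intro S.jacobi) (simp_all add: Y[symmetric] V0_presentation)
  qed
qed

text \<open>The action of the universal vertex algebra factors through the quotient by
  \<open>simple_Y_restricted\<close>, where the prime subfield enters. As for \<open>V_Vir\<close>,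
  existence is shown explicitly and uniqueness then pins down the structure selected by
  \<open>SOME\<close>.\<close>

lemma L_Vir_vact:
  assumes h: "h \<in> prime_subfield"
  shows "vertex_module (V0_Vir c) (L_Vir c h)"
    and "vact (L_Vir c h) (v0_map c u) n (simple_map c h w) = simple_map c h (simple_Y c h u n w)"
proof -
  let ?V = "V0_Vir c" and ?q = "simple_map c h" and ?I = "simple_ideal c h"
  interpret M: vir_mod_quot "vir_simple c h" ?q ?I by (rule vir_mod_quot_simple)
  interpret S: vir_vertex ?V "v0_map c" "restricted_ideal c" "vir_simple_structure c h Z" ?q ?I c for Z
    by (rule vir_vertex_V0[OF simple_map_structure(1) vir_quot_simple])
  let ?good = "\<lambda>Y. vertex_module ?V (vir_simple_structure c h Y) \<and>
        (\<forall>n. \<forall>w\<in>carrier (vir_simple c h).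
           Y (I0 c +>\<^bsub>V_Vir c\<^esub> conformal_vector c) (n + 1) w = vir (vir_simple c h) (L n) w)"
  define r where "r A = (SOME u. v0_map c u = A)" for A
  define s where "s A = (SOME u. ?q u = A)" for A
  have r: "v0_map c (r (v0_map c u)) = v0_map c u" for u
    unfolding r_def by (rule someI[of "\<lambda>x. v0_map c x = v0_map c u"]) simp
  have s: "?q (s (?q u)) = ?q u" for u
    unfolding s_def by (rule someI[of "\<lambda>x. ?q x = ?q u"]) simp
  define Y where "Y A n B = ?q (quot_Y ?I c (r A) n (s B))" for A n B
  have Y: "Y (v0_map c u) n (?q v) = ?q (quot_Y ?I c u n v)" for u n v
  proof -
    have "quot_Y ?I c (r (v0_map c u) - u) n x = 0" for x
      using r[of u] by (intro simple_Y_restricted[OF h]) (simp add: S.V.q_eq_iff)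
    moreover have "s (?q v) - v \<in> ?I" using s[of v] by (simp add: M.q_eq_iff)
    then have "quot_Y ?I c x n (s (?q v)) = quot_Y ?I c x n v" for x by (rule S.Q.quot_Y_cong)
    ultimately show ?thesis by (simp add: Y_def S.Q.quot_Y_diff)
  qed
  have "vertex_module ?V (vir_simple_structure c h Y)"
    unfolding vertex_module_def simple_map_structure(3)
  proof (intro conjI ballI allI)
    show "vertex_algebra ?V" using graded_vertex_algebra_V0 by (simp add: graded_vertex_algebra_def)
    show "vector_space (vir_simple_structure c h Y)" by (rule S.W.vector_space)
    show "vertex_operators ?V (vir_simple_structure c h Y) Y" by (rule S.module_structure(1)[OF Y])
    show "w \<in> carrier (vir_simple_structure c h Y) \<Longrightarrow> Y (vacuum ?V) n w = (if n = - 1 then w else \<zero>\<^bsub>vir_simple_structure c h Y\<^esub>)" for n w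
      unfolding V0_presentation by (rule S.module_structure(2)[OF Y])
    show "u \<in> carrier ?V \<Longrightarrow> v \<in> carrier ?V \<Longrightarrow> w \<in> carrier (vir_simple_structure c h Y) \<Longrightarrow>
      jacobi_identity (vir_simple_structure c h Y) (vprod ?V) Y u v w" for u v w
      by (rule S.jacobi[OF Y V0_presentation(2)])
  qed
  moreover have "Y (I0 c +>\<^bsub>V_Vir c\<^esub> conformal_vector c) (n + 1) w = vir (vir_simple c h) (L n) w"
    if "w \<in> carrier (vir_simple c h)" for n w
    using that by (elim M.carrier_cases) (simp add: v0_conformal Y S.Q.quot_Y_conformal M.q_vir M.q_eq_iff S.Q.quot_L_cong)
  ultimately have "?good Y" by blast
  then have "?good (SOME Y. ?good Y)" by (rule someI[of ?good])
  then obtain Y' where V: "L_Vir c h = vir_simple_structure c h Y'" and good: "?good Y'"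
    unfolding L_Vir_def by blast
  then show "vertex_module (V0_Vir c) (L_Vir c h)" by simp
  have conf: "Y' (v0_map c (EL (-2))) (k + 1) (?q w) = ?q (EL k * w)" for k w
    using good by (simp add: v0_conformal M.q_vir)
  show "vact (L_Vir c h) (v0_map c u) n (?q w) = ?q (quot_Y ?I c u n w)"
    unfolding V simple_map_structure(3)
    by (rule S.unique[where Y = Y' and P = "vprod ?V" and Z = Y'])
      (use good conf V0_conformal in \<open>simp_all add: vertex_module_def simple_map_structure(3) V0_presentation(3)\<close>)
qed

end

context odd_prime_char
begin

lemma env_quot_L_Vir: "env_quot (L_Vir c h) (simple_map c h) (simple_ideal c h)"
  unfolding L_Vir_def by (rule simple_map_structure(1))

lemma L_Vir_L:
  assumes "h \<in> prime_subfield"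
  shows "vact (L_Vir c h) (v0_map c (EL (-2))) (n + 1) (simple_map c h w) = simple_map c h (EL n * w)"
proof -
  interpret Q: vir_quot "simple_ideal c h" c by (rule vir_quot_simple)
  interpret M: env_quot "L_Vir c h" "simple_map c h" "simple_ideal c h" by (rule env_quot_L_Vir)
  show ?thesis unfolding L_Vir_vact(2)[OF assms] Q.quot_Y_conformal M.q_eq_iff by (rule Q.quot_L_cong)
qed

lemma N_graded_L_Vir:
  assumes h: "h \<in> prime_subfield"
  shows "N_graded_vertex_module (V0_Vir c) (L_Vir c h)"
proof -
  interpret M: env_quot "L_Vir c h" "simple_map c h" "simple_ideal c h" by (rule env_quot_L_Vir)
  interpret S: vir_vertex "V0_Vir c" "v0_map c" "restricted_ideal c" "L_Vir c h" "simple_map c h" "simple_ideal c h" c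
    by (rule vir_vertex_V0[OF env_quot_L_Vir vir_quot_simple])
  show ?thesis
    unfolding N_graded_vertex_module_def
  proof (intro conjI allI ballI impI)
    fix n :: int assume n: "n < 0"
    have "simple_map c h u = simple_map c h 0" if "u \<in> env_gr n" for u
    proof -
      have "hc n u \<in> simple_ideal c h" using verma_low_degree[of n u c h] n verma_subset_simple by blast
      then show ?thesis using that by (simp add: M.q_eq_iff hc_gr)
    qed
    then have "gr (L_Vir c h) n \<subseteq> {\<zero>\<^bsub>L_Vir c h\<^esub>}" unfolding M.q_gr M.q_zero by blast
    moreover have "\<zero>\<^bsub>L_Vir c h\<^esub> \<in> gr (L_Vir c h) n" by (auto simp: M.q_gr M.q_zero)
    ultimately show "gr (L_Vir c h) n = {\<zero>\<^bsub>L_Vir c h\<^esub>}" by blast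
  next
    show "vact (L_Vir c h) u m w \<in> gr (L_Vir c h) (k + n - m - 1)" if "u \<in> gr (V0_Vir c) k" "w \<in> gr (L_Vir c h) n" for k m n u w
      by (rule S.module_structure(3)[OF L_Vir_vact(2)[OF h] that])
  qed (use L_Vir_vact(1)[OF h] graded_vertex_algebra_V0 M.is_graded in auto)
qed

lemma simple_map_one: "simple_map c h 1 \<noteq> \<zero>\<^bsub>L_Vir c h\<^esub>"
  using env_quot.I_iff[OF env_quot_L_Vir] one_notin_simple_ideal by blast

text \<open>Stability under the modes of omega gives stability under U, so a graded submodule pulls
  back to a graded left ideal. Either that ideal contains 1, or it lies in
  \<open>simple_ideal\<close>.\<close>

lemma irreducible_L_Vir:
  assumes h: "h \<in> prime_subfield"
  shows "irreducible_N_graded_module (V0_Vir c) (L_Vir c h)"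
proof -
  interpret M: env_quot "L_Vir c h" "simple_map c h" "simple_ideal c h" by (rule env_quot_L_Vir)
  have "N = {\<zero>\<^bsub>L_Vir c h\<^esub>} \<or> N = carrier (L_Vir c h)" if N: "vertex_graded_submodule (V0_Vir c) N (L_Vir c h)" for N
  proof -
    let ?J = "{u. simple_map c h u \<in> N}"
    have gN: "graded_subspace N (L_Vir c h)" using N by (simp add: vertex_graded_submodule_def)
    note vs = M.graded_subspace_preimage(1)[OF gN]
    have NJ: "N = simple_map c h ` ?J" by (rule M.vector_subspace_preimage(1)[OF vs])
    have act: "simple_map c h (EL n * u) \<in> N" if "simple_map c h u \<in> N" for n u
    proof -
      have "v0_map c (EL (-2)) \<in> carrier (V0_Vir c)" using env_quot.q_carrier[OF V0_presentation(1)] .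
      then have "vact (L_Vir c h) (v0_map c (EL (-2))) (n + 1) (simple_map c h u) \<in> N"
        using N that unfolding vertex_graded_submodule_def by blast
      then show ?thesis by (simp add: L_Vir_L[OF h])
    qed
    have mult: "simple_map c h (a * u) \<in> N" if u: "simple_map c h u \<in> N" for a u
    proof (induction a)
      case (add a b)
      then show ?case using M.vector_subspace_preimage(3)[OF vs] by (simp add: distrib_right)
    next
      case (scale s a)
      then show ?case using M.vector_subspace_preimage(4)[OF vs] by (simp add: mult.assoc)
    next
      case (gen g a)
      show ?case
      proof (cases g)
        case (L n)
        then show ?thesis using act[OF gen] by (simp add: mult.assoc)
      next
        case C
        have "simple_map c h (env_gen C * (a * u)) = simple_map c h (env_scalar c * (a * u))"
          unfolding M.q_eq_iff by (rule vir_quot.charge[OF vir_quot_simple])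
        then show ?thesis using M.vector_subspace_preimage(4)[OF vs gen] by (simp add: C mult.assoc)
      qed
    qed (simp add: u)
    show ?thesis
    proof (cases "simple_map c h 1 \<in> N")
      case True
      from mult[OF this] have "carrier (L_Vir c h) \<subseteq> N" by (auto simp: M.car)
      then show ?thesis using M.Mod.submoduleE(1)[OF vs] by blast
    next
      case False
      have "?J \<subseteq> simple_ideal c h"
        by (rule simple_ideal_maximal)
          (use False mult M.graded_subspace_preimage[OF gN] verma_subset_simple[of c h] M.vector_subspace_preimage(3)[OF vs] in auto)
      then have "simple_map c h u = \<zero>\<^bsub>L_Vir c h\<^esub>" if "simple_map c h u \<in> N" for u
        using that M.I_iff by blast
      then have "N \<subseteq> {\<zero>\<^bsub>L_Vir c h\<^esub>}" using NJ by blast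
      moreover have "\<zero>\<^bsub>L_Vir c h\<^esub> \<in> N" using M.vector_subspace_preimage(2)[OF vs] by (simp add: M.q_zero)
      ultimately show ?thesis by blast
    qed
  qed
  moreover have "carrier (L_Vir c h) \<noteq> {\<zero>\<^bsub>L_Vir c h\<^esub>}" using M.q_carrier[of 1] simple_map_one by blast
  ultimately show ?thesis unfolding irreducible_N_graded_module_def using N_graded_L_Vir[OF h] by blast
qed

text \<open>Both modules have their lowest nonzero degree at 0, so the shift is 0. The eigenvalue of
  L_0 on degree 0 is then an invariant, equal to m on one side and to n on the other.\<close>

lemma L_Vir_inequivalent:
  assumes m: "m \<in> prime_subfield" and n: "n \<in> prime_subfield"
    and eq: "graded_equivalent (V0_Vir c) (L_Vir c m) (L_Vir c n)"
  shows "m = n"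
proof (rule ccontr)
  assume mn: "m \<noteq> n"
  interpret M: env_quot "L_Vir c m" "simple_map c m" "simple_ideal c m" by (rule env_quot_L_Vir)
  interpret N: env_quot "L_Vir c n" "simple_map c n" "simple_ideal c n" by (rule env_quot_L_Vir)
  obtain \<psi> k where iso: "vertex_module_iso (V0_Vir c) (L_Vir c m) (L_Vir c n) \<psi>"
    and gr: "\<And>i. \<psi> ` gr (L_Vir c m) i = gr (L_Vir c n) (i + k)"
    using eq unfolding graded_equivalent_def by blast
  have inj: "inj_on \<psi> (carrier (L_Vir c m))" using iso by (simp add: vertex_module_iso_def bij_betw_def)
  have sm: "\<psi> (a \<odot>\<^bsub>L_Vir c m\<^esub> simple_map c m u) = a \<odot>\<^bsub>L_Vir c n\<^esub> \<psi> (simple_map c m u)" for a u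
    using iso by (simp add: vertex_module_iso_def)
  have cl: "\<psi> (simple_map c m u) \<in> carrier (L_Vir c n)" for u
    using iso M.q_carrier by (auto simp: vertex_module_iso_def bij_betw_def)
  have p0: "\<psi> \<zero>\<^bsub>L_Vir c m\<^esub> = \<zero>\<^bsub>L_Vir c n\<^esub>" using sm[of 0 1] cl[of 1] N.Mod.smult_l_null M.Mod.smult_l_null[of "simple_map c m 1"] by simp
  have neg: "gr (L_Vir c h) i = {\<zero>\<^bsub>L_Vir c h\<^esub>}" if "i < 0" "h \<in> prime_subfield" for i h
    using N_graded_L_Vir[OF that(2)] that(1) by (simp add: N_graded_vertex_module_def)
  let ?v = "\<psi> (simple_map c m 1)"
  have v0: "?v \<noteq> \<zero>\<^bsub>L_Vir c n\<^esub>"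
    using inj_onD[OF inj, of "simple_map c m 1" "\<zero>\<^bsub>L_Vir c m\<^esub>"] simple_map_one p0 by auto
  have v: "?v \<in> gr (L_Vir c n) k" using gr[of 0] by (auto simp: M.q_gr)
  have "k = 0"
  proof (rule ccontr)
    assume "k \<noteq> 0"
    moreover have "\<not> k < 0" using neg[OF _ n, of k] v v0 by auto
    ultimately have "- k < 0" by simp
    then have "gr (L_Vir c n) 0 = {\<zero>\<^bsub>L_Vir c n\<^esub>}" using gr[of "- k"] neg[OF _ m, of "- k"] p0 by simp
    moreover have "simple_map c n 1 \<in> gr (L_Vir c n) 0" by (auto simp: N.q_gr)
    ultimately show False using simple_map_one by blast
  qed
  then obtain u where u: "u \<in> env_gr 0" "?v = simple_map c n u" using v by (auto simp: N.q_gr)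
  have L0: "simple_map c h (EL 0 * u) = simple_map c h (env_scalar h * u)" if "u \<in> env_gr 0" for h u
    unfolding env_quot.q_eq_iff[OF env_quot_L_Vir] L0_commute[OF that]
    using subsetD[OF verma_subset_simple verma_ideal_gens(2)[of u h c]] by simp
  have "\<psi> (vact (L_Vir c m) (v0_map c (EL (-2))) 1 (simple_map c m 1)) = vact (L_Vir c n) (v0_map c (EL (-2))) 1 ?v"
    using iso env_quot.q_carrier[OF V0_presentation(1)] by (simp add: vertex_module_iso_def)
  then have "\<psi> (simple_map c m (env_scalar m * 1)) = simple_map c n (env_scalar n * u)"
    using L_Vir_L[OF m, of 0 1] L_Vir_L[OF n, of 0 u] L0[OF u(1), of n] L0[OF env_gr_one, of m] by (simp add: u(2))
  moreover have "\<psi> (simple_map c m (env_scalar m * 1)) = simple_map c n (env_scalar m * u)"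
    using sm[of m 1] u(2) by (simp add: M.q_smult N.q_smult)
  ultimately have "simple_map c n (env_scalar m * u) = simple_map c n (env_scalar n * u)" by simp
  then have "env_scalar (m - n) * u \<in> simple_ideal c n"
    by (simp add: N.q_eq_iff env_scalar_diff left_diff_distrib)
  from simple_ideal_closed(4)[OF this, of "env_scalar (inverse (m - n))"] have "u \<in> simple_ideal c n"
    using mn unfolding mult.assoc[symmetric] env_scalar_mult[symmetric] by simp
  then show False using v0 u(2) by (simp add: N.I_iff)
qed

end

section \<open>Irreducible modules\<close>

text \<open>Since L_(i-1) omega = omega_i omega, these are the products of omega with itself, the
  singular part of its operator product. They are what is needed to recover the Virasoro relations
  from the commutator formula on an arbitrary module.\<close>

lemma restricted_congruences:
  "EL (-1) * EL (-2) - EL (-3) \<in> vacuum_ideal c"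
  "EL 0 * EL (-2) - env_scalar 2 * EL (-2) \<in> vacuum_ideal c"
  "EL 1 * EL (-2) \<in> vacuum_ideal c"
  "EL 2 * EL (-2) - env_scalar (c / 2) * 1 \<in> vacuum_ideal (c::'a::field)"
  "n \<ge> 3 \<Longrightarrow> EL n * EL (-2) \<in> vacuum_ideal c"
proof -
  interpret V: vir_quot "vacuum_ideal c" c by (rule vir_quot_vacuum)
  have L: "u * EL n \<in> vacuum_ideal c" if "n \<ge> -1" for u n using vacuum_ideal_L[OF that] .
  note L' = L[of _ 1, simplified]
  show "EL (-1) * EL (-2) - EL (-3) \<in> vacuum_ideal c"
    using L[of "-1" "EL (-2)"] env_gen_L_L[of "-1" "-2", where ?'a = 'a] by simp
  have two: "env_scalar (of_int k) = (of_int k :: 'a vir_env)" for k by (rule env_scalar_of_int)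
  show "EL 0 * EL (-2) - env_scalar 2 * EL (-2) \<in> vacuum_ideal c"
    using L[of 0 "EL (-2)"] env_gen_L_L[of 0 "-2", where ?'a = 'a] two[of 2] by simp
  show "EL 1 * EL (-2) \<in> vacuum_ideal c"
    using V.I_add[OF L[of 1 "EL (-2)"] L[of "-1" "of_int 3"]] env_gen_L_L[of 1 "-2", where ?'a = 'a] by simp
  have c2: "vir_cocycle 2 = (1 / 2 :: 'a)"
    using bin_of_nat[of 3 3, where ?'a = 'a] by (simp add: vir_cocycle_eq)
  have "env_scalar (1 / 2) * (env_gen C * 1 - env_scalar c * 1) \<in> vacuum_ideal c"
    by (intro V.I_mult V.charge)
  then have "env_scalar (1 / 2) * env_gen C - env_scalar (c / 2) * 1 \<in> vacuum_ideal c"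
    by (simp add: right_diff_distrib env_scalar_mult[symmetric])
  from V.I_add[OF V.I_add[OF L[of 2 "EL (-2)"] L[of 0 "of_int 4"]] this]
  show "EL 2 * EL (-2) - env_scalar (c / 2) * 1 \<in> vacuum_ideal c"
    using env_gen_L_L[of 2 "-2", where ?'a = 'a] by (simp add: c2 add_diff_eq add.assoc)
  show "EL n * EL (-2) \<in> vacuum_ideal c" if "n \<ge> 3"
    using V.I_add[OF L[of n "EL (-2)"] L[of "n - 2" "of_int (n + 2)"]] env_gen_L_L[of n "-2", where ?'a = 'a] that by simp
qed

locale v0_module = odd_prime_char p c
  for p :: nat and c :: "'a::field" +
  fixes W :: "('a, 'a vir_env set set, 'w) vertex_mod" (structure)
  assumes W: "N_graded_vertex_module (V0_Vir c) W"
begin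

abbreviation Y :: "'a vir_env \<Rightarrow> int \<Rightarrow> 'w \<Rightarrow> 'w" where
  "Y u n w \<equiv> vact W (v0_map c u) n w"

abbreviation T :: "int \<Rightarrow> 'w \<Rightarrow> 'w" where
  "T n w \<equiv> Y (EL (-2)) (n + 1) w"

lemma vspace: "vector_space W"
  using W by (simp add: N_graded_vertex_module_def vertex_module_def)

sublocale Mod: Module.module "scalars :: 'a ring" W by (rule vspace)

lemma Vq: "env_quot (V0_Vir c) (v0_map c) (restricted_ideal c)"
  by (rule V0_presentation(1))

lemma operators: "vertex_operators (V0_Vir c) W (vact W)"
  using W by (simp add: N_graded_vertex_module_def vertex_module_def)

lemma Y_closed [simp]: "w \<in> carrier W \<Longrightarrow> Y u n w \<in> carrier W"
  using operators env_quot.q_carrier[OF Vq] by (simp add: vertex_operators_def)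

lemma Y_add: "w \<in> carrier W \<Longrightarrow> Y (u + v) n w = Y u n w \<oplus> Y v n w"
  using operators env_quot.q_carrier[OF Vq] by (simp add: vertex_operators_def env_quot.q_add[OF Vq, symmetric])

lemma Y_smult: "w \<in> carrier W \<Longrightarrow> Y (env_scalar a * u) n w = a \<odot> Y u n w"
  using operators env_quot.q_carrier[OF Vq] by (simp add: vertex_operators_def env_quot.q_smult[OF Vq, symmetric])

lemma Y_add_right: "w \<in> carrier W \<Longrightarrow> x \<in> carrier W \<Longrightarrow> Y u n (w \<oplus> x) = Y u n w \<oplus> Y u n x"
  using operators env_quot.q_carrier[OF Vq] by (simp add: vertex_operators_def)

lemma Y_smult_right: "w \<in> carrier W \<Longrightarrow> Y u n (a \<odot> w) = a \<odot> Y u n w"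
  using operators env_quot.q_carrier[OF Vq] by (simp add: vertex_operators_def)

lemma smult_0 [simp]: "w \<in> carrier W \<Longrightarrow> 0 \<odot> w = \<zero>"
  using Mod.smult_l_null by simp

lemma smult_zero [simp]: "a \<odot> \<zero> = \<zero>"
  using Mod.smult_r_null by simp

lemma smult_1 [simp]: "w \<in> carrier W \<Longrightarrow> 1 \<odot> w = w"
  using Mod.smult_one by simp

lemma smult_closed [simp]: "w \<in> carrier W \<Longrightarrow> a \<odot> w \<in> carrier W"
  using Mod.smult_closed by simp

lemma smult_add: "w \<in> carrier W \<Longrightarrow> (a + b) \<odot> w = a \<odot> w \<oplus> b \<odot> w"
  using Mod.smult_l_distr by simp

lemma smult_add_right: "w \<in> carrier W \<Longrightarrow> x \<in> carrier W \<Longrightarrow> a \<odot> (w \<oplus> x) = a \<odot> w \<oplus> a \<odot> x"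
  using Mod.smult_r_distr by simp

lemma smult_smult: "w \<in> carrier W \<Longrightarrow> a \<odot> (b \<odot> w) = (a * b) \<odot> w"
  using Mod.smult_assoc1[of a b w] by simp

lemma smult_minus: "w \<in> carrier W \<Longrightarrow> (- a) \<odot> w = \<ominus> (a \<odot> w)"
  using smult_add[of w "- a" a] by (intro Mod.minus_equality[symmetric]) simp_all

lemma Y_zero_right [simp]: "Y u n \<zero> = \<zero>"
  using Y_smult_right[of "\<zero>" u n 0] by simp

lemma Y_cong: "u - v \<in> vacuum_ideal c \<Longrightarrow> Y u n w = Y v n w"
  using env_quot.q_eq_iff[OF Vq, of u v] vacuum_subset_restricted[of c] by auto

lemma Y_kill: "u \<in> restricted_ideal c \<Longrightarrow> w \<in> carrier W \<Longrightarrow> Y u n w = \<zero>"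
  using env_quot.q_eq_iff[OF Vq, of u 0] Y_smult[of w 0 u n] by simp

lemma Y_one: "w \<in> carrier W \<Longrightarrow> Y 1 n w = (if n = -1 then w else \<zero>)"
  using W by (simp add: N_graded_vertex_module_def vertex_module_def V0_presentation(3))

lemma Y_C: "w \<in> carrier W \<Longrightarrow> Y (env_gen C * u) n w = c \<odot> Y u n w"
  using Y_cong[OF vacuum_ideal_C[of u c]] by (simp add: Y_smult)

lemma Y_gr: "u \<in> env_gr k \<Longrightarrow> w \<in> gr W n \<Longrightarrow> Y u m w \<in> gr W (k + n - m - 1)"
  using W env_quot.q_gr[OF Vq, of k] unfolding N_graded_vertex_module_def by blast

lemma T_gr: "w \<in> gr W n \<Longrightarrow> T m w \<in> gr W (n - m)"
  using Y_gr[OF env_gr_L[of "-2"], of w n "m + 1"] by (simp add: algebra_simps)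

lemma gr_subspace: "vector_subspace (gr W n) W" and gr_carrier: "w \<in> gr W n \<Longrightarrow> w \<in> carrier W"
  using W by (auto simp: N_graded_vertex_module_def is_graded_def direct_sum_def)

lemma subspace_closed:
  assumes "vector_subspace N W"
  shows "N \<subseteq> carrier W" "\<zero> \<in> N" "x \<in> N \<Longrightarrow> y \<in> N \<Longrightarrow> x \<oplus> y \<in> N" "x \<in> N \<Longrightarrow> a \<odot> x \<in> N"
    "x \<in> N \<Longrightarrow> y \<in> N \<Longrightarrow> x \<ominus> y \<in> N"
proof -
  show N: "N \<subseteq> carrier W" using Mod.submoduleE(1)[OF assms] .
  show s: "x \<in> N \<Longrightarrow> a \<odot> x \<in> N" for x a using Mod.submoduleE(4)[OF assms] by simp
  show ad: "x \<in> N \<Longrightarrow> y \<in> N \<Longrightarrow> x \<oplus> y \<in> N" for x y using Mod.submoduleE(5)[OF assms] by simp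
  obtain x0 where "x0 \<in> N" using Mod.submoduleE(2)[OF assms] by blast
  with s[of x0 0] N show "\<zero> \<in> N" by auto
  show "x \<in> N \<Longrightarrow> y \<in> N \<Longrightarrow> x \<ominus> y \<in> N"
    using ad[of x "(- 1) \<odot> y"] s[of y "- 1"] N smult_minus[of y 1] by (auto simp: a_minus_def)
qed

lemma fsum_superset:
  assumes "finite A" "\<And>i. i \<notin> A \<Longrightarrow> g i = \<zero>" "\<And>i. g i \<in> carrier W"
  shows "fsum W g = finsum W g A"
  unfolding fsum_def
  by (rule Mod.add.finprod_mono_neutral_cong_left) (use assms in \<open>auto simp: Pi_def\<close>)

lemma fsum_single: "(\<And>i. i \<noteq> a \<Longrightarrow> g i = \<zero>) \<Longrightarrow> g a \<in> carrier W \<Longrightarrow> fsum W g = g a"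
  by (subst fsum_superset[of "{a}"]) (auto, metis Mod.zero_closed)

lemma fsum_zero: "(\<And>i. g i = \<zero>) \<Longrightarrow> fsum W g = \<zero>"
  by (simp add: fsum_def)

lemma fsum_closed: "vector_subspace N W \<Longrightarrow> (\<And>i. g i \<in> N) \<Longrightarrow> fsum W g \<in> N"
proof -
  assume N: "vector_subspace N W" and g: "\<And>i. g i \<in> N"
  have "finsum W g A \<in> N" for A
  proof (induction A rule: infinite_finite_induct)
    case (insert a A)
    have "g \<in> A \<rightarrow> carrier W" "g a \<in> carrier W" using g subspace_closed(1)[OF N] by auto
    with insert show ?case using subspace_closed(3)[OF N g] by (simp add: Mod.finsum_insert)
  qed (simp_all add: subspace_closed[OF N])
  then show ?thesis by (simp add: fsum_def)
qed

lemma jacobi_omega: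
  assumes "w \<in> carrier W"
  shows "fsum W (\<lambda>i. sbin l i \<odot> T (m + l - int i - 1) (Y u (n + int i) w)) \<ominus>
     fsum W (\<lambda>i. (eps l * sbin l i) \<odot> Y u (n + l - int i) (T (m + int i - 1) w))
     = fsum W (\<lambda>i. bin m i \<odot> Y (EL (l + int i - 1) * u) (m + n - int i) w)"
proof -
  interpret V: vir_quot "vacuum_ideal c" c by (rule vir_quot_vacuum)
  have P: "vprod (V0_Vir c) (v0_map c (EL (-2))) k (v0_map c u) = v0_map c (EL (k - 1) * u)" for k
  proof -
    have "vac_Y c (EL (-2)) k u = quot_L (vacuum_ideal c) (k - 1) u"
      using V.quot_Y_conformal[of "k - 1" u] by (simp add: vac_Y_def)
    then show ?thesis unfolding V0_presentation(2) env_quot.q_eq_iff[OF Vq]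
      using V.quot_L_cong[of "k - 1" u] vacuum_subset_restricted[of c] by auto
  qed
  have "jacobi_identity W (vprod (V0_Vir c)) (vact W) (v0_map c (EL (-2))) (v0_map c u) w"
    using W assms env_quot.q_carrier[OF Vq] by (simp add: N_graded_vertex_module_def vertex_module_def)
  then show ?thesis
    unfolding jacobi_identity_def P by (simp add: sbin_def bin_def eps_def mult.assoc)
qed

lemma iterate:
  assumes "w \<in> carrier W"
  shows "Y (EL k * u) n w =
    fsum W (\<lambda>i. sb1 k i \<odot> T (k - int i) (Y u (n + int i) w)) \<ominus>
    fsum W (\<lambda>i. (eps (k + 1) * sb1 k i) \<odot> Y u (n + k + 1 - int i) (T (int i - 1) w))"
proof -
  have "fsum W (\<lambda>i. bin 0 i \<odot> Y (EL (k + 1 + int i - 1) * u) (0 + n - int i) w) = Y (EL k * u) n w"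
    using assms by (subst fsum_single[of 0]) (simp_all add: bin_0_left)
  with jacobi_omega[OF assms, of "k + 1" 0 u n] show ?thesis by (simp add: algebra_simps)
qed

lemma commutator:
  assumes "w \<in> carrier W"
  shows "T m (Y u n w) \<ominus> Y u n (T m w) =
    fsum W (\<lambda>i. bin (m + 1) i \<odot> Y (EL (int i - 1) * u) (m + 1 + n - int i) w)"
proof -
  have 1: "fsum W (\<lambda>i. sbin 0 i \<odot> T (m + 1 + 0 - int i - 1) (Y u (n + int i) w)) = T m (Y u n w)"
    using assms by (subst fsum_single[of 0]) (simp_all add: sbin_0_left)
  have 2: "fsum W (\<lambda>i. (eps 0 * sbin 0 i) \<odot> Y u (n + 0 - int i) (T (m + 1 + int i - 1) w)) = Y u n (T m w)"
    using assms by (subst fsum_single[of 0]) (simp_all add: sbin_0_left)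
  show ?thesis using jacobi_omega[OF assms, of 0 "m + 1" u n] unfolding 1 2 by simp
qed

text \<open>As L_-3 1 = L_-1 omega, this is the derivative property (L_-1 omega)_n = -n omega_(n-1).
  It follows from the iterate formula with u = 1, where \<open>sbin (-2) i\<close> is i + 1.\<close>

lemma Y_L3:
  assumes "w \<in> carrier W"
  shows "Y (EL (-3)) n w = of_int (- n) \<odot> T (n - 2) w"
proof -
  have s: "sbin (-2) i = (of_nat (Suc i) :: 'a)" for i
  proof -
    have "bin (-2) i = ((-1) ^ i * bin (int (Suc i)) i :: 'a)"
      using bin_negated_upper[of "-2" i, where ?'a = 'a] by (simp add: algebra_simps)
    also have "bin (int (Suc i)) i = (of_nat (Suc i choose i) :: 'a)" by (rule bin_of_nat)
    also have "Suc i choose i = Suc i" using binomial_symmetric[of i "Suc i"] by simp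
    finally show ?thesis by (simp add: sbin_def mult.assoc[symmetric] power_add[symmetric])
  qed
  have 1: "fsum W (\<lambda>i. sbin (-2) i \<odot> T (-3 - int i) (Y 1 (n + int i) w)) = (if n < 0 then of_int (- n) \<odot> T (n - 2) w else \<zero>)"
  proof (cases "n < 0")
    case True
    then show ?thesis using assms
      by (subst fsum_single[of "nat (- 1 - n)"]) (auto simp: Y_one s algebra_simps)
  qed (use assms in \<open>auto simp: Y_one intro!: fsum_zero\<close>)
  have 2: "fsum W (\<lambda>i. (eps (-2) * sbin (-2) i) \<odot> Y 1 (n - 2 - int i) (T (int i - 1) w)) = (if n > 0 then of_int n \<odot> T (n - 2) w else \<zero>)"
  proof (cases "n > 0")
    case True
    then show ?thesis using assms
      by (subst fsum_single[of "nat (n - 1)"]) (auto simp: Y_one s algebra_simps)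
  qed (use assms in \<open>auto simp: Y_one intro!: fsum_zero\<close>)
  have "Y (EL (-3) * 1) n w = (if n < 0 then of_int (- n) \<odot> T (n - 2) w else \<zero>) \<ominus>
      (if n > 0 then of_int n \<odot> T (n - 2) w else \<zero>)"
    unfolding iterate[OF assms] 1[symmetric] 2[symmetric] by (simp add: algebra_simps)
  then show ?thesis using assms by (cases "n = 0") (auto simp: a_minus_def smult_minus)
qed

lemma diff_eq: "x \<in> carrier W \<Longrightarrow> y \<in> carrier W \<Longrightarrow> z \<in> carrier W \<Longrightarrow> x \<ominus> y = z \<Longrightarrow> x = y \<oplus> z"
  by (metis Mod.minus_closed Mod.a_comm Mod.a_inv_closed Mod.minus_eq Mod.r_neg1 Mod.add.m_lcomm)

lemma finsum_4:
  assumes "\<And>i. g i \<in> carrier W"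
  shows "finsum W g {0, 1, 2, 3 :: nat} = g 0 \<oplus> (g 1 \<oplus> (g 2 \<oplus> g 3))"
proof -
  have "g \<in> A \<rightarrow> carrier W" for A using assms by auto
  then show ?thesis using assms by (simp add: Mod.finsum_insert)
qed

text \<open>The commutator formula for omega with itself has contributions for i <= 3 only. The
  terms i = 0 and i = 1 combine by -(m + n + 2) + 2(m + 1) = m - n, and i = 3 gives the central
  term.\<close>

lemma T_T:
  assumes "w \<in> carrier W"
  shows "T m (T n w) = T n (T m w) \<oplus> (of_int (m - n) \<odot> T (m + n) w \<oplus>
    (if m + n = 0 then (vir_cocycle m * c) \<odot> w else \<zero>))"
proof -
  let ?o = "EL (-2) :: 'a vir_env"
  let ?g = "\<lambda>i. bin (m + 1) i \<odot> Y (EL (int i - 1) * ?o) (m + 1 + (n + 1) - int i) w"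
  have g0: "?g 0 = of_int (- (m + n + 2)) \<odot> T (m + n) w"
    using Y_cong[OF restricted_congruences(1)] Y_L3[OF assms, of "m + n + 2"] assms by (simp add: algebra_simps)
  have b1: "bin x 1 = (of_int x :: 'a)" for x by (simp add: bin_def int_binomial_def)
  have g1: "?g 1 = of_int (2 * (m + 1)) \<odot> T (m + n) w"
    using Y_cong[OF restricted_congruences(2)] assms
    by (simp add: Y_smult smult_smult b1[simplified] algebra_simps)
  have kill: "Y u k w = \<zero>" if "u \<in> vacuum_ideal c" for u k
    using Y_kill[of u w k] that vacuum_subset_restricted assms by blast
  have g2: "?g 2 = \<zero>" using kill[OF restricted_congruences(3)] by simp
  have s: "Y (env_scalar (c / 2)) k w = (c / 2) \<odot> Y 1 k w" for k
    using Y_smult[OF assms, of "c / 2" 1 k] by simp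
  have g3: "?g 3 = (if m + n = 0 then (vir_cocycle m * c) \<odot> w else \<zero>)"
    using Y_cong[OF restricted_congruences(4)] assms
    by (simp add: s Y_one smult_smult vir_cocycle_eq)
  have g4: "?g i = \<zero>" if "i \<notin> {0,1,2,3}" for i
  proof -
    have "int i - 1 \<ge> 3" using that by auto
    then show ?thesis using kill[OF restricted_congruences(5)] by simp
  qed
  have gc: "?g i \<in> carrier W" for i using assms by simp
  have "fsum W ?g = finsum W ?g {0,1,2,3}" by (rule fsum_superset) (use g4 gc in auto)
  also have "\<dots> = ?g 0 \<oplus> (?g 1 \<oplus> (?g 2 \<oplus> ?g 3))"
    by (rule finsum_4[OF gc])
  also have "\<dots> = of_int (m - n) \<odot> T (m + n) w \<oplus> ?g 3"
  proof -
    have "of_int (m - n) \<odot> T (m + n) w = ?g 0 \<oplus> ?g 1"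
      unfolding g0 g1 smult_add[OF Y_closed[OF assms], symmetric] by (simp add: algebra_simps)
    then show ?thesis using gc[of 0] gc[of 1] gc[of 3] unfolding g2 by (simp add: Mod.a_assoc)
  qed
  finally have "T m (T n w) \<ominus> T n (T m w) = of_int (m - n) \<odot> T (m + n) w \<oplus> ?g 3"
    using commutator[OF assms, of m ?o "n + 1"] by simp
  from diff_eq[OF _ _ _ this] show ?thesis unfolding g3 using assms by simp
qed

section \<open>The action of the enveloping algebra on a given module\<close>

fun act :: "vir_gen \<Rightarrow> 'w \<Rightarrow> 'w" where
  "act (L n) w = T n w"
| "act C w = c \<odot> w"

fun wact :: "vir_word \<Rightarrow> 'w \<Rightarrow> 'w" where
  "wact (Word gs) w = foldr act gs w"

text \<open>The action on a fixed vector w, defined on tensors through words. By \<open>T_T\<close>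
  it vanishes on \<open>env_ideal\<close>, and \<open>EV w\<close> is the resulting map u -> u w
  from U.\<close>

definition ev :: "'w \<Rightarrow> 'a vir_tensor \<Rightarrow> 'w" where
  "ev w t = finsum W (\<lambda>x. coef t x \<odot> wact x w) (supp t)"

lemma act_closed [simp]: "w \<in> carrier W \<Longrightarrow> act g w \<in> carrier W"
  by (cases g) simp_all

lemma wact_closed [simp]: "w \<in> carrier W \<Longrightarrow> wact x w \<in> carrier W"
proof (cases x)
  case (Word gs)
  assume "w \<in> carrier W"
  then have "foldr act gs w \<in> carrier W" by (induction gs) simp_all
  then show ?thesis by (simp add: Word)
qed

lemma act_linear:
  "w \<in> carrier W \<Longrightarrow> x \<in> carrier W \<Longrightarrow> act g (w \<oplus> x) = act g w \<oplus> act g x"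
  "w \<in> carrier W \<Longrightarrow> act g (a \<odot> w) = a \<odot> act g w"
  by (cases g; simp add: Y_add_right Y_smult_right smult_add_right smult_smult mult.commute)+

lemma wact_linear:
  assumes "w \<in> carrier W"
  shows "x \<in> carrier W \<Longrightarrow> wact u (w \<oplus> x) = wact u w \<oplus> wact u x"
    and "wact u (a \<odot> w) = a \<odot> wact u w"
proof -
  obtain gs where u: "u = Word gs" by (cases u)
  have cl: "y \<in> carrier W \<Longrightarrow> foldr act gs y \<in> carrier W" for gs y using wact_closed[of y "Word gs"] by simp
  show "x \<in> carrier W \<Longrightarrow> wact u (w \<oplus> x) = wact u w \<oplus> wact u x"
    unfolding u wact.simps by (induction gs) (simp_all add: act_linear cl assms)
  show "wact u (a \<odot> w) = a \<odot> wact u w"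
    unfolding u wact.simps by (induction gs) (simp_all add: act_linear cl assms)
qed

lemma wact_add: "wact (u + v) w = wact u (wact v w)"
  by (cases u; cases v) simp

lemma wact_zero [simp]: "wact u \<zero> = \<zero>"
  using wact_linear(2)[of "\<zero>" u 0] by simp

lemma ev_superset:
  assumes "w \<in> carrier W" "finite A" "supp t \<subseteq> A"
  shows "ev w t = finsum W (\<lambda>x. coef t x \<odot> wact x w) A"
  unfolding ev_def
  by (rule Mod.add.finprod_mono_neutral_cong_left) (use assms in \<open>auto simp: Pi_def in_keys_iff\<close>)

lemma ev_closed [simp]: "w \<in> carrier W \<Longrightarrow> ev w t \<in> carrier W"
  unfolding ev_def by (rule Mod.finsum_closed) auto

lemma ev_zero [simp]: "ev w 0 = \<zero>"
  by (simp add: ev_def)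

lemma ev_add:
  assumes "w \<in> carrier W" shows "ev w (s + t) = ev w s \<oplus> ev w t"
proof -
  let ?A = "supp s \<union> supp t"
  have A: "finite ?A" "supp (s + t) \<subseteq> ?A" "supp s \<subseteq> ?A" "supp t \<subseteq> ?A"
    using keys_add[of s t] by auto
  show ?thesis
    unfolding ev_superset[OF assms A(1,2)] ev_superset[OF assms A(1,3)] ev_superset[OF assms A(1,4)]
    by (subst Mod.finsum_addf[symmetric]) (use assms in \<open>auto simp: lookup_add smult_add\<close>)
qed

lemma ev_single: "w \<in> carrier W \<Longrightarrow> ev w (tmon x a) = a \<odot> wact x w"
  by (subst ev_superset[of w "{x}"]) auto

lemma ev_single_mult:
  assumes "w \<in> carrier W"
  shows "ev w (tmon x a * t) = a \<odot> wact x (ev w t)"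
proof (induction t rule: vir_tensor_induct)
  case (add s t)
  then show ?case using assms by (simp add: distrib_left ev_add wact_linear smult_add_right)
next
  case (single gs b)
  then show ?case using assms by (simp add: mult_single ev_single wact_add wact_linear smult_smult del: wact.simps)
qed simp

lemma ev_mult:
  assumes "w \<in> carrier W"
  shows "ev w (s * t) = ev (ev w t) s"
  by (induction s rule: vir_tensor_induct)
    (use assms in \<open>simp_all add: distrib_right ev_add ev_single_mult ev_single\<close>)

lemma ev_base_zero: "ev \<zero> t = \<zero>"
  by (induction t rule: vir_tensor_induct) (simp_all add: ev_add ev_single del: wact.simps)

lemma ev_diff:
  assumes "w \<in> carrier W" shows "ev w (s - t) = ev w s \<ominus> ev w t"
proof -
  have "ev w s = ev w (s - t) \<oplus> ev w t" using ev_add[OF assms, of "s - t" t] by simp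
  then show ?thesis using assms by (simp add: a_minus_def Mod.a_assoc Mod.r_neg)
qed

lemma ev_relation:
  assumes "w \<in> carrier W"
  shows "ev w (tensor_gen g * tensor_gen h) = ev w (tensor_gen h * tensor_gen g) \<oplus> ev w (vir_bracket g h)"
proof -
  have gh: "ev w (tensor_gen g * tensor_gen h) = act g (act h w)" for g h
    using assms by (simp add: mult_single ev_single)
  show ?thesis
  proof (cases "g = C \<or> h = C")
    case True
    then have "vir_bracket g h = (0 :: 'a vir_tensor)" using vir_bracket_C by auto
    moreover have "act g (act h w) = act h (act g w)"
      using True assms by (auto simp: act_linear)
    ultimately show ?thesis using assms by (simp add: gh)
  next
    case False
    then obtain m n where mn: "g = L m" "h = L n" by (cases g; cases h) auto
    have "ev w (vir_bracket (L m) (L n)) = of_int (m - n) \<odot> T (m + n) w \<oplus>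
      (if m + n = 0 then (vir_cocycle m * c) \<odot> w else \<zero>)"
      using assms unfolding vir_bracket.simps(1) by (simp add: ev_add ev_single smult_smult vir_cocycle_def del: single_of_int of_int_diff)
    then show ?thesis unfolding gh mn using T_T[OF assms, of m n] by simp
  qed
qed

lemma ev_env_ideal: "t \<in> env_ideal \<Longrightarrow> w \<in> carrier W \<Longrightarrow> ev w t = \<zero>"
proof (induction t rule: env_ideal.induct)
  case (step x a g h b)
  let ?w = "ev w b"
  have "ev ?w (tensor_gen g * tensor_gen h - tensor_gen h * tensor_gen g - vir_bracket g h) = \<zero>"
    using step ev_relation[of ?w g h] by (simp add: ev_diff a_minus_def Mod.a_ac Mod.r_neg Mod.r_neg1 Mod.r_neg2)
  with step show ?case by (simp add: ev_add mult.assoc ev_mult ev_base_zero del: vir_bracket.simps)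
qed simp

definition EV :: "'w \<Rightarrow> 'a vir_env \<Rightarrow> 'w" where
  "EV w u = ev w (rep_vir_env u)"

lemma EV_abs:
  assumes "w \<in> carrier W" shows "EV w (abs_vir_env t) = ev w t"
proof -
  have "ev w (rep_vir_env (abs_vir_env t) - t) = \<zero>"
    using env_rel_rep_abs[of t] ev_env_ideal[OF _ assms] by (simp add: env_rel_def)
  then show ?thesis using ev_add[OF assms, of "rep_vir_env (abs_vir_env t) - t" t] assms by (simp add: EV_def)
qed

lemma EV_closed [simp]: "w \<in> carrier W \<Longrightarrow> EV w u \<in> carrier W"
  by (simp add: EV_def)

lemma EV_hom:
  assumes "w \<in> carrier W"
  shows "EV w (u + v) = EV w u \<oplus> EV w v" "EV w (env_scalar a * u) = a \<odot> EV w u"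
    "EV w (env_gen g * u) = act g (EV w u)" "EV w 1 = w" "EV w 0 = \<zero>"
proof -
  obtain s t where st: "u = abs_vir_env s" "v = abs_vir_env t" using vir_env_abs_cases by metis
  show "EV w (u + v) = EV w u \<oplus> EV w v"
    using assms unfolding st by (simp add: abs_vir_env_add[symmetric] EV_abs ev_add)
  show "EV w (env_scalar a * u) = a \<odot> EV w u" "EV w (env_gen g * u) = act g (EV w u)"
    using assms unfolding st
    by (simp_all add: env_scalar_abs env_gen_abs abs_vir_env_mult[symmetric] EV_abs ev_single_mult zero_vir_word_def)
  show "EV w 1 = w" "EV w 0 = \<zero>"
    using assms ev_single[OF assms, of "Word []" 1] EV_abs[OF assms, of 0]
    by (simp_all add: abs_vir_env_1[symmetric] EV_abs abs_vir_env_0 single_one[symmetric] zero_vir_word_def del: single_one)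
qed

end

context odd_prime_char
begin

lemma of_int_prime_subfield: "of_int k \<in> (prime_subfield :: 'a set)"
proof -
  have p0: "int p > 0" using p_ge_3 by simp
  have "(of_int k :: 'a) = of_int (int p * (k div int p)) + of_int (k mod int p)"
    by (simp only: of_int_add[symmetric] mult_div_mod_eq)
  also have "of_int (int p * (k div int p)) = (0::'a)" by (simp only: of_int_0_iff) simp
  also have "of_int (k mod int p) = (of_nat (nat (k mod int p)) :: 'a)" using p0 by (simp add: of_nat_nat)
  finally have "(of_int k :: 'a) = of_nat (nat (k mod int p))" by simp
  moreover have "nat (k mod int p) < p" using p0 by (simp add: nat_less_iff)
  ultimately show ?thesis unfolding prime_subfield_def p_char by (intro image_eqI) simp_all
qed

end

section \<open>The lowest degree of an irreducible module\<close>

context v0_module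
begin

lemma subspaceI:
  assumes "N \<subseteq> carrier W" "\<zero> \<in> N" "\<And>x y. x \<in> N \<Longrightarrow> y \<in> N \<Longrightarrow> x \<oplus> y \<in> N" "\<And>a x. x \<in> N \<Longrightarrow> a \<odot> x \<in> N"
  shows "vector_subspace N W"
proof (rule Mod.submoduleI)
  fix x assume x: "x \<in> N"
  then have "x \<in> carrier W" using assms(1) by blast
  then show "\<ominus> x \<in> N" using smult_minus[of x 1] assms(4)[OF x, of "- 1"] by simp
qed (use assms in auto)

lemma components_unique:
  assumes "\<And>n. f n \<in> gr W n" "finite {n. f n \<noteq> \<zero>}" "\<And>n. g n \<in> gr W n" "finite {n. g n \<noteq> \<zero>}"
    "fsum W f = fsum W g"
  shows "f = g"
proof -
  have "fsum W f \<in> carrier W" using assms(1) unfolding fsum_def by (intro Mod.finsum_closed) (auto intro: gr_carrier)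
  then have "\<exists>!f'. (\<forall>n. f' n \<in> gr W n) \<and> finite {n. f' n \<noteq> \<zero>} \<and> fsum W f = fsum W f'"
    using W by (simp add: N_graded_vertex_module_def is_graded_def direct_sum_def)
  then show ?thesis using assms by blast
qed

lemma components_exist:
  assumes "w \<in> carrier W"
  obtains f where "\<And>n. f n \<in> gr W n" "finite {n. f n \<noteq> \<zero>}" "w = fsum W f"
proof -
  have "\<exists>!f. (\<forall>n. f n \<in> gr W n) \<and> finite {n. f n \<noteq> \<zero>} \<and> w = fsum W f"
    using W assms by (simp add: N_graded_vertex_module_def is_graded_def direct_sum_def)
  then show ?thesis using that by blast
qed

lemma lowest_degree:
  assumes "carrier W \<noteq> {\<zero>}"
  obtains d w where "w \<in> gr W d" "w \<noteq> \<zero>" "\<And>n. n < d \<Longrightarrow> gr W n = {\<zero>}"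
proof -
  have neg: "gr W n = {\<zero>}" if "n < 0" for n using W that by (simp add: N_graded_vertex_module_def)
  have "\<exists>k. gr W (int k) \<noteq> {\<zero>}"
  proof (rule ccontr)
    assume "\<not> (\<exists>k. gr W (int k) \<noteq> {\<zero>})"
    then have z: "gr W n = {\<zero>}" for n using neg[of n] spec[of "\<lambda>k. gr W (int k) = {\<zero>}" "nat n"] by (cases "n < 0") auto
    have "w = \<zero>" if w: "w \<in> carrier W" for w
    proof -
      obtain f where "\<And>n. f n \<in> gr W n" "w = fsum W f" using components_exist[OF w] by metis
      then show ?thesis using z by (simp add: fsum_zero)
    qed
    then show False using assms Mod.zero_closed by blast
  qed
  then obtain k where k: "gr W (int k) \<noteq> {\<zero>}" "\<And>j. j < k \<Longrightarrow> gr W (int j) = {\<zero>}"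
    using exists_least_iff[of "\<lambda>k. gr W (int k) \<noteq> {\<zero>}"] by blast
  obtain w where "w \<in> gr W (int k)" "w \<noteq> \<zero>"
    using k(1) subspace_closed(2)[OF gr_subspace[of "int k"]] by blast
  moreover have "gr W n = {\<zero>}" if "n < int k" for n
    using neg[of n] k(2)[of "nat n"] that by (cases "n < 0") auto
  ultimately show ?thesis using that by blast
qed

text \<open>The polynomial x (x + 2) ... (x + 2(j - 1)) evaluated at L_0 and applied to w.\<close>

fun wpoly :: "nat \<Rightarrow> 'w \<Rightarrow> 'w" where
  "wpoly 0 w = w"
| "wpoly (Suc j) w = T 0 (wpoly j w) \<oplus> of_nat (2 * j) \<odot> wpoly j w"

lemma wpoly_gr: "w \<in> gr W d \<Longrightarrow> wpoly j w \<in> gr W d"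
proof (induction j)
  case (Suc j)
  then show ?case
    using T_gr[of "wpoly j w" d 0] by (simp add: subspace_closed[OF gr_subspace])
qed simp

lemma wpoly_T: "w \<in> carrier W \<Longrightarrow> wpoly j (T 0 w) = T 0 (wpoly j w) \<and> wpoly j w \<in> carrier W"
  by (induction j) (simp_all add: Y_add_right Y_smult_right)

lemma finsum_2:
  assumes "\<And>i. g i \<in> carrier W"
  shows "finsum W g {0, 1 :: nat} = g 0 \<oplus> g 1"
proof -
  have "g \<in> A \<rightarrow> carrier W" for A using assms by auto
  then show ?thesis using assms by (simp add: Mod.finsum_insert)
qed

context
  fixes d :: int
  assumes low: "\<And>n. n < d \<Longrightarrow> gr W n = {\<zero>}"
begin

lemma fsum_bin_1:
  assumes "w \<in> carrier W"
  shows "fsum W (\<lambda>i. bin 1 i \<odot> Y (a i) (n - int i) w) = Y (a 0) n w \<oplus> Y (a 1) (n - 1) w"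
proof -
  have "fsum W (\<lambda>i. bin 1 i \<odot> Y (a i) (n - int i) w) = finsum W (\<lambda>i. bin 1 i \<odot> Y (a i) (n - int i) w) {0, 1}"
    by (rule fsum_superset) (use assms in \<open>auto simp: bin_1_left\<close>)
  also have "\<dots> = Y (a 0) n w \<oplus> Y (a 1) (n - 1) w"
    using assms by (subst finsum_2) (simp_all add: bin_1_left)
  finally show ?thesis .
qed

text \<open>On the lowest degree the Jacobi identity with l = -1 and m = 1 retains one term on the
  left and gives (L_-2 u)_(e+1) w + (L_-1 u)_e w = L_0 u_(e-1) w. The commutator with L_0, zero by
  assumption, gives (L_-1 u)_e w = -e u_(e-1) w.\<close>

lemma zero_mode_step:
  assumes u: "u \<in> env_gr e" and w: "w \<in> gr W d" and comm: "Y u (e - 1) (T 0 w) = T 0 (Y u (e - 1) w)"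
  shows "Y (EL (-2) * u) (e + 1) w = T 0 (Y u (e - 1) w) \<oplus> of_int e \<odot> Y u (e - 1) w"
proof -
  let ?z = "Y u (e - 1) w" and ?a = "Y (EL (-2) * u) (e + 1) w" and ?b = "Y (EL (-1) * u) e w"
  have wc: "w \<in> carrier W" by (rule gr_carrier[OF w])
  have low': "x = \<zero>" if "x \<in> gr W n" "n < d" for x n using low[OF that(2)] that(1) by blast
  have "Y u (e + int i) w = \<zero>" for i
    by (rule low'[OF Y_gr[OF u w]]) simp
  then have 1: "fsum W (\<lambda>i. sbin (-1) i \<odot> T (1 + -1 - int i - 1) (Y u (e + int i) w)) = \<zero>"
    by (intro fsum_zero) simp
  have T0: "T (1 + int i - 1) w = \<zero>" if "i \<noteq> 0" for i
    by (rule low'[OF T_gr[OF w]]) (use that in simp)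
  have 2: "fsum W (\<lambda>i. (eps (-1) * sbin (-1) i) \<odot> Y u (e + -1 - int i) (T (1 + int i - 1) w)) = \<ominus> T 0 ?z"
    using wc T0 comm by (subst fsum_single[of 0]) (simp_all add: smult_minus)
  have 3: "fsum W (\<lambda>i. bin 1 i \<odot> Y (EL (-1 + int i - 1) * u) (1 + e - int i) w) = ?a \<oplus> ?b"
    unfolding fsum_bin_1[OF wc] by (simp add: add.commute)
  have A: "T 0 ?z = ?a \<oplus> ?b"
    using jacobi_omega[OF wc, of "-1" 1 u e] wc unfolding 1 2 3 by (simp add: a_minus_def)
  have "?b \<oplus> Y (EL 0 * u) (e - 1) w = \<zero>"
  proof -
    have "fsum W (\<lambda>i. bin 1 i \<odot> Y (EL (int i - 1) * u) (e - int i) w) = ?b \<oplus> Y (EL 0 * u) (e - 1) w"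
      unfolding fsum_bin_1[OF wc] by simp
    then show ?thesis using commutator[OF wc, of 0 u "e - 1"] wc comm by (simp add: a_minus_def Mod.r_neg)
  qed
  moreover have "Y (EL 0 * u) (e - 1) w = of_int e \<odot> ?z"
  proof -
    have "EL 0 * u - env_scalar (of_int e) * u \<in> vacuum_ideal c"
      unfolding L0_commute[OF u] using vacuum_ideal_L[of 0 u c] by simp
    then show ?thesis using Y_cong Y_smult[OF wc] by metis
  qed
  ultimately have B: "?b \<oplus> of_int e \<odot> ?z = \<zero>" by simp
  have "?a = ?a \<oplus> (?b \<oplus> of_int e \<odot> ?z)" unfolding B using wc by simp
  also have "\<dots> = T 0 ?z \<oplus> of_int e \<odot> ?z" unfolding A using wc by (simp add: Mod.a_assoc)
  finally show ?thesis .
qed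

lemma zero_mode_power:
  "w \<in> gr W d \<Longrightarrow> Y (EL (-2) ^ j) (int (2 * j) - 1) w = wpoly j w"
proof (induction j arbitrary: w)
  case 0
  then show ?case using gr_carrier[OF 0] by (simp add: Y_one)
next
  case (Suc j)
  have u: "EL (-2) ^ j \<in> (env_gr (int (2 * j)) :: 'a vir_env set)"
    using env_gr_power[OF env_gr_L[of "-2"], of j] by (simp add: mult.commute)
  have w: "w \<in> carrier W" by (rule gr_carrier[OF Suc(2)])
  have T0: "T 0 w \<in> gr W d" using T_gr[OF Suc(2), of 0] by simp
  have "Y (EL (-2) * EL (-2) ^ j) (int (2 * j) + 1) w =
    T 0 (wpoly j w) \<oplus> of_int (int (2 * j)) \<odot> wpoly j w"
    using zero_mode_step[OF u Suc(2)] Suc(1)[OF T0] Suc(1)[OF Suc(2)] wpoly_T[OF w, of j] by simp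
  moreover have "int (2 * j) + 1 = int (2 * Suc j) - 1" by simp
  ultimately show ?case by (simp only: power_Suc wpoly.simps of_int_of_nat_eq)
qed

text \<open>In \<open>V\<^sup>0\<close> we have \<open>L\<^bsub>-2\<^esub>\<^sup>p\<one> = 0\<close>, so that \<open>\<Prod>\<^bsub>j<p\<^esub> (L\<^sub>0 + 2j)\<close> kills the lowest degree.\<close>

lemma eigenvector:
  assumes w: "w \<in> gr W d" "w \<noteq> \<zero>"
  obtains h w0 where "h \<in> prime_subfield" "w0 \<in> gr W d" "w0 \<noteq> \<zero>" "T 0 w0 = h \<odot> w0"
proof -
  have "\<not> int p dvd - int 2"
    using p_ge_3 zdvd_imp_le[of "int p" 2] by auto
  then have "restr_gen (- int 2) = (EL (-2) ^ p :: 'a vir_env)" by (simp add: restr_gen_def p_char)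
  moreover have "restr_gen (- int 2) \<in> restricted_ideal c"
    unfolding restricted_ideal_def by (intro left_ideal_gen) blast
  ultimately have "wpoly p w = \<zero>"
    using zero_mode_power[OF w(1), of p] Y_kill[OF _ gr_carrier[OF w(1)], of "restr_gen (- int 2)"] by simp
  \<comment> \<open>At the least k with value zero, the vector just before is nonzero and
    annihilated by L_0 + 2(k - 1), hence an eigenvector with eigenvalue in the prime field.\<close>
  then obtain k where k: "wpoly k w = \<zero>" "\<And>j. j < k \<Longrightarrow> wpoly j w \<noteq> \<zero>"
    using exists_least_iff[of "\<lambda>k. wpoly k w = \<zero>"] by blast
  then obtain j where j: "k = Suc j" using w(2) by (cases k) auto
  let ?w = "wpoly j w"
  have g: "?w \<in> gr W d" by (rule wpoly_gr[OF w(1)])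
  then have c: "?w \<in> carrier W" by (rule gr_carrier)
  have "T 0 ?w \<oplus> of_nat (2 * j) \<odot> ?w = \<zero>" using k(1) j by simp
  then have "T 0 ?w = \<ominus> (of_nat (2 * j) \<odot> ?w)"
    using c by (intro Mod.minus_equality[symmetric]) simp_all
  then have "T 0 ?w = of_int (- int (2 * j)) \<odot> ?w" using smult_minus[OF c, of "of_nat (2 * j)"] by simp
  then show ?thesis using that[OF of_int_prime_subfield g] k(2)[of j] j by blast
qed

end

text \<open>By \<open>iterate\<close> the modes of L_k u are sums of compositions of the operators T
  with modes of u, so stability under omega propagates to the whole vertex algebra.\<close>

lemma Y_invariant:
  assumes N: "vector_subspace N W" and T: "\<And>n x. x \<in> N \<Longrightarrow> T n x \<in> N" and "x \<in> N"
  shows "Y u n x \<in> N"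
  using \<open>x \<in> N\<close>
proof (induction u arbitrary: n x)
  note cl = subspace_closed[OF N]
  {
    case one
    then show ?case using cl(1,2) by (auto simp: Y_one)
  next
    case (add u v)
    have "x \<in> carrier W" using add(3) cl(1) by blast
    then show ?case using cl(3)[OF add(1)[OF add(3)] add(2)[OF add(3)]] by (simp add: Y_add)
  next
    case (scale a u)
    have "x \<in> carrier W" using scale(2) cl(1) by blast
    then show ?case using cl(4)[OF scale(1)[OF scale(2)]] by (simp add: Y_smult)
  next
    case (gen g u)
    have x: "x \<in> carrier W" using gen(2) cl(1) by blast
    show ?case
    proof (cases g)
      case C
      then show ?thesis using gen cl(4) by (simp add: Y_C[OF x])
    next
      case (L k)
      show ?thesis unfolding L iterate[OF x] using gen T by (intro cl(5) fsum_closed[OF N] cl(4)) blast+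
    qed
  }
qed

context
  fixes w0 :: 'w and d :: int
  assumes w0: "w0 \<in> gr W d"
begin

lemma w0_carrier: "w0 \<in> carrier W" by (rule gr_carrier[OF w0])

lemma EV_gr: "EV w0 (hc n u) \<in> gr W (n + d)"
proof -
  have "\<forall>n. EV w0 (hc n u) \<in> gr W (n + d)"
  proof (induction u)
    case one
    then show ?case
      using w0 subspace_closed(2)[OF gr_subspace] by (auto simp: hc_gr[OF env_gr_one] EV_hom[OF w0_carrier])
  next
    case (gen g u)
    show ?case
    proof (cases g)
      case C
      with gen show ?thesis
        using subspace_closed(4)[OF gr_subspace] by (simp add: hc_mult_left[OF env_gr_C] EV_hom[OF w0_carrier])
    next
      case (L m)
      have "T m (EV w0 (hc (n + m) u)) \<in> gr W (n + m + d - m)" for n using gen by (intro T_gr) blast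
      then show ?thesis by (simp add: L hc_mult_left[OF env_gr_L] EV_hom[OF w0_carrier] algebra_simps)
    qed
  qed (auto simp: hc_add hc_scale EV_hom[OF w0_carrier] intro: subspace_closed[OF gr_subspace])
  then show ?thesis by blast
qed

lemma EV_components:
  "finite {n. EV w0 (hc (n - d) u) \<noteq> \<zero>}" "EV w0 u = fsum W (\<lambda>n. EV w0 (hc (n - d) u))"
proof -
  let ?A = "{n. hc n u \<noteq> 0}" and ?B = "{n. hc (n - d) u \<noteq> 0}"
  have B: "?B = (\<lambda>n. n + d) ` ?A" by (auto intro: image_eqI[of _ _ "_ - d"])
  have fin: "finite ?B" unfolding B using hc_finite_sum(1) by (rule finite_imageI)
  show "finite {n. EV w0 (hc (n - d) u) \<noteq> \<zero>}"
    by (rule finite_subset[OF _ fin]) (auto simp: EV_hom[OF w0_carrier])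
  have hom: "finite A \<Longrightarrow> EV w0 (sum g A) = finsum W (\<lambda>n. EV w0 (g n)) A" for g and A :: "int set"
  proof (induction A rule: finite_induct)
    case (insert a A)
    have "(\<lambda>n. EV w0 (g n)) \<in> A \<rightarrow> carrier W" by (simp add: w0_carrier)
    with insert show ?case by (simp add: EV_hom[OF w0_carrier] Mod.finsum_insert w0_carrier)
  qed (simp add: EV_hom[OF w0_carrier])
  have "u = (\<Sum>n\<in>?A. hc n u)" by (rule hc_finite_sum)
  also have "\<dots> = (\<Sum>n\<in>?B. hc (n - d) u)"
    unfolding B by (subst sum.reindex) (auto simp: inj_on_def)
  finally have "EV w0 u = finsum W (\<lambda>n. EV w0 (hc (n - d) u)) ?B" using hom[OF fin] by metis
  also have "\<dots> = fsum W (\<lambda>n. EV w0 (hc (n - d) u))"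
    by (rule fsum_superset[symmetric]) (use fin in \<open>auto simp: EV_hom[OF w0_carrier] w0_carrier\<close>)
  finally show "EV w0 u = fsum W (\<lambda>n. EV w0 (hc (n - d) u))" .
qed

lemma EV_component_unique:
  assumes "\<And>n. f n \<in> gr W n" "finite {n. f n \<noteq> \<zero>}" "EV w0 u = fsum W f"
  shows "f n = EV w0 (hc (n - d) u)"
proof -
  have "f = (\<lambda>n. EV w0 (hc (n - d) u))"
    using EV_gr[of "_ - d" u] EV_components[of u] assms by (intro components_unique) auto
  then show ?thesis by simp
qed

text \<open>Translates graded left ideals of U into graded submodules of W, so that irreducibility
  of W can be applied to ideals.\<close>

lemma EV_submodule:
  assumes "graded_set S" "0 \<in> S" "\<And>x y. x \<in> S \<Longrightarrow> y \<in> S \<Longrightarrow> x + y \<in> S" "\<And>a x. x \<in> S \<Longrightarrow> a * x \<in> S"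
  shows "vertex_graded_submodule (V0_Vir c) (EV w0 ` S) W"
proof -
  let ?N = "EV w0 ` S"
  note hom = EV_hom[OF w0_carrier]
  have N: "vector_subspace ?N W"
  proof (rule subspaceI)
    show "?N \<subseteq> carrier W" by (auto simp: w0_carrier)
    show "\<zero> \<in> ?N" using assms(2) by (auto simp: hom intro: image_eqI[of _ _ 0])
    show "a \<odot> x \<in> ?N" if "x \<in> ?N" for a x
      using that assms(4) by (auto simp: hom(2)[symmetric])
    show "x \<oplus> y \<in> ?N" if "x \<in> ?N" "y \<in> ?N" for x y
      using that assms(3) by (auto simp: hom(1)[symmetric])
  qed
  have "graded_subspace ?N W"
    unfolding graded_subspace_def direct_sum_def
  proof (intro conjI allI ballI)
    show "vector_subspace (?N \<inter> gr W n) W" for n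
      using subspace_closed[OF N] subspace_closed[OF gr_subspace[of n]]
      by (intro subspaceI) auto
    fix x assume "x \<in> ?N"
    then obtain u where u: "u \<in> S" "x = EV w0 u" by blast
    show "\<exists>!f. (\<forall>n. f n \<in> ?N \<inter> gr W n) \<and> finite {n. f n \<noteq> \<zero>} \<and> x = fsum W f"
    proof (rule ex1I[of _ "\<lambda>n. EV w0 (hc (n - d) u)"])
      show "(\<forall>n. EV w0 (hc (n - d) u) \<in> ?N \<inter> gr W n) \<and> finite {n. EV w0 (hc (n - d) u) \<noteq> \<zero>} \<and>
        x = fsum W (\<lambda>n. EV w0 (hc (n - d) u))"
        using EV_components[of u] EV_gr[of "_ - d" u] u assms(1) by (auto simp: graded_set_def)
      show "f = (\<lambda>n. EV w0 (hc (n - d) u))"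
        if "(\<forall>n. f n \<in> ?N \<inter> gr W n) \<and> finite {n. f n \<noteq> \<zero>} \<and> x = fsum W f" for f
        using that u(2) EV_component_unique[of f u] by (intro ext) auto
    qed
  qed (simp_all add: N)
  moreover have "vact W v n x \<in> ?N" if v: "v \<in> carrier (V0_Vir c)" and x: "x \<in> ?N" for v n x
  proof -
    obtain u where "v = v0_map c u" using v by (auto simp: env_quot.car[OF Vq])
    moreover have "T k y \<in> ?N" if y: "y \<in> ?N" for k y
    proof -
      obtain s where s: "s \<in> S" "y = EV w0 s" using y by blast
      show ?thesis by (rule image_eqI[OF _ assms(4)[OF s(1), of "EL k"]]) (simp add: s hom)
    qed
    ultimately show ?thesis using Y_invariant[OF N _ x] by blast
  qed
  ultimately show ?thesis unfolding vertex_graded_submodule_def by blast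
qed

text \<open>The annihilator J of w0 is a proper graded left ideal containing the Verma ideal, so it
  lies in \<open>simple_ideal\<close>. Irreducibility, applied to the image of
  \<open>simple_ideal\<close>, gives the reverse inclusion. Both modules are then presented by the
  same ideal, and \<open>unique\<close> identifies their fields.\<close>

lemma equivalent_L_Vir:
  assumes irr: "irreducible_N_graded_module (V0_Vir c) W"
    and low: "\<And>n. n < d \<Longrightarrow> gr W n = {\<zero>}" and nz: "w0 \<noteq> \<zero>"
    and h: "h \<in> prime_subfield" and eig: "T 0 w0 = h \<odot> w0"
  shows "graded_equivalent (V0_Vir c) W (L_Vir c h)"
proof -
  let ?q = "EV w0" and ?S = "simple_ideal c h" and ?J = "{u. EV w0 u = \<zero>}"
  note hom = EV_hom[OF w0_carrier]
  have cl [simp]: "?q u \<in> carrier W" for u by (simp add: w0_carrier)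
  have dich: "?q ` A = {\<zero>} \<or> ?q ` A = carrier W"
    if "graded_set A" "0 \<in> A" "\<And>x y. x \<in> A \<Longrightarrow> y \<in> A \<Longrightarrow> x + y \<in> A" "\<And>a x. x \<in> A \<Longrightarrow> a * x \<in> A" for A
    using irr EV_submodule[OF that] unfolding irreducible_N_graded_module_def by blast
  have surj: "?q ` UNIV = carrier W"
  proof -
    have "w0 \<in> range ?q" by (rule range_eqI[of _ _ 1]) (simp add: hom)
    then show ?thesis using dich[of UNIV] nz by (auto simp: graded_set_def)
  qed
  have q_minus: "?q (- u) = \<ominus> ?q u" for u
    using hom(2)[of "- 1" u] smult_minus[of "?q u" 1] by (simp add: env_scalar_minus)
  have q_diff: "?q (u - v) = ?q u \<ominus> ?q v" for u v
    using hom(1)[of u "- v"] by (simp add: q_minus a_minus_def)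
  have J_mult: "a * u \<in> ?J" if "u \<in> ?J" for a u
  proof -
    have "?q (a * u) = \<zero>"
    proof (induction a)
      case (gen g a)
      then show ?case by (cases g) (simp_all add: mult.assoc hom)
    qed (use that in \<open>simp_all add: distrib_right mult.assoc hom\<close>)
    then show ?thesis by simp
  qed
  have J_graded: "graded_set ?J"
    unfolding graded_set_def
  proof (clarify)
    fix u n assume u: "?q u = \<zero>"
    have "\<zero> = ?q (hc ((n + d) - d) u)"
      by (rule EV_component_unique[where f = "\<lambda>n. \<zero>"])
        (simp_all add: u fsum_zero subspace_closed(2)[OF gr_subspace])
    then show "?q (hc n u) = \<zero>" by simp
  qed
  have "?J \<subseteq> ?S"
  proof (rule simple_ideal_maximal[OF _ _ J_mult J_graded])
    have gens: "s \<in> ?J" if "s \<in> {env_gen C - env_scalar c, EL 0 - env_scalar h} \<union> {EL m | m. m \<ge> 1}" for s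
    proof -
      have sc: "?q (env_scalar a) = a \<odot> w0" for a using hom(2)[of a 1] hom(4) by simp
      have g: "?q (env_gen g) = act g w0" for g using hom(3)[of g 1] hom(4) by simp
      have "T m w0 = \<zero>" if "m \<ge> 1" for m
        using T_gr[OF w0, of m] low[of "d - m"] that by auto
      then show ?thesis using that w0_carrier eig by (auto simp: q_diff sc g a_minus_def Mod.r_neg)
    qed
    show "verma_ideal c h \<subseteq> ?J"
    proof
      fix u assume "u \<in> verma_ideal c h"
      then show "u \<in> ?J" unfolding verma_ideal_def
      proof (induction u rule: left_ideal.induct)
        case (step x s a)
        then show ?case using J_mult[OF gens[OF step(2)], of a] by (simp add: hom)
      qed (simp add: hom)
    qed
  qed (use nz in \<open>auto simp: hom\<close>)
  moreover have "?S \<subseteq> ?J"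
  proof -
    \<comment> \<open>If w0 = s w0 with s in the simple ideal, then 1 - s annihilates w0, and 1
      would belong to the simple ideal.\<close>
    have "?q ` ?S \<noteq> carrier W"
    proof
      assume "?q ` ?S = carrier W"
      then obtain s where s: "s \<in> ?S" "?q s = w0" using w0_carrier by (metis imageE)
      then have "1 - s \<in> ?J" by (simp add: q_diff hom a_minus_def Mod.r_neg w0_carrier)
      then have "(1 - s) + s \<in> ?S" using \<open>?J \<subseteq> ?S\<close> s(1) by (intro simple_ideal_closed(2)) auto
      then show False using one_notin_simple_ideal[of c h] by simp
    qed
    then show ?thesis using dich[OF graded_simple_ideal simple_ideal_closed(1,2,4)] by blast
  qed
  ultimately have JS: "?J = ?S" by blast
  \<comment> \<open>Since 1 has degree 0 in U, the grading is shifted by d so that w0 sits in degree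
    0, as \<open>env_quot\<close> demands.\<close>
  define W' where "W' = W\<lparr>gr := (\<lambda>n. gr W (n + d))\<rparr>"
  have W': "carrier W' = carrier W" "add W' = add W" "zero W' = zero W" "module.smult W' = module.smult W"
    "a_inv W' = a_inv W" "a_minus W' = a_minus W" "finsum W' = finsum W" "\<And>n. gr W' n = gr W (n + d)"
    by (simp_all add: W'_def fun_eq_iff a_inv_def a_minus_def finsum_def)
  have eqi: "?q u = ?q v \<longleftrightarrow> u - v \<in> ?S" for u v
  proof -
    have "?q u = ?q v \<longleftrightarrow> ?q u \<ominus> ?q v = \<zero>"
      using diff_eq[of "?q u" "?q v" "\<zero>"] by (auto simp: a_minus_def Mod.r_neg)
    then show ?thesis unfolding JS[symmetric] by (simp add: q_diff)
  qed
  have EQ: "env_quot W' ?q ?S"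
  proof
    show "gr W' n = ?q ` env_gr n" for n
    proof (intro equalityI subsetI)
      fix x assume "x \<in> gr W' n"
      then have x: "x \<in> gr W (n + d)" by (simp add: W')
      then obtain u where u: "x = ?q u" using surj gr_carrier by blast
      have "(if n + d = n + d then x else \<zero>) = ?q (hc (n + d - d) u)"
      proof (rule EV_component_unique[where f = "\<lambda>k. if k = n + d then x else \<zero>"])
        show "?q u = fsum W (\<lambda>k. if k = n + d then x else \<zero>)"
          using gr_carrier[OF x] by (subst fsum_single[of "n + d"]) (simp_all add: u)
      qed (use x subspace_closed(2)[OF gr_subspace] in auto)
      then show "x \<in> ?q ` env_gr n" by simp
    next
      fix x assume "x \<in> ?q ` env_gr n"
      then obtain u where "u \<in> env_gr n" "x = ?q u" by blast
      then show "x \<in> gr W' n" using EV_gr[of n u] by (simp add: W' hc_gr)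
    qed
  qed (simp_all add: W' surj hom eqi simple_ideal_closed graded_simple_ideal)
  interpret S: vir_vertex "V0_Vir c" "v0_map c" "restricted_ideal c" W' ?q ?S c
    by (rule vir_vertex_V0[OF EQ vir_quot_simple])
  \<comment> \<open>W' differs from W in its grading only, so the fields of W meet the hypotheses of
    \<open>unique\<close> and are those constructed on U.\<close>
  have Yq: "Y u n (?q w) = ?q (quot_Y ?S c u n w)" for u n w
  proof (rule S.unique[where Y = "vact W" and P = "vprod (V0_Vir c)"])
    show "vertex_operators (V0_Vir c) W' (vact W)"
      using operators unfolding vertex_operators_def W' .
    show "vact W (v0_map c 1) n w = (if n = - 1 then w else \<zero>\<^bsub>W'\<^esub>)" if "w \<in> carrier W'" for n w
      using Y_one that by (simp add: W')
    show "jacobi_identity W' (vprod (V0_Vir c)) (vact W) u v w"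
      if "u \<in> carrier (V0_Vir c)" "v \<in> carrier (V0_Vir c)" "w \<in> carrier W'" for u v w
      using W that unfolding jacobi_identity_def fsum_def W' N_graded_vertex_module_def vertex_module_def by blast
    show "vprod (V0_Vir c) (v0_map c (EL (-2))) (k + 1) (v0_map c v) = v0_map c (EL k * v)" for k v
      by (rule V0_conformal)
  qed (simp add: hom)
  interpret M: env_quot "L_Vir c h" "simple_map c h" ?S by (rule env_quot_L_Vir)
  define \<psi> where "\<psi> x = simple_map c h (SOME u. ?q u = x)" for x
  have \<psi>: "\<psi> (?q u) = simple_map c h u" for u
  proof -
    have "?q (SOME v. ?q v = ?q u) = ?q u" by (rule someI[of "\<lambda>v. ?q v = ?q u"]) simp
    then show ?thesis unfolding \<psi>_def M.q_eq_iff eqi .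
  qed
  have car: "x \<in> carrier W \<longleftrightarrow> (\<exists>u. x = ?q u)" for x using surj by blast
  have "vertex_module_iso (V0_Vir c) W (L_Vir c h) \<psi>"
    unfolding vertex_module_iso_def
  proof (intro conjI)
    show "bij_betw \<psi> (carrier W) (carrier (L_Vir c h))"
      unfolding surj[symmetric] M.car by (auto simp: bij_betw_def inj_on_def \<psi> eqi M.q_eq_iff image_image)
  qed (auto simp: car env_quot.car[OF Vq] \<psi> hom(1,2)[symmetric] M.q_add M.q_smult Yq L_Vir_vact(2)[OF h])
  moreover have "\<psi> ` gr W n = gr (L_Vir c h) (n + - d)" for n
  proof -
    have "gr W n = ?q ` env_gr (n - d)" using S.W.q_gr[of "n - d"] by (simp add: W')
    then show ?thesis by (simp add: image_image \<psi> M.q_gr)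
  qed
  ultimately show ?thesis unfolding graded_equivalent_def by blast
qed

end

end

theorem corollary4p5:
  fixes c :: "'a::alg_closed_field"
  assumes "prime CHAR('a)" and "CHAR('a) \<ge> 3"
  shows "(\<forall>n \<in> prime_subfield. irreducible_N_graded_module (V0_Vir c) (L_Vir c n)) \<and>
    (\<forall>W :: ('a, 'a vir_env set set, 'w) vertex_mod.
       irreducible_N_graded_module (V0_Vir c) W \<longrightarrow>
       (\<exists>n \<in> prime_subfield. graded_equivalent (V0_Vir c) W (L_Vir c n))) \<and>
    (\<forall>m \<in> prime_subfield. \<forall>n \<in> prime_subfield.
       graded_equivalent (V0_Vir c) (L_Vir c m) (L_Vir c n) \<longrightarrow> m = n)"
proof -
  interpret odd_prime_char "CHAR('a)" c
    using assms prime_odd_nat[of "CHAR('a)"] by unfold_locales auto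
  have "\<exists>n \<in> prime_subfield. graded_equivalent (V0_Vir c) W (L_Vir c n)"
    if irr: "irreducible_N_graded_module (V0_Vir c) W" for W :: "('a, 'a vir_env set set, 'w) vertex_mod"
  proof -
    interpret v0_module "CHAR('a)" c W
      using irr by unfold_locales (simp add: irreducible_N_graded_module_def)
    obtain d w where w: "w \<in> gr W d" "w \<noteq> \<zero>\<^bsub>W\<^esub>" and low: "\<And>n. n < d \<Longrightarrow> gr W n = {\<zero>\<^bsub>W\<^esub>}"
      using irr lowest_degree unfolding irreducible_N_graded_module_def by metis
    obtain h w0 where "h \<in> prime_subfield" "w0 \<in> gr W d" "w0 \<noteq> \<zero>\<^bsub>W\<^esub>" "T 0 w0 = h \<odot>\<^bsub>W\<^esub> w0"
      by (rule eigenvector[OF low w])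
    then show ?thesis using equivalent_L_Vir irr low by blast
  qed
  then show ?thesis using irreducible_L_Vir L_Vir_inequivalent by blast
qed

end
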